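(* Let $k\ge2$ be an integer, $P$ a fixed polynomial with real coefficients, and $y=T^{\vartheta_k}$ with fixed $0<\vartheta_k<\frac1{4k}$. Then, as $T\to\infty$, uniformly for complex shifts $\alpha_1,\alpha_2,\alpha_3,\alpha_4\ll1/\log T$, $$\begin{aligned}\mathcal J_{k,2}&(\alpha_1,\alpha_2,\alpha_3,\alpha_4)=a_{k+2}\,T(\log y)^{(k+2)^2}\,\widehat\Phi(0)\left(\frac T{2\pi}\right)^{-\alpha_1-\alpha_2}\int_{\mathcal R}y^{\alpha_1\sum_{i=1}^{k+2}w_i+\alpha_2\sum_{i=1}^{k+2}x_i-\alpha_3\sum_{i=1}^{k+2}y_i-\alpha_4\sum_{i=1}^{k+2}z_i}\\&\times\prod_{i=1}^{k+2}P\left(1-\sum_{j=1}^{k-2}t_{i,j}-w_i-x_i-y_i-z_i\right)\prod_{j=1}^{k-2}P\left(1-\sum_{i=1}^{k+2}t_{i,j}\right)\\&\times dt_{1,1}\cdots dt_{k+2,k-2}\,dw_1\cdots dw_{k+2}\,dx_1\cdots dx_{k+2}\,dy_1\cdots dy_{k+2}\,dz_1\cdots dz_{k+2}\\&+O\left(T(\log T)^{(k+2)^2-1}\right),\end{aligned}$$ where $\mathcal R$ is the set of $(t_{i,j})_{1\le i\le k+2,\,1\le j\le k-2}$, $(w_i),(x_i),(y_i),(z_i)$ ($1\le i\le k+2$) with all entries in $[0,1]$ satisfying $\sum_{j=1}^{k-2}t_{i,j}+w_i+x_i+y_i+z_i\le1$ for $1\le i\le k+2$ and $\sum_{i=1}^{k+2}t_{i,j}\le1$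 for $1\le j\le k-2$. For $k=2$ all products, sums and integrals indexed by $1\le j\le k-2$ are interpreted as empty.
   Context: $\zeta$ is the Riemann zeta function and $\chi$ is the factor in its functional equation $\zeta(s)=\chi(s)\zeta(1-s)$. For $1\le n\le y$ put $P[n]=P\left(\frac{\log(y/n)}{\log y}\right)$, and let $A(s)=\sum_{n\le y}P[n]n^{-s}$. (The unindexed $y$ is always $T^{\vartheta_k}$; the indexed $y_i$ are integration variables.) $\Phi$ is a smooth weight (possibly depending on $T$) with $0\le\Phi\le1$, with $\Phi$ supported in $[1/4,2]$, and with $\frac{d^j}{dt^j}\left[\Phi(t/T)\right]\ll_j(T/\log T)^{-j}$ for every integer $j\ge0$; $\widehat\Phi(0)=\int_{\mathbb R}\Phi(u)\,du$. Define $$\begin{aligned}\mathcal J_{k,2}(\alpha_1,\alpha_2,\alpha_3,\alpha_4)=\int_{-\infty}^{\infty}&\zeta(\tfrac12+\alpha_1+it)\zeta(\tfrac12+\alpha_2+it)\zeta(\tfrac12+\alpha_3-it)\zeta(\tfrac12+\alpha_4-it)\\&\times|A(\tfrac12+it)|^{2k-4}A(\tfrac12+it)^{4}\chi(\tfrac12-it)^2\,\Phi(\tfrac tT)\,dt.\end{aligned}$$ For a positive integer $m$, $$a_m=\prod_p\left(1-\frac1p\right)^{m^2}\sum_{r=0}^\infty\left(\frac{\Gamma(r+m)}{\Gamma(r+1)\Gamma(m)}\right)^2p^{-r}.$$ *)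

theory Defs
  imports
    "HOL-Complex_Analysis.Complex_Analysis"
    "HOL-Computational_Algebra.Computational_Algebra"
begin

text \<open>
  The Riemann zeta function, as the analytic continuation of its Dirichlet series to the plane
  punctured at 1. Such a continuation is unique on the punctured plane; the value at 1 is arbitrary.
\<close>
definition zeta :: "complex \<Rightarrow> complex" where
  "zeta = (SOME f. f holomorphic_on (- {1}) \<and>
     (\<forall>s. Re s > 1 \<longrightarrow> (\<lambda>n. of_nat (Suc n) powr (- s)) sums f s))"

text \<open>
  The factor in the functional equation \<open>zeta s = zeta_chi s * zeta (1 - s)\<close>, in closed form: the
  quotient of the two zeta values would be lost at the zeros of zeta.
\<close>
definition zeta_chi :: "complex \<Rightarrow> complex" where
  "zeta_chi s = 2 powr s * of_real pi powr (s - 1) * sin (of_real pi * s / 2) * Gamma (1 - s)"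

definition smoothed_zeta_sum :: "real poly \<Rightarrow> real \<Rightarrow> complex \<Rightarrow> complex" where
  "smoothed_zeta_sum P y s =
     (\<Sum>n | 1 \<le> n \<and> real n \<le> y. of_real (poly P (ln (y / real n) / ln y)) * of_nat n powr (- s))"

text \<open>
  A weight is a family indexed by \<open>T\<close>; conditions are required for large \<open>T\<close> only, and the implied
  constants depend on \<open>j\<close> alone.
\<close>
definition smooth_weight :: "(real \<Rightarrow> real \<Rightarrow> real) \<Rightarrow> bool" where
  "smooth_weight \<Phi> \<longleftrightarrow>
     (\<forall>\<^sub>F T in at_top.
        (\<forall>j u. (deriv ^^ j) (\<Phi> T) field_differentiable (at u)) \<and>
        (\<forall>u. 0 \<le> \<Phi> T u \<and> \<Phi> T u \<le> 1) \<and>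
        closure {u. \<Phi> T u \<noteq> 0} \<subseteq> {1/4..2}) \<and>
     (\<forall>j. \<exists>C. \<forall>\<^sub>F T in at_top. \<forall>t.
        \<bar>(deriv ^^ j) (\<lambda>x. \<Phi> T (x / T)) t\<bar> \<le> C * (T / ln T) powi (- int j))"

definition twisted_moment ::
  "nat \<Rightarrow> real poly \<Rightarrow> real \<Rightarrow> (real \<Rightarrow> real) \<Rightarrow> real \<Rightarrow>
    complex \<Rightarrow> complex \<Rightarrow> complex \<Rightarrow> complex \<Rightarrow> complex" where
  "twisted_moment k P y \<phi> T \<alpha>1 \<alpha>2 \<alpha>3 \<alpha>4 =
     (LBINT t.
        zeta (1/2 + \<alpha>1 + \<i> * of_real t) * zeta (1/2 + \<alpha>2 + \<i> * of_real t) *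
        zeta (1/2 + \<alpha>3 - \<i> * of_real t) * zeta (1/2 + \<alpha>4 - \<i> * of_real t) *
        of_real (cmod (smoothed_zeta_sum P y (1/2 + \<i> * of_real t)) ^ (2 * k - 4)) *
        smoothed_zeta_sum P y (1/2 + \<i> * of_real t) ^ 4 *
        zeta_chi (1/2 - \<i> * of_real t) ^ 2 * of_real (\<phi> (t / T)))"

definition arith_factor :: "nat \<Rightarrow> real" where
  "arith_factor m =
     (\<Prod>p. if prime p
        then (1 - 1 / real p) ^ (m\<^sup>2) *
          (\<Sum>r. (Gamma (real r + real m) / (Gamma (real r + 1) * Gamma (real m)))\<^sup>2 *
            real p powi (- int r))
        else 1)"

type_synonym point =
  "(nat \<times> nat \<Rightarrow> real) \<times> (nat \<Rightarrow> real) \<times> (nat \<Rightarrow> real) \<times> (nat \<Rightarrow> real) \<times> (nat \<Rightarrow> real)"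

text \<open>
  Lebesgue measure in the \<open>(k+2)(k-2) + 4(k+2)\<close> variables \<open>(t, w, x, y, z)\<close>. For \<open>k = 2\<close> the first
  factor is the one-point measure of mass 1. Truncated subtraction is harmless as \<open>k \<ge> 2\<close> throughout.
\<close>
definition param_measure :: "nat \<Rightarrow> point measure" where
  "param_measure k =
     (\<Pi>\<^sub>M p\<in>{1..k+2} \<times> {1..k-2}. lborel) \<Otimes>\<^sub>M (\<Pi>\<^sub>M i\<in>{1..k+2}. lborel) \<Otimes>\<^sub>M
     (\<Pi>\<^sub>M i\<in>{1..k+2}. lborel) \<Otimes>\<^sub>M (\<Pi>\<^sub>M i\<in>{1..k+2}. lborel) \<Otimes>\<^sub>M (\<Pi>\<^sub>M i\<in>{1..k+2}. lborel)"

definition param_region :: "nat \<Rightarrow> point set" where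
  "param_region k =
     {(t, w, x, y, z).
        t \<in> {1..k+2} \<times> {1..k-2} \<rightarrow>\<^sub>E {0..1} \<and>
        w \<in> {1..k+2} \<rightarrow>\<^sub>E {0..1} \<and> x \<in> {1..k+2} \<rightarrow>\<^sub>E {0..1} \<and>
        y \<in> {1..k+2} \<rightarrow>\<^sub>E {0..1} \<and> z \<in> {1..k+2} \<rightarrow>\<^sub>E {0..1} \<and>
        (\<forall>i\<in>{1..k+2}. (\<Sum>j=1..k-2. t (i, j)) + w i + x i + y i + z i \<le> 1) \<and>
        (\<forall>j\<in>{1..k-2}. (\<Sum>i=1..k+2. t (i, j)) \<le> 1)}"

definition param_integral ::
  "nat \<Rightarrow> real poly \<Rightarrow> real \<Rightarrow> complex \<Rightarrow> complex \<Rightarrow> complex \<Rightarrow> complex \<Rightarrow> complex" where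
  "param_integral k P Y \<alpha>1 \<alpha>2 \<alpha>3 \<alpha>4 =
     set_lebesgue_integral (param_measure k) (param_region k) (\<lambda>(t, w, x, y, z).
       of_real Y powr
         (\<alpha>1 * of_real (\<Sum>i=1..k+2. w i) + \<alpha>2 * of_real (\<Sum>i=1..k+2. x i)
          - \<alpha>3 * of_real (\<Sum>i=1..k+2. y i) - \<alpha>4 * of_real (\<Sum>i=1..k+2. z i)) *
       of_real
         ((\<Prod>i=1..k+2. poly P (1 - (\<Sum>j=1..k-2. t (i, j)) - w i - x i - y i - z i)) *
          (\<Prod>j=1..k-2. poly P (1 - (\<Sum>i=1..k+2. t (i, j))))))"

end

theory Submission
  imports Defs "HOL-Real_Asymp.Real_Asymp"
begin

text \<open>
  The functional equation turns the factors \<open>zeta (1/2 + \<alpha>\<^sub>i + \<i> t) * zeta_chi (1/2 - \<i> t)\<close>, \<open>i = 1, 2\<close>, into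
  \<open>zeta (1/2 - \<alpha>\<^sub>i - \<i> t)\<close> times a nonoscillating function close to \<open>(T / (2 * pi)) powr - \<alpha>\<^sub>i\<close>. Replacing
  the four zeta values by Dirichlet polynomials of length \<open>T ^ 40\<close>, one has to integrate
  \<open>((\<nu>\<^sub>1 \<cdots> \<nu>\<^sub>K) / (\<mu>\<^sub>1 \<cdots> \<mu>\<^sub>K)) powr (\<i> t)\<close>, \<open>K = k + 2\<close>, against a smooth weight. The products of the \<open>\<mu>\<^sub>i \<le> y\<close>
  are at most \<open>y ^ K \<le> T powr (1/2)\<close>, so unequal products differ in logarithm by at least \<open>T powr - (1/2) / 2\<close>,
  and repeated integration by parts makes these terms smaller than any power of \<open>T\<close>.

  The pairs of tuples with equal products are parametrized by \<open>K * K\<close> matrices of positive integers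
  \<open>d\<close> with row products \<open>\<mu>\<close> and column products \<open>\<nu>\<close>; uniqueness is a condition on the exponents at each prime.
  Removing these conditions one prime at a time contributes the arithmetic factor, and the remaining sum
  of \<open>1 / d\<close> over unrestricted matrices is a Riemann sum for the parameter integral in the variables \<open>ln d / ln y\<close>.

  The functional equation itself is proved for \<open>-1 < s < 0\<close> by writing the errors of the trapezoid rule as
  integrals and inserting the partial fractions of \<open>coth\<close>, and then extended by analytic continuation.
\<close>

section \<open>The zeta function and its functional equation\<close>

text \<open>Since \<open>|A| ^ (2 * k - 4) * A ^ 4 = A ^ (k + 2) * cnj A ^ (k - 2)\<close>, turning
  the first two zeta factors over puts all four zetas beside the \<open>cnj A\<close>, and each side
  then has \<open>k + 2\<close> factors. The gap between the logarithms of unequal products is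
  governed by the short side alone, so the zeta polynomials can be as long as convenient and no
  approximate functional equation enters. The condition \<open>\<theta> < 1 / (4 * k)\<close> acts
  through \<open>(k + 2) * \<theta> <= 2 * k * \<theta> < 1/2\<close>.

  With \<open>L = ln y\<close> the main term has order \<open>L ^ (K * K)\<close>, and every error
  has to save one factor \<open>L\<close>. Removing the condition at a prime \<open>p\<close> does
  so at a cost of \<open>p powr (- 5 / 4)\<close>: exponent matrices of total at most 1 are all
  permitted, and dilating a variable by \<open>q\<close> changes the weight, summed over that
  variable, only by \<open>O(1 + ln q)\<close>.

  \<open>P\<close> may be nonzero at 0. The weights are therefore Lipschitz only up to a jump, and
  each summation estimate has to pay for the jump separately.\<close>

lemma Digamma_reflection:
  fixes z :: complex
  assumes "z \<notin> \<int>"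
  shows "Digamma (1 - z) - Digamma z = of_real pi * cot (of_real pi * z)"
proof -
  have z1: "z \<notin> \<int>\<^sub>\<le>\<^sub>0" and z2: "1 - z \<notin> \<int>\<^sub>\<le>\<^sub>0"
    using assms by (auto elim!: nonpos_Ints_cases) (metis Ints_1 Ints_diff Ints_of_int diff_diff_eq2 add_diff_cancel_left')
  have s: "sin (of_real pi * z) \<noteq> 0"
    using assms by (metis Ints_of_int sin_eq_0 mult.commute mult_cancel_right of_real_eq_0_iff pi_neq_zero of_real_of_int_eq of_real_mult)
  define S where "S = sin (of_real pi * z)"
  define D where "D = Gamma z * Digamma z * Gamma (1 - z) + Gamma z * (Gamma (1 - z) * Digamma (1 - z) * (-1))"
  \<comment> \<open>Logarithmic differentiation of the reflection formula: \<open>D\<close> is the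
    derivative of \<open>Gamma w * Gamma (1 - w)\<close>, to be compared with that of
    \<open>pi / sin (pi * w)\<close>.\<close>
  have "((\<lambda>w. Gamma w * Gamma (1 - w)) has_field_derivative D) (at z)"
    using z1 z2 unfolding D_def by (auto intro!: derivative_eq_intros simp: algebra_simps)
  moreover have "((\<lambda>w. of_real pi / sin (of_real pi * w)) has_field_derivative
      - of_real pi * (of_real pi * cos (of_real pi * z)) / S\<^sup>2) (at z)"
    using s unfolding S_def by (auto intro!: derivative_eq_intros simp: field_simps power2_eq_square)
  ultimately have "D = - of_real pi * (of_real pi * cos (of_real pi * z)) / S\<^sup>2"
    unfolding Gamma_reflection_complex by (rule DERIV_unique)
  moreover have "D = (Gamma z * Gamma (1 - z)) * (Digamma z - Digamma (1 - z))"
    by (simp add: D_def algebra_simps)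
  ultimately have "of_real pi / S * (Digamma z - Digamma (1 - z)) =
      - of_real pi * (of_real pi * cos (of_real pi * z)) / S\<^sup>2"
    by (simp only: Gamma_reflection_complex S_def)
  then have "of_real pi * S * (S * (Digamma z - Digamma (1 - z)) + of_real pi * cos (of_real pi * z)) = 0"
    using s unfolding S_def[symmetric] by (simp add: field_simps power2_eq_square)
  then have "S * (Digamma z - Digamma (1 - z)) + of_real pi * cos (of_real pi * z) = 0"
    using s unfolding S_def[symmetric] by (simp only: mult_eq_0_iff) simp
  then have "S * (Digamma (1 - z) - Digamma z) = of_real pi * cos (of_real pi * z)"
    by (simp add: algebra_simps)
  then have "Digamma (1 - z) - Digamma z = of_real pi * cos (of_real pi * z) / S"
    using s unfolding S_def[symmetric] by (simp add: field_simps)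
  then show ?thesis by (simp add: cot_def S_def)
qed

text \<open>In the limit formula for \<open>Digamma\<close> the logarithms cancel between
  \<open>1 - z\<close> and \<open>z\<close>. The remaining difference is the paired series, up to
  the isolated term \<open>1 / z\<close> and one boundary term tending to 0.\<close>

lemma cot_partial_fractions:
  fixes z :: complex
  assumes "z \<notin> \<int>"
  shows "(\<lambda>n. 1 / (z + of_nat (Suc n)) + 1 / (z - of_nat (Suc n))) sums
    (of_real pi * cot (of_real pi * z) - 1 / z)"
proof -
  have z0: "z \<noteq> 0" "1 - z \<noteq> 0" using assms by auto
  have "(\<lambda>m. (of_real (ln (real m)) - (\<Sum>n<m. inverse ((1 - z) + of_nat n))) -
      (of_real (ln (real m)) - (\<Sum>n<m. inverse (z + of_nat n)))) \<longlonglongrightarrow> Digamma (1 - z) - Digamma z"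
    by (intro tendsto_diff Digamma_LIMSEQ z0)
  then have "(\<lambda>m. (\<Sum>n<m. inverse (z + of_nat n)) - (\<Sum>n<m. inverse ((1 - z) + of_nat n)))
      \<longlonglongrightarrow> of_real pi * cot (of_real pi * z)"
    by (simp add: Digamma_reflection[OF assms])
  then have *: "(\<lambda>m. (\<Sum>n<Suc m. inverse (z + of_nat n)) - (\<Sum>n<Suc m. inverse ((1 - z) + of_nat n)))
      \<longlonglongrightarrow> of_real pi * cot (of_real pi * z)"
    by (rule LIMSEQ_Suc)
  have l0: "(\<lambda>m. inverse ((1 - z) + of_nat m)) \<longlonglongrightarrow> 0"
    by (intro tendsto_inverse_0[THEN filterlim_compose] tendsto_add_filterlim_at_infinity[OF tendsto_const]
        tendsto_of_nat)
  have "(\<Sum>n<m. 1 / (z + of_nat (Suc n)) + 1 / (z - of_nat (Suc n))) =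
     ((\<Sum>n<Suc m. inverse (z + of_nat n)) - (\<Sum>n<Suc m. inverse ((1 - z) + of_nat n)))
      + inverse ((1 - z) + of_nat m) - 1 / z" for m
  proof -
    have "(\<Sum>n<Suc m. inverse (z + of_nat n)) = 1 / z + (\<Sum>n<m. 1 / (z + of_nat (Suc n)))"
      by (subst sum.lessThan_Suc_shift) (simp add: inverse_eq_divide)
    moreover have "(\<Sum>n<Suc m. inverse ((1 - z) + of_nat n)) =
       - (\<Sum>n<m. 1 / (z - of_nat (Suc n))) + inverse ((1 - z) + of_nat m)"
    proof -
      have "inverse ((1 - z) + of_nat n) = - (1 / (z - of_nat (Suc n)))" for n
        by (simp add: inverse_eq_divide divide_minus_right[symmetric] algebra_simps del: divide_minus_right)
      then show ?thesis by (simp add: sum_negf)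
    qed
    ultimately show ?thesis by (simp add: sum.distrib)
  qed
  then show ?thesis
    unfolding sums_def using tendsto_diff[OF tendsto_add[OF * l0] tendsto_const[of "1/z"]] by simp
qed

text \<open>The first fraction of the limit is \<open>coth (x / 2) / 2\<close>, that is
  \<open>\<i> / 2\<close> times \<open>cot\<close> at \<open>\<i> * x / 2\<close>; hence the
  cotangent series is taken at \<open>\<i> * x / (2 * pi)\<close> and scaled by
  \<open>\<i> / (2 * pi)\<close>. A Mellin transform will turn the summands into powers of
  \<open>2 * pi * n\<close>, the source of the dual Dirichlet series.\<close>

lemma coth_partial_fractions:
  fixes x :: real
  assumes "x > 0"
  shows "(\<lambda>n. 2 * x / (x\<^sup>2 + (2 * pi * real (Suc n))\<^sup>2)) sums
    ((1 + exp (- x)) / (2 * (1 - exp (- x))) - 1 / x)"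
proof -
  define z where "z = \<i> * of_real (x / (2 * pi))"
  have zI: "z \<notin> \<int>"
  proof
    assume "z \<in> \<int>"
    then have "Im z = 0" by (auto elim!: Ints_cases)
    then show False using assms by (simp add: z_def)
  qed
  have t: "\<i> / (2 * of_real pi) * (1 / (z + of_nat (Suc n)) + 1 / (z - of_nat (Suc n))) =
      of_real (2 * x / (x\<^sup>2 + (2 * pi * real (Suc n))\<^sup>2))" for n
  proof -
    define m where "m = (of_nat (Suc n) :: complex)"
    have ne: "z + m \<noteq> 0" "z - m \<noteq> 0"
      using assms by (auto simp: z_def m_def complex_eq_iff)
    have "x\<^sup>2 + (2 * pi * real (Suc n))\<^sup>2 > 0" using assms by (intro add_pos_nonneg) auto
    then have "complex_of_real (x\<^sup>2 + (2 * pi * real (Suc n))\<^sup>2) \<noteq> 0"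
      by (metis of_real_eq_0_iff less_irrefl)
    then have ne2: "of_real x^2 + (2 * of_real pi * m)\<^sup>2 \<noteq> 0"
      by (simp add: m_def)
    have "1 / (z + m) + 1 / (z - m) = 2 * z / (z\<^sup>2 - m\<^sup>2)"
      using ne by (simp add: divide_simps power2_eq_square algebra_simps)
    also have "z\<^sup>2 - m\<^sup>2 = - (of_real x^2 + (2 * of_real pi * m)\<^sup>2) / (4 * of_real pi ^ 2)"
      by (simp add: z_def power_mult_distrib power_divide field_simps)
    finally have eq: "1 / (z + m) + 1 / (z - m) = 2 * z / (- (of_real x^2 + (2 * of_real pi * m)\<^sup>2) / (4 * of_real pi ^ 2))" .
    have aux: "\<i> / (2 * of_real pi) * (2 * z / (- D / (4 * of_real pi ^ 2))) = - (\<i> * z) * (4 * of_real pi) / D" if "D \<noteq> 0" for D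
      using that by (simp add: field_simps power2_eq_square)
    have iz: "- (\<i> * z) * (4 * of_real pi) = 2 * of_real x"
      by (simp add: z_def)
    have "\<i> / (2 * of_real pi) * (1 / (z + m) + 1 / (z - m)) = 2 * of_real x / (of_real x^2 + (2 * of_real pi * m)\<^sup>2)"
      unfolding eq aux[OF ne2] iz ..
    then show ?thesis unfolding m_def by simp
  qed
  have c: "\<i> / (2 * of_real pi) * (of_real pi * cot (of_real pi * z) - 1 / z) =
     of_real ((1 + exp (- x)) / (2 * (1 - exp (- x))) - 1 / x)"
  proof -
    define E where "E = exp (of_real (x / 2) :: complex)"
    have E0: "E \<noteq> 0" by (simp add: E_def)
    have q: "of_real (exp (- x)) = 1 / E\<^sup>2"
    proof -
      have "E\<^sup>2 = exp (of_real x)" by (simp add: E_def power2_eq_square flip: exp_add)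
      then show ?thesis by (simp add: exp_of_real[symmetric] exp_minus inverse_eq_divide)
    qed
    have "exp (- x) \<noteq> 1" using assms by simp
    then have "complex_of_real (exp (- x)) \<noteq> 1" by (metis of_real_eq_1_iff)
    then have E1: "E\<^sup>2 \<noteq> 1" using q by auto
    have pz: "of_real pi * z = \<i> * of_real (x / 2)" by (simp add: z_def)
    have e1: "exp (\<i> * (\<i> * of_real (x / 2))) = 1 / E"
    proof -
      have "\<i> * (\<i> * of_real (x / 2)) = - complex_of_real (x / 2)" by (simp flip: mult.assoc)
      then show ?thesis by (simp add: E_def exp_minus inverse_eq_divide)
    qed
    have e2: "exp (- (\<i> * (\<i> * of_real (x / 2)))) = E"
      by (simp add: E_def)
    have "cot (of_real pi * z) = \<i> * (1 / E + E) / (1 / E - E)"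
    proof -
      have "(X / 2) / (Y / (2 * \<i>)) = \<i> * X / Y" for X Y :: complex
        by (cases "Y = 0") (simp_all add: field_simps)
      then show ?thesis unfolding cot_def sin_exp_eq cos_exp_eq pz e1 e2 .
    qed
    also have "\<dots> = \<i> * (1 + E\<^sup>2) / (1 - E\<^sup>2)"
      using E0 E1 by (simp add: divide_simps power2_eq_square)
    finally have ct: "cot (of_real pi * z) = \<i> * (1 + E\<^sup>2) / (1 - E\<^sup>2)" .
    have "\<i> / (2 * of_real pi) * (1 / z) = 1 / of_real x"
      using assms by (simp add: z_def field_simps)
    moreover have "\<i> / (2 * of_real pi) * (of_real pi * cot (of_real pi * z)) =
        (1 + 1 / E\<^sup>2) / (2 * (1 - 1 / E\<^sup>2))"
      unfolding ct using E0 E1 by (simp add: divide_simps) (simp add: algebra_simps power2_eq_square)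
    ultimately show ?thesis unfolding of_real_diff of_real_divide of_real_add of_real_mult q
      by (simp only: right_diff_distrib of_real_1 of_real_numeral)
  qed
  have "(\<lambda>n. of_real (2 * x / (x\<^sup>2 + (2 * pi * real (Suc n))\<^sup>2)) :: complex) sums
    of_real ((1 + exp (- x)) / (2 * (1 - exp (- x))) - 1 / x)"
    using sums_mult[OF cot_partial_fractions[OF zI], of "\<i> / (2 * of_real pi)"] unfolding t c .
  then show ?thesis by (simp only: sums_of_real_iff)
qed

section \<open>Mellin integrals of nonnegative functions\<close>

lemma nn_integral_powr_exp:
  fixes s c :: real
  assumes "s > 0" "c > 0"
  shows "(\<integral>\<^sup>+x. ennreal (indicator {0<..} x * (x powr (s - 1) * exp (- c * x))) \<partial>lborel) = ennreal (Gamma s * c powr (- s))"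
proof -
  let ?I = "\<integral>\<^sup>+t. ennreal (indicator {0<..} t * (t powr (s - 1) * exp (- c * t))) \<partial>lborel"
  have "ennreal (Gamma s) = (\<integral>\<^sup>+t. ennreal (indicator {0..} t * t powr (s - 1) / exp t) \<partial>lborel)"
    using Gamma_conv_nn_integral_real[OF assms(1)] .
  also have "\<dots> = ennreal \<bar>c\<bar> * (\<integral>\<^sup>+t. ennreal (indicator {0..} (0 + c * t) * (0 + c * t) powr (s - 1) / exp (0 + c * t)) \<partial>lborel)"
    using assms by (intro nn_integral_real_affine) auto
  also have "(\<integral>\<^sup>+t. ennreal (indicator {0..} (0 + c * t) * (0 + c * t) powr (s - 1) / exp (0 + c * t)) \<partial>lborel) =
     (\<integral>\<^sup>+t. ennreal (c powr (s - 1)) * ennreal (indicator {0<..} t * (t powr (s - 1) * exp (- c * t))) \<partial>lborel)"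
    using assms by (intro nn_integral_cong)
      (auto simp: indicator_def zero_le_mult_iff powr_mult exp_minus field_simps simp flip: ennreal_mult')
  also have "\<dots> = ennreal (c powr (s - 1)) * ?I"
    by (intro nn_integral_cmult) auto
  also have "ennreal \<bar>c\<bar> * (ennreal (c powr (s - 1)) * ?I) = (ennreal \<bar>c\<bar> * ennreal (c powr (s - 1))) * ?I"
    by (rule mult.assoc[symmetric])
  also have "ennreal \<bar>c\<bar> * ennreal (c powr (s - 1)) = ennreal (c powr s)"
    using assms by (subst ennreal_mult'[symmetric]) (auto simp: powr_diff)
  finally have *: "ennreal (Gamma s) = ennreal (c powr s) * ?I" .
  have "ennreal (Gamma s * c powr (- s)) = ennreal (c powr (- s)) * ennreal (Gamma s)"
    by (subst mult.commute, subst ennreal_mult') auto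
  also have "\<dots> = (ennreal (c powr (-s)) * ennreal (c powr s)) * ?I"
    unfolding * by (rule mult.assoc[symmetric])
  also have "ennreal (c powr (-s)) * ennreal (c powr s) = 1"
    using assms by (subst ennreal_mult'[symmetric]) (auto simp: powr_minus)
  finally show ?thesis by simp
qed

lemma nn_integral_indicator_powr:
  fixes r a b :: real
  assumes "r > -1" "0 \<le> a" "a \<le> b"
  shows "(\<integral>\<^sup>+u. ennreal (indicator {a..b} u * u powr r) \<partial>lborel) = ennreal ((b powr (r + 1) - a powr (r + 1)) / (r + 1))"
proof -
  have A: "((\<lambda>x. x powr r) has_integral (b powr (r+1) / (r+1))) {0..b}"
    using assms by (intro has_integral_powr_from_0) auto
  have B: "((\<lambda>x. x powr r) has_integral (a powr (r+1) / (r+1))) {0..a}"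
    using assms by (intro has_integral_powr_from_0) auto
  have "(\<lambda>x. x powr r) integrable_on {0..b}" using A by auto
  then have "(\<lambda>x. x powr r) integrable_on {a..b}"
    by (rule integrable_on_subinterval) (use assms in auto)
  then obtain I where I: "((\<lambda>x. x powr r) has_integral I) {a..b}" by auto
  have "((\<lambda>x. x powr r) has_integral (a powr (r+1) / (r+1) + I)) {0..b}"
    using assms by (intro has_integral_combine[OF _ _ B I]) auto
  with A have "I = (b powr (r + 1) - a powr (r + 1)) / (r + 1)"
    by (auto dest: has_integral_unique simp: diff_divide_distrib)
  with nn_integral_has_integral_lebesgue[OF _ I] show ?thesis by simp
qed

text \<open>The Gamma integral diverges at 0 for negative \<open>s\<close>, but
  \<open>1 - exp (- a * x)\<close> supplies a factor \<open>x\<close>: it is \<open>x\<close> times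
  the integral of \<open>exp (- b * x)\<close> over \<open>0 <= b <= a\<close>. After exchanging the
  integrals the Gamma integral at \<open>s + 1\<close> applies.\<close>

lemma nn_integral_powr_one_minus_exp:
  fixes s a :: real
  assumes "-1 < s" "s < 0" "a \<ge> 0"
  shows "(\<integral>\<^sup>+x. ennreal (indicator {0<..} x * (x powr (s - 1) * (1 - exp (- a * x)))) \<partial>lborel) =
    ennreal (- Gamma s * a powr (- s))"
proof -
  have inner: "(\<integral>\<^sup>+b. ennreal (indicator {0..a} b * (indicator {0<..} x * (x powr s * exp (- b * x)))) \<partial>lborel)
     = ennreal (indicator {0<..} x * (x powr (s - 1) * (1 - exp (- a * x))))" for x :: real
  proof (cases "x > 0")
    case True
    have "(\<integral>\<^sup>+b. ennreal (x powr s * exp (- b * x)) * indicator {0..a} b \<partial>lborel)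
       = ennreal ((- (x powr (s - 1)) * exp (- a * x)) - (- (x powr (s - 1)) * exp (- 0 * x)))"
    proof (rule nn_integral_FTC_Icc)
      show "((\<lambda>b. - (x powr (s - 1)) * exp (- b * x)) has_real_derivative x powr s * exp (- b * x)) (at b)" for b
        using True by (auto intro!: derivative_eq_intros simp: powr_diff)
    qed (use assms True in auto)
    also have "(\<integral>\<^sup>+b. ennreal (x powr s * exp (- b * x)) * indicator {0..a} b \<partial>lborel) =
       (\<integral>\<^sup>+b. ennreal (indicator {0..a} b * (indicator {0<..} x * (x powr s * exp (- b * x)))) \<partial>lborel)"
      using True by (intro nn_integral_cong) (auto split: split_indicator)
    finally show ?thesis using True by (simp add: algebra_simps)
  qed auto
  have "(\<integral>\<^sup>+x. ennreal (indicator {0<..} x * (x powr (s - 1) * (1 - exp (- a * x)))) \<partial>lborel) =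
    (\<integral>\<^sup>+x. (\<integral>\<^sup>+b. ennreal (indicator {0..a} b * (indicator {0<..} x * (x powr s * exp (- b * x)))) \<partial>lborel) \<partial>lborel)"
    by (simp only: inner)
  also have "\<dots> = (\<integral>\<^sup>+b. (\<integral>\<^sup>+x. ennreal (indicator {0..a} b * (indicator {0<..} x * (x powr s * exp (- b * x)))) \<partial>lborel) \<partial>lborel)"
    by (rule lborel_pair.Fubini') (auto simp: case_prod_unfold)
  also have "\<dots> = (\<integral>\<^sup>+b. ennreal (indicator {0..a} b * (Gamma (s + 1) * b powr (- s - 1))) \<partial>lborel)"
  \<comment> \<open>At \<open>b = 0\<close> the inner integral is infinite whereas
    \<open>0 powr _\<close> is 0, so the two sides agree only almost everywhere.\<close>
  proof (intro nn_integral_cong_AE eventually_mono[OF AE_lborel_singleton[of 0]])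
    fix b :: real assume b: "b \<noteq> 0"
    show "(\<integral>\<^sup>+x. ennreal (indicator {0..a} b * (indicator {0<..} x * (x powr s * exp (- b * x)))) \<partial>lborel) =
       ennreal (indicator {0..a} b * (Gamma (s + 1) * b powr (- s - 1)))"
    proof (cases "b \<in> {0..a}")
      case True
      with b nn_integral_powr_exp[of "s + 1" b] assms show ?thesis by (simp add: minus_diff_commute)
    qed auto
  qed
  also have "\<dots> = (\<integral>\<^sup>+b. ennreal (Gamma (s + 1)) * ennreal (indicator {0..a} b * b powr (- s - 1)) \<partial>lborel)"
    using assms by (intro nn_integral_cong) (auto simp: indicator_def ennreal_mult'')
  also have "\<dots> = ennreal (Gamma (s + 1)) * ennreal ((a powr (- s - 1 + 1) - 0 powr (- s - 1 + 1)) / (- s - 1 + 1))"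
    using assms by (subst nn_integral_cmult, simp, subst nn_integral_indicator_powr) auto
  also have "\<dots> = ennreal (- Gamma s * a powr (- s))"
  proof -
    have "Gamma (s + 1) = s * Gamma s" using assms
      by (intro Gamma_plus1) (auto elim!: nonpos_Ints_cases)
    then show ?thesis using assms Gamma_real_pos[of "s+1"]
      by (subst ennreal_mult'[symmetric]) (auto simp: field_simps)
  qed
  finally show ?thesis .
qed

text \<open>The quotient is the mean of \<open>exp (- b * x)\<close> over \<open>[a, a + 1]\<close>,
  so this averages the previous formula over \<open>b\<close>. It accounts for the integral term of
  a trapezoid error.\<close>

lemma nn_integral_powr_one_minus_exp_mean:
  fixes s a :: real
  assumes "-1 < s" "s < 0" "a \<ge> 0"
  shows "(\<integral>\<^sup>+x. ennreal (indicator {0<..} x * (x powr (s - 1) * (1 - (exp (- a * x) - exp (- (a + 1) * x)) / x))) \<partial>lborel) =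
    ennreal (- Gamma s * (((a + 1) powr (1 - s) - a powr (1 - s)) / (1 - s)))"
proof -
  have inner: "(\<integral>\<^sup>+b. ennreal (indicator {a..a+1} b * (indicator {0<..} x * (x powr (s - 1) * (1 - exp (- b * x))))) \<partial>lborel)
     = ennreal (indicator {0<..} x * (x powr (s - 1) * (1 - (exp (- a * x) - exp (- (a + 1) * x)) / x)))" for x :: real
  proof (cases "x > 0")
    case True
    have "(\<integral>\<^sup>+b. ennreal (x powr (s - 1) * (1 - exp (- b * x))) * indicator {a..a+1} b \<partial>lborel)
       = ennreal (x powr (s - 1) * ((a + 1) + exp (- (a + 1) * x) / x) - x powr (s - 1) * (a + exp (- a * x) / x))"
    proof (rule nn_integral_FTC_Icc)
      show "((\<lambda>b. x powr (s - 1) * (b + exp (- b * x) / x)) has_real_derivative x powr (s - 1) * (1 - exp (- b * x))) (at b)" for b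
        using True by (auto intro!: derivative_eq_intros)
    qed (use assms True in auto)
    also have "x powr (s - 1) * ((a + 1) + exp (- (a + 1) * x) / x) - x powr (s - 1) * (a + exp (- a * x) / x)
       = x powr (s - 1) * (1 - (exp (- a * x) - exp (- (a + 1) * x)) / x)"
      by (simp add: algebra_simps diff_divide_distrib)
    also have "(\<integral>\<^sup>+b. ennreal (x powr (s - 1) * (1 - exp (- b * x))) * indicator {a..a+1} b \<partial>lborel) =
       (\<integral>\<^sup>+b. ennreal (indicator {a..a+1} b * (indicator {0<..} x * (x powr (s - 1) * (1 - exp (- b * x))))) \<partial>lborel)"
      using True by (intro nn_integral_cong) (auto split: split_indicator)
    finally show ?thesis using True by simp
  qed auto
  have G: "Gamma s \<le> 0"
  proof -
    have "Gamma (s + 1) = s * Gamma s" using assms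
      by (intro Gamma_plus1) (auto elim!: nonpos_Ints_cases)
    then have "s * Gamma s > 0" using assms Gamma_real_pos[of "s+1"] by simp
    then show ?thesis using assms by (simp add: zero_less_mult_iff)
  qed
  have "(\<integral>\<^sup>+x. ennreal (indicator {0<..} x * (x powr (s - 1) * (1 - (exp (- a * x) - exp (- (a + 1) * x)) / x))) \<partial>lborel) =
    (\<integral>\<^sup>+x. (\<integral>\<^sup>+b. ennreal (indicator {a..a+1} b * (indicator {0<..} x * (x powr (s - 1) * (1 - exp (- b * x))))) \<partial>lborel) \<partial>lborel)"
    by (simp only: inner)
  also have "\<dots> = (\<integral>\<^sup>+b. (\<integral>\<^sup>+x. ennreal (indicator {a..a+1} b * (indicator {0<..} x * (x powr (s - 1) * (1 - exp (- b * x))))) \<partial>lborel) \<partial>lborel)"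
    by (rule lborel_pair.Fubini') (auto simp: case_prod_unfold)
  also have "\<dots> = (\<integral>\<^sup>+b. ennreal (indicator {a..a+1} b * (- Gamma s * b powr (- s))) \<partial>lborel)"
  proof (intro nn_integral_cong)
    fix b :: real
    show "(\<integral>\<^sup>+x. ennreal (indicator {a..a+1} b * (indicator {0<..} x * (x powr (s - 1) * (1 - exp (- b * x))))) \<partial>lborel) =
       ennreal (indicator {a..a+1} b * (- Gamma s * b powr (- s)))"
    proof (cases "b \<in> {a..a+1}")
      case True
      with nn_integral_powr_one_minus_exp[of s b] assms show ?thesis by simp
    qed auto
  qed
  also have "\<dots> = (\<integral>\<^sup>+b. ennreal (- Gamma s) * ennreal (indicator {a..a+1} b * b powr (- s)) \<partial>lborel)"
    using G by (intro nn_integral_cong, subst ennreal_mult'[symmetric]) (auto simp: indicator_def)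
  also have "\<dots> = ennreal (- Gamma s) * ennreal (((a+1) powr (- s + 1) - a powr (- s + 1)) / (- s + 1))"
    using assms by (subst nn_integral_cmult, simp, subst nn_integral_indicator_powr) auto
  also have "\<dots> = ennreal (- Gamma s * (((a + 1) powr (1 - s) - a powr (1 - s)) / (1 - s)))"
    using G by (subst ennreal_mult'[symmetric]) (auto simp: add.commute)
  finally show ?thesis .
qed

text \<open>The substitution \<open>t = x^2 / (x^2 + a^2)\<close> maps the half-line to the unit
  interval and produces a Beta integral with parameters \<open>(s + 1) / 2\<close> and
  \<open>(1 - s) / 2\<close>. Their sum is 1, so the reflection formula for Gamma evaluates it as
  \<open>pi / cos (pi * s / 2)\<close>.\<close>

lemma nn_integral_powr_div_quadratic:
  fixes s a :: real
  assumes s: "-1 < s" "s < 0" and a: "a > 0"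
  shows "(\<integral>\<^sup>+x. ennreal (indicator {0<..} x * (x powr (s - 1) * (2 * x / (x\<^sup>2 + a\<^sup>2)))) \<partial>lborel) =
    ennreal (a powr (s - 1) * pi / cos (pi * s / 2))"
proof -
  define p where "p = (s + 1) / 2"
  define q where "q = (1 - s) / 2"
  have pq: "p > 0" "q > 0" "p + q = 1" "q = 1 - p" using s by (auto simp: p_def q_def field_simps)
  define f where "f = (\<lambda>t::real. t powr (p - 1) * (1 - t) powr (q - 1))"
  define g where "g = (\<lambda>x::real. x\<^sup>2 / (x\<^sup>2 + a\<^sup>2))"
  define g' where "g' = (\<lambda>x::real. 2 * x * a\<^sup>2 / (x\<^sup>2 + a\<^sup>2)\<^sup>2)"
  have pos: "x\<^sup>2 + a\<^sup>2 > 0" for x :: real using a by (intro add_nonneg_pos) auto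
  have one: "1 - g x = a\<^sup>2 / (x\<^sup>2 + a\<^sup>2)" for x using a pos[of x] by (simp add: g_def field_simps flip: add_divide_distrib)
  have img: "g ` {0<..} = {0<..<1}"
  proof (intro equalityI subsetI)
    fix t assume "t \<in> g ` {0<..}"
    then show "t \<in> {0<..<1}" using pos a by (auto simp: g_def field_simps)
  next
    fix t :: real assume t: "t \<in> {0<..<1}"
    define x where "x = a * sqrt (t / (1 - t))"
    have "x > 0" "x\<^sup>2 = a\<^sup>2 * (t / (1 - t))" using t a by (auto simp: x_def power_mult_distrib)
    moreover have "a\<^sup>2 * (t / (1 - t)) + a\<^sup>2 = a\<^sup>2 / (1 - t)" using t by (simp add: field_simps)
    ultimately have "g x = t" "x \<in> {0<..}" using t a by (auto simp: g_def)
    then show "t \<in> g ` {0<..}" by blast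
  qed
  have fi: "(f has_integral Beta p q) {0<..<1}"
    using has_integral_Beta_real[OF pq(1,2)] by (simp add: f_def has_integral_Icc_iff_Ioo)
  have fabs: "f absolutely_integrable_on {0<..<1}"
    using fi by (intro nonnegative_absolutely_integrable_1) (auto simp: f_def)
  have der: "(g has_real_derivative g' x) (at x within {0<..})" for x
    unfolding g_def g'_def using pos[of x]
    by (auto intro!: derivative_eq_intros simp: field_simps power2_eq_square)
  have inj: "inj_on g {0<..}"
  proof (rule inj_onI)
    fix x y assume "x \<in> {0<..}" "y \<in> {0<..}" "g x = g y"
    then have "x\<^sup>2 * a\<^sup>2 = y\<^sup>2 * a\<^sup>2" using pos[of x] pos[of y] by (simp add: g_def field_simps)
    then show "x = y" using a \<open>x \<in> _\<close> \<open>y \<in> _\<close> by (simp add: power2_eq_iff_nonneg)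
  qed
  have "f absolutely_integrable_on g ` {0<..} \<and> integral (g ` {0<..}) f = Beta p q"
    using fi fabs by (simp add: img integral_unique)
  then have "(\<lambda>x. \<bar>g' x\<bar> * f (g x)) absolutely_integrable_on {0<..} \<and> integral {0<..} (\<lambda>x. \<bar>g' x\<bar> * f (g x)) = Beta p q"
    using has_absolute_integral_change_of_variables_1'[OF _ der inj, of f "Beta p q"] by simp
  then have hi: "((\<lambda>x. \<bar>g' x\<bar> * f (g x)) has_integral Beta p q) {0<..}"
    by (metis absolutely_integrable_on_def has_integral_integral)
  have eq: "\<bar>g' x\<bar> * f (g x) = a powr (1 - s) * (x powr (s - 1) * (2 * x / (x\<^sup>2 + a\<^sup>2)))" if "x \<in> {0<..}" for x
  proof -
    have x: "x > 0" using that by simp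
    define w where "w = x\<^sup>2 + a\<^sup>2"
    have w: "w > 0" using pos[of x] by (simp add: w_def)
    have "f (g x) = (x\<^sup>2 / w) powr (p - 1) * (a\<^sup>2 / w) powr (q - 1)"
      by (simp add: f_def one) (simp add: g_def w_def)
    also have "\<dots> = (x\<^sup>2) powr (p - 1) * (a\<^sup>2) powr (q - 1) / (w powr (p - 1) * w powr (q - 1))"
      using w x a by (simp add: powr_divide)
    also have "w powr (p - 1) * w powr (q - 1) = 1 / w"
    proof -
      have "w powr (p - 1) * w powr (q - 1) = w powr ((p - 1) + (q - 1))" by (rule powr_add[symmetric])
      also have "(p - 1) + (q - 1) = -1" using pq by simp
      finally show ?thesis using w by (simp add: powr_minus_divide)
    qed
    also have "(x\<^sup>2) powr (p - 1) = x powr (s - 1)"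
    proof -
      have "(x\<^sup>2) powr (p - 1) = x powr (2 * (p - 1))" using x by (simp add: powr_powr flip: powr_numeral)
      also have "2 * (p - 1) = s - 1" by (simp add: p_def)
      finally show ?thesis .
    qed
    also have "(a\<^sup>2) powr (q - 1) = a powr (1 - s) / a\<^sup>2"
    proof -
      have "(a\<^sup>2) powr (q - 1) = a powr (2 * (q - 1))" using a by (simp add: powr_powr flip: powr_numeral)
      also have "2 * (q - 1) = (1 - s) - 2" by (simp add: q_def)
      also have "a powr \<dots> = a powr (1 - s) / a\<^sup>2" using a by (simp only: powr_diff powr_numeral)
      finally show ?thesis .
    qed
    finally have "f (g x) = x powr (s - 1) * (a powr (1 - s) / a\<^sup>2) * w" by simp
    moreover have "\<bar>g' x\<bar> = 2 * x * a\<^sup>2 / w\<^sup>2" using x w by (simp add: g'_def w_def)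
    ultimately have "\<bar>g' x\<bar> * f (g x) = (2 * x * a\<^sup>2 / w\<^sup>2) * (x powr (s - 1) * (a powr (1 - s) / a\<^sup>2) * w)"
      by (simp only:)
    then show ?thesis using w a unfolding w_def[symmetric] by (simp add: field_simps power2_eq_square)
  qed
  have "((\<lambda>x. a powr (1 - s) * (x powr (s - 1) * (2 * x / (x\<^sup>2 + a\<^sup>2)))) has_integral Beta p q) {0<..}"
    by (rule has_integral_eq[OF eq hi])
  from has_integral_mult_right[OF this, of "a powr (s - 1)"]
  have "((\<lambda>x. a powr (s - 1) * (a powr (1 - s) * (x powr (s - 1) * (2 * x / (x\<^sup>2 + a\<^sup>2))))) has_integral a powr (s - 1) * Beta p q) {0<..}" .
  also have "(\<lambda>x. a powr (s - 1) * (a powr (1 - s) * (x powr (s - 1) * (2 * x / (x\<^sup>2 + a\<^sup>2))))) =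
     (\<lambda>x. x powr (s - 1) * (2 * x / (x\<^sup>2 + a\<^sup>2)))"
  proof
    fix x
    have "a powr (s - 1) * a powr (1 - s) = 1" using a by (simp flip: powr_add)
    then show "a powr (s - 1) * (a powr (1 - s) * (x powr (s - 1) * (2 * x / (x\<^sup>2 + a\<^sup>2)))) = x powr (s - 1) * (2 * x / (x\<^sup>2 + a\<^sup>2))"
      by (simp only: mult.assoc[symmetric] mult_1)
  qed
  finally have fin: "((\<lambda>x. x powr (s - 1) * (2 * x / (x\<^sup>2 + a\<^sup>2))) has_integral a powr (s - 1) * Beta p q) {0<..}" .
  have B: "Beta p q = pi / cos (pi * s / 2)"
  proof -
    have "complex_of_real (Gamma p) * complex_of_real (Gamma q) = of_real pi / of_real (sin (pi * p))"
    proof -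
      have "Gamma (1 - complex_of_real p) = of_real (Gamma q)"
        unfolding pq(4) by (metis Gamma_complex_of_real of_real_1 of_real_diff)
      moreover have "sin (complex_of_real pi * of_real p) = of_real (sin (pi * p))"
        by (metis sin_of_real of_real_mult)
      ultimately show ?thesis
        using Gamma_reflection_complex[of "of_real p"] by (simp only: Gamma_complex_of_real)
    qed
    then have "complex_of_real (Gamma p * Gamma q) = complex_of_real (pi / sin (pi * p))"
      by (simp only: of_real_mult of_real_divide)
    then have "Gamma p * Gamma q = pi / sin (pi * p)" by (simp only: of_real_eq_iff)
    also have "pi * p = pi * s / 2 + pi / 2" by (simp add: p_def field_simps)
    also have "sin \<dots> = cos (pi * s / 2)" by (simp add: sin_add)
    finally show ?thesis using pq by (simp add: Beta_def)
  qed
  show ?thesis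
    using nn_integral_has_integral_lebesgue[OF _ fin] by (simp add: B)
qed

text \<open>The error of the trapezoid rule for \<open>u powr - s\<close> on \<open>[n, n + 1]\<close>. Summed over \<open>n\<close>, these
  errors continue zeta to the half-plane \<open>Re s > -1\<close>. As \<open>0 powr z = 0\<close>, the term \<open>n = 0\<close> is the
  correct one only for \<open>Re s < 0\<close>.\<close>
definition trapezoid_error :: "complex \<Rightarrow> nat \<Rightarrow> complex" where
  "trapezoid_error s n = (of_nat n powr (- s) + of_nat (Suc n) powr (- s)) / 2
     - (of_nat (Suc n) powr (1 - s) - of_nat n powr (1 - s)) / (1 - s)"

text \<open>Euler-Maclaurin summation: for \<open>Re s > 1\<close>, \<open>1 / (s - 1)\<close> is
  the integral of \<open>u powr - s\<close> from 1 on, and \<open>1 / 2\<close> is half of the first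
  term.\<close>

definition zeta_trapezoid :: "complex \<Rightarrow> complex" where
  "zeta_trapezoid s = 1 / (s - 1) + 1 / 2 + (\<Sum>n. trapezoid_error s (Suc n))"

text \<open>\<open>Gamma s * \<tau> n\<close> is the Mellin transform of the trapezoid error
  \<open>H n x\<close> of \<open>exp (- u * x)\<close> on \<open>[n, n + 1]\<close>. Over
  \<open>n\<close> these errors form a geometric series with value
  \<open>coth (x / 2) / 2 - 1 / x\<close>, which is expanded in partial fractions and transformed
  term by term into the Dirichlet series at \<open>1 - s\<close>. Everything is nonnegative, so both
  exchanges hold in \<open>ennreal\<close> without convergence questions.\<close>

lemma trapezoid_error_real_sums:
  fixes s :: real
  assumes s: "-1 < s" "s < 0"
  defines "\<tau> \<equiv> (\<lambda>n. (real n powr (- s) + real (Suc n) powr (- s)) / 2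
     - (real (Suc n) powr (1 - s) - real n powr (1 - s)) / (1 - s))"
  shows "(\<lambda>n. Gamma s * \<tau> n) sums
    ((2 * pi) powr (s - 1) * pi / cos (pi * s / 2) * (\<Sum>n. real (Suc n) powr (s - 1)))"
proof -
  let ?c = "(2 * pi) powr (s - 1) * pi / cos (pi * s / 2)"
  define H where "H = (\<lambda>n x. exp (- real n * x) * ((1 + exp (- x)) / 2 - (1 - exp (- x)) / x))"
  define g where "g = (\<lambda>x::real. (1 + exp (- x)) / (2 * (1 - exp (- x))) - 1 / x)"
  have G: "Gamma s < 0"
  proof -
    have "Gamma (s + 1) = s * Gamma s" using s
      by (intro Gamma_plus1) (auto elim!: nonpos_Ints_cases)
    then have "s * Gamma s > 0" using s Gamma_real_pos[of "s+1"] by simp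
    then show ?thesis using s by (simp add: zero_less_mult_iff)
  qed
  have cpos: "cos (pi * s / 2) > 0"
  proof (rule cos_gt_zero_pi)
    have "pi * (-1) < pi * s" using s by (intro mult_strict_left_mono) auto
    then show "- (pi / 2) < pi * s / 2" by simp
    have "pi * s < pi * 1" using s by (intro mult_strict_left_mono) auto
    then show "pi * s / 2 < pi / 2" by simp
  qed
  \<comment> \<open>The partial fractions also supply the sign: their terms are nonnegative, hence
    so is \<open>g\<close>, and with it each error \<open>H n x\<close>.\<close>
  have gnn: "g x \<ge> 0" if "x > 0" for x
    using coth_partial_fractions[OF that] unfolding g_def
    by (rule sums_le[OF _ sums_zero, rotated]) (use that in auto)
  have H0: "(1 + exp (- x)) / 2 - (1 - exp (- x)) / x = g x * (1 - exp (- x))" if "x > 0" for x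
    using that by (simp add: g_def field_simps)
  have Hnn: "H n x \<ge> 0" if "x > 0" for n x
    unfolding H_def H0[OF that] using gnn[OF that] that by simp
  have Hsum: "(\<lambda>n. H n x) sums g x" if "x > 0" for x
  proof -
    have "(\<lambda>n. exp (- x) ^ n) sums (1 / (1 - exp (- x)))"
      using that by (intro geometric_sums) auto
    from sums_mult2[OF this, of "g x * (1 - exp (- x))"]
    show ?thesis unfolding H_def H0[OF that] using that
      by (simp add: exp_of_nat_mult[symmetric])
  qed
  have trm: "(\<integral>\<^sup>+x. ennreal (indicator {0<..} x * (x powr (s - 1) * H n x)) \<partial>lborel) = ennreal (Gamma s * \<tau> n) \<and> Gamma s * \<tau> n \<ge> 0" for n
  proof -
    define A where "A = (\<lambda>a x. ennreal (indicator {0<..} x * (x powr (s - 1) * (1 - exp (- a * x)))))"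
    define B where "B = (\<lambda>x. ennreal (indicator {0<..} x * (x powr (s - 1) * (1 - (exp (- real n * x) - exp (- (real n + 1) * x)) / x))))"
    define I where "I = (\<integral>\<^sup>+x. ennreal (indicator {0<..} x * (x powr (s - 1) * H n x)) \<partial>lborel)"
    \<comment> \<open>Subtraction in \<open>ennreal\<close> is truncated, so twice the definition of
      \<open>H\<close> is rearranged into an identity between sums of nonnegative terms.\<close>
    have eq: "2 * ennreal (indicator {0<..} x * (x powr (s - 1) * H n x)) + (A (real n) x + A (real n + 1) x) = 2 * B x" for x
    proof (cases "x > 0")
      case True
      have e: "exp (- (real n + 1) * x) = exp (- real n * x) * exp (- x)"
        unfolding exp_add[symmetric] by (rule arg_cong[where f = exp]) (simp add: algebra_simps)
      have le: "exp (- a * x) \<le> 1" if "a \<ge> 0" for a using True that by simp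
      have Hn: "x powr (s - 1) * H n x \<ge> 0" using Hnn[OF True] by simp
      have An: "x powr (s - 1) * (1 - exp (- a * x)) \<ge> 0" if "a \<ge> 0" for a using le[OF that] by simp
      have id: "2 * (x powr (s - 1) * H n x) + (x powr (s - 1) * (1 - exp (- real n * x)) + x powr (s - 1) * (1 - exp (- (real n + 1) * x)))
         = 2 * (x powr (s - 1) * (1 - (exp (- real n * x) - exp (- (real n + 1) * x)) / x))"
        unfolding e H_def using True by (simp add: field_simps)
      have two: "(2::ennreal) * ennreal r = ennreal (2 * r)" for r by (simp add: ennreal_mult')
      have "2 * ennreal (x powr (s - 1) * H n x) + (ennreal (x powr (s - 1) * (1 - exp (- real n * x))) + ennreal (x powr (s - 1) * (1 - exp (- (real n + 1) * x))))
         = ennreal (2 * (x powr (s - 1) * H n x) + (x powr (s - 1) * (1 - exp (- real n * x)) + x powr (s - 1) * (1 - exp (- (real n + 1) * x))))"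
        unfolding two using Hn An[of "real n"] An[of "real n + 1"] by (simp only: ennreal_plus[symmetric] add_nonneg_nonneg mult_nonneg_nonneg zero_le_numeral of_nat_0_le_iff zero_le_one)
      then show ?thesis unfolding id A_def B_def using True by (simp add: two)
    qed (simp add: A_def B_def)
    have m[measurable]: "(\<lambda>x. ennreal (indicator {0<..} x * (x powr (s - 1) * H n x))) \<in> borel_measurable lborel"
      "A a \<in> borel_measurable lborel" "B \<in> borel_measurable lborel" for a
      unfolding A_def B_def H_def by measurable
    have "2 * I + ((\<integral>\<^sup>+x. A (real n) x \<partial>lborel) + (\<integral>\<^sup>+x. A (real n + 1) x \<partial>lborel)) = 2 * (\<integral>\<^sup>+x. B x \<partial>lborel)"
      unfolding I_def
      by (simp add: nn_integral_add[symmetric] nn_integral_cmult[symmetric] eq)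
    moreover have "(\<integral>\<^sup>+x. A (real n) x \<partial>lborel) = ennreal (- Gamma s * real n powr (- s))"
      "(\<integral>\<^sup>+x. A (real n + 1) x \<partial>lborel) = ennreal (- Gamma s * (real n + 1) powr (- s))"
      unfolding A_def using s by (intro nn_integral_powr_one_minus_exp; simp)+
    moreover have "(\<integral>\<^sup>+x. B x \<partial>lborel) = ennreal (- Gamma s * (((real n + 1) powr (1 - s) - real n powr (1 - s)) / (1 - s)))"
      unfolding B_def using s by (intro nn_integral_powr_one_minus_exp_mean; simp)
    ultimately have I: "2 * I + (ennreal (- Gamma s * real n powr (- s)) + ennreal (- Gamma s * (real n + 1) powr (- s)))
       = 2 * ennreal (- Gamma s * (((real n + 1) powr (1 - s) - real n powr (1 - s)) / (1 - s)))" by simp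
    \<comment> \<open>Finiteness of \<open>I\<close> is read off from the same identity, which can
      then be solved for \<open>I\<close> over the reals.\<close>
    have "I \<noteq> top"
    proof
      assume "I = top"
      then have "(2::ennreal) * ennreal (- Gamma s * (((real n + 1) powr (1 - s) - real n powr (1 - s)) / (1 - s))) = top"
        using I by (simp add: ennreal_mult_top)
      moreover have "(2::ennreal) * ennreal z = ennreal (2 * z)" for z by (simp add: ennreal_mult')
      ultimately show False by (simp only: ennreal_neq_top)
    qed
    then obtain r where r: "I = ennreal r" "r \<ge> 0" by (cases I) auto
    have g: "- Gamma s \<ge> 0" using G by simp
    have J: "((real n + 1) powr (1 - s) - real n powr (1 - s)) / (1 - s) \<ge> 0"
      using s by (intro divide_nonneg_nonneg) (auto intro: powr_mono2)
    have nn: "- Gamma s * real n powr (- s) \<ge> 0" "- Gamma s * (real n + 1) powr (- s) \<ge> 0"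
      "- Gamma s * (((real n + 1) powr (1 - s) - real n powr (1 - s)) / (1 - s)) \<ge> 0"
      using mult_nonneg_nonneg[OF g J] mult_nonneg_nonneg[OF g powr_ge_zero] by blast+
    have inj: "2 * r + (a + b) = 2 * c" if "a \<ge> 0" "b \<ge> 0" "c \<ge> 0" "2 * ennreal r + (ennreal a + ennreal b) = 2 * ennreal c" for a b c
    proof -
      have "2 * ennreal r + (ennreal a + ennreal b) = ennreal (2 * r + (a + b))" using that r by (simp add: ennreal_mult')
      moreover have "2 * ennreal c = ennreal (2 * c)" by (simp add: ennreal_mult')
      ultimately have "ennreal (2 * r + (a + b)) = ennreal (2 * c)" using that(4) by simp
      then show ?thesis using that r by (subst (asm) ennreal_inj) auto
    qed
    have "2 * r + (- Gamma s * real n powr (- s) + - Gamma s * (real n + 1) powr (- s)) =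
      2 * (- Gamma s * (((real n + 1) powr (1 - s) - real n powr (1 - s)) / (1 - s)))"
      by (rule inj[OF nn I[unfolded r]])
    moreover have "r = G * ((A + B) / 2 - J)" if "2 * r + (- G * A + - G * B) = 2 * (- G * J)" for A B J G
      using that by (simp add: algebra_simps)
    ultimately have "r = Gamma s * \<tau> n" unfolding \<tau>_def of_nat_Suc by (simp only: add.commute[of 1])
    then show ?thesis using r unfolding I_def by simp
  qed
  have sm: "summable (\<lambda>n. real (Suc n) powr (s - 1))"
    using s by (subst summable_Suc_iff) (simp add: summable_real_powr_iff)
  have fin: "(\<lambda>n. ?c * real (Suc n) powr (s - 1)) sums (?c * (\<Sum>n. real (Suc n) powr (s - 1)))"
    using sm by (intro sums_mult summable_sums)
  have "(\<Sum>n. ennreal (Gamma s * \<tau> n)) = (\<Sum>n. \<integral>\<^sup>+x. ennreal (indicator {0<..} x * (x powr (s - 1) * H n x)) \<partial>lborel)"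
    using trm by simp
  also have "\<dots> = (\<integral>\<^sup>+x. (\<Sum>n. ennreal (indicator {0<..} x * (x powr (s - 1) * H n x))) \<partial>lborel)"
    unfolding H_def by (intro nn_integral_suminf[symmetric]) measurable
  also have "\<dots> = (\<integral>\<^sup>+x. ennreal (indicator {0<..} x * (x powr (s - 1) * g x)) \<partial>lborel)"
  proof (intro nn_integral_cong)
    fix x :: real
    show "(\<Sum>n. ennreal (indicator {0<..} x * (x powr (s - 1) * H n x))) = ennreal (indicator {0<..} x * (x powr (s - 1) * g x))"
    proof (cases "x > 0")
      case True
      then show ?thesis using Hnn[OF True] sums_mult[OF Hsum[OF True]] by (intro suminf_ennreal_eq) auto
    qed simp
  qed
  also have "\<dots> = (\<integral>\<^sup>+x. (\<Sum>n. ennreal (indicator {0<..} x * (x powr (s - 1) * (2 * x / (x\<^sup>2 + (2 * pi * real (Suc n))\<^sup>2))))) \<partial>lborel)"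
  proof (intro nn_integral_cong)
    fix x :: real
    show "ennreal (indicator {0<..} x * (x powr (s - 1) * g x)) = (\<Sum>n. ennreal (indicator {0<..} x * (x powr (s - 1) * (2 * x / (x\<^sup>2 + (2 * pi * real (Suc n))\<^sup>2)))))"
    proof (cases "x > 0")
      case True
      have "(\<Sum>n. ennreal (x powr (s - 1) * (2 * x / (x\<^sup>2 + (2 * pi * real (Suc n))\<^sup>2)))) = ennreal (x powr (s - 1) * g x)"
        using sums_mult[OF coth_partial_fractions[OF True]] True unfolding g_def by (intro suminf_ennreal_eq) auto
      then show ?thesis using True by simp
    qed simp
  qed
  also have "\<dots> = (\<Sum>n. \<integral>\<^sup>+x. ennreal (indicator {0<..} x * (x powr (s - 1) * (2 * x / (x\<^sup>2 + (2 * pi * real (Suc n))\<^sup>2)))) \<partial>lborel)"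
    by (intro nn_integral_suminf) measurable
  also have "\<dots> = (\<Sum>n. ennreal (?c * real (Suc n) powr (s - 1)))"
  proof (intro suminf_cong)
    fix n
    have e: "(2 * pi * real (Suc n)) powr (s - 1) = (2 * pi) powr (s - 1) * real (Suc n) powr (s - 1)"
      by (rule powr_mult)
    have "(\<integral>\<^sup>+x. ennreal (indicator {0<..} x * (x powr (s - 1) * (2 * x / (x\<^sup>2 + (2 * pi * real (Suc n))\<^sup>2)))) \<partial>lborel)
       = ennreal ((2 * pi * real (Suc n)) powr (s - 1) * pi / cos (pi * s / 2))"
      by (rule nn_integral_powr_div_quadratic[OF s]) simp
    then show "(\<integral>\<^sup>+x. ennreal (indicator {0<..} x * (x powr (s - 1) * (2 * x / (x\<^sup>2 + (2 * pi * real (Suc n))\<^sup>2)))) \<partial>lborel) = ennreal (?c * real (Suc n) powr (s - 1))"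
      unfolding e by (simp only: times_divide_eq_left mult.assoc mult.commute[of "real (Suc n) powr (s - 1)" pi])
  qed
  also have "\<dots> = ennreal (?c * (\<Sum>n. real (Suc n) powr (s - 1)))"
    using cpos fin by (intro suminf_ennreal_eq) auto
  finally have E: "(\<Sum>n. ennreal (Gamma s * \<tau> n)) = ennreal (?c * (\<Sum>n. real (Suc n) powr (s - 1)))" .
  have nn: "Gamma s * \<tau> n \<ge> 0" for n using trm by blast
  have smG: "summable (\<lambda>n. Gamma s * \<tau> n)"
    using E nn by (intro summable_suminf_not_top) auto
  then have "(\<Sum>n. Gamma s * \<tau> n) = ?c * (\<Sum>n. real (Suc n) powr (s - 1))"
  proof -
    have "ennreal (\<Sum>n. Gamma s * \<tau> n) = ennreal (?c * (\<Sum>n. real (Suc n) powr (s - 1)))"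
      using E nn by (subst suminf_ennreal[symmetric]) auto
    moreover have "(\<Sum>n. Gamma s * \<tau> n) \<ge> 0" using smG nn by (rule suminf_nonneg)
    moreover have "?c * (\<Sum>n. real (Suc n) powr (s - 1)) \<ge> 0"
      using cpos suminf_nonneg[OF sm] by (intro mult_nonneg_nonneg divide_nonneg_nonneg) auto
    ultimately show ?thesis by (simp only: ennreal_inj)
  qed
  then show ?thesis using summable_sums[OF smG] by (simp only:)
qed

section \<open>Continuation by trapezoid errors\<close>

lemma norm_trapezoid_error_le:
  assumes "n \<ge> 1" "s \<noteq> 1" "Re s \<ge> -2"
  shows "norm (trapezoid_error s n) \<le> norm s * norm (s + 1) * real n powr (- Re s - 2)"
proof -
  let ?S = "closed_segment (of_nat n :: complex) (of_nat (Suc n))"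
  \<comment> \<open>\<open>H\<close> is a primitive of \<open>(u - n) * (n + 1 - u) / 2\<close>
    times the second derivative of \<open>u powr - s\<close>, found by integrating by parts twice.
    Its increment over the segment is the trapezoid error, so a bound for its derivative
    suffices.\<close>
  define H where "H = (\<lambda>u::complex. (u - of_nat n) * (of_nat n + 1 - u) / 2 * (- s * u powr (- s - 1))
     + (u - of_nat n - 1/2) * u powr (- s) - u powr (1 - s) / (1 - s))"
  have S: "\<exists>r. u = of_real r \<and> real n \<le> r \<and> r \<le> real n + 1" if "u \<in> ?S" for u
  proof -
    have "\<exists>t. 0 \<le> t \<and> t \<le> 1 \<and> u = (1 - t) *\<^sub>R of_nat n + t *\<^sub>R of_nat (Suc n)"
      using that by (simp only: in_segment)
    then obtain t where t: "0 \<le> t" "t \<le> 1" "u = (1 - t) *\<^sub>R of_nat n + t *\<^sub>R of_nat (Suc n)"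
      by blast
    have "u = of_real (real n + t)" unfolding t(3) by (simp add: scaleR_conv_of_real algebra_simps)
    then show ?thesis using t by (intro exI[of _ "real n + t"]) auto
  qed
  have der: "(H has_field_derivative (u - of_nat n) * (of_nat n + 1 - u) / 2 * (s * (s + 1) * u powr (- s - 2))) (at u within ?S)"
    if "u \<in> ?S" for u
  proof -
    note uS = that
    obtain r where r: "u = of_real r" "real n \<le> r" using S[OF uS] by auto
    then have "r > 0" using assms by auto
    then have nz: "u \<notin> \<real>\<^sub>\<le>\<^sub>0" "u \<noteq> 0" using r by auto
    define N where "N = (of_nat n :: complex)"
    have H_N: "H = (\<lambda>u. (u - N) * (N + 1 - u) / 2 * (- s * u powr (- s - 1))
     + (u - N - 1/2) * u powr (- s) - u powr (1 - s) / (1 - s))" unfolding H_def N_def ..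
    have pw: "((\<lambda>u. u powr a) has_field_derivative a * u powr (a - 1)) (at u within ?S)" for a
      using has_field_derivative_powr[OF nz(1)] by (rule DERIV_subset) simp
    have P1: "((\<lambda>u. (u - N) * (N + 1 - u) / 2) has_field_derivative ((N + 1 - u) - (u - N)) / 2) (at u within ?S)"
      by (auto intro!: derivative_eq_intros)
    have P2: "((\<lambda>u. u - N - 1/2) has_field_derivative 1) (at u within ?S)"
      by (auto intro!: derivative_eq_intros)
    have "(H has_field_derivative
       (((N + 1 - u) - (u - N)) / 2 * (- s * u powr (- s - 1)) + (- s * ((- s - 1) * u powr (- s - 1 - 1))) * ((u - N) * (N + 1 - u) / 2)
       + (1 * u powr (- s) + (- s * u powr (- s - 1)) * (u - N - 1/2)) - ((1 - s) * u powr (1 - s - 1)) / (1 - s))) (at u within ?S)"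
      unfolding H_N
      by (rule DERIV_diff[OF DERIV_add[OF DERIV_mult[OF P1 DERIV_cmult[OF pw]] DERIV_mult[OF P2 pw]] DERIV_cdivide[OF pw]])
    moreover have "((N + 1 - u) - (u - N)) / 2 * (- s * u powr (- s - 1)) + (- s * ((- s - 1) * u powr (- s - 1 - 1))) * ((u - N) * (N + 1 - u) / 2)
       + (1 * u powr (- s) + (- s * u powr (- s - 1)) * (u - N - 1/2)) - ((1 - s) * u powr (1 - s - 1)) / (1 - s)
      = (u - of_nat n) * (of_nat n + 1 - u) / 2 * (s * (s + 1) * u powr (- s - 2))"
    proof -
      have e: "1 - s - 1 = - s" "- s - 1 - 1 = - s - 2" by simp_all
      have c: "((1 - s) * X) / (1 - s) = X" for X using assms by simp
      have "((N + 1 - u) - (u - N)) / 2 * (- s * B) + (- s * ((- s - 1) * C)) * ((u - N) * (N + 1 - u) / 2)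
         + (1 * A + (- s * B) * (u - N - 1/2)) - A = (u - N) * (N + 1 - u) / 2 * (s * (s + 1) * C)" for A B C :: complex
        by (simp add: algebra_simps diff_divide_distrib add_divide_distrib)
      then show ?thesis unfolding e c N_def .
    qed
    ultimately show ?thesis by (simp only:)
  qed
  have bd: "norm ((u - of_nat n) * (of_nat n + 1 - u) / 2 * (s * (s + 1) * u powr (- s - 2))) \<le> norm s * norm (s + 1) * real n powr (- Re s - 2)"
    if "u \<in> ?S" for u
  proof -
    note uS = that
    obtain r where r: "u = of_real r" "real n \<le> r" "r \<le> real n + 1" using S[OF uS] by auto
    have "norm (u - of_nat n) \<le> 1"
    proof -
      have "u - of_nat n = of_real (r - real n)" by (simp add: r(1))
      then show ?thesis using r by (simp only: norm_of_real)
    qed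
    moreover have "of_nat n + 1 - u = of_real (real n + 1 - r)" by (simp add: r(1))
    then have "norm (of_nat n + 1 - u) \<le> 1"
      using r by (simp only: norm_of_real)
    ultimately have "norm ((u - of_nat n) * (of_nat n + 1 - u) / 2) \<le> 1"
      using mult_mono[of "norm (u - of_nat n)" 1 "norm (of_nat n + 1 - u)" 1] by (simp add: norm_mult norm_divide)
    moreover have "norm (u powr (- s - 2)) \<le> real n powr (- Re s - 2)"
    proof -
      have "norm (u powr (- s - 2)) = r powr (- Re s - 2)"
        using r assms by (subst norm_powr_real_powr) auto
      also have "\<dots> \<le> real n powr (- Re s - 2)"
        using r assms by (intro powr_mono2') auto
      finally show ?thesis .
    qed
    then have "norm (s * (s + 1) * u powr (- s - 2)) \<le> norm s * norm (s + 1) * real n powr (- Re s - 2)"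
      by (simp add: norm_mult mult_left_mono)
    ultimately show ?thesis
      using mult_mono[of "norm ((u - of_nat n) * (of_nat n + 1 - u) / 2)" 1 "norm (s * (s + 1) * u powr (- s - 2))"]
      by (simp add: norm_mult)
  qed
  have "norm (H (of_nat (Suc n)) - H (of_nat n)) \<le> norm s * norm (s + 1) * real n powr (- Re s - 2) * norm (of_nat (Suc n) - of_nat n :: complex)"
    by (rule field_differentiable_bound[OF convex_closed_segment der bd]) auto
  moreover have "H (of_nat (Suc n)) - H (of_nat n) = trapezoid_error s n"
  proof -
    have "H (of_nat n) = - (of_nat n powr (- s) / 2) - of_nat n powr (1 - s) / (1 - s)" by (simp add: H_def)
    moreover have "H (of_nat (Suc n)) = of_nat (Suc n) powr (- s) / 2 - of_nat (Suc n) powr (1 - s) / (1 - s)" by (simp add: H_def)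
    ultimately show ?thesis by (simp add: trapezoid_error_def add_divide_distrib diff_divide_distrib)
  qed
  ultimately show ?thesis by (simp add: algebra_simps)
qed

lemma divide_one_minus: "a / (1 - s) = - (a / (s - 1))" for a s :: complex
proof -
  have "1 - s = - (s - 1)" by simp
  then show ?thesis by (simp only: divide_minus_right)
qed

lemma summable_trapezoid_bound:
  fixes r :: real assumes "r > -1" shows "summable (\<lambda>n. real (Suc n) powr (- r - 2))"
  using assms by (subst summable_Suc_iff) (simp add: summable_real_powr_iff)

lemma trapezoid_error_summable:
  assumes "Re s > -1" "s \<noteq> 1"
  shows "summable (\<lambda>n. trapezoid_error s (Suc n))"
proof (rule summable_comparison_test[OF exI[of _ 0]])
  show "summable (\<lambda>n. norm s * norm (s + 1) * real (Suc n) powr (- Re s - 2))"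
    using assms by (intro summable_mult summable_trapezoid_bound)
  show "\<forall>n\<ge>0. norm (trapezoid_error s (Suc n)) \<le> norm s * norm (s + 1) * real (Suc n) powr (- Re s - 2)"
    using norm_trapezoid_error_le[of "Suc _" s] assms by auto
qed

lemma sum_trapezoid_error:
  assumes "s \<noteq> 1"
  shows "(\<Sum>n<N. trapezoid_error s (Suc n)) = (\<Sum>n<N. of_nat (Suc n) powr (- s)) - 1 / 2
    + of_nat (Suc N) powr (- s) / 2 - (of_nat (Suc N) powr (1 - s) - 1) / (1 - s)"
proof (induction N)
  case (Suc N)
  have "(\<Sum>n<Suc N. trapezoid_error s (Suc n)) = (\<Sum>n<N. of_nat (Suc n) powr (- s)) - 1 / 2
    + of_nat (Suc N) powr (- s) / 2 - (of_nat (Suc N) powr (1 - s) - 1) / (1 - s) + trapezoid_error s (Suc N)"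
    using Suc by simp
  then show ?case by (simp add: trapezoid_error_def diff_divide_distrib add_divide_distrib)
qed simp

lemma tendsto_Suc_powr_0:
  fixes w :: complex assumes "Re w < 0"
  shows "(\<lambda>N. of_nat (Suc N) powr w) \<longlonglongrightarrow> 0"
proof (rule tendsto_norm_zero_cancel)
  have "(\<lambda>N. real (Suc N) powr Re w) \<longlonglongrightarrow> 0"
    using assms by (intro tendsto_neg_powr filterlim_compose[OF filterlim_real_sequentially filterlim_Suc])
  then show "(\<lambda>N. norm (of_nat (Suc N) powr w)) \<longlonglongrightarrow> 0"
    by (subst norm_powr_real_powr) auto
qed

lemma zeta_trapezoid_dirichlet:
  assumes "Re s > 1"
  shows "(\<lambda>n. of_nat (Suc n) powr (- s)) sums zeta_trapezoid s"
proof -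
  have s1: "s \<noteq> 1" using assms by auto
  have "(\<lambda>N. (\<Sum>n<N. trapezoid_error s (Suc n)) + 1 / 2 - of_nat (Suc N) powr (- s) / 2 + (of_nat (Suc N) powr (1 - s) - 1) / (1 - s))
     \<longlonglongrightarrow> (\<Sum>n. trapezoid_error s (Suc n)) + 1 / 2 - 0 / 2 + (0 - 1) / (1 - s)"
    using assms s1 by (intro tendsto_intros tendsto_Suc_powr_0 summable_LIMSEQ trapezoid_error_summable) auto
  also have "(\<lambda>N. (\<Sum>n<N. trapezoid_error s (Suc n)) + 1 / 2 - of_nat (Suc N) powr (- s) / 2 + (of_nat (Suc N) powr (1 - s) - 1) / (1 - s))
     = (\<lambda>N. \<Sum>n<N. of_nat (Suc n) powr (- s))"
    unfolding sum_trapezoid_error[OF s1] by (simp add: fun_eq_iff)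
  also have "(\<Sum>n. trapezoid_error s (Suc n)) + 1 / 2 - 0 / 2 + (0 - 1) / (1 - s) = zeta_trapezoid s"
    by (simp add: zeta_trapezoid_def divide_one_minus)
  finally show ?thesis unfolding sums_def .
qed

lemma zeta_trapezoid_holomorphic: "zeta_trapezoid holomorphic_on ({s. Re s > -1} - {1})"
proof -
  let ?S = "{s. Re s > -1} - {1::complex}"
  have oS: "open ?S" by (intro open_Diff open_halfspace_Re_gt) auto
  have hol: "(\<lambda>s. trapezoid_error s (Suc n)) holomorphic_on ?S" for n
    unfolding trapezoid_error_def by (intro holomorphic_intros) auto
  obtain g where g: "\<forall>x\<in>?S. ((\<lambda>n. trapezoid_error x (Suc n)) sums g x) \<and> g field_differentiable (at x)"
  proof (rule series_differentiable_comparison_complex[OF oS, of "\<lambda>n s. trapezoid_error s (Suc n)"])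
    show "(\<lambda>s. trapezoid_error s (Suc n)) field_differentiable at x" if "x \<in> ?S" for n x
      using hol[of n] oS that holomorphic_on_imp_differentiable_at by blast
    fix x assume x: "x \<in> ?S"
    \<comment> \<open>Half the distance to the line \<open>Re s = -1\<close>: on the ball
      \<open>Re y > (Re x - 1) / 2 > -1\<close>, so one summable majorant serves all
      \<open>y\<close>.\<close>
    define d where "d = (Re x + 1) / 2"
    define K where "K = (norm x + d) * (norm x + d + 1)"
    have d: "d > 0" using x by (simp add: d_def)
    have bd: "norm (trapezoid_error y (Suc n)) \<le> K * real (Suc n) powr (- (Re x - d) - 2)" if y: "y \<in> ball x d \<inter> ?S" for n y
    proof -
      have dxy: "norm (y - x) < d" using y by (simp add: dist_norm norm_minus_commute)
      have ny: "norm y \<le> norm x + d" using dxy norm_triangle_sub[of y x] by linarith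
      have ny1: "norm (y + 1) \<le> norm x + d + 1" using ny norm_triangle_ineq[of y 1] by simp
      have "\<bar>Re (y - x)\<bar> < d" using dxy abs_Re_le_cmod[of "y - x"] by linarith
      then have ry: "Re y > Re x - d" by simp
      have "norm (trapezoid_error y (Suc n)) \<le> norm y * norm (y + 1) * real (Suc n) powr (- Re y - 2)"
        using y by (intro norm_trapezoid_error_le) auto
      also have "\<dots> \<le> K * real (Suc n) powr (- (Re x - d) - 2)"
        unfolding K_def using ny ny1 ry d by (intro mult_mono powr_mono) auto
      finally show ?thesis .
    qed
    show "\<exists>d (h :: nat \<Rightarrow> complex). 0 < d \<and> summable h \<and> range h \<subseteq> \<real>\<^sub>\<ge>\<^sub>0 \<and>
        (\<forall>\<^sub>F n in sequentially. \<forall>y\<in>ball x d \<inter> ?S. norm (trapezoid_error y (Suc n)) \<le> norm (h n))"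
    proof (intro exI[of _ d] exI[of _ "\<lambda>n. of_real (K * real (Suc n) powr (- (Re x - d) - 2))"] conjI)
      have K: "K \<ge> 0" using d by (simp add: K_def)
      have "summable (\<lambda>n. K * real (Suc n) powr (- (Re x - d) - 2))"
      proof (intro summable_mult summable_trapezoid_bound)
        have "Re x - d = (Re x - 1) / 2" by (simp add: d_def field_simps)
        then show "-1 < Re x - d" using x by simp
      qed
      then show "summable (\<lambda>n. complex_of_real (K * real (Suc n) powr (- (Re x - d) - 2)))"
        by (rule summable_of_real)
      show "range (\<lambda>n. complex_of_real (K * real (Suc n) powr (- (Re x - d) - 2))) \<subseteq> \<real>\<^sub>\<ge>\<^sub>0"
        using K by auto
      show "\<forall>\<^sub>F n in sequentially. \<forall>y\<in>ball x d \<inter> ?S. norm (trapezoid_error y (Suc n)) \<le> norm (complex_of_real (K * real (Suc n) powr (- (Re x - d) - 2)))"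
        using bd K by (intro always_eventually allI ballI) (simp only: norm_of_real abs_of_nonneg mult_nonneg_nonneg powr_ge_zero)
    qed (use d in simp)
  qed blast
  have "g holomorphic_on ?S"
    using g oS by (auto simp: holomorphic_on_open field_differentiable_def)
  then have "(\<lambda>s. 1 / (s - 1) + 1 / 2 + g s) holomorphic_on ?S"
    by (intro holomorphic_intros) auto
  then show ?thesis
  proof (rule holomorphic_transform)
    fix s assume "s \<in> ?S"
    then have "(\<lambda>n. trapezoid_error s (Suc n)) sums g s" using g by blast
    then have "(\<Sum>n. trapezoid_error s (Suc n)) = g s" by (rule sums_unique[symmetric])
    then show "1 / (s - 1) + 1 / 2 + g s = zeta_trapezoid s" by (simp add: zeta_trapezoid_def)
  qed
qed

text \<open>\<open>M powr (1 - s) / (s - 1)\<close> continues the integral of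
  \<open>u powr - s\<close> from \<open>M\<close> on. What remains is half a boundary term and the
  tail of the errors; splitting \<open>n powr (- Re s - 2)\<close> into at most
  \<open>M powr - Re s\<close> and an inverse square makes the bound uniform for
  \<open>Re s >= 0\<close>.\<close>

lemma norm_zeta_trapezoid_approx_le:
  assumes "Re s \<ge> 0" "s \<noteq> 1" "M \<ge> 1"
  shows "norm (zeta_trapezoid s - ((\<Sum>n\<in>{1..<M}. of_nat n powr (- s)) + of_nat M powr (1 - s) / (s - 1)))
    \<le> (1 + 2 * norm s * norm (s + 1)) * real M powr (- Re s)"
proof -
  obtain N where N: "M = Suc N" using assms(3) by (cases M) auto
  have sm: "summable (\<lambda>n. trapezoid_error s (Suc n))" using assms by (intro trapezoid_error_summable) auto
  define R where "R = (\<Sum>n. trapezoid_error s (Suc (n + N)))"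
  have "zeta_trapezoid s = 1 / (s - 1) + 1 / 2 + (R + (\<Sum>n<N. trapezoid_error s (Suc n)))"
    unfolding zeta_trapezoid_def R_def using suminf_split_initial_segment[OF sm, of N] by simp
  also have "\<dots> = R + (\<Sum>n<N. of_nat (Suc n) powr (- s)) + of_nat M powr (- s) / 2 + of_nat M powr (1 - s) / (s - 1)"
  proof -
    have "(of_nat M powr (1 - s) - 1) / (1 - s) = - (of_nat M powr (1 - s) / (s - 1)) + 1 / (s - 1)"
      by (simp add: divide_one_minus diff_divide_distrib)
    then show ?thesis unfolding sum_trapezoid_error[OF assms(2)] N[symmetric] by simp
  qed
  also have "(\<Sum>n<N. of_nat (Suc n) powr (- s)) = (\<Sum>n\<in>{1..<M}. of_nat n powr (- s))"
    unfolding N by (rule sum.reindex_bij_witness[of _ "\<lambda>n. n - 1" Suc]) auto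
  finally have eq: "zeta_trapezoid s - ((\<Sum>n\<in>{1..<M}. of_nat n powr (- s)) + of_nat M powr (1 - s) / (s - 1)) = R + of_nat M powr (- s) / 2"
    by simp
  have isq: "(\<lambda>n. 1 / (real (Suc n))\<^sup>2) sums (pi\<^sup>2 / 6)"
    using inverse_squares_sums by (simp add: add.commute)
  have sm2: "summable (\<lambda>n. norm s * norm (s + 1) * real M powr (- Re s) * (1 / (real (Suc n))\<^sup>2))"
  proof (intro summable_mult)
    show "summable (\<lambda>n. 1 / (real (Suc n))\<^sup>2)"
      using isq by (rule sums_summable)
  qed
  have le: "norm (trapezoid_error s (Suc (n + N))) \<le> norm s * norm (s + 1) * real M powr (- Re s) * (1 / (real (Suc n))\<^sup>2)" for n
  proof -
    have "norm (trapezoid_error s (Suc (n + N))) \<le> norm s * norm (s + 1) * real (Suc (n + N)) powr (- Re s - 2)"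
      using assms by (intro norm_trapezoid_error_le) auto
    also have "real (Suc (n + N)) powr (- Re s - 2) = real (Suc (n + N)) powr (- Re s) * (1 / (real (Suc (n + N)))\<^sup>2)"
      by (simp add: powr_diff)
    also have "\<dots> \<le> real M powr (- Re s) * (1 / (real (Suc n))\<^sup>2)"
      using assms by (intro mult_mono powr_mono2' divide_left_mono power_mono) (auto simp: N)
    finally show ?thesis by (simp add: mult_left_mono mult.assoc)
  qed
  have smn: "summable (\<lambda>n. norm (trapezoid_error s (Suc (n + N))))"
    using le by (intro summable_comparison_test[OF exI[of _ 0] sm2]) auto
  have "norm R \<le> (\<Sum>n. norm (trapezoid_error s (Suc (n + N))))"
    unfolding R_def by (rule summable_norm[OF smn])
  also have "\<dots> \<le> (\<Sum>n. norm s * norm (s + 1) * real M powr (- Re s) * (1 / (real (Suc n))\<^sup>2))"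
    using le smn sm2 by (intro suminf_le) auto
  also have "\<dots> = norm s * norm (s + 1) * real M powr (- Re s) * (pi\<^sup>2 / 6)"
    using sums_unique[OF sums_mult[OF isq]] by simp
  also have "\<dots> \<le> norm s * norm (s + 1) * real M powr (- Re s) * 2"
  proof (intro mult_left_mono)
    have "pi\<^sup>2 \<le> (3.2)\<^sup>2" using pi_approx by (intro power_mono) auto
    then show "pi\<^sup>2 / 6 \<le> 2" by (simp add: power2_eq_square)
  qed auto
  finally have R: "norm R \<le> norm s * norm (s + 1) * real M powr (- Re s) * 2" .
  have "norm (of_nat M powr (- s) / 2) \<le> real M powr (- Re s)"
    using assms norm_powr_real_powr[of "of_nat M" "- s"] by (simp add: norm_divide)
  then show ?thesis unfolding eq using R norm_triangle_ineq[of R "of_nat M powr (- s) / 2"] by (simp add: algebra_simps)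
qed

section \<open>The functional equation and the uniqueness of zeta\<close>

lemma zeta_chi_holomorphic:
  assumes "\<And>s. s \<in> A \<Longrightarrow> 1 - s \<notin> \<int>\<^sub>\<le>\<^sub>0"
  shows "zeta_chi holomorphic_on A"
proof -
  have "Gamma holomorphic_on ((\<lambda>s. 1 - s) ` A)"
    using assms by (intro holomorphic_Gamma) auto
  from holomorphic_on_compose[OF _ this]
  have "(\<lambda>s. Gamma (1 - s)) holomorphic_on A" by (simp add: o_def holomorphic_intros)
  moreover have "(\<lambda>s. 2 powr s * of_real pi powr (s - 1) * sin (of_real pi * s / 2)) holomorphic_on A"
    by (intro holomorphic_intros) auto
  ultimately show ?thesis unfolding zeta_chi_def[abs_def] by (rule holomorphic_on_mult[rotated])
qed

text \<open>For \<open>x < 0\<close> the polar part \<open>1 / (x - 1) + 1 / 2\<close> is itself the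
  trapezoid error at \<open>n = 0\<close>, as \<open>0 powr _ = 0\<close> is then the right value.
  So \<open>zeta_trapezoid x\<close> is the full sum over \<open>n >= 0\<close>, which the Mellin
  computation evaluates; its factor \<open>c / Gamma x\<close> becomes \<open>zeta_chi x\<close> by
  the reflection formula and the doubling of the sine.\<close>

lemma zeta_trapezoid_functional_real:
  fixes x :: real
  assumes x: "-1 < x" "x < 0"
  shows "zeta_trapezoid (of_real x) = zeta_chi (of_real x) * zeta_trapezoid (1 - of_real x)"
proof -
  define \<tau> where "\<tau> = (\<lambda>n. (real n powr (- x) + real (Suc n) powr (- x)) / 2
     - (real (Suc n) powr (1 - x) - real n powr (1 - x)) / (1 - x))"
  define c where "c = (2 * pi) powr (x - 1) * pi / cos (pi * x / 2)"
  define Z where "Z = (\<Sum>n. real (Suc n) powr (x - 1))"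
  have S: "(\<lambda>n. Gamma x * \<tau> n) sums (c * Z)"
    unfolding \<tau>_def c_def Z_def using trapezoid_error_real_sums[OF x] .
  have G: "Gamma x \<noteq> 0" using x by (auto simp: Gamma_eq_zero_iff elim!: nonpos_Ints_cases)
  have te: "trapezoid_error (of_real x) n = of_real (\<tau> n)" for n
  proof -
    have p: "of_nat m powr (complex_of_real r) = of_real (real m powr r)" for m r
      using powr_of_real[of "real m" r] by simp
    have "of_nat n powr (- complex_of_real x) = of_real (real n powr (- x))" "of_nat (Suc n) powr (- complex_of_real x) = of_real (real (Suc n) powr (- x))"
      "of_nat n powr (1 - complex_of_real x) = of_real (real n powr (1 - x))" "of_nat (Suc n) powr (1 - complex_of_real x) = of_real (real (Suc n) powr (1 - x))"
      using p[of n "- x"] p[of "Suc n" "- x"] p[of n "1 - x"] p[of "Suc n" "1 - x"] by (simp_all del: of_nat_Suc)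
    then show ?thesis unfolding trapezoid_error_def \<tau>_def by (simp only: of_real_add of_real_diff of_real_divide of_real_1 of_real_numeral)
  qed
  have zt: "zeta_trapezoid (of_real x) = of_real (\<Sum>n. \<tau> n)"
  proof -
    have sm: "summable \<tau>" using S G by (metis sums_summable summable_cmult_iff)
    then have "(\<Sum>n. \<tau> n) = \<tau> 0 + (\<Sum>n. \<tau> (Suc n))"
      by (subst suminf_split_head) auto
    moreover have "\<tau> 0 = 1 / 2 + 1 / (x - 1)" using x by (simp add: \<tau>_def field_simps)
    moreover have "(\<Sum>n. trapezoid_error (of_real x) (Suc n)) = of_real (\<Sum>n. \<tau> (Suc n))"
      unfolding te by (rule suminf_of_real[symmetric]) (use sm in \<open>simp add: summable_Suc_iff\<close>)
    ultimately show ?thesis by (simp add: zeta_trapezoid_def)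
  qed
  have z1: "zeta_trapezoid (1 - of_real x) = of_real Z"
  proof -
    have "(\<lambda>n. of_nat (Suc n) powr (- (1 - complex_of_real x))) sums zeta_trapezoid (1 - of_real x)"
      using x by (intro zeta_trapezoid_dirichlet) auto
    moreover have "of_nat (Suc n) powr (- (1 - complex_of_real x)) = of_real (real (Suc n) powr (x - 1))" for n
      using powr_of_real[of "real (Suc n)" "x - 1"] by (simp del: of_nat_Suc)
    moreover have "(\<lambda>n. real (Suc n) powr (x - 1)) sums Z"
      unfolding Z_def using x by (intro summable_sums) (subst summable_Suc_iff, simp add: summable_real_powr_iff)
    then have "(\<lambda>n. complex_of_real (real (Suc n) powr (x - 1))) sums of_real Z" by (rule sums_of_real)
    ultimately show ?thesis using sums_unique2 by simp
  qed
  have sinx: "sin (pi * x / 2) < 0"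
  proof -
    have "pi * x < 0" using x by (simp add: mult_pos_neg)
    moreover have "pi * (-1) < pi * x" using x by (intro mult_strict_left_mono) auto
    ultimately have "0 < sin (- (pi * x / 2))" by (intro sin_gt_zero) auto
    then show ?thesis by simp
  qed
  have chi: "zeta_chi (of_real x) = of_real (c / Gamma x)"
  proof -
    have "complex_of_real (Gamma x) * Gamma (1 - of_real x) = of_real pi / of_real (sin (pi * x))"
      using Gamma_reflection_complex[of "of_real x"] by (simp only: Gamma_complex_of_real of_real_mult sin_of_real[symmetric])
    moreover have "Gamma (1 - complex_of_real x) = (complex_of_real (Gamma x) * Gamma (1 - of_real x)) / of_real (Gamma x)"
      using G by simp
    ultimately have "Gamma (1 - complex_of_real x) = of_real (pi / (sin (pi * x) * Gamma x))"
      by (simp only: of_real_divide of_real_mult divide_divide_eq_left)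
    moreover have "sin (pi * x) = 2 * sin (pi * x / 2) * cos (pi * x / 2)"
      using sin_double[of "pi * x / 2"] by simp
    moreover have "(2::complex) powr of_real x = of_real (2 powr x)"
      using powr_of_real[of 2 x] by simp
    moreover have "complex_of_real pi powr (of_real x - 1) = of_real (pi powr (x - 1))"
      using powr_of_real[of pi "x - 1"] by simp
    moreover have "sin (complex_of_real pi * of_real x / 2) = of_real (sin (pi * x / 2))"
    proof -
      have "complex_of_real pi * of_real x / 2 = of_real (pi * x / 2)" by simp
      then show ?thesis by (simp only: sin_of_real)
    qed
    ultimately have "zeta_chi (of_real x) = of_real (2 powr x * pi powr (x - 1) * sin (pi * x / 2) * (pi / (2 * sin (pi * x / 2) * cos (pi * x / 2) * Gamma x)))"
      unfolding zeta_chi_def by (simp only: of_real_mult)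
    also have "2 powr x * pi powr (x - 1) * sin (pi * x / 2) * (pi / (2 * sin (pi * x / 2) * cos (pi * x / 2) * Gamma x)) = c / Gamma x"
      using sinx by (simp add: c_def powr_mult powr_diff)
    finally show ?thesis .
  qed
  have "Gamma x * (\<Sum>n. \<tau> n) = c * Z"
    using sums_unique[OF S] S G by (metis sums_summable suminf_mult summable_cmult_iff)
  then have "(\<Sum>n. \<tau> n) = c / Gamma x * Z" using G by (simp add: field_simps)
  then show ?thesis unfolding zt z1 chi by (simp only: of_real_mult)
qed

text \<open>Both sides are holomorphic on the strip and agree on the real segment, which accumulates
  inside it.\<close>

lemma zeta_trapezoid_functional:
  assumes "-1 < Re s" "Re s < 0"
  shows "zeta_trapezoid s = zeta_chi s * zeta_trapezoid (1 - s)"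
proof -
  let ?S = "{s. -1 < Re s} \<inter> {s. Re s < 0}"
  have oS: "open ?S" by (intro open_Int open_halfspace_Re_gt open_halfspace_Re_lt)
  have cS: "connected ?S"
    by (intro convex_connected convex_Int convex_halfspace_Re_gt convex_halfspace_Re_lt)
  have h1: "zeta_trapezoid holomorphic_on ?S"
    by (rule holomorphic_on_subset[OF zeta_trapezoid_holomorphic]) auto
  have h2: "zeta_chi holomorphic_on ?S"
    by (rule zeta_chi_holomorphic) (auto elim!: nonpos_Ints_cases simp: complex_eq_iff)
  have "zeta_trapezoid holomorphic_on ((\<lambda>s. 1 - s) ` ?S)"
    by (rule holomorphic_on_subset[OF zeta_trapezoid_holomorphic]) auto
  from holomorphic_on_compose[OF _ this]
  have h3: "(\<lambda>s. zeta_trapezoid (1 - s)) holomorphic_on ?S" by (simp add: o_def holomorphic_intros)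
  define U where "U = complex_of_real ` {-1<..<0}"
  have "zeta_trapezoid s - zeta_chi s * zeta_trapezoid (1 - s) = 0"
  proof (rule analytic_continuation[of "\<lambda>s. zeta_trapezoid s - zeta_chi s * zeta_trapezoid (1 - s)" ?S U "of_real (-1/2)"])
    show "(\<lambda>s. zeta_trapezoid s - zeta_chi s * zeta_trapezoid (1 - s)) holomorphic_on ?S"
      by (intro holomorphic_intros h1 h2 h3)
    show "U \<subseteq> ?S" by (auto simp: U_def)
    show "complex_of_real (-1/2) islimpt U"
      unfolding U_def
    proof (rule islimpt_isCont_image)
      show "\<forall>\<^sub>F y in at (- 1 / 2). complex_of_real y \<noteq> complex_of_real (- 1 / 2)"
        unfolding of_real_eq_iff by (simp add: eventually_at_filter)
      show "(- 1 / 2) islimpt {-1<..<0::real}"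
        by (intro interior_limit_point) (auto simp: interior_open)
    qed (intro continuous_intros)
    show "\<And>z. z \<in> U \<Longrightarrow> zeta_trapezoid z - zeta_chi z * zeta_trapezoid (1 - z) = 0"
      using zeta_trapezoid_functional_real by (auto simp: U_def)
  qed (use assms oS cS in auto)
  then show ?thesis by simp
qed

text \<open>\<open>zeta\<close> is a choice, so a function with the required properties has to be
  exhibited. Far to the left the functional equation serves as the definition; the strip
  \<open>-1 < Re s < 0\<close>, where both formulas agree, glues the two pieces.\<close>

lemma zeta_exists:
  "\<exists>f. f holomorphic_on (- {1}) \<and> (\<forall>s. Re s > 1 \<longrightarrow> (\<lambda>n. of_nat (Suc n) powr (- s)) sums f s)
     \<and> (\<forall>s. Re s > -1 \<longrightarrow> s \<noteq> 1 \<longrightarrow> f s = zeta_trapezoid s) \<and> (\<forall>s. Re s < 0 \<longrightarrow> f s = zeta_chi s * zeta_trapezoid (1 - s))"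
proof -
  define f where "f = (\<lambda>s. if Re s > -1 then zeta_trapezoid s else zeta_chi s * zeta_trapezoid (1 - s))"
  let ?A = "{s. Re s > -1} - {1::complex}" and ?B = "{s. Re s < 0}"
  have fB: "f s = zeta_chi s * zeta_trapezoid (1 - s)" if "Re s < 0" for s
    using that zeta_trapezoid_functional by (auto simp: f_def)
  have "f holomorphic_on ?A"
    by (rule holomorphic_transform[OF zeta_trapezoid_holomorphic]) (auto simp: f_def)
  moreover have "f holomorphic_on ?B"
  proof (rule holomorphic_transform)
    have "zeta_trapezoid holomorphic_on ((\<lambda>s. 1 - s) ` ?B)"
      by (rule holomorphic_on_subset[OF zeta_trapezoid_holomorphic]) auto
    from holomorphic_on_compose[OF _ this]
    have "(\<lambda>s. zeta_trapezoid (1 - s)) holomorphic_on ?B" by (simp add: o_def holomorphic_intros)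
    moreover have "zeta_chi holomorphic_on ?B"
      by (rule zeta_chi_holomorphic) (auto elim!: nonpos_Ints_cases simp: complex_eq_iff)
    ultimately show "(\<lambda>s. zeta_chi s * zeta_trapezoid (1 - s)) holomorphic_on ?B"
      by (intro holomorphic_intros)
  qed (use fB in auto)
  ultimately have "f holomorphic_on (?A \<union> ?B)"
    by (intro holomorphic_on_Un open_Diff open_halfspace_Re_gt open_halfspace_Re_lt) auto
  moreover have "?A \<union> ?B = - {1}" by auto
  ultimately show ?thesis
    using zeta_trapezoid_dirichlet fB by (intro exI[of _ f]) (auto simp: f_def)
qed

text \<open>Two continuations agree off the point 1 by the identity theorem, the punctured plane
  being connected. Hence the chosen function inherits the formulas of the constructed one.\<close>

lemma zeta_holomorphic: "zeta holomorphic_on (- {1})"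
  and zeta_eq_trapezoid: "Re s > -1 \<Longrightarrow> s \<noteq> 1 \<Longrightarrow> zeta s = zeta_trapezoid s"
  and zeta_functional_left: "Re s < 0 \<Longrightarrow> zeta s = zeta_chi s * zeta (1 - s)"
proof -
  let ?P = "\<lambda>f. f holomorphic_on (- {1}) \<and> (\<forall>s. Re s > 1 \<longrightarrow> (\<lambda>n. of_nat (Suc n) powr (- s)) sums f s)"
  obtain f where f: "?P f" and f1: "\<And>s. Re s > -1 \<Longrightarrow> s \<noteq> 1 \<Longrightarrow> f s = zeta_trapezoid s"
    and f2: "\<And>s. Re s < 0 \<Longrightarrow> f s = zeta_chi s * zeta_trapezoid (1 - s)"
    using zeta_exists by blast
  have z: "?P zeta" unfolding zeta_def by (rule someI[of ?P f]) (rule f)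
  then show "zeta holomorphic_on (- {1})" by blast
  have eq: "zeta s = f s" if "s \<noteq> 1" for s
  proof (rule analytic_continuation_open[of "{s. Re s > 1}" "- {1}" zeta f])
    show "open {s. 1 < Re s}" by (rule open_halfspace_Re_gt)
    have "2 \<in> {s. 1 < Re s}" by simp
    then show "{s. 1 < Re s} \<noteq> {}" by blast
    show "connected (- {1::complex})" by (rule connected_punctured_universe) simp
    show "\<And>s. s \<in> {s. 1 < Re s} \<Longrightarrow> zeta s = f s" using z f sums_unique2 by blast
  qed (use that z f in auto)
  show e1: "zeta s = zeta_trapezoid s" if "Re s > -1" "s \<noteq> 1" for s using eq f1 that by auto
  show "zeta s = zeta_chi s * zeta (1 - s)" if "Re s < 0" for s
  proof -
    have "s \<noteq> 1" using that by auto
    moreover have "zeta (1 - s) = zeta_trapezoid (1 - s)" using that by (intro e1) auto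
    ultimately show ?thesis using eq f2[OF that] by simp
  qed
qed

text \<open>The upper half-plane is connected, avoids 0, 1 and the poles of
  \<open>Gamma (1 - s)\<close>, and meets \<open>Re s < 0\<close> in an open set, so the identity
  theorem carries the equation across.\<close>

lemma zeta_functional_equation:
  assumes "Im s > 0"
  shows "zeta s = zeta_chi s * zeta (1 - s)"
proof (rule analytic_continuation_open[of "{s. Re s < 0} \<inter> {s. Im s > 0}" "{s. Im s > 0}" zeta "\<lambda>s. zeta_chi s * zeta (1 - s)"])
  show "open ({s. Re s < 0} \<inter> {s. 0 < Im s})" by (intro open_Int open_halfspace_Re_lt open_halfspace_Im_gt)
  show "open {s. 0 < Im s}" by (rule open_halfspace_Im_gt)
  have "Complex (-1) 1 \<in> {s. Re s < 0} \<inter> {s. 0 < Im s}" by simp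
  then show "{s. Re s < 0} \<inter> {s. 0 < Im s} \<noteq> {}" by blast
  show "connected {s. 0 < Im s}" by (intro convex_connected convex_halfspace_Im_gt)
  show "zeta holomorphic_on {s. 0 < Im s}"
    by (rule holomorphic_on_subset[OF zeta_holomorphic]) auto
  have "zeta holomorphic_on ((\<lambda>s. 1 - s) ` {s. 0 < Im s})"
    by (rule holomorphic_on_subset[OF zeta_holomorphic]) auto
  from holomorphic_on_compose[OF _ this]
  have "(\<lambda>s. zeta (1 - s)) holomorphic_on {s. 0 < Im s}" by (simp add: o_def holomorphic_intros)
  moreover have "zeta_chi holomorphic_on {s. 0 < Im s}"
    by (rule zeta_chi_holomorphic) (auto elim!: nonpos_Ints_cases simp: complex_eq_iff)
  ultimately show "(\<lambda>s. zeta_chi s * zeta (1 - s)) holomorphic_on {s. 0 < Im s}"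
    by (intro holomorphic_intros)
qed (use assms zeta_functional_left in auto)

lemma norm_zeta_approx_le:
  assumes "Re s \<ge> 0" "s \<noteq> 1" "M \<ge> 1"
  shows "norm (zeta s - ((\<Sum>n\<in>{1..<M}. of_nat n powr (- s)) + of_nat M powr (1 - s) / (s - 1)))
    \<le> (1 + 2 * norm s * norm (s + 1)) * real M powr (- Re s)"
  using norm_zeta_trapezoid_approx_le[OF assms] zeta_eq_trapezoid[of s] assms by simp

section \<open>The factor of the functional equation along the critical line\<close>

text \<open>The two sines combine to \<open>sin (pi * s) / 2\<close> by the double-angle formula and
  cancel against \<open>Gamma s * Gamma (1 - s) = pi / sin (pi * s)\<close>.\<close>

lemma zeta_chi_reflection:
  assumes "s \<notin> \<int>"
  shows "zeta_chi s * zeta_chi (1 - s) = 1"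
proof -
  have s0: "sin (of_real pi * s) \<noteq> 0"
    using assms by (metis Ints_of_int sin_eq_0 mult.commute mult_cancel_right of_real_eq_0_iff pi_neq_zero of_real_of_int_eq of_real_mult)
  have a: "(2::complex) powr s * 2 powr (1 - s) = 2" by (simp flip: powr_add)
  have b: "complex_of_real pi powr (s - 1) * of_real pi powr (- s) = 1 / of_real pi"
  proof -
    have "complex_of_real pi powr (s - 1) * of_real pi powr (- s) = of_real pi powr (-1)" by (simp flip: powr_add)
    then show ?thesis by (simp add: powr_minus inverse_eq_divide)
  qed
  have c: "sin (of_real pi * (1 - s) / 2) = cos (of_real pi * s / 2)"
  proof -
    have "of_real pi * (1 - s) / 2 = of_real pi / 2 - of_real pi * s / 2" by (simp add: field_simps)
    then show ?thesis by (simp only: cos_sin_eq)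
  qed
  have d: "sin (of_real pi * s / 2) * cos (of_real pi * s / 2) = sin (of_real pi * s) / 2"
    using sin_double[of "of_real pi * s / 2"] by simp
  have "zeta_chi s * zeta_chi (1 - s) = ((2 powr s * 2 powr (1 - s)) * (of_real pi powr (s - 1) * of_real pi powr (- s)))
     * (sin (of_real pi * s / 2) * cos (of_real pi * s / 2)) * (Gamma s * Gamma (1 - s))"
    by (simp add: zeta_chi_def c mult_ac)
  also have "\<dots> = 1"
    unfolding a b d Gamma_reflection_complex using s0 by simp
  finally show ?thesis .
qed

text \<open>In the limit formula the terms up to about \<open>2 * T\<close> are at most
  \<open>16 / T\<close> each because of the imaginary part, in total 48. Beyond,
  \<open>1 / (z + n)\<close> differs from \<open>1 / n\<close> by at most
  \<open>10 * T / n^2\<close>, in total 10. Comparing the harmonic sum with the logarithm, and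
  \<open>N\<close> with \<open>T\<close>, costs 2 each.\<close>

lemma norm_Digamma_minus_ln_le:
  fixes z :: complex
  assumes T: "T \<ge> 1" and z: "T / 16 \<le> \<bar>Im z\<bar>" "\<bar>Im z\<bar> \<le> 4 * T" "\<bar>Re z\<bar> \<le> T"
  shows "norm (Digamma z - of_real (ln T)) \<le> 80"
proof -
  define N where "N = nat \<lceil>2 * T\<rceil>"
  have N: "real N \<ge> 2 * T" "real N \<le> 2 * T + 1" "N \<ge> 1" using T unfolding N_def by (auto simp: le_nat_iff)
  have z0: "z \<noteq> 0" using T z by auto
  have nz: "norm z \<le> 5 * T" using cmod_le[of z] z by linarith
  have im: "norm (z + of_nat n) \<ge> T / 16" for n
    using abs_Im_le_cmod[of "z + of_nat n"] z by simp
  have re: "norm (z + of_nat n) \<ge> real n / 2" if "n \<ge> N" for n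
  proof -
    have "real n \<ge> 2 * T" using that N by (meson of_nat_le_iff order_trans)
    then show ?thesis using abs_Re_le_cmod[of "z + of_nat n"] z by simp
  qed
  have sq: "(\<Sum>n\<in>{N..<m}. 1 / (real n)\<^sup>2) \<le> 2 / real N" for m
  proof (cases "N \<le> m")
    case True
    have "(\<Sum>n\<in>{N..<m}. 1 / (real n)\<^sup>2) \<le> (\<Sum>n\<in>{N..<m}. (- 2 / real (Suc n)) - (- 2 / real n))"
    proof (rule sum_mono)
      fix n assume "n \<in> {N..<m}"
      then have n: "real n \<ge> 1" using N by auto
      have "(- 2 / real (Suc n)) - (- 2 / real n) = 2 / (real n * real (Suc n))" using n by (simp add: field_simps)
      moreover have "2 / (2 * (real n)\<^sup>2) \<le> 2 / (real n * real (Suc n))"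
        using n by (intro divide_left_mono) (auto simp: power2_eq_square)
      ultimately show "1 / (real n)\<^sup>2 \<le> (- 2 / real (Suc n)) - (- 2 / real n)" by simp
    qed
    also have "\<dots> = - 2 / real m - (- 2 / real N)" using True by (rule sum_Suc_diff')
    also have "\<dots> \<le> 2 / real N" by simp
    finally show ?thesis .
  qed simp
  have main: "norm (of_real (ln (real m)) - (\<Sum>n<m. inverse (z + of_nat n)) - of_real (ln T)) \<le> 80" if m: "m \<ge> N" for m
  proof -
    have "{..<m} = {..<N} \<union> {N..<m}" using m by auto
    then have split: "(\<Sum>n<m. inverse (z + of_nat n)) = (\<Sum>n<N. inverse (z + of_nat n)) + (\<Sum>n\<in>{N..<m}. inverse (z + of_nat n))"
      by (simp add: sum.union_disjoint ivl_disj_int)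
    define A where "A = (\<Sum>n<N. inverse (z + of_nat n))"
    define D where "D = (\<Sum>n\<in>{N..<m}. inverse (z + of_nat n) - of_real (1 / real n))"
    define L where "L = (\<Sum>n\<in>{N..<m}. 1 / real n - ln (real (Suc n) / real n))"
    have tel: "(\<Sum>n\<in>{N..<m}. ln (real (Suc n) / real n)) = ln (real m) - ln (real N)"
    proof -
      have "(\<Sum>n\<in>{N..<m}. ln (real (Suc n) / real n)) = (\<Sum>n\<in>{N..<m}. ln (real (Suc n)) - ln (real n))"
        using N by (intro sum.cong) (auto simp: ln_div)
      also have "\<dots> = ln (real m) - ln (real N)" using m by (rule sum_Suc_diff')
      finally show ?thesis .
    qed
    have LL: "ln (real m) = ln (real N) + (\<Sum>n\<in>{N..<m}. 1 / real n) - L"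
      using tel by (simp add: L_def sum_subtractf)
    have eq: "of_real (ln (real m)) - (\<Sum>n<m. inverse (z + of_nat n)) - of_real (ln T) =
       of_real (ln (real N / T)) - of_real L - A - D"
    proof -
      have "D = (\<Sum>n\<in>{N..<m}. inverse (z + of_nat n)) - of_real (\<Sum>n\<in>{N..<m}. 1 / real n)"
        unfolding D_def sum_subtractf of_real_sum ..
      moreover have "ln (real N / T) = ln (real N) - ln T" using N T by (simp add: ln_div)
      ultimately show ?thesis unfolding split LL A_def by simp
    qed
    have A: "norm A \<le> 48"
    proof -
      have "norm A \<le> real (card {..<N}) * (16 / T)"
        unfolding A_def
      proof (rule sum_norm_bound)
        fix n
        have "norm (inverse (z + of_nat n)) = 1 / norm (z + of_nat n)" by (simp add: norm_divide inverse_eq_divide)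
        also have "\<dots> \<le> 1 / (T / 16)" using im[of n] T by (intro divide_left_mono mult_pos_pos) auto
        finally show "norm (inverse (z + of_nat n)) \<le> 16 / T" by simp
      qed
      also have "\<dots> \<le> (3 * T) * (16 / T)" using N T by (intro mult_right_mono) auto
      also have "\<dots> = 48" using T by simp
      finally show ?thesis .
    qed
    have D: "norm D \<le> 10"
    proof -
      have "norm D \<le> (\<Sum>n\<in>{N..<m}. 10 * T * (1 / (real n)\<^sup>2))"
        unfolding D_def
      proof (rule sum_norm_le)
        fix n assume "n \<in> {N..<m}"
        then have n: "n \<ge> N" "real n \<ge> 1" using N by auto
        have zn: "z + of_nat n \<noteq> 0" using im[of n] T by (intro notI) simp
        have "inverse (z + of_nat n) - of_real (1 / real n) = - z / (of_nat n * (z + of_nat n))"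
          using zn n by (simp add: field_simps)
        then have "norm (inverse (z + of_nat n) - of_real (1 / real n)) = norm z / (real n * norm (z + of_nat n))"
          by (simp add: norm_divide norm_mult)
        also have "\<dots> \<le> (5 * T) / (real n * (real n / 2))"
          using nz re[OF n(1)] n T by (intro frac_le mult_left_mono mult_pos_pos) auto
        also have "\<dots> = 10 * T * (1 / (real n)\<^sup>2)" by (simp add: power2_eq_square)
        finally show "norm (inverse (z + of_nat n) - of_real (1 / real n)) \<le> 10 * T * (1 / (real n)\<^sup>2)" .
      qed
      also have "\<dots> \<le> 10 * T * (2 / real N)" unfolding sum_distrib_left[symmetric] using sq T by (intro mult_left_mono) auto
      also have "\<dots> \<le> 10 * T * (2 / (2 * T))" using N T by (intro mult_left_mono divide_left_mono) auto
      also have "\<dots> = 10" using T by simp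
      finally show ?thesis .
    qed
    have L: "\<bar>L\<bar> \<le> 2"
    proof -
      have "0 \<le> 1 / real n - ln (real (Suc n) / real n) \<and> 1 / real n - ln (real (Suc n) / real n) \<le> 1 / (real n)\<^sup>2" if "n \<in> {N..<m}" for n
      proof -
        have n: "real n \<ge> 1" using that N by auto
        have "real (Suc n) / real n = 1 + 1 / real n" using n by (simp add: field_simps)
        moreover have "ln (1 + 1 / real n) \<le> 1 / real n" by (rule ln_add_one_self_le_self) simp
        moreover have "1 / real n - (1 / real n)\<^sup>2 \<le> ln (1 + 1 / real n)" using n by (intro ln_one_plus_pos_lower_bound) auto
        ultimately show ?thesis by (simp add: power_one_over)
      qed
      then have "0 \<le> L" "L \<le> (\<Sum>n\<in>{N..<m}. 1 / (real n)\<^sup>2)"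
        unfolding L_def by (auto intro!: sum_nonneg sum_mono)
      moreover have "2 / real N \<le> 2" using N(3) by (simp add: divide_le_eq)
      ultimately show ?thesis using sq[of m] by linarith
    qed
    have R: "\<bar>ln (real N / T)\<bar> \<le> 2"
    proof -
      have "1 \<le> real N / T" "real N / T \<le> 3" using N T by (auto simp: field_simps)
      then have "0 \<le> ln (real N / T)" "ln (real N / T) \<le> real N / T - 1" by (auto intro: ln_le_minus_one)
      then show ?thesis using \<open>real N / T \<le> 3\<close> by linarith
    qed
    have "norm (of_real (ln (real N / T)) - of_real L - A - D) \<le> \<bar>ln (real N / T)\<bar> + \<bar>L\<bar> + norm A + norm D"
      by (rule order_trans[OF norm_triangle_ineq4 add_right_mono[OF order_trans[OF norm_triangle_ineq4 add_right_mono[OF order_trans[OF norm_triangle_ineq4]]]]]) simp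
    then show ?thesis unfolding eq using A D L R by linarith
  qed
  have "(\<lambda>m. norm (of_real (ln (real m)) - (\<Sum>n<m. inverse (z + of_nat n)) - of_real (ln T))) \<longlonglongrightarrow> norm (Digamma z - of_real (ln T))"
    by (intro tendsto_intros Digamma_LIMSEQ z0)
  then show ?thesis
    by (rule tendsto_upperbound) (use main in \<open>auto simp: eventually_sequentially\<close>)
qed

text \<open>With \<open>q = exp (\<i> * w)\<close>, which is small high up in the upper half-plane,
  \<open>cot w = \<i> * (q^2 + 1) / (q^2 - 1)\<close>.\<close>

lemma norm_cot_le:
  fixes w :: complex
  assumes "Im w \<ge> 1"
  shows "norm (cot w) \<le> 2"
proof -
  define q where "q = exp (\<i> * w)"
  have q: "q \<noteq> 0" "norm q = exp (- Im w)" by (simp_all add: q_def)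
  have "exp (- Im w) \<le> exp (-1)" using assms by simp
  also have "exp (- 1 :: real) \<le> 1 / 2" using exp_ge_add_one_self[of 1] by (simp add: exp_minus field_simps)
  finally have nq: "norm q \<le> 1 / 2" using q by simp
  have nq2: "norm (q\<^sup>2) \<le> 1 / 4"
    using power_mono[OF nq norm_ge_zero, of 2] by (simp add: norm_power power_divide)
  have e: "exp (- (\<i> * w)) = 1 / q" by (simp add: q_def exp_minus inverse_eq_divide)
  have "cot w = ((q + 1 / q) / 2) / ((q - 1 / q) / (2 * \<i>))"
    unfolding cot_def sin_exp_eq cos_exp_eq q_def[symmetric] e ..
  also have "\<dots> = \<i> * (q + 1 / q) / (q - 1 / q)"
  proof -
    have "(a / 2) / (b / (2 * \<i>)) = \<i> * a / b" for a b :: complex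
      by (cases "b = 0") (simp_all add: field_simps)
    then show ?thesis .
  qed
  also have "\<dots> = \<i> * (q\<^sup>2 + 1) / (q\<^sup>2 - 1)"
  proof -
    have "q + 1 / q = (q\<^sup>2 + 1) / q" "q - 1 / q = (q\<^sup>2 - 1) / q" using q(1) by (simp_all add: field_simps power2_eq_square)
    then show ?thesis using q(1) by simp
  qed
  finally have "norm (cot w) = norm (q\<^sup>2 + 1) / norm (q\<^sup>2 - 1)" by (simp add: norm_mult norm_divide)
  also have "\<dots> \<le> (5 / 4) / (3 / 4)"
  proof (rule frac_le)
    show "norm (q\<^sup>2 + 1) \<le> 5 / 4" using norm_triangle_ineq[of "q\<^sup>2" 1] nq2 by simp
    show "3 / 4 \<le> norm (q\<^sup>2 - 1)" using norm_triangle_ineq2[of 1 "q\<^sup>2"] nq2 by (simp add: norm_minus_commute)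
  qed auto
  finally show ?thesis by simp
qed

text \<open>The bracket is the logarithmic derivative. At large height the cotangent is bounded and
  \<open>Digamma (1 - s)\<close> is close to the logarithm of the height, so up to a bounded error
  only \<open>ln (2 * pi) - ln T\<close> survives.\<close>

lemma zeta_chi_has_field_derivative:
  assumes "Im s > 0"
  shows "(zeta_chi has_field_derivative
    zeta_chi s * (of_real (ln (2 * pi)) + of_real pi / 2 * cot (of_real pi * s / 2) - Digamma (1 - s))) (at s)"
proof -
  have g: "1 - s \<notin> \<int>\<^sub>\<le>\<^sub>0" using assms by (auto elim!: nonpos_Ints_cases simp: complex_eq_iff)
  have sn: "sin (of_real pi * s / 2) \<noteq> 0"
  proof
    assume "sin (of_real pi * s / 2) = 0"
    then obtain n :: int where "of_real pi * s / 2 = of_real (of_int n * pi)" unfolding sin_eq_0 by auto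
    then have "Im (of_real pi * s / 2) = 0" by simp
    then show False using assms by simp
  qed
  have d1: "((\<lambda>s. 2 powr s) has_field_derivative of_real (ln 2) * 2 powr s) (at s)"
    using has_field_derivative_powr_right[of 2 s] Ln_of_real[of 2] by simp
  have d2: "((\<lambda>s. of_real pi powr (s - 1)) has_field_derivative of_real (ln pi) * of_real pi powr (s - 1)) (at s)"
  proof -
    have "((\<lambda>s. of_real pi powr (s - 1)) has_field_derivative (Ln (of_real pi) * of_real pi powr (s - 1)) * 1) (at s)"
      by (rule DERIV_chain2[OF has_field_derivative_powr_right]) (auto intro!: derivative_eq_intros)
    then show ?thesis using Ln_of_real[of pi] by simp
  qed
  have d3: "((\<lambda>s. sin (of_real pi * s / 2)) has_field_derivative cos (of_real pi * s / 2) * (of_real pi / 2)) (at s)"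
    by (auto intro!: derivative_eq_intros)
  have d4: "((\<lambda>s. Gamma (1 - s)) has_field_derivative - (Gamma (1 - s) * Digamma (1 - s))) (at s)"
    using g by (auto intro!: derivative_eq_intros)
  have D: "(zeta_chi has_field_derivative
     ((of_real (ln 2) * 2 powr s * of_real pi powr (s - 1) + of_real (ln pi) * of_real pi powr (s - 1) * 2 powr s) * sin (of_real pi * s / 2)
       + cos (of_real pi * s / 2) * (of_real pi / 2) * (2 powr s * of_real pi powr (s - 1))) * Gamma (1 - s)
       + - (Gamma (1 - s) * Digamma (1 - s)) * (2 powr s * of_real pi powr (s - 1) * sin (of_real pi * s / 2))) (at s)"
    unfolding zeta_chi_def[abs_def] by (rule DERIV_mult[OF DERIV_mult[OF DERIV_mult[OF d1 d2] d3] d4])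
  have alg: "((l2 * a * b + lp * b * a) * S + C * (p / 2) * (a * b)) * G + - (G * \<psi>) * (a * b * S) = (a * b * S * G) * ((l2 + lp) + p / 2 * (C / S) - \<psi>)"
    if "S \<noteq> 0" for a b S C G \<psi> p l2 lp :: complex
    using that by (simp add: field_simps)
  have ln: "complex_of_real (ln (2 * pi)) = of_real (ln 2) + of_real (ln pi)" by (simp add: ln_mult)
  show ?thesis
    using D unfolding alg[OF sn] ln cot_def zeta_chi_def .
qed

lemma norm_exp_minus_one_le: "norm (exp z - 1) \<le> norm z * exp (norm z)" for z :: complex
proof -
  have "norm (exp z - exp 0) \<le> exp (norm z) * norm (z - 0)"
  proof (rule field_differentiable_bound[of "closed_segment 0 z"])
    fix w assume "w \<in> closed_segment 0 z"
    then have "norm w \<le> norm z" using segment_bound1[of w 0 z] by simp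
    then show "norm (exp w) \<le> exp (norm z)"
      using abs_Re_le_cmod[of w] by simp
  qed (auto intro!: derivative_eq_intros)
  then show ?thesis by (simp add: mult.commute)
qed

text \<open>The factor \<open>(T / (2 * pi)) powr w\<close> cancels the growth of the logarithmic
  derivative of \<open>zeta_chi w\<close>, which leaves at most \<open>80 + pi < 84\<close> on a
  rectangle. A holomorphic logarithm therefore changes by at most 84 times the shift, and
  \<open>zeta_chi (1 - s)\<close> removes the value at the unshifted point. The height
  \<open>z\<close> is complex so that Cauchy's estimates apply to it later.\<close>

lemma norm_zeta_chi_shift_le:
  assumes T: "T \<ge> 32" and \<alpha>: "norm \<alpha> \<le> 1" and z: "T / 8 \<le> Re z" "Re z \<le> 3 * T" "\<bar>Im z\<bar> \<le> T / 16"
  shows "norm (zeta_chi (1/2 + \<alpha> + \<i> * z) * zeta_chi (1/2 - \<i> * z) * exp (\<alpha> * of_real (ln (T / (2 * pi)))) - 1)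
    \<le> 84 * norm \<alpha> * exp (84 * norm \<alpha>)"
proof -
  define l where "l = complex_of_real (ln (T / (2 * pi)))"
  define \<Omega> where "\<Omega> = {s. T / 16 < Im s} \<inter> {s. Im s < 4 * T} \<inter> ({s. - (T - 1) < Re s} \<inter> {s. Re s < T - 1})"
  define f where "f = (\<lambda>w. zeta_chi w * exp (w * l))"
  define \<Lambda> where "\<Lambda> = (\<lambda>w::complex. of_real pi / 2 * cot (of_real pi * w / 2) + (of_real (ln T) - Digamma (1 - w)))"
  have op: "open \<Omega>" unfolding \<Omega>_def
    by (intro open_Int open_halfspace_Re_gt open_halfspace_Re_lt open_halfspace_Im_gt open_halfspace_Im_lt)
  have cv: "convex \<Omega>" unfolding \<Omega>_def
    by (intro convex_Int convex_halfspace_Re_gt convex_halfspace_Re_lt convex_halfspace_Im_gt convex_halfspace_Im_lt)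
  have der: "(f has_field_derivative f w * \<Lambda> w) (at w)" if "w \<in> \<Omega>" for w
  proof -
    have im: "Im w > 0" using that T by (auto simp: \<Omega>_def)
    have ll: "l = of_real (ln T) - of_real (ln (2 * pi))" using T by (simp add: l_def ln_div)
    have "(f has_field_derivative zeta_chi w * (of_real (ln (2 * pi)) + of_real pi / 2 * cot (of_real pi * w / 2) - Digamma (1 - w)) * exp (w * l)
       + (exp (w * l) * l) * zeta_chi w) (at w)"
      unfolding f_def by (intro DERIV_mult zeta_chi_has_field_derivative im) (auto intro!: derivative_eq_intros)
    moreover have "zeta_chi w * (of_real (ln (2 * pi)) + of_real pi / 2 * cot (of_real pi * w / 2) - Digamma (1 - w)) * exp (w * l)
       + (exp (w * l) * l) * zeta_chi w = f w * \<Lambda> w"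
      by (simp add: f_def \<Lambda>_def ll algebra_simps)
    ultimately show ?thesis by simp
  qed
  have chi0: "zeta_chi w * zeta_chi (1 - w) = 1" if "Im w \<noteq> 0" for w
    using that by (intro zeta_chi_reflection) (auto elim!: Ints_cases)
  have f0: "f w \<noteq> 0" if "w \<in> \<Omega>" for w
  proof -
    have "Im w \<noteq> 0" using that T by (auto simp: \<Omega>_def)
    then have "zeta_chi w \<noteq> 0" using chi0 by fastforce
    then show ?thesis by (simp add: f_def)
  qed
  have bd: "norm (\<Lambda> w) \<le> 84" if "w \<in> \<Omega>" for w
  proof -
    have w: "T / 16 \<le> Im w" "Im w \<le> 4 * T" "\<bar>Re (1 - w)\<bar> \<le> T" using that by (auto simp: \<Omega>_def abs_le_iff)
    have "norm (cot (of_real pi * w / 2)) \<le> 2"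
    proof (rule norm_cot_le)
      have "pi * Im w \<ge> 3 * 2" using w T pi_gt3 by (intro mult_mono) auto
      then show "1 \<le> Im (of_real pi * w / 2)" by simp
    qed
    then have "norm (of_real pi / 2 * cot (of_real pi * w / 2)) \<le> pi / 2 * 2"
      by (simp add: norm_mult norm_divide)
    moreover have "norm (of_real (ln T) - Digamma (1 - w)) \<le> 80"
      using norm_Digamma_minus_ln_le[of T "1 - w"] w T by (simp add: norm_minus_commute)
    ultimately show ?thesis using norm_triangle_ineq[of "of_real pi / 2 * cot (of_real pi * w / 2)" "of_real (ln T) - Digamma (1 - w)"] pi_less_4
      unfolding \<Lambda>_def by linarith
  qed
  define s where "s = 1/2 + \<i> * z"
  have ra: "\<bar>Re \<alpha>\<bar> \<le> 1" "\<bar>Im \<alpha>\<bar> \<le> 1" using \<alpha> abs_Re_le_cmod[of \<alpha>] abs_Im_le_cmod[of \<alpha>] by linarith+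
  have s1: "s \<in> \<Omega>" and s2: "s + \<alpha> \<in> \<Omega>"
    using z T ra unfolding s_def \<Omega>_def by (auto simp: abs_le_iff)
  have holf: "f holomorphic_on \<Omega>"
    using der op by (auto simp: holomorphic_on_open)
  obtain g where g: "g holomorphic_on \<Omega>" "\<And>w. w \<in> \<Omega> \<Longrightarrow> exp (g w) = f w"
    using holomorphic_logarithm_exists[OF cv op holf f0 s1] by blast
  have dg: "(g has_field_derivative \<Lambda> w) (at w)" if w: "w \<in> \<Omega>" for w
  proof -
    have g': "(g has_field_derivative deriv g w) (at w)" using holomorphic_derivI[OF g(1) op w] .
    have "((\<lambda>w. exp (g w)) has_field_derivative exp (g w) * deriv g w) (at w)"
      using g' by (auto intro!: derivative_eq_intros)
    then have "(f has_field_derivative exp (g w) * deriv g w) (at w)"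
      by (rule has_field_derivative_transform_within_open[OF _ op w]) (rule g(2))
    then have "exp (g w) * deriv g w = f w * \<Lambda> w" using der[OF w] by (rule DERIV_unique)
    then have "deriv g w = \<Lambda> w" using f0[OF w] g(2)[OF w] by simp
    then show ?thesis using g' by simp
  qed
  define \<delta> where "\<delta> = g (s + \<alpha>) - g s"
  have "norm \<delta> \<le> 84 * norm (s + \<alpha> - s)"
    unfolding \<delta>_def by (rule field_differentiable_bound[OF cv has_field_derivative_at_within[OF dg] bd s2 s1])
  then have nd: "norm \<delta> \<le> 84 * norm \<alpha>" by simp
  have "f (s + \<alpha>) = f s * exp \<delta>"
  proof -
    have "exp (g (s + \<alpha>)) = exp (g s) * exp \<delta>" by (simp add: \<delta>_def flip: exp_add)
    then show ?thesis by (simp only: g(2)[OF s1] g(2)[OF s2])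
  qed
  then have "zeta_chi (s + \<alpha>) * exp (\<alpha> * l) = zeta_chi s * exp \<delta>"
    by (simp add: f_def distrib_right exp_add)
  then have "zeta_chi (s + \<alpha>) * exp (\<alpha> * l) * zeta_chi (1 - s) = (zeta_chi s * zeta_chi (1 - s)) * exp \<delta>"
    by (simp add: mult_ac)
  also have "zeta_chi s * zeta_chi (1 - s) = 1" using s1 T by (intro chi0) (auto simp: \<Omega>_def)
  finally have "zeta_chi (s + \<alpha>) * zeta_chi (1 - s) * exp (\<alpha> * l) = exp \<delta>" by (simp add: mult_ac)
  moreover have "s + \<alpha> = 1/2 + \<alpha> + \<i> * z" "1 - s = 1/2 - \<i> * z" by (simp_all add: s_def)
  ultimately have "norm (zeta_chi (1/2 + \<alpha> + \<i> * z) * zeta_chi (1/2 - \<i> * z) * exp (\<alpha> * l) - 1) \<le> norm \<delta> * exp (norm \<delta>)"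
    using norm_exp_minus_one_le[of \<delta>] by simp
  also have "\<dots> \<le> (84 * norm \<alpha>) * exp (84 * norm \<alpha>)" using nd by (intro mult_mono) auto
  finally show ?thesis by (simp add: l_def)
qed

section \<open>Oscillatory integrals\<close>

text \<open>Each integration by parts gains \<open>1 / |x|\<close> and puts a derivative either on
  the weight or on \<open>h\<close>; either costs a factor \<open>\<delta>\<close>, for
  \<open>h\<close> by Cauchy's estimate on discs of radius \<open>r >= 1 / \<delta>\<close>.
  \<open>2 ^ J\<close> counts the choices and \<open>fact J\<close> comes from Cauchy's estimate.
  Boundary terms vanish since all \<open>\<phi> j\<close> do at the ends.\<close>

lemma norm_oscillatory_integral_le:
  fixes \<phi> :: "nat \<Rightarrow> real \<Rightarrow> real" and h :: "complex \<Rightarrow> complex"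
  assumes ab: "a \<le> b" and x: "x \<noteq> 0" and c: "c \<ge> 0" and \<delta>: "\<delta> > 0"
    and der: "\<And>j t. t \<in> {a..b} \<Longrightarrow> (\<phi> j has_real_derivative \<phi> (Suc j) t) (at t)"
    and van: "\<And>j. \<phi> j a = 0" "\<And>j. \<phi> j b = 0"
    and bd: "\<And>j t. j \<le> J \<Longrightarrow> t \<in> {a..b} \<Longrightarrow> \<bar>\<phi> j t\<bar> \<le> c * \<delta> ^ j"
    and S: "open S" "h holomorphic_on S" and r: "r > 0" "1 / r \<le> \<delta>"
    and disc: "\<And>t. t \<in> {a..b} \<Longrightarrow> cball (of_real t) r \<subseteq> S"
    and hB: "\<And>z. z \<in> S \<Longrightarrow> norm (h z) \<le> B"
  shows "norm (integral {a..b} (\<lambda>t. of_real (\<phi> 0 t) * h (of_real t) * exp (\<i> * of_real (x * t))))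
    \<le> (b - a) * c * B * fact J * (2 * \<delta> / \<bar>x\<bar>) ^ J"
proof -
  define H where "H = (\<lambda>l t. (deriv ^^ l) h (complex_of_real t))"
  define e where "e = (\<lambda>t. exp (\<i> * complex_of_real (x * t)))"
  define I where "I = (\<lambda>i l. integral {a..b} (\<lambda>t. of_real (\<phi> i t) * H l t * e t))"
  have tS: "of_real t \<in> S" if "t \<in> {a..b}" for t using disc[OF that] r by auto
  have B0: "B \<ge> 0" using hB[OF tS[of a]] ab norm_ge_zero order_trans by (metis atLeastAtMost_iff order_refl)
  have holl: "(deriv ^^ l) h holomorphic_on S" for l by (rule holomorphic_higher_deriv[OF S(2,1)])
  have derH: "(H l has_vector_derivative H (Suc l) t) (at t within {a..b})" if "t \<in> {a..b}" for l t
  proof -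
    have "((deriv ^^ l) h has_field_derivative (deriv ^^ Suc l) h (of_real t)) (at (of_real t))"
      using holomorphic_derivI[OF holl S(1) tS[OF that]] by simp
    then have "(((deriv ^^ l) h \<circ> of_real) has_vector_derivative (1 * (deriv ^^ Suc l) h (of_real t))) (at t within {a..b})"
      by (intro field_vector_diff_chain_within[OF _ has_field_derivative_at_within])
         (auto intro!: derivative_eq_intros)
    then show ?thesis by (simp add: H_def o_def)
  qed
  have dere: "(e has_vector_derivative \<i> * of_real x * e t) (at t within {a..b})" for t
  proof -
    have "((\<lambda>z. exp (\<i> * (of_real x * z))) has_field_derivative \<i> * of_real x * e t) (at (of_real t))"
      by (auto intro!: derivative_eq_intros simp: e_def)
    then have "(((\<lambda>z. exp (\<i> * (of_real x * z))) \<circ> of_real) has_vector_derivative (1 * (\<i> * of_real x * e t))) (at t within {a..b})"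
      by (intro field_vector_diff_chain_within[OF _ has_field_derivative_at_within])
         (auto intro!: derivative_eq_intros)
    then show ?thesis by (simp add: e_def o_def)
  qed
  have der\<phi>: "((\<lambda>t. complex_of_real (\<phi> i t)) has_vector_derivative of_real (\<phi> (Suc i) t)) (at t within {a..b})" if "t \<in> {a..b}" for i t
    using der[OF that, of i] by (intro has_vector_derivative_of_real) (auto intro: has_field_derivative_at_within)
  have cont: "continuous_on {a..b} (\<lambda>t. of_real (\<phi> i t) * H l t * e t)" for i l
    using der\<phi> derH dere
    by (intro continuous_on_mult continuous_on_vector_derivative) blast+
  have bound0: "norm (I i l) \<le> (b - a) * (c * B * fact J * \<delta> ^ (i + l))" if il: "i + l \<le> J" for i l
  proof -
    have "norm (I i l) \<le> (c * B * fact J * \<delta> ^ (i + l)) * (b - a)"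
      unfolding I_def
    proof (rule integral_bound[OF ab cont])
      fix t assume t: "t \<in> {a..b}"
      have "norm (H l t) \<le> fact l * B / r ^ l"
        unfolding H_def
      proof (rule Cauchy_inequality[OF _ _ r(1)])
        show "h holomorphic_on ball (of_real t) r"
          using disc[OF t] ball_subset_cball by (blast intro: holomorphic_on_subset[OF S(2)])
        show "continuous_on (cball (of_real t) r) h"
          using disc[OF t] by (blast intro: holomorphic_on_imp_continuous_on holomorphic_on_subset[OF S(2)])
        show "norm (h z) \<le> B" if "norm (of_real t - z) = r" for z
          using disc[OF t] that by (intro hB) (auto simp: dist_norm)
      qed
      also have "fact l * B / r ^ l = fact l * B * (1 / r) ^ l" by (simp add: power_one_over)
      also have "\<dots> \<le> fact J * B * \<delta> ^ l"
        using il r B0 by (intro mult_mono power_mono fact_mono) auto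
      finally have "norm (of_real (\<phi> i t) * H l t * e t) \<le> (c * \<delta> ^ i) * (fact J * B * \<delta> ^ l) * 1"
        unfolding norm_mult using bd[of i t] il t \<delta> c B0 by (intro mult_mono) (auto simp: e_def)
      then show "norm (of_real (\<phi> i t) * H l t * e t) \<le> c * B * fact J * \<delta> ^ (i + l)"
        by (simp add: power_add mult_ac)
    qed
    then show ?thesis by (simp add: mult_ac)
  qed
  have step: "norm (I i l) \<le> (norm (I (Suc i) l) + norm (I i (Suc l))) / \<bar>x\<bar>" for i l
  proof -
    have "((\<lambda>t. of_real (\<phi> i t) * H l t * e t) has_vector_derivative
       (of_real (\<phi> i t) * H l t * (\<i> * of_real x * e t) + (of_real (\<phi> i t) * H (Suc l) t + of_real (\<phi> (Suc i) t) * H l t) * e t)) (at t within {a..b})"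
      if "t \<in> {a..b}" for t
      by (intro has_vector_derivative_mult der\<phi>[OF that] derH[OF that] dere)
    then have "((\<lambda>t. of_real (\<phi> i t) * H l t * (\<i> * of_real x * e t) + (of_real (\<phi> i t) * H (Suc l) t + of_real (\<phi> (Suc i) t) * H l t) * e t)
       has_integral (of_real (\<phi> i b) * H l b * e b - of_real (\<phi> i a) * H l a * e a)) {a..b}"
      by (intro fundamental_theorem_of_calculus ab)
    then have z: "((\<lambda>t. (\<i> * of_real x) * (of_real (\<phi> i t) * H l t * e t) + (of_real (\<phi> i t) * H (Suc l) t * e t + of_real (\<phi> (Suc i) t) * H l t * e t))
       has_integral 0) {a..b}"
      by (simp add: van algebra_simps)
    have "((\<lambda>t. (\<i> * of_real x) * (of_real (\<phi> i t) * H l t * e t) + (of_real (\<phi> i t) * H (Suc l) t * e t + of_real (\<phi> (Suc i) t) * H l t * e t))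
       has_integral ((\<i> * of_real x) * I i l + (I i (Suc l) + I (Suc i) l))) {a..b}"
      unfolding I_def by (intro has_integral_add has_integral_mult_right integrable_integral integrable_continuous_real cont)
    with z have "(\<i> * of_real x) * I i l + (I i (Suc l) + I (Suc i) l) = 0" by (rule has_integral_unique[symmetric])
    then have "(\<i> * of_real x) * I i l = - (I i (Suc l) + I (Suc i) l)" by (simp only: eq_neg_iff_add_eq_0)
    then have "norm ((\<i> * of_real x) * I i l) = norm (I i (Suc l) + I (Suc i) l)" by (simp only: norm_minus_cancel)
    then have "\<bar>x\<bar> * norm (I i l) = norm (I i (Suc l) + I (Suc i) l)" by (simp add: norm_mult)
    also have "\<dots> \<le> norm (I (Suc i) l) + norm (I i (Suc l))" using norm_triangle_ineq[of "I i (Suc l)" "I (Suc i) l"] by simp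
    finally show ?thesis using x by (simp add: field_simps)
  qed
  \<comment> \<open>Induction on the number \<open>m\<close> of integrations still to be done;
    \<open>i + l + m <= J\<close> keeps the derivatives of the weight within the range of
    \<open>bd\<close>.\<close>
  have "norm (I i l) \<le> (b - a) * (c * B * fact J * \<delta> ^ (i + l)) * (2 * \<delta> / \<bar>x\<bar>) ^ m" if "i + l + m \<le> J" for i l m
    using that
  proof (induction m arbitrary: i l)
    case 0 then show ?case using bound0 by simp
  next
    case (Suc m)
    let ?K = "(b - a) * (c * B * fact J * \<delta> ^ Suc (i + l)) * (2 * \<delta> / \<bar>x\<bar>) ^ m"
    have "norm (I (Suc i) l) \<le> ?K" "norm (I i (Suc l)) \<le> ?K"
      using Suc.IH[of "Suc i" l] Suc.IH[of i "Suc l"] Suc.prems by simp_all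
    then have "norm (I i l) \<le> (?K + ?K) / \<bar>x\<bar>"
      using step[of i l] x by (meson add_mono divide_right_mono abs_ge_zero order_trans)
    also have "\<dots> = (b - a) * (c * B * fact J * \<delta> ^ (i + l)) * (2 * \<delta> / \<bar>x\<bar>) ^ Suc m"
      using x by (simp add: field_simps)
    finally show ?case .
  qed
  from this[of 0 0 J] show ?thesis by (simp add: I_def H_def e_def mult_ac)
qed

section \<open>Sums of cut-off Lipschitz functions\<close>

text \<open>Lipschitz on \<open>[0, U]\<close> with a possible jump to 0 behind \<open>U\<close>:
  \<open>P (1 - v)\<close> cut off at \<open>v = 1\<close> is discontinuous unless \<open>P\<close>
  vanishes at 0. Only \<open>v >= 0\<close> matters, and a negative \<open>U\<close> means that
  \<open>f\<close> vanishes there, which makes the class stable under shifts. One constant bounds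
  both size and slope.\<close>

definition cut_lipschitz :: "real \<Rightarrow> real \<Rightarrow> (real \<Rightarrow> complex) \<Rightarrow> bool" where
  "cut_lipschitz C U f \<longleftrightarrow> (\<forall>v\<ge>0. norm (f v) \<le> C) \<and> (\<forall>v\<ge>0. v > U \<longrightarrow> f v = 0) \<and>
     (\<forall>v v'. 0 \<le> v \<and> v \<le> v' \<and> v' \<le> U \<longrightarrow> norm (f v - f v') \<le> C * (v' - v))"

lemma cut_lipschitz_nonneg: "cut_lipschitz C U f \<Longrightarrow> C \<ge> 0"
  unfolding cut_lipschitz_def by (meson norm_ge_zero order_trans order_refl)

lemma cut_lipschitzD:
  assumes "cut_lipschitz C U f" "v \<ge> 0"
  shows "norm (f v) \<le> C" "v > U \<Longrightarrow> f v = 0" "v \<le> v' \<Longrightarrow> v' \<le> U \<Longrightarrow> norm (f v - f v') \<le> C * (v' - v)"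
  using assms unfolding cut_lipschitz_def by blast+

lemma cut_lipschitz_shift:
  assumes "cut_lipschitz C U f" "a \<ge> 0"
  shows "cut_lipschitz C (U - a) (\<lambda>v. f (v + a))"
  unfolding cut_lipschitz_def
proof (intro conjI allI impI)
  fix v v' :: real assume "0 \<le> v \<and> v \<le> v' \<and> v' \<le> U - a"
  then show "norm (f (v + a) - f (v' + a)) \<le> C * (v' - v)"
    using cut_lipschitzD(3)[OF assms(1), of "v + a" "v' + a"] assms(2) by auto
qed (use cut_lipschitzD[OF assms(1)] assms(2) in auto)

lemma cut_lipschitz_mult:
  assumes f: "cut_lipschitz C U f" and g: "cut_lipschitz C' U' g"
  shows "cut_lipschitz (2 * C * C') (min U U') (\<lambda>v. f v * g v)"
  unfolding cut_lipschitz_def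
proof (intro conjI allI impI)
  note C = cut_lipschitz_nonneg[OF f] cut_lipschitz_nonneg[OF g]
  fix v :: real assume v: "v \<ge> 0"
  have "norm (f v * g v) \<le> C * C'"
    using cut_lipschitzD(1)[OF f v] cut_lipschitzD(1)[OF g v] C by (simp add: norm_mult mult_mono)
  also have "\<dots> \<le> 2 * C * C'" using C by simp
  finally show "norm (f v * g v) \<le> 2 * C * C'" .
  show "v > min U U' \<Longrightarrow> f v * g v = 0"
    using cut_lipschitzD(2)[OF f v] cut_lipschitzD(2)[OF g v] by (auto simp: min_def split: if_splits)
next
  note C = cut_lipschitz_nonneg[OF f] cut_lipschitz_nonneg[OF g]
  fix v v' :: real assume v: "0 \<le> v \<and> v \<le> v' \<and> v' \<le> min U U'"
  have "f v * g v - f v' * g v' = f v * (g v - g v') + (f v - f v') * g v'" by (simp add: algebra_simps)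
  then have "norm (f v * g v - f v' * g v') \<le> norm (f v) * norm (g v - g v') + norm (f v - f v') * norm (g v')"
    by (metis norm_triangle_ineq norm_mult)
  also have "\<dots> \<le> C * (C' * (v' - v)) + C * (v' - v) * C'"
    using cut_lipschitzD(1,3)[OF f, of v] cut_lipschitzD(3)[OF g, of v v'] cut_lipschitzD(1)[OF g, of v'] cut_lipschitzD(3)[OF f, of v v'] v C
    by (intro add_mono mult_mono) auto
  finally show "norm (f v * g v - f v' * g v') \<le> 2 * C * C' * (v' - v)" by (simp add: algebra_simps)
qed

lemma cut_lipschitz_cmult:
  assumes f: "cut_lipschitz C U f" and c: "norm c \<le> D"
  shows "cut_lipschitz (D * C) U (\<lambda>v. c * f v)"
  unfolding cut_lipschitz_def
proof (intro conjI allI impI)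
  have D: "D \<ge> 0" using c norm_ge_zero order_trans by blast
  note C = cut_lipschitz_nonneg[OF f]
  show "norm (c * f v) \<le> D * C" if "v \<ge> 0" for v
    using cut_lipschitzD(1)[OF f that] c D by (simp add: norm_mult mult_mono)
  show "c * f v = 0" if "v \<ge> 0" "v > U" for v using cut_lipschitzD(2)[OF f that] by simp
  fix v v' :: real assume v: "0 \<le> v \<and> v \<le> v' \<and> v' \<le> U"
  have "norm (c * f v - c * f v') = norm c * norm (f v - f v')" by (simp add: norm_mult flip: right_diff_distrib)
  also have "\<dots> \<le> D * (C * (v' - v))" using cut_lipschitzD(3)[OF f] v c D by (intro mult_mono) auto
  finally show "norm (c * f v - c * f v') \<le> D * C * (v' - v)" by simp
qed

lemma cut_lipschitz_mono:
  assumes "cut_lipschitz C U f" "C \<le> C'"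
  shows "cut_lipschitz C' U f"
  using assms unfolding cut_lipschitz_def
  by (meson diff_ge_0_iff_ge mult_right_mono order_trans)

lemma cut_lipschitz_integrable:
  assumes f: "cut_lipschitz C U f" and "0 \<le> a"
  shows "f integrable_on {a..b}"
proof -
  have C: "C \<ge> 0" by (rule cut_lipschitz_nonneg[OF f])
  have cont: "continuous_on {a..U} f"
  proof (rule continuous_on_iff[THEN iffD2], intro ballI allI impI)
    fix x e :: real assume x: "x \<in> {a..U}" and e: "e > 0"
    show "\<exists>d>0. \<forall>x'\<in>{a..U}. dist x' x < d \<longrightarrow> dist (f x') (f x) < e"
    proof (intro exI[of _ "e / (C + 1)"] conjI ballI impI)
      show "e / (C + 1) > 0" using e C by simp
      fix x' assume x': "x' \<in> {a..U}" "dist x' x < e / (C + 1)"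
      have "dist (f x') (f x) \<le> C * \<bar>x' - x\<bar>"
        using cut_lipschitzD(3)[OF f, of x x'] cut_lipschitzD(3)[OF f, of x' x] x x' assms(2)
        by (cases "x \<le> x'") (auto simp: dist_norm norm_minus_commute)
      also have "\<dots> \<le> (C + 1) * \<bar>x' - x\<bar>" by (simp add: mult_right_mono)
      also have "\<dots> < e" using x'(2) C by (simp add: dist_norm field_simps)
      finally show "dist (f x') (f x) < e" .
    qed
  qed
  show ?thesis
  proof (cases "U < a")
    case True
    have "(\<lambda>_. 0::complex) integrable_on {a..b}" by (rule integrable_const_ivl)
    then show ?thesis
      by (rule integrable_eq) (use True assms cut_lipschitzD(2)[OF f] in auto)
  next
    case False
    show ?thesis
    proof (cases "b \<le> U")
      case True
      then show ?thesis
        by (intro integrable_continuous_real continuous_on_subset[OF cont]) auto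
    next
      case b: False
      have 1: "f integrable_on {a..U}" by (intro integrable_continuous_real cont)
      have "(\<lambda>_. 0::complex) integrable_on {U..b}" by (rule integrable_const_ivl)
      then have 2: "f integrable_on {U..b}"
        by (rule integrable_spike_finite[of "{U}", rotated 2])
           (use False assms cut_lipschitzD(2)[OF f] in auto)
      show ?thesis using Henstock_Kurzweil_Integration.integrable_combine[OF _ _ 1 2] False b by auto
    qed
  qed
qed

lemma cut_integral_bound:
  fixes f :: "real \<Rightarrow> complex"
  assumes "f integrable_on {a..b}" "a \<le> b" "B \<ge> 0" "\<And>x. x \<in> {a..b} \<Longrightarrow> norm (f x) \<le> B"
  shows "norm (integral {a..b} f) \<le> B * (b - a)"
  using has_integral_bound_real[OF assms(3) _ integrable_integral[OF assms(1)], of "{}"] assms by simp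

lemma harmonic_tail_le:
  assumes "1 \<le> m" "m \<le> Z"
  shows "(\<Sum>n=m..Z. 1 / real n) \<le> 1 / real m + ln (real Z / real m)"
  using assms(2)
proof (induction Z rule: dec_induct)
  case base
  then show ?case using assms by simp
next
  case (step Z)
  have Z: "real Z > 0" using step assms by simp
  have "1 / real (Suc Z) \<le> ln (real (Suc Z) / real Z)"
  proof -
    have "ln (real Z / real (Suc Z)) \<le> real Z / real (Suc Z) - 1"
      using Z by (intro ln_le_minus_one) auto
    also have "\<dots> = - (1 / real (Suc Z))" using Z by (simp add: field_simps)
    finally show ?thesis using Z by (simp add: ln_div)
  qed
  moreover have "ln (real (Suc Z) / real m) = ln (real Z / real m) + ln (real (Suc Z) / real Z)"
    using Z assms by (simp add: ln_div)
  ultimately show ?case using step by simp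
qed

lemma sum_inverse_squares_le: "(\<Sum>n=1..Y. 1 / (real n)\<^sup>2) \<le> 2"
proof -
  have "(\<Sum>n=1..Y. 1 / (real n)\<^sup>2) \<le> 2 - 1 / real Y" if "Y \<ge> 1"
    using that
  proof (induction Y rule: nat_induct_at_least)
    case (Suc Y)
    have "1 / (real (Suc Y))\<^sup>2 \<le> 1 / real Y - 1 / real (Suc Y)"
    proof -
      have "1 / (real (Suc Y))\<^sup>2 \<le> 1 / (real Y * real (Suc Y))"
        using Suc.hyps by (intro divide_left_mono) (auto simp: power2_eq_square)
      also have "\<dots> = 1 / real Y - 1 / real (Suc Y)" using Suc.hyps by (simp add: field_simps)
      finally show ?thesis .
    qed
    then show ?case using Suc.IH by simp
  qed simp
  then show ?thesis by (cases "Y \<ge> 1") (auto intro: order_trans)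
qed

text \<open>On the cell from \<open>ln n / L\<close> to \<open>ln (n + 1) / L\<close> the weight
  \<open>1 / n\<close> differs from \<open>L\<close> times the length by at most
  \<open>1 / n^2\<close>, and the Lipschitz condition gives an error of the same order. The cell
  with the jump costs \<open>2 * C\<close>. So the total error does not grow with
  \<open>L\<close>.\<close>

lemma cut_lipschitz_sum_integral:
  assumes f: "cut_lipschitz C U f" and U: "U \<le> 1" and L: "L \<ge> 1"
  shows "norm ((\<Sum>n=1..nat \<lfloor>exp L\<rfloor>. f (ln (real n) / L) / of_nat n) - of_real L * integral {0..1} f) \<le> 6 * C"
proof -
  define Y where "Y = nat \<lfloor>exp L\<rfloor>"
  define l where "l = (\<lambda>n. ln (real n) / L)"
  have C: "C \<ge> 0" by (rule cut_lipschitz_nonneg[OF f])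
  have l0: "l n \<ge> 0" if "n \<ge> 1" for n using that L by (simp add: l_def)
  have lm: "l n \<le> l (Suc n)" if "n \<ge> 1" for n using that L by (simp add: l_def divide_right_mono)
  have comb: "integral {0..l (Suc N)} f = (\<Sum>n=1..N. integral {l n..l (Suc n)} f)" for N
  proof (induction N)
    case 0 show ?case by (simp add: l_def)
  next
    case (Suc N)
    have "integral {0..l (Suc N)} f + integral {l (Suc N)..l (Suc (Suc N))} f = integral {0..l (Suc (Suc N))} f"
      using l0[of "Suc N"] lm[of "Suc N"] by (intro Henstock_Kurzweil_Integration.integral_combine cut_lipschitz_integrable[OF f]) auto
    then show ?case using Suc by simp
  qed
  \<comment> \<open>The cells reach past 1 because \<open>Y + 1 >= exp L\<close>; the overshoot
    contributes nothing, as \<open>f\<close> vanishes behind \<open>U <= 1\<close>.\<close>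
  have "real Y \<ge> exp L - 1" unfolding Y_def by linarith
  then have "exp L \<le> real (Suc Y)" by simp
  then have "L \<le> ln (real (Suc Y))" by (subst ln_ge_iff) auto
  then have lY: "l (Suc Y) \<ge> 1" using L by (simp add: l_def)
  have "integral {0..1} f + integral {1..l (Suc Y)} f = integral {0..l (Suc Y)} f"
    using lY by (intro Henstock_Kurzweil_Integration.integral_combine cut_lipschitz_integrable[OF f]) auto
  moreover have "integral {1..l (Suc Y)} f = integral {1..l (Suc Y)} (\<lambda>_. 0)"
    by (rule integral_spike[of "{1}"]) (use U cut_lipschitzD(2)[OF f] in auto)
  ultimately have I1: "integral {0..1} f = (\<Sum>n=1..Y. integral {l n..l (Suc n)} f)"
    using comb by simp
  \<comment> \<open>The difference of truth values is 1 only on the cell where the jump at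
    \<open>U\<close> falls, and it telescopes in the sum over \<open>n\<close>.\<close>
  have per: "norm (f (l n) / of_nat n - of_real L * integral {l n..l (Suc n)} f)
      \<le> 2 * C * (1 / (real n)\<^sup>2) + 2 * C * (of_bool (l n \<le> U) - of_bool (l (Suc n) \<le> U))"
    if n: "n \<ge> 1" for n
  proof -
    define d where "d = l (Suc n) - l n"
    have dn: "d \<ge> 0" using lm[OF n] by (simp add: d_def)
    have Ld: "L * d = ln (1 + 1 / real n)"
    proof -
      have "L * d = ln (real (Suc n)) - ln (real n)" using L by (simp add: d_def l_def field_simps)
      also have "\<dots> = ln (real (Suc n) / real n)" using n by (simp add: ln_div)
      also have "real (Suc n) / real n = 1 + 1 / real n" using n by (simp add: field_simps)
      finally show ?thesis .
    qed
    have Ld1: "L * d \<le> 1 / real n" unfolding Ld by (rule ln_add_one_self_le_self) simp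
    have Ld2: "1 / real n - (1 / real n)\<^sup>2 \<le> L * d" unfolding Ld
      using n by (intro ln_one_plus_pos_lower_bound) auto
    have d1: "d \<le> 1 / real n"
    proof -
      have "d * 1 \<le> d * L" using dn L by (intro mult_left_mono) auto
      then show ?thesis using Ld1 by (simp add: mult.commute)
    qed
    consider "l (Suc n) \<le> U" | "l n \<le> U" "U < l (Suc n)" | "U < l n" by linarith
    then show ?thesis
    proof cases
      case 1
      have fint: "f integrable_on {l n..l (Suc n)}" using l0[OF n] by (rule cut_lipschitz_integrable[OF f])
      have "norm (integral {l n..l (Suc n)} (\<lambda>v. f v - f (l n))) \<le> (C * d) * (l (Suc n) - l n)"
      proof (rule cut_integral_bound)
        show "(\<lambda>v. f v - f (l n)) integrable_on {l n..l (Suc n)}"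
          by (intro integrable_diff fint integrable_const_ivl)
      qed (use lm[OF n] cut_lipschitzD(3)[OF f l0[OF n]] 1 C in
        \<open>auto simp: norm_minus_commute[of _ "f (l n)"] d_def intro!: order_trans[OF cut_lipschitzD(3)[OF f l0[OF n]]] mult_left_mono\<close>)
      moreover have "integral {l n..l (Suc n)} (\<lambda>v. f v - f (l n)) = integral {l n..l (Suc n)} f - of_real d * f (l n)"
        using lm[OF n] by (subst integral_diff[OF fint]) (auto simp: d_def scaleR_conv_of_real)
      ultimately have A: "norm (integral {l n..l (Suc n)} f - of_real d * f (l n)) \<le> C * d * d" by (simp add: d_def)
      have "f (l n) / of_nat n - of_real L * integral {l n..l (Suc n)} f =
         of_real (1 / real n - L * d) * f (l n) - of_real L * (integral {l n..l (Suc n)} f - of_real d * f (l n))"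
        by (simp add: algebra_simps)
      also have "norm \<dots> \<le> norm (of_real (1 / real n - L * d) * f (l n)) + norm (of_real L * (integral {l n..l (Suc n)} f - of_real d * f (l n)))"
        by (rule norm_triangle_ineq4)
      also have "\<dots> \<le> (1 / real n)\<^sup>2 * C + L * (C * d * d)"
        unfolding norm_mult norm_of_real using A Ld1 Ld2 L C cut_lipschitzD(1)[OF f l0[OF n]]
        by (intro add_mono mult_mono) auto
      also have "L * (C * d * d) \<le> C * ((1 / real n) * (1 / real n))"
      proof -
        have "(L * d) * d \<le> (1 / real n) * (1 / real n)" using Ld1 d1 dn by (intro mult_mono) auto
        then show ?thesis using C by (metis mult.assoc mult.left_commute mult_left_mono)
      qed
      finally show ?thesis using 1 lm[OF n] C by (simp add: power2_eq_square)
    next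
      case 2
      have fint: "f integrable_on {l n..l (Suc n)}" using l0[OF n] by (rule cut_lipschitz_integrable[OF f])
      have A: "norm (integral {l n..l (Suc n)} f) \<le> C * (l (Suc n) - l n)"
        by (rule cut_integral_bound[OF fint]) (use lm[OF n] l0[OF n] cut_lipschitzD(1)[OF f] C in auto)
      have "norm (f (l n) / of_nat n - of_real L * integral {l n..l (Suc n)} f) \<le> norm (f (l n) / of_nat n) + norm (of_real L * integral {l n..l (Suc n)} f)"
        by (rule norm_triangle_ineq4)
      also have "\<dots> \<le> C * 1 + L * (C * d)"
      proof (intro add_mono)
        have "norm (f (l n) / of_nat n) = norm (f (l n)) * (1 / real n)" by (simp add: norm_divide)
        also have "\<dots> \<le> C * 1" using cut_lipschitzD(1)[OF f l0[OF n]] n C by (intro mult_mono) auto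
        finally show "norm (f (l n) / of_nat n) \<le> C * 1" .
        show "norm (of_real L * integral {l n..l (Suc n)} f) \<le> L * (C * d)"
          using A L by (simp add: norm_mult d_def)
      qed
      also have "L * (C * d) \<le> C * 1"
      proof -
        have "1 / real n \<le> 1" using n by simp
        then have "L * d \<le> 1" using Ld1 by linarith
        then have "C * (L * d) \<le> C * 1" using C by (intro mult_left_mono)
        then show ?thesis by (simp add: algebra_simps)
      qed
      finally have "norm (f (l n) / of_nat n - of_real L * integral {l n..l (Suc n)} f) \<le> 2 * C" by simp
      moreover have "2 * C * (1 / (real n)\<^sup>2) \<ge> 0" using C by simp
      ultimately show ?thesis using 2 by (simp del: times_divide_eq_right)
    next
      case 3
      have "integral {l n..l (Suc n)} f = integral {l n..l (Suc n)} (\<lambda>_. 0)"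
        by (rule integral_cong) (use 3 l0[OF n] cut_lipschitzD(2)[OF f] in auto)
      then show ?thesis using 3 lm[OF n] l0[OF n] cut_lipschitzD(2)[OF f, of "l n"] C by simp
    qed
  qed
  have "(\<Sum>n=1..Y. f (l n) / of_nat n) - of_real L * integral {0..1} f =
      (\<Sum>n=1..Y. f (l n) / of_nat n - of_real L * integral {l n..l (Suc n)} f)"
    by (simp add: I1 sum_subtractf sum_distrib_left)
  also have "norm \<dots> \<le> (\<Sum>n=1..Y. 2 * C * (1 / (real n)\<^sup>2) + 2 * C * (of_bool (l n \<le> U) - of_bool (l (Suc n) \<le> U)))"
    by (rule sum_norm_le) (use per in auto)
  also have "\<dots> = 2 * C * (\<Sum>n=1..Y. 1 / (real n)\<^sup>2) + 2 * C * (\<Sum>n=1..Y. of_bool (l n \<le> U) - of_bool (l (Suc n) \<le> U))"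
    by (simp add: sum.distrib sum_distrib_left)
  also have "(\<Sum>n=1..Y. of_bool (l n \<le> U) - of_bool (l (Suc n) \<le> U)) = (of_bool (l 1 \<le> U) - of_bool (l (Suc Y) \<le> U) :: real)"
    by (induction Y) auto
  also have "2 * C * (\<Sum>n=1..Y. 1 / (real n)\<^sup>2) + 2 * C * (of_bool (l 1 \<le> U) - of_bool (l (Suc Y) \<le> U)) \<le> 2 * C * 2 + 2 * C * 1"
    using C sum_inverse_squares_le[of Y] by (intro add_mono mult_left_mono) auto
  finally show ?thesis by (simp add: l_def Y_def)
qed

text \<open>Dilation by \<open>q\<close> moves the argument by \<open>ln q / L\<close>. Where no
  jump is crossed this costs \<open>C * ln q / L\<close>, against a harmonic sum of size
  \<open>L\<close>. The \<open>n\<close> for which the jump is crossed lie between some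
  \<open>m\<close> and \<open>m * q\<close>, where the harmonic sum is at most
  \<open>1 + ln q\<close>. The bound is free of \<open>L\<close>; this is the logarithm saved in the
  sieve.\<close>

lemma cut_lipschitz_sum_dilation:
  assumes f: "cut_lipschitz C U f" and U: "U \<le> 1" and L: "L \<ge> 1" and q: "q \<ge> (1::nat)"
  shows "(\<Sum>n=1..nat \<lfloor>exp L\<rfloor>. norm (f (ln (real (n * q)) / L) - f (ln (real n) / L)) / real n) \<le> 3 * C * (1 + ln (real q))"
proof -
  define Y where "Y = nat \<lfloor>exp L\<rfloor>"
  have C: "C \<ge> 0" by (rule cut_lipschitz_nonneg[OF f])
  have lq: "ln (real q) \<ge> 0" using q by simp
  have Y1: "Y \<ge> 1" unfolding Y_def using L by (simp add: le_nat_iff le_floor_iff)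
  have YL: "ln (real Y) \<le> L"
  proof -
    have "real Y \<le> exp L" unfolding Y_def by simp
    then show ?thesis using Y1 by (metis ln_exp ln_le_cancel_iff exp_gt_zero of_nat_0_less_iff less_le_trans zero_less_one)
  qed
  have h: "(\<Sum>n=1..Y. 1 / real n) \<le> 1 + L"
    using harmonic_tail_le[of 1 Y] Y1 YL by simp
  define S where "S = {n\<in>{1..Y}. ln (real n) / L \<le> U \<and> U < ln (real (n * q)) / L}"
  have per: "norm (f (ln (real (n * q)) / L) - f (ln (real n) / L)) / real n \<le> C * ln (real q) / L * (1 / real n) + C * (of_bool (n \<in> S) * (1 / real n))"
    if n: "n \<in> {1..Y}" for n
  proof -
    have nq: "ln (real (n * q)) = ln (real n) + ln (real q)" using n q by (simp add: ln_mult)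
    have l0: "ln (real n) / L \<ge> 0" "ln (real (n * q)) / L \<ge> 0" using n L q lq unfolding nq by auto
    have ll: "ln (real n) / L \<le> ln (real (n * q)) / L" using L lq unfolding nq by (simp add: divide_right_mono)
    have "norm (f (ln (real (n * q)) / L) - f (ln (real n) / L)) \<le> C * ln (real q) / L + C * of_bool (n \<in> S)"
    proof -
      consider "ln (real (n * q)) / L \<le> U" | "n \<in> S" | "U < ln (real n) / L" using n by (force simp: S_def)
      then show ?thesis
      proof cases
        case 1
        have "norm (f (ln (real n) / L) - f (ln (real (n * q)) / L)) \<le> C * (ln (real (n * q)) / L - ln (real n) / L)"
          by (rule cut_lipschitzD(3)[OF f l0(1) ll 1])
        also have "\<dots> = C * ln (real q) / L" unfolding nq by (simp add: add_divide_distrib)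
        finally show ?thesis using C by (simp add: norm_minus_commute)
      next
        case 2
        then have "f (ln (real (n * q)) / L) = 0" using cut_lipschitzD(2)[OF f l0(2)] by (auto simp: S_def)
        then show ?thesis using 2 cut_lipschitzD(1)[OF f l0(1)] C lq L by (simp add: add_increasing)
      next
        case 3
        then have "f (ln (real (n * q)) / L) = 0" "f (ln (real n) / L) = 0"
          using cut_lipschitzD(2)[OF f l0(2)] cut_lipschitzD(2)[OF f l0(1)] ll by auto
        then show ?thesis using C lq L by simp
      qed
    qed
    then have "norm (f (ln (real (n * q)) / L) - f (ln (real n) / L)) / real n \<le> (C * ln (real q) / L + C * of_bool (n \<in> S)) / real n"
      by (intro divide_right_mono) auto
    then show ?thesis by (simp add: add_divide_distrib)
  qed
  have S: "(\<Sum>n\<in>S. 1 / real n) \<le> 1 + ln (real q)"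
  proof (cases "S = {}")
    case False
    have fS: "finite S" by (simp add: S_def)
    define m where "m = Min S"
    define Z where "Z = Max S"
    have mS: "m \<in> S" "Z \<in> S" using False fS by (auto simp: m_def Z_def)
    have mZ: "m \<le> Z" using fS mS by (simp add: m_def)
    have m1: "m \<ge> 1" using mS by (simp add: S_def)
    have "ln (real Z) / L < ln (real (m * q)) / L" using mS by (auto simp: S_def)
    then have "ln (real Z) < ln (real m) + ln (real q)" using L m1 q by (simp add: ln_mult divide_less_cancel)
    then have lt: "ln (real Z / real m) \<le> ln (real q)" using m1 mZ by (simp add: ln_div)
    have "(\<Sum>n\<in>S. 1 / real n) \<le> (\<Sum>n=m..Z. 1 / real n)"
      using fS by (intro sum_mono2) (auto simp: m_def Z_def)
    also have "\<dots> \<le> 1 / real m + ln (real Z / real m)" by (rule harmonic_tail_le[OF m1 mZ])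
    also have "\<dots> \<le> 1 + ln (real q)" using lt m1 by (intro add_mono) auto
    finally show ?thesis .
  qed (use lq in simp)
  have "(\<Sum>n=1..Y. norm (f (ln (real (n * q)) / L) - f (ln (real n) / L)) / real n) \<le>
     (\<Sum>n=1..Y. C * ln (real q) / L * (1 / real n) + C * (of_bool (n \<in> S) * (1 / real n)))"
    by (rule sum_mono) (rule per)
  also have "\<dots> = C * ln (real q) / L * (\<Sum>n=1..Y. 1 / real n) + C * (\<Sum>n=1..Y. of_bool (n \<in> S) * (1 / real n))"
    by (simp only: sum.distrib sum_distrib_left)
  also have "(\<Sum>n=1..Y. of_bool (n \<in> S) * (1 / real n)) = (\<Sum>n\<in>S. 1 / real n)"
    by (rule sum.mono_neutral_cong_right) (auto simp: S_def)
  also have "C * ln (real q) / L * (\<Sum>n=1..Y. 1 / real n) + C * (\<Sum>n\<in>S. 1 / real n) \<le>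
      C * ln (real q) / L * (2 * L) + C * (1 + ln (real q))"
    using h S C lq L by (intro add_mono mult_left_mono) auto
  also have "\<dots> = 2 * (C * ln (real q)) + C * (1 + ln (real q))" using L by simp
  also have "\<dots> \<le> 3 * C * (1 + ln (real q))" using C lq by (simp add: algebra_simps)
  finally show ?thesis by (simp add: Y_def)
qed

section \<open>Sums over tuples of positive integers\<close>

abbreviation positive_tuples :: "'a set \<Rightarrow> ('a \<Rightarrow> nat) set" where
  "positive_tuples X \<equiv> X \<rightarrow>\<^sub>E {1..}"

abbreviation grid :: "'a set \<Rightarrow> nat \<Rightarrow> ('a \<Rightarrow> nat) set" where
  "grid X Y \<equiv> X \<rightarrow>\<^sub>E {1..Y}"

definition harmonic_sum :: "nat \<Rightarrow> real" where "harmonic_sum Y = (\<Sum>n=1..Y. 1 / real n)"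

lemma harmonic_sum_nonneg: "harmonic_sum Y \<ge> 0"
  by (simp add: harmonic_sum_def sum_nonneg)

lemma sum_PiE_insert:
  assumes "finite X" "x \<notin> X"
  shows "(\<Sum>d\<in>insert x X \<rightarrow>\<^sub>E A. F d) = (\<Sum>u\<in>X \<rightarrow>\<^sub>E A. \<Sum>n\<in>A. F (u(x := n)))"
proof -
  have "(\<Sum>d\<in>insert x X \<rightarrow>\<^sub>E A. F d) = (\<Sum>(n, u)\<in>A \<times> (X \<rightarrow>\<^sub>E A). F (u(x := n)))"
    unfolding PiE_insert_eq using inj_combinator[OF assms(2), of "\<lambda>_. A"]
    by (subst sum.reindex) (auto simp: case_prod_unfold)
  also have "\<dots> = (\<Sum>n\<in>A. \<Sum>u\<in>X \<rightarrow>\<^sub>E A. F (u(x := n)))"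
    by (rule sum.cartesian_product[symmetric])
  finally show ?thesis by (simp add: sum.swap[of _ A])
qed

lemma sum_inverse_prod_box:
  assumes "finite X"
  shows "(\<Sum>d\<in>grid X Y. 1 / (\<Prod>x\<in>X. real (d x))) = harmonic_sum Y ^ card X"
proof -
  have "(\<Sum>d\<in>grid X Y. 1 / (\<Prod>x\<in>X. real (d x))) = (\<Sum>d\<in>grid X Y. \<Prod>x\<in>X. 1 / real (d x))"
    by (simp add: prod_dividef)
  also have "\<dots> = (\<Prod>x\<in>X. \<Sum>n=1..Y. 1 / real n)"
    using assms by (intro prod_sum_PiE[symmetric]) auto
  finally show ?thesis by (simp add: harmonic_sum_def)
qed

text \<open>The coordinates are dilated one after the other. The one being dilated contributes
  \<open>B * (1 + ln q)\<close> in place of a harmonic sum, the others a harmonic sum each. A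
  coordinate with \<open>q = 1\<close> costs nothing, so an exponent vector is charged only for its
  nonzero entries.\<close>

lemma sum_dilation_box_le:
  fixes w :: "('a \<Rightarrow> nat) \<Rightarrow> complex"
  assumes X: "finite X" and Z: "Z \<subseteq> X" and B: "B \<ge> 0"
    and dil: "\<And>x d q. x \<in> X \<Longrightarrow> d \<in> positive_tuples X \<Longrightarrow> q \<ge> 1 \<Longrightarrow>
      (\<Sum>n=1..Y. norm (w (d(x := n * q)) - w (d(x := n))) / real n) \<le> B * (1 + ln (real q))"
    and q: "\<And>x. x \<in> X \<Longrightarrow> q x \<ge> 1"
  shows "(\<Sum>d\<in>grid X Y. norm (w (\<lambda>x. if x \<in> Z then d x * q x else d x) - w d) / (\<Prod>x\<in>X. real (d x)))
    \<le> (\<Sum>x\<in>Z. if q x = 1 then 0 else B * (1 + ln (real (q x)))) * harmonic_sum Y ^ (card X - 1)"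
proof -
  have "finite Z" using X Z finite_subset by blast
  then show ?thesis using Z
  proof (induction Z rule: finite_induct)
    case empty then show ?case by simp
  next
    case (insert x Z)
    define s where "s = (\<lambda>Z d y. if y \<in> Z then d y * q y else d y :: nat)"
    have xX: "x \<in> X" using insert by simp
    have step: "(\<Sum>d\<in>grid X Y. norm (w (s (insert x Z) d) - w (s Z d)) / (\<Prod>x\<in>X. real (d x)))
       \<le> (if q x = 1 then 0 else B * (1 + ln (real (q x)))) * harmonic_sum Y ^ (card X - 1)"
    proof (cases "q x = 1")
      case True
      then have "s (insert x Z) d = s Z d" for d by (auto simp: s_def fun_eq_iff)
      then show ?thesis using True by simp
    next
      case False
      define X' where "X' = X - {x}"
      have X': "X = insert x X'" "x \<notin> X'" "finite X'" "card X - 1 = card X'" using xX X by (auto simp: X'_def)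
      have "(\<Sum>d\<in>grid X Y. norm (w (s (insert x Z) d) - w (s Z d)) / (\<Prod>x\<in>X. real (d x))) =
        (\<Sum>u\<in>grid X' Y. \<Sum>n\<in>{1..Y}. norm (w (s (insert x Z) (u(x := n))) - w (s Z (u(x := n)))) / (\<Prod>y\<in>X. real ((u(x := n)) y)))"
        unfolding X'(1) using X'(2,3) by (intro sum_PiE_insert)
      also have "\<dots> \<le> (\<Sum>u\<in>grid X' Y. B * (1 + ln (real (q x))) * (1 / (\<Prod>y\<in>X'. real (u y))))"
      proof (rule sum_mono)
        fix u assume u: "u \<in> grid X' Y"
        define p where "p = (\<Prod>y\<in>X'. real (u y))"
        have p: "p > 0" unfolding p_def using u by (intro prod_pos) (force simp: PiE_iff)
        define d where "d = (s Z u)(x := 1)"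
        have d: "d \<in> positive_tuples X"
        proof (rule PiE_I)
          fix y assume y: "y \<in> X"
          show "d y \<in> {1..}"
          proof (cases "y = x")
            case False
            then have "u y \<ge> 1" using u y X'(1) by (auto simp: PiE_iff)
            moreover have "q y \<ge> 1" using q y by blast
            ultimately have "u y * q y \<ge> 1" by (metis mult_le_mono nat_mult_1)
            then show ?thesis using False \<open>u y \<ge> 1\<close> by (simp add: d_def s_def)
          qed (simp add: d_def)
        next
          fix y assume y: "y \<notin> X"
          then have "u y = undefined" using u X'(1) by (auto simp: PiE_iff extensional_def)
          then show "d y = undefined" using y xX insert.prems by (auto simp: d_def s_def)
        qed
        have e: "s (insert x Z) (u(x := n)) = d(x := n * q x)" "s Z (u(x := n)) = d(x := n)" for n
          using insert.hyps by (auto simp: d_def s_def fun_eq_iff)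
        have pr: "(\<Prod>y\<in>X. real ((u(x := n)) y)) = real n * p" for n
        proof -
          have "(\<Prod>y\<in>X'. real ((u(x := n)) y)) = p" unfolding p_def using X'(2) by (intro prod.cong) auto
          then show ?thesis unfolding X'(1) using X'(2,3) by simp
        qed
        have "(\<Sum>n\<in>{1..Y}. norm (w (s (insert x Z) (u(x := n))) - w (s Z (u(x := n)))) / (\<Prod>y\<in>X. real ((u(x := n)) y)))
          = (\<Sum>n=1..Y. norm (w (d(x := n * q x)) - w (d(x := n))) / real n) * (1 / p)"
          unfolding e pr by (simp add: sum_divide_distrib)
        also have "\<dots> \<le> B * (1 + ln (real (q x))) * (1 / p)"
          using dil[OF xX d q[OF xX]] p by (intro mult_right_mono) auto
        finally show "(\<Sum>n\<in>{1..Y}. norm (w (s (insert x Z) (u(x := n))) - w (s Z (u(x := n)))) / (\<Prod>y\<in>X. real ((u(x := n)) y)))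
           \<le> B * (1 + ln (real (q x))) * (1 / (\<Prod>y\<in>X'. real (u y)))" unfolding p_def .
      qed
      also have "\<dots> = B * (1 + ln (real (q x))) * harmonic_sum Y ^ card X'"
        using sum_inverse_prod_box[OF X'(3)] by (simp only: sum_distrib_left[symmetric])
      finally show ?thesis using False X'(4) by simp
    qed
    have "(\<Sum>d\<in>grid X Y. norm (w (s (insert x Z) d) - w d) / (\<Prod>x\<in>X. real (d x))) \<le>
      (\<Sum>d\<in>grid X Y. norm (w (s (insert x Z) d) - w (s Z d)) / (\<Prod>x\<in>X. real (d x)) + norm (w (s Z d) - w d) / (\<Prod>x\<in>X. real (d x)))"
    proof (rule sum_mono)
      fix d
      have "norm (w (s (insert x Z) d) - w d) \<le> norm (w (s (insert x Z) d) - w (s Z d)) + norm (w (s Z d) - w d)"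
        using norm_triangle_ineq[of "w (s (insert x Z) d) - w (s Z d)" "w (s Z d) - w d"] by simp
      then show "norm (w (s (insert x Z) d) - w d) / (\<Prod>x\<in>X. real (d x)) \<le> norm (w (s (insert x Z) d) - w (s Z d)) / (\<Prod>x\<in>X. real (d x)) + norm (w (s Z d) - w d) / (\<Prod>x\<in>X. real (d x))"
        unfolding add_divide_distrib[symmetric] by (intro divide_right_mono prod_nonneg) auto
    qed
    also have "\<dots> \<le> (if q x = 1 then 0 else B * (1 + ln (real (q x)))) * harmonic_sum Y ^ (card X - 1)
       + (\<Sum>x\<in>Z. if q x = 1 then 0 else B * (1 + ln (real (q x)))) * harmonic_sum Y ^ (card X - 1)"
      unfolding sum.distrib using step insert.IH insert.prems by (intro add_mono) (auto simp: s_def)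
    also have "\<dots> = (\<Sum>x\<in>insert x Z. if q x = 1 then 0 else B * (1 + ln (real (q x)))) * harmonic_sum Y ^ (card X - 1)"
      using insert.hyps by (simp add: distrib_right)
    finally show ?case unfolding s_def .
  qed
qed

section \<open>Splitting off the powers of one prime\<close>

definition prime_vector :: "'a set \<Rightarrow> nat \<Rightarrow> ('a \<Rightarrow> nat) \<Rightarrow> 'a \<Rightarrow> nat" where
  "prime_vector X p d = (\<lambda>x\<in>X. multiplicity p (d x))"

definition dilate :: "'a set \<Rightarrow> nat \<Rightarrow> ('a \<Rightarrow> nat) \<Rightarrow> ('a \<Rightarrow> nat) \<Rightarrow> 'a \<Rightarrow> nat" where
  "dilate X p d e = (\<lambda>x\<in>X. d x * p ^ e x)"

lemma multiplicity_le_self: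
  fixes p n :: nat
  assumes "prime p" "n \<ge> 1"
  shows "multiplicity p n \<le> n"
proof -
  have "p ^ multiplicity p n dvd n" by (rule multiplicity_dvd)
  then have "p ^ multiplicity p n \<le> n" using assms by (intro dvd_imp_le) auto
  moreover have "multiplicity p n < p ^ multiplicity p n"
    using assms prime_gt_1_nat by (intro power_gt_expt) auto
  ultimately show ?thesis by simp
qed

text \<open>Every positive tuple is in a unique way a tuple prime to \<open>p\<close> dilated by
  powers of \<open>p\<close>. Exponents up to \<open>Y\<close> suffice because
  \<open>p ^ e > e\<close>, and dilated tuples outside the grid contribute 0 by the support of
  \<open>F\<close>.\<close>

lemma sum_box_prime_split:
  fixes F :: "('a \<Rightarrow> nat) \<Rightarrow> complex"
  assumes X: "finite X" and p: "prime p"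
    and F: "\<And>d. d \<in> positive_tuples X \<Longrightarrow> d \<notin> grid X Y \<Longrightarrow> F d = 0"
  shows "(\<Sum>d\<in>grid X Y. F d) = (\<Sum>d\<in>{d\<in>grid X Y. \<forall>x\<in>X. \<not> p dvd d x}. \<Sum>e\<in>X \<rightarrow>\<^sub>E {0..Y}. F (dilate X p d e))"
proof -
  let ?B = "{d\<in>grid X Y. \<forall>x\<in>X. \<not> p dvd d x}"
  have p0: "p > 0" and p1: "p > 1" using prime_gt_0_nat[OF p] prime_gt_1_nat[OF p] by auto
  have fin: "finite (grid X Y)" "finite (X \<rightarrow>\<^sub>E {0..Y})" using X by (auto intro: finite_PiE)
  have "(\<Sum>d\<in>?B. \<Sum>e\<in>X \<rightarrow>\<^sub>E {0..Y}. F (dilate X p d e)) = (\<Sum>(d,e)\<in>?B \<times> (X \<rightarrow>\<^sub>E {0..Y}). F (dilate X p d e))"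
    using fin by (intro sum.cartesian_product)
  also have "\<dots> = (\<Sum>(d,e)\<in>{(d,e). d \<in> ?B \<and> e \<in> X \<rightarrow>\<^sub>E {0..Y} \<and> dilate X p d e \<in> grid X Y}. F (dilate X p d e))"
  proof (rule sum.mono_neutral_right)
    show "finite (?B \<times> (X \<rightarrow>\<^sub>E {0..Y}))" using fin by auto
    show "\<forall>i\<in>?B \<times> (X \<rightarrow>\<^sub>E {0..Y}) - {(d, e). d \<in> ?B \<and> e \<in> X \<rightarrow>\<^sub>E {0..Y} \<and> dilate X p d e \<in> grid X Y}. (case i of (d, e) \<Rightarrow> F (dilate X p d e)) = 0"
    proof (intro ballI)
      fix i assume "i \<in> ?B \<times> (X \<rightarrow>\<^sub>E {0..Y}) - {(d, e). d \<in> ?B \<and> e \<in> X \<rightarrow>\<^sub>E {0..Y} \<and> dilate X p d e \<in> grid X Y}"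
      then obtain d e where i: "i = (d, e)" and d: "d \<in> grid X Y" and n: "dilate X p d e \<notin> grid X Y" by (cases i) auto
      have "dilate X p d e \<in> positive_tuples X" using d p0 by (force simp: dilate_def PiE_iff)
      then show "(case i of (d, e) \<Rightarrow> F (dilate X p d e)) = 0" using n F by (simp add: i)
    qed
  qed auto
  also have "\<dots> = (\<Sum>d\<in>grid X Y. F d)"
  proof (rule sum.reindex_bij_witness[of _ "\<lambda>d. ((\<lambda>x\<in>X. d x div p ^ multiplicity p (d x)), prime_vector X p d)" "\<lambda>(d,e). dilate X p d e"])
    fix a assume "a \<in> {(d,e). d \<in> ?B \<and> e \<in> X \<rightarrow>\<^sub>E {0..Y} \<and> dilate X p d e \<in> grid X Y}"
    then obtain d e where a: "a = (d, e)" and d: "d \<in> ?B" and e: "e \<in> X \<rightarrow>\<^sub>E {0..Y}" and b: "dilate X p d e \<in> grid X Y" by auto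
    have m: "multiplicity p (d x * p ^ e x) = e x" if "x \<in> X" for x
    proof -
      have "d x \<noteq> 0" "\<not> p dvd d x" using d that by (force simp: PiE_iff)+
      then show ?thesis using p by (simp add: prime_elem_multiplicity_mult_distrib not_dvd_imp_multiplicity_0)
    qed
    have "(\<lambda>x\<in>X. dilate X p d e x div p ^ multiplicity p (dilate X p d e x)) = d"
      using d p0 by (auto simp: fun_eq_iff dilate_def m PiE_iff extensional_def)
    moreover have "prime_vector X p (dilate X p d e) = e"
      using e by (auto simp: fun_eq_iff dilate_def prime_vector_def m PiE_iff extensional_def)
    ultimately show "(\<lambda>d. ((\<lambda>x\<in>X. d x div p ^ multiplicity p (d x)), prime_vector X p d)) (case a of (d, e) \<Rightarrow> dilate X p d e) = a"
      by (simp add: a)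
    show "(case a of (d, e) \<Rightarrow> dilate X p d e) \<in> grid X Y" using b by (simp add: a)
    show "F (case a of (d, e) \<Rightarrow> dilate X p d e) = (case a of (d, e) \<Rightarrow> F (dilate X p d e))" by (simp add: a)
  next
    fix b assume b: "b \<in> grid X Y"
    have b1: "b x \<ge> 1" "b x \<le> Y" if "x \<in> X" for x using b that by (force simp: PiE_iff)+
    have md: "b x div p ^ multiplicity p (b x) * p ^ multiplicity p (b x) = b x" for x
      by (rule dvd_div_mult_self[OF multiplicity_dvd])
    have nd: "\<not> p dvd b x div p ^ multiplicity p (b x)" if "x \<in> X" for x
      using b1[OF that] p1 by (intro multiplicity_decompose) auto
    have eq: "dilate X p (\<lambda>x\<in>X. b x div p ^ multiplicity p (b x)) (prime_vector X p b) = b"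
      using b by (auto simp: fun_eq_iff dilate_def prime_vector_def md PiE_iff extensional_def)
    show "(case ((\<lambda>x\<in>X. b x div p ^ multiplicity p (b x)), prime_vector X p b) of (d, e) \<Rightarrow> dilate X p d e) = b"
      using eq by simp
    have "b x div p ^ multiplicity p (b x) \<in> {1..Y}" if "x \<in> X" for x
    proof -
      have "b x div p ^ multiplicity p (b x) \<noteq> 0" using nd[OF that] by (metis dvd_0_right)
      moreover have "b x div p ^ multiplicity p (b x) \<le> Y"
        using div_le_dividend b1(2)[OF that] by (rule le_trans)
      ultimately show ?thesis by auto
    qed
    moreover have "multiplicity p (b x) \<le> Y" if "x \<in> X" for x
      using multiplicity_le_self[OF p b1(1)[OF that]] b1(2)[OF that] by simp
    ultimately show "((\<lambda>x\<in>X. b x div p ^ multiplicity p (b x)), prime_vector X p b) \<in> {(d,e). d \<in> ?B \<and> e \<in> X \<rightarrow>\<^sub>E {0..Y} \<and> dilate X p d e \<in> grid X Y}"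
      using nd eq b by (auto simp: prime_vector_def)
  qed
  finally show ?thesis ..
qed

section \<open>Sieving tuples prime by prime\<close>

abbreviation exponents :: "'a set \<Rightarrow> ('a \<Rightarrow> nat) set" where
  "exponents X \<equiv> X \<rightarrow>\<^sub>E UNIV"

definition weight :: "'a set \<Rightarrow> real \<Rightarrow> ('a \<Rightarrow> nat) \<Rightarrow> real" where
  "weight X q e = (\<Prod>x\<in>X. q ^ e x)"

text \<open>The probability that the exponent vector at \<open>p\<close> lies in \<open>R\<close>
  when its entries are independent and geometric, the value \<open>n\<close> having probability
  \<open>(1 - 1 / p) / p ^ n\<close>.\<close>

definition local_density :: "'a set \<Rightarrow> ('a \<Rightarrow> nat) set \<Rightarrow> nat \<Rightarrow> real" where
  "local_density X R p = (1 - 1 / real p) ^ card X * infsum (weight X (1 / real p)) R"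

lemma weight_eq_power: "weight X q e = q ^ (\<Sum>x\<in>X. e x)"
  by (simp add: weight_def power_sum)

lemma infsum_weight:
  assumes "finite X" "0 \<le> q" "q < 1"
  shows "weight X q summable_on exponents X" "infsum (weight X q) (exponents X) = (1 / (1 - q)) ^ card X"
proof -
  have 1: "((\<lambda>n. q ^ n) has_sum (1 / (1 - q))) UNIV"
    using assms by (intro sums_nonneg_imp_has_sum geometric_sums) auto
  have s: "(\<lambda>n. norm (q ^ n)) summable_on UNIV"
    using 1 assms by (simp add: norm_power has_sum_imp_summable)
  have "infsum (\<lambda>e. \<Prod>x\<in>X. q ^ e x) (exponents X) = (\<Prod>x\<in>X. infsum (\<lambda>n. q ^ n) UNIV)"
    using assms s by (intro infsum_prod_PiE_abs) auto
  also have "\<dots> = (1 / (1 - q)) ^ card X" using infsumI[OF 1] by simp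
  finally show eq: "infsum (weight X q) (exponents X) = (1 / (1 - q)) ^ card X"
    by (simp add: weight_def[abs_def])
  show "weight X q summable_on exponents X"
  \<comment> \<open>\<open>infsum\<close> is 0 by default on a family that is not summable, so the
    nonzero value already shows summability.\<close>
  proof (rule ccontr)
    assume "\<not> ?thesis"
    then have "infsum (weight X q) (exponents X) = 0" by (rule infsum_not_exists)
    then show False using eq assms by simp
  qed
qed

lemma infsum_sum_swap:
  fixes f :: "'d \<Rightarrow> 'e \<Rightarrow> real"
  assumes "finite D" "\<And>d. d \<in> D \<Longrightarrow> f d summable_on E"
  shows "(\<lambda>e. \<Sum>d\<in>D. f d e) summable_on E \<and> infsum (\<lambda>e. \<Sum>d\<in>D. f d e) E = (\<Sum>d\<in>D. infsum (f d) E)"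
  using assms by (induction D rule: finite_induct) (auto simp: summable_on_add infsum_add)

text \<open>With \<open>u = r * ln p / 4\<close>, the term \<open>r * ln p\<close> is
  \<open>4 * u\<close> and, as \<open>ln p >= 1/2\<close>, the term \<open>r\<close> is at most
  \<open>8 * u\<close>; the right side is \<open>12 * exp u\<close>.\<close>

lemma mult_log_le_powr:
  assumes "p \<ge> 2" "r \<ge> 1"
  shows "real r * (1 + ln (real p)) \<le> 12 * real p powr (real r / 4)"
proof -
  define u where "u = real r * ln (real p) / 4"
  have lp: "ln (real p) \<ge> 1/2"
  proof -
    have "1/2 \<le> ln (2::real)" using ln2_ge_two_thirds by simp
    also have "\<dots> \<le> ln (real p)" using assms by simp
    finally show ?thesis .
  qed
  have e: "real p powr (real r / 4) = exp u" using assms by (simp add: u_def powr_def)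
  have u0: "u \<le> exp u" using exp_ge_add_one_self[of u] by linarith
  have 1: "real r * ln (real p) = 4 * u" by (simp add: u_def)
  have "real r * (1 / 2) \<le> real r * ln (real p)" using lp by (intro mult_left_mono) auto
  then have 2: "real r \<le> 8 * u" unfolding 1 by simp
  have "real r * (1 + ln (real p)) = real r + real r * ln (real p)" by (simp add: algebra_simps)
  also have "\<dots> \<le> 12 * u" using 1 2 by linarith
  also have "\<dots> \<le> 12 * exp u" using u0 by simp
  finally show ?thesis by (simp add: e)
qed

text \<open>The total weight of all exponent vectors with \<open>N\<close> entries at ratio
  \<open>2 powr (- 1 / 8)\<close>. For primes \<open>p > 2\<close> the ratio
  \<open>p powr (- 1 / 8)\<close> is smaller, so this bound is uniform in \<open>p\<close>.\<close>

definition decay_constant :: "nat \<Rightarrow> real" where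
  "decay_constant N = (1 / (1 - 2 powr (- 1 / 8))) ^ N"

lemma decay_base: "p \<ge> 2 \<Longrightarrow> 0 \<le> real p powr (- 1/8) \<and> real p powr (- 1 / 8) < 1 \<and> real p powr (- 1 / 8) \<le> 2 powr (- 1 / 8)"
  by (auto intro!: powr_mono2' simp: powr_less_one)

lemma decay_constant_ge_1: "decay_constant N \<ge> 1"
  unfolding decay_constant_def using decay_base[of 2] by (intro one_le_power) (simp add: divide_simps)

lemma infsum_decay_weight_le:
  assumes "finite X" "p \<ge> 2"
  shows "infsum (weight X (real p powr (- 1 / 8))) (exponents X) \<le> decay_constant (card X)"
proof -
  have "infsum (weight X (real p powr (- 1 / 8))) (exponents X) = (1 / (1 - real p powr (- 1 / 8))) ^ card X"
    using assms decay_base[of p] by (intro infsum_weight) auto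
  also have "\<dots> \<le> decay_constant (card X)"
    unfolding decay_constant_def using decay_base[of p] decay_base[of 2] assms by (intro power_mono divide_left_mono) auto
  finally show ?thesis .
qed

text \<open>With total exponent \<open>s >= 2\<close>, the factor \<open>s * (1 + ln p)\<close>
  costs \<open>12 * p powr (s / 4)\<close>. The remaining \<open>p powr (- 3 * s / 4)\<close> splits
  into \<open>p powr (- s / 8)\<close>, summable over exponent vectors, and
  \<open>p powr (- 5 * s / 8)\<close>, which is at most \<open>p powr (- 5 / 4)\<close> and summable
  over primes.\<close>

lemma weight_decay:
  assumes "p \<ge> 2" and r: "(\<Sum>x\<in>X. e x) \<ge> 2"
  shows "real (\<Sum>x\<in>X. e x) * (1 + ln (real p)) * weight X (1 / real p) e \<le> 12 * real p powr (- 5 / 4) * weight X (real p powr (- 1 / 8)) e"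
proof -
  define s where "s = (\<Sum>x\<in>X. e x)"
  have s2: "real s \<ge> 2" using r unfolding s_def[symmetric] by simp
  have w1: "weight X (1 / real p) e = real p powr (- real s)"
    unfolding weight_eq_power s_def[symmetric] using assms
    by (simp add: powr_minus powr_realpow power_one_over inverse_eq_divide)
  have w2: "weight X (real p powr (- 1 / 8)) e = real p powr (- real s / 8)"
    unfolding weight_eq_power s_def[symmetric] using assms
    by (simp add: powr_realpow[symmetric] powr_powr)
  have "real s * (1 + ln (real p)) * weight X (1 / real p) e \<le> 12 * real p powr (real s / 4) * real p powr (- real s)"
    unfolding w1 using mult_log_le_powr[of p s] assms by (intro mult_right_mono) (auto simp: s_def)
  also have "\<dots> = 12 * real p powr (- 3 * real s / 4)" by (simp add: mult.assoc flip: powr_add)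
  also have "\<dots> \<le> 12 * real p powr (- 5 / 4 + - real s / 8)"
    using assms(1) s2 by (intro mult_left_mono powr_mono) auto
  also have "\<dots> = 12 * real p powr (- 5 / 4) * weight X (real p powr (- 1 / 8)) e"
    by (simp only: w2 powr_add mult.assoc)
  finally show ?thesis by (simp add: s_def)
qed

text \<open>\<open>R\<close> is the set of exponent vectors permitted at each prime. By
  \<open>small\<close> the local densities differ from 1 only through vectors of total exponent at
  least 2, so their product over the primes converges.\<close>

locale prime_sieve =
  fixes X :: "'a set" and R :: "('a \<Rightarrow> nat) set"
  assumes fin: "finite X" and R: "R \<subseteq> exponents X"
    and small: "\<And>e. e \<in> exponents X \<Longrightarrow> (\<Sum>x\<in>X. e x) \<le> 1 \<Longrightarrow> e \<in> R"
begin

text \<open>The deficit is the normalized weight of the complement of \<open>R\<close>, whose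
  vectors have total exponent at least 2, so \<open>weight_decay\<close> applies to each of
  them.\<close>

lemma local_density_bounds:
  assumes p: "p \<ge> 2"
  shows "0 \<le> local_density X R p" "local_density X R p \<le> 1"
    "1 - local_density X R p \<le> 12 * decay_constant (card X) * real p powr (- 5 / 4)"
proof -
  let ?w = "weight X (1 / real p)" and ?v = "weight X (real p powr (- 1 / 8))"
  let ?E = "exponents X"
  have q: "0 \<le> 1 / real p" "1 / real p < 1" using p by auto
  have w0: "?w e \<ge> 0" for e by (simp add: weight_def prod_nonneg)
  have v0: "?v e \<ge> 0" for e by (simp add: weight_def prod_nonneg)
  have sE: "?w summable_on ?E" by (rule infsum_weight(1)[OF fin q])
  have sR: "?w summable_on R" by (rule summable_on_subset_banach[OF sE R])
  have sD: "?w summable_on (?E - R)" by (rule summable_on_subset_banach[OF sE]) auto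
  have vE: "?v summable_on ?E" using decay_base[OF p] by (intro infsum_weight(1)[OF fin]) auto
  have c: "0 \<le> (1 - 1 / real p) ^ card X" "(1 - 1 / real p) ^ card X \<le> 1"
    using q by (auto intro: power_le_one)
  have tot: "(1 - 1 / real p) ^ card X * infsum ?w ?E = 1"
    unfolding infsum_weight(2)[OF fin q] using p by (subst power_mult_distrib[symmetric]) simp
  have split: "infsum ?w ?E = infsum ?w R + infsum ?w (?E - R)"
  proof -
    have "infsum ?w (R \<union> (?E - R)) = infsum ?w R + infsum ?w (?E - R)"
      by (rule infsum_Un_disjoint[OF sR sD]) auto
    moreover have "R \<union> (?E - R) = ?E" using R by auto
    ultimately show ?thesis by simp
  qed
  have one: "1 - local_density X R p = (1 - 1 / real p) ^ card X * infsum ?w (?E - R)"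
    using tot unfolding split local_density_def by (simp add: algebra_simps)
  show "0 \<le> local_density X R p" unfolding local_density_def using c w0 by (intro mult_nonneg_nonneg infsum_nonneg) auto
  have "0 \<le> (1 - 1 / real p) ^ card X * infsum ?w (?E - R)"
    using c w0 by (intro mult_nonneg_nonneg infsum_nonneg) auto
  then show "local_density X R p \<le> 1" using one by simp
  have "(1 - 1 / real p) ^ card X * infsum ?w (?E - R) \<le> 1 * infsum ?w (?E - R)"
    using c w0 by (intro mult_right_mono infsum_nonneg) auto
  also have "1 * infsum ?w (?E - R) \<le> infsum (\<lambda>e. 12 * real p powr (- 5 / 4) * ?v e) ?E"
    unfolding mult_1
  proof (rule infsum_mono_neutral[OF sD summable_on_cmult_right[OF vE]])
    fix e assume "e \<in> (?E - R) \<inter> ?E"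
    then have s: "(\<Sum>x\<in>X. e x) \<ge> 2" using small[of e] by force
    have l: "ln (real p) \<ge> 0" using p by simp
    have "1 * ?w e \<le> real (\<Sum>x\<in>X. e x) * (1 + ln (real p)) * ?w e"
    proof (rule mult_right_mono)
      have s1: "1 \<le> real (\<Sum>x\<in>X. e x)" using s by linarith
      have "1 * 1 \<le> real (\<Sum>x\<in>X. e x) * (1 + ln (real p))"
        by (rule mult_mono[OF s1]) (use l s1 in linarith)+
      then show "1 \<le> real (\<Sum>x\<in>X. e x) * (1 + ln (real p))" by simp
    qed (rule w0)
    also have "\<dots> \<le> 12 * real p powr (- 5 / 4) * ?v e" by (rule weight_decay[OF p s])
    finally show "?w e \<le> 12 * real p powr (- 5 / 4) * ?v e" by simp
  qed (use v0 in auto)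
  also have "\<dots> = 12 * real p powr (- 5 / 4) * infsum ?v ?E" by (rule infsum_cmult_right')
  also have "\<dots> \<le> 12 * real p powr (- 5 / 4) * decay_constant (card X)"
    using infsum_decay_weight_le[OF fin p] by (intro mult_left_mono) auto
  finally show "1 - local_density X R p \<le> 12 * decay_constant (card X) * real p powr (- 5 / 4)"
    unfolding one by (simp add: mult_ac)
qed

text \<open>The density is subtracted so that the total of these signed weights is 0. A function
  summed against them is then felt only through its variation under dilation by powers of
  \<open>p\<close>.\<close>

definition mean_zero_weight :: "nat \<Rightarrow> ('a \<Rightarrow> nat) \<Rightarrow> real" where
  "mean_zero_weight p e = (of_bool (e \<in> R) - local_density X R p) * weight X (1 / real p) e"

text \<open>Three ranges of the total exponent. At 0 the left side vanishes. At 1 the vector is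
  permitted, and the deficit \<open>1 - local_density\<close> supplies
  \<open>p powr (- 5 / 4)\<close>. From 2 on the weight alone is small enough by
  \<open>weight_decay\<close>. The constant 144 is \<open>12 * 12\<close> from the middle
  range.\<close>

lemma mean_zero_weight_le:
  assumes p: "p \<ge> 2" and e: "e \<in> exponents X"
  shows "\<bar>mean_zero_weight p e\<bar> * (real (\<Sum>x\<in>X. e x) * (1 + ln (real p)))
    \<le> 144 * decay_constant (card X) * real p powr (- 5 / 4) * weight X (real p powr (- 1 / 8)) e"
proof -
  let ?s = "\<Sum>x\<in>X. e x"
  let ?w = "weight X (1 / real p) e" and ?v = "weight X (real p powr (- 1 / 8)) e"
  note K = local_density_bounds[OF p]
  have G: "decay_constant (card X) \<ge> 1" by (rule decay_constant_ge_1)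
  have w0: "?w \<ge> 0" by (simp add: weight_def prod_nonneg)
  have v0: "?v \<ge> 0" by (simp add: weight_def prod_nonneg)
  have l: "ln (real p) \<ge> 0" using p by simp
  consider "?s = 0" | "?s = 1" | "?s \<ge> 2" by linarith
  then show ?thesis
  proof cases
    case 1
    then have "real ?s = 0" by simp
    then show ?thesis using v0 G by simp
  next
    case 2
    then have "e \<in> R" using small e by simp
    then have "\<bar>mean_zero_weight p e\<bar> = (1 - local_density X R p) * ?w"
      using K w0 by (simp add: mean_zero_weight_def abs_mult)
    also have "\<dots> * (real ?s * (1 + ln (real p))) = (1 - local_density X R p) * ((1 + ln (real p)) * ?w)"
      using 2 by simp
    also have "\<dots> \<le> (12 * decay_constant (card X) * real p powr (- 5 / 4)) * (12 * ?v)"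
    proof (rule mult_mono)
      have "(1 + ln (real p)) * ?w \<le> 12 * real p powr (1 / 4) * real p powr (- 1)"
        using mult_log_le_powr[OF p, of 1] p unfolding weight_eq_power 2
        by (simp add: powr_minus_divide divide_right_mono)
      also have "\<dots> = 12 * real p powr (1 / 4 + - 1)" by (simp only: powr_add mult.assoc)
      also have "\<dots> \<le> 12 * real p powr (- 1 / 8)" using p by (intro mult_left_mono powr_mono) auto
      finally show "(1 + ln (real p)) * ?w \<le> 12 * ?v" unfolding weight_eq_power 2 by simp
    qed (use K w0 l v0 G in auto)
    finally show ?thesis by (simp add: mult_ac)
  next
    case 3
    have "\<bar>mean_zero_weight p e\<bar> \<le> 1 * ?w"
      unfolding mean_zero_weight_def abs_mult using K w0 by (intro mult_mono) auto
    then have "\<bar>mean_zero_weight p e\<bar> * (real ?s * (1 + ln (real p))) \<le> ?w * (real ?s * (1 + ln (real p)))"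
    proof (intro mult_right_mono)
      show "0 \<le> real ?s * (1 + ln (real p))"
        by (rule mult_nonneg_nonneg[OF of_nat_0_le_iff]) (use l in linarith)
    qed (use \<open>\<bar>mean_zero_weight p e\<bar> \<le> 1 * ?w\<close> in simp)
    also have "\<dots> = real ?s * (1 + ln (real p)) * ?w" by (simp add: mult_ac)
    also have "\<dots> \<le> 12 * real p powr (- 5 / 4) * ?v" by (rule weight_decay[OF p 3])
    also have "\<dots> \<le> (144 * decay_constant (card X)) * real p powr (- 5 / 4) * ?v"
      using G v0 by (intro mult_right_mono) auto
    finally show ?thesis .
  qed
qed

lemma infsum_mean_zero_weight:
  assumes p: "p \<ge> 2"
  shows "mean_zero_weight p summable_on exponents X" "infsum (mean_zero_weight p) (exponents X) = 0"
    "(\<lambda>e. \<bar>mean_zero_weight p e\<bar>) summable_on exponents X"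
proof -
  let ?w = "weight X (1 / real p)" and ?E = "exponents X"
  have q: "0 \<le> 1 / real p" "1 / real p < 1" using p by auto
  have w0: "?w e \<ge> 0" for e by (simp add: weight_def prod_nonneg)
  have sE: "?w summable_on ?E" by (rule infsum_weight(1)[OF fin q])
  have sR: "?w summable_on R" by (rule summable_on_subset_banach[OF sE R])
  have sR': "(\<lambda>e. of_bool (e \<in> R) * ?w e) summable_on ?E"
    using sR by (rule summable_on_cong_neutral[THEN iffD1, rotated -1]) (use R in auto)
  have iR: "infsum (\<lambda>e. of_bool (e \<in> R) * ?w e) ?E = infsum ?w R"
    by (rule infsum_cong_neutral) (use R in auto)
  have eq: "mean_zero_weight p = (\<lambda>e. of_bool (e \<in> R) * ?w e + (- local_density X R p) * ?w e)"
    by (simp add: mean_zero_weight_def fun_eq_iff algebra_simps)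
  show "mean_zero_weight p summable_on ?E"
    unfolding eq by (intro summable_on_add sR' summable_on_cmult_right sE)
  have "infsum (mean_zero_weight p) ?E = infsum ?w R + (- local_density X R p) * infsum ?w ?E"
    unfolding eq by (subst infsum_add[OF sR' summable_on_cmult_right[OF sE]]) (simp only: iR infsum_cmult_right')
  also have "\<dots> = 0"
    unfolding infsum_weight(2)[OF fin q] local_density_def using q p by (simp add: power_one_over field_simps)
  finally show "infsum (mean_zero_weight p) ?E = 0" .
  show "(\<lambda>e. \<bar>mean_zero_weight p e\<bar>) summable_on ?E"
  proof (rule summable_on_comparison_test[OF sE])
    fix e
    note K = local_density_bounds[OF p]
    have "\<bar>mean_zero_weight p e\<bar> \<le> 1 * ?w e"
      unfolding mean_zero_weight_def abs_mult using K w0[of e] by (intro mult_mono) auto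
    then show "\<bar>mean_zero_weight p e\<bar> \<le> ?w e" by simp
  qed auto
qed

definition sieved_sum :: "(('a \<Rightarrow> nat) \<Rightarrow> complex) \<Rightarrow> nat \<Rightarrow> nat set \<Rightarrow> complex" where
  "sieved_sum w Y Q = (\<Sum>d\<in>grid X Y. of_bool (\<forall>q\<in>Q. prime_vector X q d \<in> R) * w d / of_real (\<Prod>x\<in>X. real (d x)))"

lemma prime_vector_dilate:
  assumes "prime p" "d \<in> positive_tuples X"
  shows "prime q \<Longrightarrow> q \<noteq> p \<Longrightarrow> prime_vector X q (dilate X p d e) = prime_vector X q d"
    and "\<forall>x\<in>X. \<not> p dvd d x \<Longrightarrow> e \<in> exponents X \<Longrightarrow> prime_vector X p (dilate X p d e) = e"
proof -
  have d0: "d x \<noteq> 0" if "x \<in> X" for x using assms that by (force simp: PiE_iff)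
  have p0: "p \<noteq> 0" using assms by auto
  show "prime_vector X q (dilate X p d e) = prime_vector X q d" if q: "prime q" "q \<noteq> p"
  proof -
    have "multiplicity q (d x * p ^ e x) = multiplicity q (d x)" if "x \<in> X" for x
    proof -
      have "multiplicity q (p ^ e x) = 0"
        using q assms by (metis not_dvd_imp_multiplicity_0 prime_dvd_power primes_dvd_imp_eq)
      then show ?thesis using d0[OF that] p0 q by (simp add: prime_elem_multiplicity_mult_distrib)
    qed
    then show ?thesis by (auto simp: prime_vector_def dilate_def fun_eq_iff)
  qed
  show "prime_vector X p (dilate X p d e) = e" if "\<forall>x\<in>X. \<not> p dvd d x" "e \<in> exponents X"
  proof -
    have "multiplicity p (d x * p ^ e x) = e x" if "x \<in> X" for x
      using d0[OF that] p0 assms \<open>\<forall>x\<in>X. \<not> p dvd d x\<close> that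
      by (simp add: prime_elem_multiplicity_mult_distrib not_dvd_imp_multiplicity_0)
    then show ?thesis using that by (auto simp: prime_vector_def dilate_def fun_eq_iff PiE_iff extensional_def)
  qed
qed

text \<open>Replacing the condition at \<open>p\<close> by its density means summing
  \<open>mean_zero_weight\<close> over the exponents of \<open>p\<close>. As these weights have
  total 0, the value of \<open>w\<close> at the tuple prime to \<open>p\<close> can be subtracted,
  and only differences under dilation remain. They save one harmonic sum, and the decay of the
  signed weights makes the loss summable over \<open>p\<close>.\<close>

lemma sieved_sum_insert:
  assumes p: "prime p" and Q: "\<forall>q\<in>Q. prime q" "p \<notin> Q" and B: "B \<ge> 0"
    and dil: "\<And>x d q. x \<in> X \<Longrightarrow> d \<in> positive_tuples X \<Longrightarrow> q \<ge> 1 \<Longrightarrow>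
      (\<Sum>n=1..Y. norm (w (d(x := n * q)) - w (d(x := n))) / real n) \<le> B * (1 + ln (real q))"
    and bdd: "\<And>d. d \<in> positive_tuples X \<Longrightarrow> norm (w d) \<le> W"
    and supp: "\<And>d x. d \<in> positive_tuples X \<Longrightarrow> d \<notin> grid X Y \<Longrightarrow> w d = 0"
  shows "norm (sieved_sum w Y (insert p Q) - of_real (local_density X R p) * sieved_sum w Y Q)
    \<le> 144 * (decay_constant (card X))\<^sup>2 * B * harmonic_sum Y ^ (card X - 1) * real p powr (- 5 / 4)"
proof -
  let ?E = "exponents X" and ?\<gamma> = "mean_zero_weight p" and ?k = "local_density X R p"
  let ?B = "{d\<in>grid X Y. \<forall>x\<in>X. \<not> p dvd d x}"
  define P where "P = (\<lambda>d. \<Prod>x\<in>X. real (d x))"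
  define c where "c = (\<lambda>d. \<forall>q\<in>Q. prime_vector X q d \<in> R)"
  define D where "D = (\<lambda>d e. norm (w (dilate X p d e) - w d))"
  have p2: "p \<ge> 2" using p by (rule prime_ge_2_nat)
  have finB: "finite ?B" "finite (grid X Y)" using fin by (auto intro!: finite_PiE)
  have pos: "d \<in> positive_tuples X" if "d \<in> grid X Y" for d using that by (force simp: PiE_iff)
  have Ppos: "P d > 0" if "d \<in> positive_tuples X" for d
    unfolding P_def using that by (intro prod_pos) (force simp: PiE_iff)
  have dpos: "dilate X p d e \<in> positive_tuples X" if "d \<in> positive_tuples X" for d e
    using that p2 by (force simp: dilate_def PiE_iff)
  define F where "F = (\<lambda>d. (of_bool (prime_vector X p d \<in> R) - of_real ?k) * of_bool (c d) * w d / complex_of_real (P d))"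
  have "sieved_sum w Y (insert p Q) - of_real ?k * sieved_sum w Y Q = (\<Sum>d\<in>grid X Y. F d)"
    unfolding sieved_sum_def sum_distrib_left sum_subtractf[symmetric]
    by (intro sum.cong) (auto simp: F_def c_def P_def diff_divide_distrib algebra_simps)
  also have "\<dots> = (\<Sum>d\<in>?B. \<Sum>e\<in>X \<rightarrow>\<^sub>E {0..Y}. F (dilate X p d e))"
    by (rule sum_box_prime_split[OF fin p]) (simp add: F_def supp)
  also have "\<dots> = (\<Sum>d\<in>?B. of_bool (c d) / of_real (P d) * (\<Sum>e\<in>X \<rightarrow>\<^sub>E {0..Y}. of_real (?\<gamma> e) * w (dilate X p d e)))"
  proof (rule sum.cong[OF refl], unfold sum_distrib_left, rule sum.cong[OF refl])
    fix d e assume d: "d \<in> ?B" and e: "e \<in> X \<rightarrow>\<^sub>E {0..Y}"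
    have eE: "e \<in> ?E" using e by auto
    have "prime_vector X p (dilate X p d e) = e" using d eE pos by (intro prime_vector_dilate[OF p]) auto
    moreover have "c (dilate X p d e) = c d"
      unfolding c_def using prime_vector_dilate(1)[OF p pos] Q d by (metis (no_types, lifting) mem_Collect_eq)
    moreover have "P (dilate X p d e) = P d * real p ^ (\<Sum>x\<in>X. e x)"
      by (simp add: P_def dilate_def prod.distrib power_sum)
    ultimately show "F (dilate X p d e) = of_bool (c d) / of_real (P d) * (of_real (?\<gamma> e) * w (dilate X p d e))"
      by (simp add: F_def mean_zero_weight_def weight_eq_power power_one_over divide_simps)
  qed
  finally have main: "sieved_sum w Y (insert p Q) - of_real ?k * sieved_sum w Y Q =
     (\<Sum>d\<in>?B. of_bool (c d) / of_real (P d) * (\<Sum>e\<in>X \<rightarrow>\<^sub>E {0..Y}. of_real (?\<gamma> e) * w (dilate X p d e)))" .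
  have sD: "(\<lambda>e. \<bar>?\<gamma> e\<bar> * D d e) summable_on ?E" if "d \<in> positive_tuples X" for d
  proof (rule summable_on_comparison_test[OF summable_on_cmult_left[OF infsum_mean_zero_weight(3)[OF p2], of "2 * W"]])
    fix e
    have "D d e \<le> 2 * W"
      unfolding D_def using bdd[OF that] bdd[OF dpos[OF that, of e]] norm_triangle_ineq4[of "w (dilate X p d e)" "w d"] by linarith
    then show "\<bar>?\<gamma> e\<bar> * D d e \<le> \<bar>?\<gamma> e\<bar> * (2 * W)" by (intro mult_left_mono) auto
  qed (simp add: D_def)
  have inner: "norm (\<Sum>e\<in>X \<rightarrow>\<^sub>E {0..Y}. of_real (?\<gamma> e) * w (dilate X p d e)) \<le> infsum (\<lambda>e. \<bar>?\<gamma> e\<bar> * D d e) ?E"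
    if d: "d \<in> grid X Y" for d
  proof -
    have d': "d \<in> positive_tuples X" using pos d by blast
    have fE: "finite (X \<rightarrow>\<^sub>E {0..Y})" using fin by (intro finite_PiE) auto
    \<comment> \<open>An exponent above \<open>Y\<close> already pushes the tuple out of the grid,
      so the finite sum can be completed to all exponent vectors, over which the signed weights have
      total 0.\<close>
    have z: "w (dilate X p d e) = 0" if "e \<in> ?E - (X \<rightarrow>\<^sub>E {0..Y})" for e
    proof (rule supp[OF dpos[OF d']])
      note eE = that
      obtain x where x: "x \<in> X" "e x > Y" using eE by (auto simp: PiE_iff not_le)
      have "e x < p ^ e x" using p2 by (intro power_gt_expt) auto
      also have "\<dots> \<le> d x * p ^ e x" using d' x by (force simp: PiE_iff)
      finally have "dilate X p d e x > Y" using x by (simp add: dilate_def)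
      then show "dilate X p d e \<notin> grid X Y" using x by (force simp: PiE_iff)
    qed
    have s0: "(\<lambda>e. of_real (?\<gamma> e) * w (dilate X p d e)) summable_on ?E"
    proof -
      have "(\<lambda>e. of_real (?\<gamma> e) * w (dilate X p d e)) summable_on (X \<rightarrow>\<^sub>E {0..Y})"
        by (rule summable_on_finite[OF fE])
      then show ?thesis
        by (rule summable_on_cong_neutral[THEN iffD1, rotated -1]) (use z in auto)
    qed
    have s1: "(\<lambda>e. of_real (?\<gamma> e) * - w d) summable_on ?E"
      by (intro summable_on_cmult_left summable_on_of_real infsum_mean_zero_weight(1) p2)
    have "(\<Sum>e\<in>X \<rightarrow>\<^sub>E {0..Y}. of_real (?\<gamma> e) * w (dilate X p d e)) = infsum (\<lambda>e. of_real (?\<gamma> e) * w (dilate X p d e)) (X \<rightarrow>\<^sub>E {0..Y})"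
      using fE by simp
    also have "\<dots> = infsum (\<lambda>e. of_real (?\<gamma> e) * w (dilate X p d e)) ?E"
      by (rule infsum_cong_neutral) (use z in auto)
    also have "\<dots> = \<dots> + infsum (\<lambda>e. of_real (?\<gamma> e) * - w d) ?E"
    proof -
      have "infsum (\<lambda>e. complex_of_real (?\<gamma> e)) ?E = 0"
      proof -
        have "(?\<gamma> has_sum 0) ?E"
          using infsum_mean_zero_weight(1,2)[OF p2] by (metis has_sum_infsum)
        then show ?thesis using has_sum_of_real[of ?\<gamma> ?E 0] by (metis infsumI of_real_0)
      qed
      then have "infsum (\<lambda>e. of_real (?\<gamma> e) * - w d) ?E = 0" by (subst infsum_cmult_left') simp
      then show ?thesis by simp
    qed
    also have "\<dots> = infsum (\<lambda>e. of_real (?\<gamma> e) * w (dilate X p d e) + of_real (?\<gamma> e) * - w d) ?E"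
      by (rule infsum_add[OF s0 s1, symmetric])
    also have "norm \<dots> \<le> infsum (\<lambda>e. norm (of_real (?\<gamma> e) * w (dilate X p d e) + of_real (?\<gamma> e) * - w d)) ?E"
    proof (rule norm_infsum_bound)
      show "(\<lambda>e. norm (of_real (?\<gamma> e) * w (dilate X p d e) + of_real (?\<gamma> e) * - w d)) summable_on ?E"
      proof (rule summable_on_comparison_test[OF sD[OF d']])
        show "norm (of_real (?\<gamma> e) * w (dilate X p d e) + of_real (?\<gamma> e) * - w d) \<le> \<bar>?\<gamma> e\<bar> * D d e" for e
          by (simp add: D_def norm_mult flip: right_diff_distrib)
      qed (rule norm_ge_zero)
    qed
    also have "\<dots> = infsum (\<lambda>e. \<bar>?\<gamma> e\<bar> * D d e) ?E"
      by (rule infsum_cong) (simp add: D_def norm_mult flip: right_diff_distrib)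
    finally show ?thesis .
  qed
  let ?h = "harmonic_sum Y ^ (card X - 1)"
  have shift: "(\<Sum>d\<in>grid X Y. D d e / P d) \<le> B * (real (\<Sum>x\<in>X. e x) * (1 + ln (real p))) * ?h" if e: "e \<in> ?E" for e
  proof -
    have dd: "dilate X p d e = (\<lambda>x. if x \<in> X then d x * p ^ e x else d x)" if "d \<in> grid X Y" for d
      using that by (auto simp: dilate_def fun_eq_iff PiE_iff extensional_def)
    have l: "ln (real p) \<ge> 0" using p2 by simp
    have "(\<Sum>d\<in>grid X Y. D d e / P d) = (\<Sum>d\<in>grid X Y. norm (w (\<lambda>x. if x \<in> X then d x * p ^ e x else d x) - w d) / P d)"
      by (intro sum.cong) (simp_all add: D_def dd)
    also have "\<dots> \<le> (\<Sum>x\<in>X. if p ^ e x = 1 then 0 else B * (1 + ln (real (p ^ e x)))) * ?h"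
      unfolding P_def using p2 by (intro sum_dilation_box_le[OF fin order_refl B dil]) auto
    also have "\<dots> \<le> (\<Sum>x\<in>X. B * (real (e x) * (1 + ln (real p)))) * ?h"
    proof (intro mult_right_mono sum_mono)
      fix x assume "x \<in> X"
      show "(if p ^ e x = 1 then 0 else B * (1 + ln (real (p ^ e x)))) \<le> B * (real (e x) * (1 + ln (real p)))"
      proof (cases "e x = 0")
        case False
        have "1 + ln (real (p ^ e x)) = 1 + real (e x) * ln (real p)" using p2 by (simp add: ln_realpow)
        also have "\<dots> \<le> real (e x) * (1 + ln (real p))" using False by (simp add: algebra_simps)
        finally have "B * (1 + ln (real (p ^ e x))) \<le> B * (real (e x) * (1 + ln (real p)))" using B by (rule mult_left_mono)
        moreover have "0 \<le> B * (real (e x) * (1 + ln (real p)))" using B l by simp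
        ultimately show ?thesis by simp
      qed (use B in simp)
    qed (simp add: harmonic_sum_nonneg)
    also have "(\<Sum>x\<in>X. B * (real (e x) * (1 + ln (real p)))) = B * (real (\<Sum>x\<in>X. e x) * (1 + ln (real p)))"
      by (simp add: sum_distrib_left sum_distrib_right)
    finally show ?thesis .
  qed
  have "norm (sieved_sum w Y (insert p Q) - of_real ?k * sieved_sum w Y Q) \<le>
     (\<Sum>d\<in>?B. 1 / P d * infsum (\<lambda>e. \<bar>?\<gamma> e\<bar> * D d e) ?E)"
    unfolding main
  proof (rule sum_norm_le)
    fix d assume d: "d \<in> ?B"
    have "norm (of_bool (c d) / complex_of_real (P d)) \<le> 1 / P d"
      using Ppos[OF pos, of d] d by (auto simp: norm_divide)
    then show "norm (of_bool (c d) / of_real (P d) * (\<Sum>e\<in>X \<rightarrow>\<^sub>E {0..Y}. of_real (?\<gamma> e) * w (dilate X p d e))) \<le> 1 / P d * infsum (\<lambda>e. \<bar>?\<gamma> e\<bar> * D d e) ?E"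
      using inner[of d] d Ppos[OF pos, of d] unfolding norm_mult by (intro mult_mono) auto
  qed
  \<comment> \<open>All terms are nonnegative by now, so the restriction to tuples prime to
    \<open>p\<close> is dropped and the dilation bound on the full grid applies.\<close>
  also have "\<dots> \<le> (\<Sum>d\<in>grid X Y. 1 / P d * infsum (\<lambda>e. \<bar>?\<gamma> e\<bar> * D d e) ?E)"
  proof (rule sum_mono2[OF finB(2)])
    fix b assume "b \<in> grid X Y - ?B"
    then have "P b > 0" using Ppos[OF pos] by blast
    then show "0 \<le> 1 / P b * infsum (\<lambda>e. \<bar>?\<gamma> e\<bar> * D b e) ?E"
      by (intro mult_nonneg_nonneg infsum_nonneg) (simp_all add: D_def)
  qed auto
  also have "\<dots> = (\<Sum>d\<in>grid X Y. infsum (\<lambda>e. 1 / P d * (\<bar>?\<gamma> e\<bar> * D d e)) ?E)"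
    by (simp only: infsum_cmult_right')
  also have "\<dots> = infsum (\<lambda>e. \<Sum>d\<in>grid X Y. 1 / P d * (\<bar>?\<gamma> e\<bar> * D d e)) ?E"
    using finB(2) sD[OF pos] by (intro infsum_sum_swap[THEN conjunct2, symmetric] summable_on_cmult_right) auto
  also have "\<dots> \<le> infsum (\<lambda>e. B * ?h * (144 * decay_constant (card X) * real p powr (- 5 / 4)) * weight X (real p powr (- 1 / 8)) e) ?E"
  proof (rule infsum_mono)
    show "(\<lambda>e. \<Sum>d\<in>grid X Y. 1 / P d * (\<bar>?\<gamma> e\<bar> * D d e)) summable_on ?E"
      using finB(2) sD[OF pos] by (intro infsum_sum_swap[THEN conjunct1] summable_on_cmult_right) auto
    show "(\<lambda>e. B * ?h * (144 * decay_constant (card X) * real p powr (- 5 / 4)) * weight X (real p powr (- 1 / 8)) e) summable_on ?E"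
      using decay_base[OF p2] by (intro summable_on_cmult_right infsum_weight(1) fin) auto
    fix e assume e: "e \<in> ?E"
    have "(\<Sum>d\<in>grid X Y. 1 / P d * (\<bar>?\<gamma> e\<bar> * D d e)) = \<bar>?\<gamma> e\<bar> * (\<Sum>d\<in>grid X Y. D d e / P d)"
      by (simp add: sum_distrib_left mult_ac)
    also have "\<dots> \<le> \<bar>?\<gamma> e\<bar> * (B * (real (\<Sum>x\<in>X. e x) * (1 + ln (real p))) * ?h)"
      using shift[OF e] by (intro mult_left_mono) auto
    also have "\<dots> = B * ?h * (\<bar>?\<gamma> e\<bar> * (real (\<Sum>x\<in>X. e x) * (1 + ln (real p))))"
      by (simp only: mult_ac)
    also have "\<dots> \<le> B * ?h * (144 * decay_constant (card X) * real p powr (- 5 / 4) * weight X (real p powr (- 1 / 8)) e)"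
      using mean_zero_weight_le[OF p2 e] B by (intro mult_left_mono) (auto simp: harmonic_sum_nonneg)
    finally show "(\<Sum>d\<in>grid X Y. 1 / P d * (\<bar>?\<gamma> e\<bar> * D d e)) \<le> B * ?h * (144 * decay_constant (card X) * real p powr (- 5 / 4)) * weight X (real p powr (- 1 / 8)) e"
      by (simp only: mult.assoc)
  qed
  also have "\<dots> = B * ?h * (144 * decay_constant (card X) * real p powr (- 5 / 4)) * infsum (weight X (real p powr (- 1 / 8))) ?E"
    by (rule infsum_cmult_right')
  also have "\<dots> \<le> B * ?h * (144 * decay_constant (card X) * real p powr (- 5 / 4)) * decay_constant (card X)"
    using infsum_decay_weight_le[OF fin p2] B decay_constant_ge_1[of "card X"]
    by (intro mult_left_mono) (auto simp: harmonic_sum_nonneg)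
  finally show ?thesis by (simp add: power2_eq_square mult_ac)
qed

end

section \<open>Riemann sums over the unit cube\<close>

lemma cube_emeasure:
  assumes "finite X"
  shows "(X \<rightarrow>\<^sub>E {0..1::real}) \<in> sets (Pi\<^sub>M X (\<lambda>_. lborel))" "emeasure (Pi\<^sub>M X (\<lambda>_. lborel)) (X \<rightarrow>\<^sub>E {0..1::real}) = 1"
proof -
  interpret product_sigma_finite "\<lambda>_. lborel :: real measure" by standard
  show "(X \<rightarrow>\<^sub>E {0..1::real}) \<in> sets (Pi\<^sub>M X (\<lambda>_. lborel))"
    using assms by (intro sets_PiM_I_finite) auto
  have "emeasure (Pi\<^sub>M X (\<lambda>_. lborel)) (X \<rightarrow>\<^sub>E {0..1::real}) = (\<Prod>x\<in>X. emeasure lborel {0..1::real})"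
    using assms by (intro emeasure_PiM) auto
  then show "emeasure (Pi\<^sub>M X (\<lambda>_. lborel)) (X \<rightarrow>\<^sub>E {0..1::real}) = 1" by simp
qed

lemma integrable_cube:
  fixes W :: "('a \<Rightarrow> real) \<Rightarrow> complex"
  assumes X: "finite X" and W: "W \<in> borel_measurable (Pi\<^sub>M X (\<lambda>_. lborel))"
    and bd: "\<And>u. u \<in> X \<rightarrow>\<^sub>E {0..1} \<Longrightarrow> norm (W u) \<le> B"
  shows "integrable (Pi\<^sub>M X (\<lambda>_. lborel)) (\<lambda>u. indicator (X \<rightarrow>\<^sub>E {0..1}) u *\<^sub>R W u)"
    "norm (\<integral>u. indicator (X \<rightarrow>\<^sub>E {0..1}) u *\<^sub>R W u \<partial>Pi\<^sub>M X (\<lambda>_. lborel)) \<le> B"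
proof -
  let ?M = "Pi\<^sub>M X (\<lambda>_. lborel :: real measure)" and ?Q = "X \<rightarrow>\<^sub>E {0..1::real}"
  show i: "integrable ?M (\<lambda>u. indicator ?Q u *\<^sub>R W u)"
    using cube_emeasure[OF X] W bd by (intro integrableI_bounded_set_indicator[where B = B]) auto
  have "(\<lambda>x\<in>X. 0) \<in> ?Q" by auto
  then have B: "B \<ge> 0" using bd norm_ge_zero order_trans by blast
  have "norm (\<integral>u. indicator ?Q u *\<^sub>R W u \<partial>?M) \<le> (\<integral>u. norm (indicator ?Q u *\<^sub>R W u) \<partial>?M)"
    by (rule integral_norm_bound)
  also have "\<dots> \<le> (\<integral>u. indicator ?Q u *\<^sub>R B \<partial>?M)"
  proof (rule integral_mono[OF integrable_norm[OF i]])
    show "integrable ?M (\<lambda>u. indicator ?Q u *\<^sub>R B)"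
      using cube_emeasure[OF X] B by (intro integrableI_bounded_set_indicator[where B = B]) auto
    show "norm (indicator ?Q u *\<^sub>R W u) \<le> indicator ?Q u *\<^sub>R B" for u
      using bd by (auto split: split_indicator)
  qed
  also have "\<dots> = measure ?M ?Q * B"
    using cube_emeasure[OF X] by (simp add: mult.commute)
  also have "measure ?M ?Q = 1" using cube_emeasure(2)[OF X] by (simp add: measure_def)
  finally show "norm (\<integral>u. indicator ?Q u *\<^sub>R W u \<partial>?M) \<le> B" by simp
qed

lemma harmonic_sum_le:
  assumes "L \<ge> 1" shows "harmonic_sum (nat \<lfloor>exp L\<rfloor>) \<le> 2 * L"
proof -
  define Y where "Y = nat \<lfloor>exp L\<rfloor>"
  have Y1: "Y \<ge> 1" unfolding Y_def using assms by (simp add: le_nat_iff le_floor_iff)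
  have "real Y \<le> exp L" unfolding Y_def by simp
  then have "ln (real Y) \<le> L"
    using Y1 by (metis ln_exp ln_le_cancel_iff exp_gt_zero of_nat_0_less_iff less_le_trans zero_less_one)
  then show ?thesis
    using harmonic_tail_le[of 1 Y] Y1 assms unfolding harmonic_sum_def Y_def[symmetric] by simp
qed

text \<open>Induction on the coordinates: for each value of the new coordinate the others are summed
  by the induction hypothesis, then the new one is summed by the one-dimensional estimate under the
  integral. Each coordinate loses \<open>6 * C\<close> once, against factors \<open>2 * L\<close>
  from the others. Asking for cut Lipschitz slices only along single coordinates admits weights that
  jump across slanted hyperplanes.\<close>

lemma box_sum_integral:
  fixes W :: "('a \<Rightarrow> real) \<Rightarrow> complex"
  assumes X: "finite X" and L: "L \<ge> 1" and C: "C \<ge> 0"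
    and W: "W \<in> borel_measurable (Pi\<^sub>M X (\<lambda>_. lborel))"
    and sl: "\<And>u x. u \<in> X \<rightarrow>\<^sub>E {0..} \<Longrightarrow> x \<in> X \<Longrightarrow> \<exists>U\<le>1. cut_lipschitz C U (\<lambda>v. W (u(x := v)))"
  shows "norm ((\<Sum>d\<in>grid X (nat \<lfloor>exp L\<rfloor>). W (\<lambda>x\<in>X. ln (real (d x)) / L) / of_real (\<Prod>x\<in>X. real (d x)))
     - of_real (L ^ card X) * (\<integral>u. indicator (X \<rightarrow>\<^sub>E {0..1}) u *\<^sub>R W u \<partial>Pi\<^sub>M X (\<lambda>_. lborel)))
    \<le> 6 * C * real (card X) * (2 * L) ^ (card X - 1)"
  using X W sl
proof (induction X arbitrary: W rule: finite_induct)
  case empty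
  interpret product_sigma_finite "\<lambda>_. lborel :: real measure" by standard
  show ?case by (simp add: PiM_empty lebesgue_integral_count_space_finite restrict_def)
next
  case (insert x X)
  interpret product_sigma_finite "\<lambda>_. lborel :: real measure" by standard
  define Y where "Y = nat \<lfloor>exp L\<rfloor>"
  define l where "l = (\<lambda>n. ln (real n) / L)"
  let ?M = "Pi\<^sub>M X (\<lambda>_. lborel :: real measure)" and ?Q = "X \<rightarrow>\<^sub>E {0..1::real}"
  let ?M' = "Pi\<^sub>M (insert x X) (\<lambda>_. lborel :: real measure)" and ?Q' = "insert x X \<rightarrow>\<^sub>E {0..1::real}"
  note Wm[measurable] = insert.prems(1)
  have l0: "l n \<ge> 0" for n
  proof (cases "n = 0")
    case False then show ?thesis using L by (simp add: l_def)
  qed (simp add: l_def)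
  have upd: "u(x := v) \<in> insert x X \<rightarrow>\<^sub>E {0..}" if "u \<in> X \<rightarrow>\<^sub>E {0..}" "v \<ge> 0" for u and v :: real
    using that by (auto simp: PiE_iff extensional_def)
  have bdW: "norm (W u) \<le> C" if u: "u \<in> insert x X \<rightarrow>\<^sub>E {0..}" for u
  proof -
    obtain U where "cut_lipschitz C U (\<lambda>v. W (u(x := v)))" using insert.prems(2)[OF u insertI1] by blast
    from cut_lipschitzD(1)[OF this, of "u x"] show ?thesis using u by (auto simp: PiE_iff)
  qed
  define Wn where "Wn = (\<lambda>n u. W (u(x := l n)))"
  have updm: "(\<lambda>u. u(x := v)) \<in> measurable ?M ?M'" for v
    by (rule measurable_fun_upd) (auto simp: insert.hyps)
  have Wnm: "Wn n \<in> borel_measurable ?M" for n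
    unfolding Wn_def by (rule measurable_compose[OF updm Wm])
  have IH: "norm ((\<Sum>d\<in>grid X Y. Wn n (\<lambda>y\<in>X. l (d y)) / of_real (\<Prod>y\<in>X. real (d y)))
     - of_real (L ^ card X) * (\<integral>u. indicator ?Q u *\<^sub>R Wn n u \<partial>?M)) \<le> 6 * C * real (card X) * (2 * L) ^ (card X - 1)" for n
    unfolding Y_def l_def
  proof (rule insert.IH[OF Wnm])
    fix u :: "'a \<Rightarrow> real" and y assume u: "u \<in> X \<rightarrow>\<^sub>E {0..}" and y: "y \<in> X"
    have "Wn n (u(y := v)) = W ((u(x := l n))(y := v))" for v
      unfolding Wn_def using y insert.hyps by (metis fun_upd_twist)
    then show "\<exists>U\<le>1. cut_lipschitz C U (\<lambda>v. Wn n (u(y := v)))"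
      using insert.prems(2)[OF upd[OF u l0] insertI2[OF y]] by (simp only:)
  qed
  have "(\<Sum>d\<in>grid (insert x X) Y. W (\<lambda>y\<in>insert x X. l (d y)) / of_real (\<Prod>y\<in>insert x X. real (d y))) =
     (\<Sum>u\<in>grid X Y. \<Sum>n\<in>{1..Y}. W (\<lambda>y\<in>insert x X. l ((u(x := n)) y)) / of_real (\<Prod>y\<in>insert x X. real ((u(x := n)) y)))"
    by (rule sum_PiE_insert[OF insert.hyps])
  also have "\<dots> = (\<Sum>u\<in>grid X Y. \<Sum>n\<in>{1..Y}. 1 / of_nat n * (Wn n (\<lambda>y\<in>X. l (u y)) / of_real (\<Prod>y\<in>X. real (u y))))"
  proof (intro sum.cong refl)
    fix u n assume "u \<in> grid X Y" "n \<in> {1..Y}"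
    have "(\<lambda>y\<in>insert x X. l ((u(x := n)) y)) = (\<lambda>y\<in>X. l (u y))(x := l n)"
      by (auto simp: fun_eq_iff)
    moreover have "(\<Prod>y\<in>insert x X. real ((u(x := n)) y)) = real n * (\<Prod>y\<in>X. real (u y))"
    proof -
      have "(\<Prod>y\<in>X. real ((u(x := n)) y)) = (\<Prod>y\<in>X. real (u y))" using insert.hyps by (intro prod.cong) auto
      then show ?thesis using insert.hyps by simp
    qed
    ultimately show "W (\<lambda>y\<in>insert x X. l ((u(x := n)) y)) / of_real (\<Prod>y\<in>insert x X. real ((u(x := n)) y))
       = 1 / of_nat n * (Wn n (\<lambda>y\<in>X. l (u y)) / of_real (\<Prod>y\<in>X. real (u y)))"
      by (simp add: Wn_def)
  qed
  also have "\<dots> = (\<Sum>n\<in>{1..Y}. 1 / of_nat n * (\<Sum>u\<in>grid X Y. Wn n (\<lambda>y\<in>X. l (u y)) / of_real (\<Prod>y\<in>X. real (u y))))"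
    by (subst sum.swap) (simp add: sum_distrib_left)
  finally have S: "(\<Sum>d\<in>grid (insert x X) Y. W (\<lambda>y\<in>insert x X. l (d y)) / of_real (\<Prod>y\<in>insert x X. real (d y))) =
    (\<Sum>n\<in>{1..Y}. 1 / of_nat n * (\<Sum>u\<in>grid X Y. Wn n (\<lambda>y\<in>X. l (u y)) / of_real (\<Prod>y\<in>X. real (u y))))" .
  have e1: "norm ((\<Sum>n\<in>{1..Y}. 1 / of_nat n * (\<Sum>u\<in>grid X Y. Wn n (\<lambda>y\<in>X. l (u y)) / of_real (\<Prod>y\<in>X. real (u y))))
     - (\<Sum>n\<in>{1..Y}. 1 / of_nat n * (of_real (L ^ card X) * (\<integral>u. indicator ?Q u *\<^sub>R Wn n u \<partial>?M))))
    \<le> 6 * C * real (card X) * (2 * L) ^ card X"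
  proof -
    have "norm (\<Sum>n\<in>{1..Y}. 1 / of_nat n * ((\<Sum>u\<in>grid X Y. Wn n (\<lambda>y\<in>X. l (u y)) / of_real (\<Prod>y\<in>X. real (u y)))
       - of_real (L ^ card X) * (\<integral>u. indicator ?Q u *\<^sub>R Wn n u \<partial>?M)))
       \<le> (\<Sum>n\<in>{1..Y}. 1 / real n * (6 * C * real (card X) * (2 * L) ^ (card X - 1)))"
    proof (rule sum_norm_le)
      fix n
      show "norm (1 / of_nat n * ((\<Sum>u\<in>grid X Y. Wn n (\<lambda>y\<in>X. l (u y)) / of_real (\<Prod>y\<in>X. real (u y)))
       - of_real (L ^ card X) * (\<integral>u. indicator ?Q u *\<^sub>R Wn n u \<partial>?M))) \<le> 1 / real n * (6 * C * real (card X) * (2 * L) ^ (card X - 1))"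
        unfolding norm_mult using IH[of n] by (intro mult_mono) (auto simp: norm_divide)
    qed
    also have "\<dots> = harmonic_sum Y * (6 * C * real (card X) * (2 * L) ^ (card X - 1))"
      by (simp only: harmonic_sum_def sum_distrib_right)
    also have "\<dots> \<le> (2 * L) * (6 * C * real (card X) * (2 * L) ^ (card X - 1))"
      using harmonic_sum_le[OF L] C L unfolding Y_def by (intro mult_right_mono) auto
    also have "\<dots> = 6 * C * real (card X) * (2 * L) ^ card X"
      by (cases "card X") (simp_all add: mult_ac)
    finally show ?thesis by (simp only: right_diff_distrib sum_subtractf)
  qed
  \<comment> \<open>The one-dimensional error in the new coordinate with the others fixed at
    \<open>u\<close>; it is at most \<open>6 * C\<close> throughout the cube.\<close>
  define V where "V = (\<lambda>u. (\<Sum>n\<in>{1..Y}. Wn n u / of_nat n) - of_real L * (\<integral>v. indicator {0..1} v *\<^sub>R W (u(x := v)) \<partial>lborel))"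
  have nonneg: "u \<in> X \<rightarrow>\<^sub>E {0..}" if "u \<in> ?Q" for u using that by (auto simp: PiE_iff)
  have slx: "\<exists>U\<le>1. cut_lipschitz C U (\<lambda>v. W (u(x := v)))" if u: "u \<in> ?Q" for u
    using insert.prems(2)[OF upd[OF nonneg[OF u] l0[of 1]] insertI1] by (simp only: fun_upd_upd)
  have iWn: "integrable ?M (\<lambda>u. indicator ?Q u *\<^sub>R Wn n u)" for n
    by (rule integrable_cube(1)[OF insert.hyps(1) Wnm, where B = C]) (unfold Wn_def, rule bdW[OF upd[OF nonneg l0]])
  have iW: "integrable ?M' (\<lambda>u. indicator ?Q' u *\<^sub>R W u)"
    by (rule integrable_cube(1)[where B = C]) (use insert.hyps bdW Wm in \<open>auto simp: PiE_iff\<close>)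
  have ind: "indicator ?Q' (u(x := v)) = (indicator ?Q u * indicator {0..1} v :: real)" if "u \<in> space ?M" for u v
    using that insert.hyps by (auto simp: space_PiM PiE_iff extensional_def indicator_def)
  have fub: "(\<integral>u. indicator ?Q' u *\<^sub>R W u \<partial>?M') = (\<integral>u. indicator ?Q u *\<^sub>R (\<integral>v. indicator {0..1} v *\<^sub>R W (u(x := v)) \<partial>lborel) \<partial>?M)"
  proof -
    have "(\<integral>u. indicator ?Q' u *\<^sub>R W u \<partial>?M') = (\<integral>u. (\<integral>v. indicator ?Q' (u(x := v)) *\<^sub>R W (u(x := v)) \<partial>lborel) \<partial>?M)"
      by (rule product_integral_insert[OF insert.hyps iW])
    also have "\<dots> = (\<integral>u. indicator ?Q u *\<^sub>R (\<integral>v. indicator {0..1} v *\<^sub>R W (u(x := v)) \<partial>lborel) \<partial>?M)"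
      by (intro Bochner_Integration.integral_cong refl) (simp add: ind flip: scaleR_scaleR)
    finally show ?thesis .
  qed
  have mW2: "(\<lambda>(u, v). W (u(x := v))) \<in> borel_measurable (?M \<Otimes>\<^sub>M lborel)"
    using measurable_compose[OF measurable_add_dim Wm] by (simp add: case_prod_unfold)
  have mI: "(\<lambda>u. \<integral>v. indicator {0..1} v *\<^sub>R W (u(x := v)) \<partial>lborel) \<in> borel_measurable ?M"
  proof (rule sigma_finite_measure.borel_measurable_lebesgue_integral)
    show "sigma_finite_measure (lborel :: real measure)" by standard
    show "(\<lambda>(u, v). indicator {0..1} v *\<^sub>R W (u(x := v))) \<in> borel_measurable (?M \<Otimes>\<^sub>M lborel)"
      using mW2 by (simp add: case_prod_unfold)
  qed
  have mV: "V \<in> borel_measurable ?M"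
    unfolding V_def using Wnm mI by (intro borel_measurable_diff borel_measurable_sum borel_measurable_divide borel_measurable_times) auto
  have sm: "(\<lambda>v. W (u(x := v))) \<in> borel_measurable lborel" if "u \<in> ?Q" for u
  proof -
    have "u \<in> space ?M" using that by (auto simp: space_PiM PiE_iff)
    from measurable_compose[OF measurable_Pair1'[OF this] mW2] show ?thesis by simp
  qed
  have bV: "norm (V u) \<le> 6 * C" if u: "u \<in> ?Q" for u
  proof -
    obtain U where U: "U \<le> 1" "cut_lipschitz C U (\<lambda>v. W (u(x := v)))"
      using slx[OF u] by blast
    have "set_integrable lborel {0..1} (\<lambda>v. W (u(x := v)))"
      unfolding set_integrable_def
      by (rule integrableI_bounded_set_indicator[where B = C])
         (use sm[OF u] cut_lipschitzD(1)[OF U(2)] in auto)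
    then have "(\<integral>v. indicator {0..1} v *\<^sub>R W (u(x := v)) \<partial>lborel) = integral {0..1} (\<lambda>v. W (u(x := v)))"
      using set_borel_integral_eq_integral(2) unfolding set_lebesgue_integral_def by blast
    then show ?thesis
      using cut_lipschitz_sum_integral[OF U(2) U(1) L] unfolding V_def Wn_def l_def Y_def by simp
  qed
  have e2: "(\<Sum>n\<in>{1..Y}. 1 / of_nat n * (of_real (L ^ card X) * (\<integral>u. indicator ?Q u *\<^sub>R Wn n u \<partial>?M)))
     - of_real (L ^ card (insert x X)) * (\<integral>u. indicator ?Q' u *\<^sub>R W u \<partial>?M')
     = of_real (L ^ card X) * (\<integral>u. indicator ?Q u *\<^sub>R V u \<partial>?M)"
  proof -
    have iI: "integrable ?M (\<lambda>u. indicator ?Q u *\<^sub>R (\<integral>v. indicator {0..1} v *\<^sub>R W (u(x := v)) \<partial>lborel))"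
    proof (rule integrable_cube(1)[OF insert.hyps(1) mI])
      fix u assume u: "u \<in> ?Q"
      obtain U where U: "U \<le> 1" "cut_lipschitz C U (\<lambda>v. W (u(x := v)))"
        using slx[OF u] by blast
      have "norm (\<integral>v. indicator {0..1} v *\<^sub>R W (u(x := v)) \<partial>lborel) \<le> (\<integral>v. norm (indicator {0..1} v *\<^sub>R W (u(x := v))) \<partial>lborel)"
        by (rule integral_norm_bound)
      also have "\<dots> \<le> (\<integral>v. indicator {0..1::real} v *\<^sub>R C \<partial>lborel)"
      proof (rule integral_mono[OF integrable_norm])
        show "integrable lborel (\<lambda>v. indicator {0..1} v *\<^sub>R W (u(x := v)))"
          using sm[OF u] cut_lipschitzD(1)[OF U(2)] by (intro integrableI_bounded_set_indicator[where B = C]) auto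
        show "integrable lborel (\<lambda>v. indicator {0..1::real} v *\<^sub>R C)"
          using C by (intro integrableI_bounded_set_indicator[where B = C]) auto
        show "norm (indicator {0..1} v *\<^sub>R W (u(x := v))) \<le> indicator {0..1} v *\<^sub>R C" for v
          using cut_lipschitzD(1)[OF U(2)] by (auto split: split_indicator)
      qed
      also have "\<dots> = C" by simp
      finally show "norm (\<integral>v. indicator {0..1} v *\<^sub>R W (u(x := v)) \<partial>lborel) \<le> C" .
    qed
    have "(\<integral>u. indicator ?Q u *\<^sub>R V u \<partial>?M) =
      (\<integral>u. (\<Sum>n\<in>{1..Y}. (1 / of_nat n) * (indicator ?Q u *\<^sub>R Wn n u)) - of_real L * (indicator ?Q u *\<^sub>R (\<integral>v. indicator {0..1} v *\<^sub>R W (u(x := v)) \<partial>lborel)) \<partial>?M)"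
      by (intro Bochner_Integration.integral_cong refl)
         (simp add: V_def scaleR_conv_of_real right_diff_distrib sum_distrib_left mult_ac)
    also have "\<dots> = (\<Sum>n\<in>{1..Y}. (1 / of_nat n) * (\<integral>u. indicator ?Q u *\<^sub>R Wn n u \<partial>?M)) - of_real L * (\<integral>u. indicator ?Q u *\<^sub>R (\<integral>v. indicator {0..1} v *\<^sub>R W (u(x := v)) \<partial>lborel) \<partial>?M)"
    proof -
      have a: "integrable ?M (\<lambda>u. (1 / of_nat n) * (indicator ?Q u *\<^sub>R Wn n u))" for n
        by (rule integrable_mult_right) (rule iWn)
      have b: "integrable ?M (\<lambda>u. \<Sum>n\<in>{1..Y}. (1 / of_nat n) * (indicator ?Q u *\<^sub>R Wn n u))"
        by (rule Bochner_Integration.integrable_sum) (rule a)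
      have c: "integrable ?M (\<lambda>u. of_real L * (indicator ?Q u *\<^sub>R (\<integral>v. indicator {0..1} v *\<^sub>R W (u(x := v)) \<partial>lborel)))"
        by (rule integrable_mult_right) (rule iI)
      show ?thesis
        by (simp only: Bochner_Integration.integral_diff[OF b c] Bochner_Integration.integral_sum[OF a] Bochner_Integration.integral_mult_right_zero)
    qed
    finally show ?thesis unfolding fub using insert.hyps by (simp add: right_diff_distrib sum_distrib_left mult_ac)
  qed
  have e3: "norm (of_real (L ^ card X) * (\<integral>u. indicator ?Q u *\<^sub>R V u \<partial>?M)) \<le> 6 * C * (2 * L) ^ card X"
  proof -
    have "norm (of_real (L ^ card X) * (\<integral>u. indicator ?Q u *\<^sub>R V u \<partial>?M)) \<le> L ^ card X * (6 * C)"
      using integrable_cube(2)[OF insert.hyps(1) mV bV] L by (simp add: norm_mult norm_power mult_left_mono)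
    also have "\<dots> \<le> (2 * L) ^ card X * (6 * C)" using L C by (intro mult_right_mono power_mono) auto
    finally show ?thesis by (simp add: mult_ac)
  qed
  have "norm ((\<Sum>d\<in>grid (insert x X) Y. W (\<lambda>y\<in>insert x X. l (d y)) / of_real (\<Prod>y\<in>insert x X. real (d y)))
     - of_real (L ^ card (insert x X)) * (\<integral>u. indicator ?Q' u *\<^sub>R W u \<partial>?M')) \<le> 6 * C * real (card X) * (2 * L) ^ card X + 6 * C * (2 * L) ^ card X"
    unfolding S using norm_triangle_le[OF add_mono[OF e1 e3]] unfolding e2[symmetric] by (simp only: diff_add_cancel add_diff_eq)
  also have "\<dots> = 6 * C * real (card (insert x X)) * (2 * L) ^ (card (insert x X) - 1)"
    using insert.hyps by (simp add: algebra_simps)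
  finally show ?case unfolding Y_def l_def .
qed

section \<open>Integer matrices with given margins\<close>

text \<open>Greedy construction by induction on the total: a unit is taken from a positive row
  margin and from a positive column margin and placed where they cross.\<close>

lemma exists_matrix_with_margins:
  fixes a :: "'i \<Rightarrow> nat" and b :: "'j \<Rightarrow> nat"
  assumes I: "finite I" and J: "finite J" and ab: "(\<Sum>i\<in>I. a i) = (\<Sum>j\<in>J. b j)"
  shows "\<exists>e\<in>I \<times> J \<rightarrow>\<^sub>E UNIV. (\<forall>i\<in>I. (\<Sum>j\<in>J. e (i, j)) = a i) \<and> (\<forall>j\<in>J. (\<Sum>i\<in>I. e (i, j)) = b j)"
  using ab
proof (induction "\<Sum>i\<in>I. a i" arbitrary: a b)
  case 0
  then have "\<forall>i\<in>I. a i = 0" "\<forall>j\<in>J. b j = 0" using I J by auto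
  then show ?case by (intro bexI[of _ "\<lambda>x\<in>I \<times> J. 0"]) auto
next
  case (Suc s)
  obtain i0 where i0: "i0 \<in> I" "a i0 > 0" using Suc(2) by (metis gr0I nat.simps(3) sum.neutral)
  obtain j0 where j0: "j0 \<in> J" "b j0 > 0" using Suc(2,3) by (metis gr0I nat.simps(3) sum.neutral)
  define a' where "a' = a(i0 := a i0 - 1)"
  define b' where "b' = b(j0 := b j0 - 1)"
  have ra: "a i = a' i + of_bool (i = i0)" for i using i0 by (simp add: a'_def)
  have rb: "b j = b' j + of_bool (j = j0)" for j using j0 by (simp add: b'_def)
  have oneI: "(\<Sum>i\<in>I. of_bool (i = i0)) = (1::nat)" using i0 I by (simp add: of_bool_def sum.delta)
  have oneJ: "(\<Sum>j\<in>J. of_bool (j = j0)) = (1::nat)" using j0 J by (simp add: of_bool_def sum.delta)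
  have sa: "(\<Sum>i\<in>I. a i) = (\<Sum>i\<in>I. a' i) + 1" unfolding ra sum.distrib oneI ..
  have sb: "(\<Sum>j\<in>J. b j) = (\<Sum>j\<in>J. b' j) + 1" unfolding rb sum.distrib oneJ ..
  have "s = (\<Sum>i\<in>I. a' i)" "(\<Sum>i\<in>I. a' i) = (\<Sum>j\<in>J. b' j)" using sa sb Suc(2,3) by linarith+
  from Suc(1)[OF this] obtain e where e: "e \<in> I \<times> J \<rightarrow>\<^sub>E UNIV" "\<forall>i\<in>I. (\<Sum>j\<in>J. e (i, j)) = a' i" "\<forall>j\<in>J. (\<Sum>i\<in>I. e (i, j)) = b' j"
    by blast
  define f where "f = e((i0, j0) := e (i0, j0) + 1)"
  have f: "f (i, j) = e (i, j) + of_bool (i = i0) * of_bool (j = j0)" for i j by (simp add: f_def)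
  show ?case
  proof (intro bexI[of _ f] conjI ballI)
    show "f \<in> I \<times> J \<rightarrow>\<^sub>E UNIV" using e(1) i0 j0 by (auto simp: f_def PiE_iff extensional_def)
    show "(\<Sum>j\<in>J. f (i, j)) = a i" if "i \<in> I" for i
      unfolding f sum.distrib ra sum_distrib_left[symmetric] oneJ using e(2) that by simp
    show "(\<Sum>i\<in>I. f (i, j)) = b j" if "j \<in> J" for j
      unfolding f sum.distrib rb sum_distrib_right[symmetric] oneI using e(3) that by simp
  qed
qed

definition row_sums :: "'i set \<Rightarrow> 'j set \<Rightarrow> ('i \<times> 'j \<Rightarrow> nat) \<Rightarrow> 'i \<Rightarrow> nat" where
  "row_sums I J e = (\<lambda>i\<in>I. \<Sum>j\<in>J. e (i, j))"

definition col_sums :: "'i set \<Rightarrow> 'j set \<Rightarrow> ('i \<times> 'j \<Rightarrow> nat) \<Rightarrow> 'j \<Rightarrow> nat" where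
  "col_sums I J e = (\<lambda>j\<in>J. \<Sum>i\<in>I. e (i, j))"

text \<open>With one exponent matrix fixed for each pair of margins at every prime, each pair of tuples with
  equal products is the pair of row and column products of exactly one matrix of positive integers.\<close>
definition margin_matrix :: "'i set \<Rightarrow> 'j set \<Rightarrow> ('i \<Rightarrow> nat) \<Rightarrow> ('j \<Rightarrow> nat) \<Rightarrow> 'i \<times> 'j \<Rightarrow> nat" where
  "margin_matrix I J a b = (SOME e. e \<in> I \<times> J \<rightarrow>\<^sub>E UNIV \<and> row_sums I J e = a \<and> col_sums I J e = b)"

definition margins :: "'i set \<Rightarrow> 'j set \<Rightarrow> (('i \<Rightarrow> nat) \<times> ('j \<Rightarrow> nat)) set" where
  "margins I J = {(a, b). a \<in> I \<rightarrow>\<^sub>E UNIV \<and> b \<in> J \<rightarrow>\<^sub>E UNIV \<and> (\<Sum>i\<in>I. a i) = (\<Sum>j\<in>J. b j)}"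

definition chosen_matrices :: "'i set \<Rightarrow> 'j set \<Rightarrow> ('i \<times> 'j \<Rightarrow> nat) set" where
  "chosen_matrices I J = (\<lambda>(a, b). margin_matrix I J a b) ` margins I J"

lemma margin_matrix:
  assumes "finite I" "finite J" "(a, b) \<in> margins I J"
  shows "margin_matrix I J a b \<in> I \<times> J \<rightarrow>\<^sub>E UNIV" "row_sums I J (margin_matrix I J a b) = a"
    "col_sums I J (margin_matrix I J a b) = b"
proof -
  obtain e where e: "e\<in>I \<times> J \<rightarrow>\<^sub>E UNIV" "\<forall>i\<in>I. (\<Sum>j\<in>J. e (i, j)) = a i" "\<forall>j\<in>J. (\<Sum>i\<in>I. e (i, j)) = b j"
    using exists_matrix_with_margins[of I J a b] assms by (auto simp: margins_def)
  have "row_sums I J e = a" "col_sums I J e = b"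
    using e assms by (auto simp: row_sums_def col_sums_def margins_def fun_eq_iff PiE_iff extensional_def)
  with e(1) have "\<exists>e. e \<in> I \<times> J \<rightarrow>\<^sub>E UNIV \<and> row_sums I J e = a \<and> col_sums I J e = b" by blast
  from someI_ex[OF this] show "margin_matrix I J a b \<in> I \<times> J \<rightarrow>\<^sub>E UNIV" "row_sums I J (margin_matrix I J a b) = a"
    "col_sums I J (margin_matrix I J a b) = b" unfolding margin_matrix_def by blast+
qed

lemma sum_eq_sum_margins:
  assumes "finite I" "finite J"
  shows "(\<Sum>x\<in>I \<times> J. e x) = (\<Sum>i\<in>I. row_sums I J e i)" "(\<Sum>x\<in>I \<times> J. e x) = (\<Sum>j\<in>J. col_sums I J e j)"
proof -
  have "(\<Sum>x\<in>I \<times> J. e x) = (\<Sum>i\<in>I. \<Sum>j\<in>J. e (i, j))" by (simp add: sum.cartesian_product)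
  then show "(\<Sum>x\<in>I \<times> J. e x) = (\<Sum>i\<in>I. row_sums I J e i)" by (simp add: row_sums_def)
  have "(\<Sum>x\<in>I \<times> J. e x) = (\<Sum>i\<in>I. \<Sum>j\<in>J. e (i, j))" by (simp add: sum.cartesian_product)
  also have "\<dots> = (\<Sum>j\<in>J. \<Sum>i\<in>I. e (i, j))" by (rule sum.swap)
  finally show "(\<Sum>x\<in>I \<times> J. e x) = (\<Sum>j\<in>J. col_sums I J e j)" by (simp add: col_sums_def)
qed

lemma margins_of_matrix:
  assumes "finite I" "finite J"
  shows "(row_sums I J e, col_sums I J e) \<in> margins I J"
  unfolding margins_def using sum_eq_sum_margins[OF assms, of e] by (simp add: row_sums_def col_sums_def)

text \<open>A matrix of total at most 1 is zero or a single unit, whose place is read off from the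
  margins. It is thus the only matrix with these margins, and every choice picks it; this yields
  condition \<open>small\<close> of the sieve.\<close>

lemma small_matrix_eq:
  assumes I: "finite I" and J: "finite J" and le: "(\<Sum>x\<in>I \<times> J. e x) \<le> (1::nat)" and ij: "i \<in> I" "j \<in> J"
  shows "e (i, j) = row_sums I J e i * col_sums I J e j"
proof (cases "(\<Sum>x\<in>I \<times> J. e x) = 0")
  case True
  then have "\<forall>x\<in>I \<times> J. e x = 0" using I J by auto
  then show ?thesis using ij by (simp add: row_sums_def)
next
  case False
  with le have "(\<Sum>x\<in>I \<times> J. e x) = 1" by linarith
  then obtain x0 where x0: "x0 \<in> I \<times> J" "e x0 = 1" "\<forall>x\<in>I \<times> J. x0 \<noteq> x \<longrightarrow> e x = 0"
    using I J by (subst (asm) sum_eq_1_iff) auto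
  obtain i0 j0 where [simp]: "x0 = (i0, j0)" by (cases x0)
  have e: "e (i', j') = of_bool (i' = i0) * of_bool (j' = j0)" if "i' \<in> I" "j' \<in> J" for i' j'
    using x0 that by (cases "(i', j') = (i0, j0)") auto
  have "row_sums I J e i = of_bool (i = i0)"
  proof -
    have "(\<Sum>j\<in>J. e (i, j)) = (\<Sum>j\<in>J. of_bool (i = i0) * of_bool (j = j0))" using ij e by (intro sum.cong) auto
    also have "\<dots> = of_bool (i = i0)"
      using J x0 unfolding sum_distrib_left[symmetric] by (simp add: of_bool_def sum.delta)
    finally show ?thesis using ij by (simp add: row_sums_def)
  qed
  moreover have "col_sums I J e j = of_bool (j = j0)"
  proof -
    have "(\<Sum>i\<in>I. e (i, j)) = (\<Sum>i\<in>I. of_bool (i = i0) * of_bool (j = j0))" using ij e by (intro sum.cong) auto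
    also have "\<dots> = of_bool (j = j0)"
      using I x0 unfolding sum_distrib_right[symmetric] by (simp add: of_bool_def sum.delta)
    finally show ?thesis using ij by (simp add: col_sums_def)
  qed
  ultimately show ?thesis using e[OF ij] by simp
qed

lemma chosen_matrices:
  assumes I: "finite I" and J: "finite J"
  shows "chosen_matrices I J \<subseteq> I \<times> J \<rightarrow>\<^sub>E UNIV"
    and "\<And>e. e \<in> chosen_matrices I J \<Longrightarrow> margin_matrix I J (row_sums I J e) (col_sums I J e) = e"
    and "\<And>e. e \<in> I \<times> J \<rightarrow>\<^sub>E UNIV \<Longrightarrow> (\<Sum>x\<in>I \<times> J. e x) \<le> 1 \<Longrightarrow> e \<in> chosen_matrices I J"
    and "bij_betw (\<lambda>e. (row_sums I J e, col_sums I J e)) (chosen_matrices I J) (margins I J)"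
proof -
  show 1: "chosen_matrices I J \<subseteq> I \<times> J \<rightarrow>\<^sub>E UNIV"
    using margin_matrix(1)[OF I J] by (auto simp: chosen_matrices_def)
  show 2: "margin_matrix I J (row_sums I J e) (col_sums I J e) = e" if "e \<in> chosen_matrices I J" for e
    using that margin_matrix(2,3)[OF I J] by (auto simp: chosen_matrices_def)
  show "e \<in> chosen_matrices I J" if e: "e \<in> I \<times> J \<rightarrow>\<^sub>E UNIV" "(\<Sum>x\<in>I \<times> J. e x) \<le> 1" for e
  proof -
    define f where "f = margin_matrix I J (row_sums I J e) (col_sums I J e)"
    note m = margin_matrix[OF I J margins_of_matrix[OF I J, of e], folded f_def]
    have fs: "(\<Sum>x\<in>I \<times> J. f x) \<le> 1"
      using e(2) unfolding sum_eq_sum_margins(1)[OF I J] m(2) .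
    have "f = e"
    proof (rule PiE_ext[OF m(1) e(1)])
      fix x assume "x \<in> I \<times> J"
      then obtain i j where x: "x = (i, j)" "i \<in> I" "j \<in> J" by auto
      show "f x = e x"
        using small_matrix_eq[OF I J fs x(2,3)] small_matrix_eq[OF I J e(2) x(2,3)] m x by simp
    qed
    moreover have "f \<in> chosen_matrices I J"
      unfolding f_def chosen_matrices_def using margins_of_matrix[OF I J, of e] by (intro image_eqI[of _ _ "(row_sums I J e, col_sums I J e)"]) auto
    ultimately show ?thesis by simp
  qed
  show "bij_betw (\<lambda>e. (row_sums I J e, col_sums I J e)) (chosen_matrices I J) (margins I J)"
    by (rule bij_betw_byWitness[where f' = "\<lambda>(a, b). margin_matrix I J a b"])
       (use 2 margin_matrix[OF I J] margins_of_matrix[OF I J] in \<open>auto simp: chosen_matrices_def\<close>)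
qed

text \<open>Stars and bars, by induction on the index set with \<open>sum_choose_lower\<close>. For
  \<open>card I = m\<close> the value is the quotient
  \<open>Gamma (r + m) / (Gamma (r + 1) * Gamma m)\<close> of the arithmetic factor.\<close>

lemma card_PiE_sum_eq:
  assumes "finite I" "I \<noteq> {}"
  shows "finite {a \<in> I \<rightarrow>\<^sub>E UNIV. (\<Sum>i\<in>I. a i) = r} \<and> card {a \<in> I \<rightarrow>\<^sub>E (UNIV :: nat set). (\<Sum>i\<in>I. a i) = r} = (r + card I - 1) choose r"
  using assms
proof (induction I arbitrary: r rule: finite_ne_induct)
  case (singleton x)
  have "{a \<in> {x} \<rightarrow>\<^sub>E UNIV. (\<Sum>i\<in>{x}. a i) = r} = {\<lambda>i\<in>{x}. r}"
    by (auto simp: PiE_iff extensional_def fun_eq_iff)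
  then show ?case by simp
next
  case (insert x I)
  let ?A = "\<lambda>I r. {a \<in> I \<rightarrow>\<^sub>E (UNIV :: nat set). (\<Sum>i\<in>I. a i) = r}"
  have eq: "?A (insert x I) r = (\<Union>s\<in>{..r}. (\<lambda>a. a(x := r - s)) ` ?A I s)"
  proof (intro equalityI subsetI)
    fix a assume a: "a \<in> ?A (insert x I) r"
    define b where "b = (\<lambda>i\<in>I. a i)"
    have sb: "(\<Sum>i\<in>I. b i) = (\<Sum>i\<in>I. a i)" by (simp add: b_def)
    have tot: "a x + (\<Sum>i\<in>I. a i) = r" using a insert.hyps by simp
    have "a = b(x := r - (\<Sum>i\<in>I. a i))"
    proof
      fix i show "a i = (b(x := r - (\<Sum>i\<in>I. a i))) i"
        using a tot by (cases "i = x") (auto simp: b_def PiE_iff extensional_def)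
    qed
    moreover have "b \<in> ?A I (\<Sum>i\<in>I. a i)" using sb by (auto simp: b_def)
    moreover have "(\<Sum>i\<in>I. a i) \<in> {..r}" using tot by simp
    ultimately show "a \<in> (\<Union>s\<in>{..r}. (\<lambda>a. a(x := r - s)) ` ?A I s)" by blast
  next
    fix a assume "a \<in> (\<Union>s\<in>{..r}. (\<lambda>a. a(x := r - s)) ` ?A I s)"
    then obtain s b where sb: "s \<le> r" "b \<in> ?A I s" "a = b(x := r - s)" by auto
    have "(\<Sum>i\<in>I. a i) = (\<Sum>i\<in>I. b i)" unfolding sb(3) using insert.hyps by (intro sum.cong) auto
    then show "a \<in> ?A (insert x I) r" using sb insert.hyps by (auto simp: PiE_iff extensional_def)
  qed
  have fin: "finite (?A I s)" and cd: "card (?A I s) = (s + card I - 1) choose s" for s using insert.IH[of s] by blast+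
  have inj: "inj_on (\<lambda>a. a(x := r - s)) (?A I s)" for s
  proof (rule inj_onI)
    fix a b assume ab: "a \<in> ?A I s" "b \<in> ?A I s" "a(x := r - s) = b(x := r - s)"
    show "a = b"
    proof
      fix i show "a i = b i"
        using ab insert.hyps by (cases "i = x") (auto simp: PiE_iff extensional_def dest: fun_cong[of _ _ i])
    qed
  qed
  have disj: "(\<lambda>a. a(x := r - s)) ` ?A I s \<inter> (\<lambda>a. a(x := r - s')) ` ?A I s' = {}" if "s \<le> r" "s' \<le> r" "s \<noteq> s'" for s s'
    using that by (auto simp: fun_upd_def fun_eq_iff) (metis diff_diff_cancel)
  have "card (?A (insert x I) r) = (\<Sum>s\<le>r. card ((\<lambda>a. a(x := r - s)) ` ?A I s))"
    unfolding eq using fin disj by (intro card_UN_disjoint) auto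
  also have "\<dots> = (\<Sum>s\<le>r. (s + card I - 1) choose s)" using inj cd by (simp add: card_image)
  also have "\<dots> = (\<Sum>s\<le>r. ((card I - 1) + s) choose s)"
    using insert.hyps by (intro sum.cong refl) (metis Nat.add_diff_assoc Suc_leI add.commute card_gt_0_iff One_nat_def)
  also have "\<dots> = Suc ((card I - 1) + r) choose r" by (rule sum_choose_lower)
  also have "Suc ((card I - 1) + r) = r + card (insert x I) - 1"
    using insert.hyps card_gt_0_iff[of I] by simp
  finally show ?case using fin eq by simp
qed

section \<open>Sieving by all primes\<close>

context prime_sieve
begin

lemma zero_in_R: "(\<lambda>x\<in>X. 0) \<in> R"
  by (rule small) auto

text \<open>One prime is treated at a time; since densities are at most 1, the errors made before
  are not enlarged by the next factor.\<close>

lemma sieved_sum_finite: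
  assumes Q: "finite Q" "\<forall>q\<in>Q. prime q" and B: "B \<ge> 0"
    and dil: "\<And>x d q. x \<in> X \<Longrightarrow> d \<in> positive_tuples X \<Longrightarrow> q \<ge> 1 \<Longrightarrow>
      (\<Sum>n=1..Y. norm (w (d(x := n * q)) - w (d(x := n))) / real n) \<le> B * (1 + ln (real q))"
    and bdd: "\<And>d. d \<in> positive_tuples X \<Longrightarrow> norm (w d) \<le> W"
    and supp: "\<And>d. d \<in> positive_tuples X \<Longrightarrow> d \<notin> grid X Y \<Longrightarrow> w d = 0"
  shows "norm (sieved_sum w Y Q - of_real (\<Prod>p\<in>Q. local_density X R p) * sieved_sum w Y {})
    \<le> 144 * (decay_constant (card X))\<^sup>2 * B * harmonic_sum Y ^ (card X - 1) * (\<Sum>p\<in>Q. real p powr (- 5 / 4))"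
  using Q
proof (induction Q rule: finite_induct)
  case empty then show ?case by simp
next
  case (insert p Q)
  let ?E = "144 * (decay_constant (card X))\<^sup>2 * B * harmonic_sum Y ^ (card X - 1)" and ?k = "local_density X R"
  have p: "prime p" using insert by simp
  note k = local_density_bounds[OF prime_ge_2_nat[OF p]]
  have E0: "?E \<ge> 0" using B harmonic_sum_nonneg[of Y] by simp
  have 1: "norm (sieved_sum w Y (insert p Q) - of_real (?k p) * sieved_sum w Y Q) \<le> ?E * real p powr (- 5 / 4)"
    by (rule sieved_sum_insert[OF p _ _ B dil bdd supp]) (use insert in auto)
  have 2: "norm (sieved_sum w Y Q - of_real (\<Prod>p\<in>Q. ?k p) * sieved_sum w Y {}) \<le> ?E * (\<Sum>p\<in>Q. real p powr (- 5 / 4))"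
    using insert by simp
  have "norm (of_real (?k p) * (sieved_sum w Y Q - of_real (\<Prod>p\<in>Q. ?k p) * sieved_sum w Y {})) \<le> 1 * (?E * (\<Sum>p\<in>Q. real p powr (- 5 / 4)))"
    unfolding norm_mult using k 2 by (intro mult_mono) auto
  then have "norm ((sieved_sum w Y (insert p Q) - of_real (?k p) * sieved_sum w Y Q) + of_real (?k p) * (sieved_sum w Y Q - of_real (\<Prod>p\<in>Q. ?k p) * sieved_sum w Y {}))
     \<le> ?E * real p powr (- 5 / 4) + ?E * (\<Sum>p\<in>Q. real p powr (- 5 / 4))"
    using 1 by (intro norm_triangle_le) simp
  moreover have "(sieved_sum w Y (insert p Q) - of_real (?k p) * sieved_sum w Y Q) + of_real (?k p) * (sieved_sum w Y Q - of_real (\<Prod>p\<in>Q. ?k p) * sieved_sum w Y {})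
     = sieved_sum w Y (insert p Q) - of_real (\<Prod>p\<in>insert p Q. ?k p) * sieved_sum w Y {}"
    using insert.hyps by (simp add: algebra_simps)
  moreover have "?E * real p powr (- 5 / 4) + ?E * (\<Sum>p\<in>Q. real p powr (- 5 / 4)) = ?E * (\<Sum>p\<in>insert p Q. real p powr (- 5 / 4))"
    using insert.hyps by (simp add: distrib_left)
  ultimately show ?case by (simp only:)
qed

lemma summable_powr_five_quarters: "summable (\<lambda>n. real n powr (- 5 / 4))"
  by (subst summable_real_powr_iff) simp

text \<open>Extended by 1 off the primes, to match the infinite product in
  \<open>arith_factor\<close>.\<close>

definition density_factor :: "nat \<Rightarrow> real" where
  "density_factor p = (if prime p then local_density X R p else 1)"

lemma density_factor_LIMSEQ: "(\<lambda>n. \<Prod>p\<le>n. density_factor p) \<longlonglongrightarrow> (\<Prod>p. density_factor p)"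
proof -
  have "summable (\<lambda>p. norm (density_factor p - 1))"
  proof (rule summable_comparison_test)
    show "summable (\<lambda>n. 12 * decay_constant (card X) * real n powr (- 5 / 4))"
      by (intro summable_mult summable_powr_five_quarters)
    show "\<exists>N. \<forall>n\<ge>N. norm (norm (density_factor n - 1)) \<le> 12 * decay_constant (card X) * real n powr (- 5 / 4)"
    proof (intro exI[of _ 0] allI impI)
      fix n :: nat
      show "norm (norm (density_factor n - 1)) \<le> 12 * decay_constant (card X) * real n powr (- 5 / 4)"
      proof (cases "prime n")
        case True
        note k = local_density_bounds[OF prime_ge_2_nat[OF True]]
        have "norm (norm (density_factor n - 1)) = 1 - local_density X R n"
          using True k by (simp add: density_factor_def)
        then show ?thesis using k by simp
      qed (use decay_constant_ge_1[of "card X"] in \<open>simp add: density_factor_def\<close>)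
    qed
  qed
  then have "convergent_prod density_factor"
    by (intro abs_convergent_prod_imp_convergent_prod) (simp add: abs_convergent_prod_conv_summable)
  then show ?thesis by (rule convergent_prod_LIMSEQ)
qed

text \<open>Primes above \<open>Y\<close> impose nothing on tuples in the grid, so the sieved sum is
  constant from \<open>Y\<close> on while the product of the densities converges. The error stays
  bounded because \<open>p powr (- 5 / 4)\<close> is summable.\<close>

lemma sieved_sum_primes:
  assumes B: "B \<ge> 0"
    and dil: "\<And>x d q. x \<in> X \<Longrightarrow> d \<in> positive_tuples X \<Longrightarrow> q \<ge> 1 \<Longrightarrow>
      (\<Sum>n=1..Y. norm (w (d(x := n * q)) - w (d(x := n))) / real n) \<le> B * (1 + ln (real q))"
    and bdd: "\<And>d. d \<in> positive_tuples X \<Longrightarrow> norm (w d) \<le> W"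
    and supp: "\<And>d. d \<in> positive_tuples X \<Longrightarrow> d \<notin> grid X Y \<Longrightarrow> w d = 0"
  shows "norm (sieved_sum w Y {p. prime p} - of_real (\<Prod>p. density_factor p) * sieved_sum w Y {})
    \<le> 144 * (decay_constant (card X))\<^sup>2 * B * harmonic_sum Y ^ (card X - 1) * (\<Sum>n. real n powr (- 5 / 4))"
proof -
  let ?E = "144 * (decay_constant (card X))\<^sup>2 * B * harmonic_sum Y ^ (card X - 1)"
  have E0: "?E \<ge> 0" using B harmonic_sum_nonneg[of Y] by simp
  define P where "P = (\<lambda>n. {p :: nat. prime p \<and> p \<le> n})"
  have eq: "sieved_sum w Y (P n) = sieved_sum w Y {p. prime p}" if n: "n \<ge> Y" for n
    unfolding sieved_sum_def
  proof (intro sum.cong refl)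
    fix d assume d: "d \<in> grid X Y"
    have "prime_vector X q d \<in> R" if q: "prime q" "q > n" for q
    proof -
      have "multiplicity q (d x) = 0" if "x \<in> X" for x
      proof -
        have "d x \<ge> 1" "d x \<le> Y" using d that by (auto simp: PiE_iff)
        then have "\<not> q dvd d x" using q n by (auto dest!: dvd_imp_le)
        then show ?thesis by (rule not_dvd_imp_multiplicity_0)
      qed
      then have "prime_vector X q d = (\<lambda>x\<in>X. 0)" by (auto simp: prime_vector_def fun_eq_iff)
      then show ?thesis using zero_in_R by simp
    qed
    then have "(\<forall>q\<in>P n. prime_vector X q d \<in> R) = (\<forall>q\<in>{p. prime p}. prime_vector X q d \<in> R)"
      proof (intro iffI ballI)
      fix q :: nat assume a: "\<forall>q\<in>P n. prime_vector X q d \<in> R" and q: "q \<in> {p. prime p}"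
      show "prime_vector X q d \<in> R"
      proof (cases "q \<le> n")
        case True
        then show ?thesis using a q by (simp add: P_def)
      next
        case False
        then show ?thesis using q \<open>\<And>q. prime q \<Longrightarrow> q > n \<Longrightarrow> prime_vector X q d \<in> R\<close> by simp
      qed
    qed (simp add: P_def)
    then show "of_bool (\<forall>q\<in>P n. prime_vector X q d \<in> R) * w d / of_real (\<Prod>x\<in>X. real (d x)) =
       of_bool (\<forall>q\<in>{p. prime p}. prime_vector X q d \<in> R) * w d / of_real (\<Prod>x\<in>X. real (d x))" by simp
  qed
  have fP: "finite (P n)" for n by (rule finite_subset[of _ "{..n}"]) (auto simp: P_def)
  have pr: "(\<Prod>p\<in>P n. local_density X R p) = (\<Prod>p\<le>n. density_factor p)" for n
    by (rule prod.mono_neutral_cong_left) (auto simp: P_def density_factor_def)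
  have bd: "norm (sieved_sum w Y {p. prime p} - of_real (\<Prod>p\<le>n. density_factor p) * sieved_sum w Y {}) \<le> ?E * (\<Sum>n. real n powr (- 5 / 4))"
    if n: "n \<ge> Y" for n
  proof -
    have "norm (sieved_sum w Y (P n) - of_real (\<Prod>p\<in>P n. local_density X R p) * sieved_sum w Y {}) \<le> ?E * (\<Sum>p\<in>P n. real p powr (- 5 / 4))"
      by (rule sieved_sum_finite[OF fP _ B dil bdd supp]) (auto simp: P_def)
    also have "\<dots> \<le> ?E * (\<Sum>n. real n powr (- 5 / 4))"
      using E0 by (intro mult_left_mono sum_le_suminf summable_powr_five_quarters fP) auto
    finally show ?thesis unfolding eq[OF n] pr .
  qed
  have "(\<lambda>n. norm (sieved_sum w Y {p. prime p} - of_real (\<Prod>p\<le>n. density_factor p) * sieved_sum w Y {}))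
     \<longlonglongrightarrow> norm (sieved_sum w Y {p. prime p} - of_real (\<Prod>p. density_factor p) * sieved_sum w Y {})"
    by (intro tendsto_intros density_factor_LIMSEQ)
  then show ?thesis
    by (rule tendsto_upperbound) (use bd in \<open>auto simp: eventually_sequentially\<close>)
qed

end

section \<open>The arithmetic factor as a product of local densities\<close>

lemma prime_sieve_chosen:
  assumes "finite I" "finite J"
  shows "prime_sieve (I \<times> J) (chosen_matrices I J)"
proof
  show "finite (I \<times> J)" using assms by simp
  show "chosen_matrices I J \<subseteq> I \<times> J \<rightarrow>\<^sub>E UNIV" by (rule chosen_matrices(1)[OF assms])
  show "e \<in> chosen_matrices I J" if "e \<in> I \<times> J \<rightarrow>\<^sub>E UNIV" "(\<Sum>x\<in>I \<times> J. e x) \<le> 1" for e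
    using that by (rule chosen_matrices(3)[OF assms])
qed

text \<open>Chosen matrices correspond to pairs of margins with a common total \<open>r\<close>.
  Either margin can be picked in \<open>(r + m - 1) choose r\<close> ways, which produces the
  square.\<close>

lemma infsum_weight_chosen:
  assumes I: "finite I" "I \<noteq> {}" and J: "finite J" "J \<noteq> {}" and card: "card I = m" "card J = m"
    and q: "0 \<le> q" "q < 1"
  shows "infsum (weight (I \<times> J) q) (chosen_matrices I J) = (\<Sum>r. (real ((r + m - 1) choose r))\<^sup>2 * q ^ r)"
proof -
  let ?A = "\<lambda>I r. {a \<in> I \<rightarrow>\<^sub>E (UNIV :: nat set). (\<Sum>i\<in>I. a i) = r}"
  let ?S = "Sigma (UNIV :: nat set) (\<lambda>r. ?A I r \<times> ?A J r)"
  have bij1: "bij_betw (\<lambda>e. (row_sums I J e, col_sums I J e)) (chosen_matrices I J) (margins I J)"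
    by (rule chosen_matrices(4)[OF I(1) J(1)])
  have bij2: "bij_betw (\<lambda>(a, b). (\<Sum>i\<in>I. a i, a, b)) (margins I J) ?S"
    by (rule bij_betw_byWitness[where f' = snd]) (auto simp: margins_def)
  have bij: "bij_betw ((\<lambda>(a, b). (\<Sum>i\<in>I. a i, a, b)) \<circ> (\<lambda>e. (row_sums I J e, col_sums I J e))) (chosen_matrices I J) ?S"
    by (rule bij_betw_trans[OF bij1 bij2])
  define F where "F = (\<lambda>(r, ab :: ('a \<Rightarrow> nat) \<times> ('b \<Rightarrow> nat)). q ^ r)"
  have w: "weight (I \<times> J) q e = F (((\<lambda>(a, b). (\<Sum>i\<in>I. a i, a, b)) \<circ> (\<lambda>e. (row_sums I J e, col_sums I J e))) e)" for e
    by (simp add: F_def weight_eq_power sum_eq_sum_margins(1)[OF I(1) J(1)])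
  have s: "weight (I \<times> J) q summable_on chosen_matrices I J"
    by (rule summable_on_subset_banach[OF infsum_weight(1)[of "I \<times> J"]]) (use I J q chosen_matrices(1)[OF I(1) J(1)] in auto)
  have sF: "F summable_on ?S"
    using s unfolding w[abs_def] by (simp only: summable_on_reindex_bij_betw[OF bij])
  have fin: "finite (?A I r)" "card (?A I r) = (r + m - 1) choose r" for r
    using card_PiE_sum_eq[OF I, of r] card by auto
  have finJ: "finite (?A J r)" "card (?A J r) = (r + m - 1) choose r" for r
    using card_PiE_sum_eq[OF J, of r] card by auto
  have "infsum (weight (I \<times> J) q) (chosen_matrices I J) = infsum F ?S"
    unfolding w[abs_def] by (rule infsum_reindex_bij_betw[OF bij])
  also have "\<dots> = infsum (\<lambda>r. infsum (\<lambda>ab. F (r, ab)) (?A I r \<times> ?A J r)) UNIV"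
    by (rule infsum_Sigma_banach[OF sF, symmetric])
  also have "(\<lambda>r. infsum (\<lambda>ab. F (r, ab)) (?A I r \<times> ?A J r)) = (\<lambda>r. (real ((r + m - 1) choose r))\<^sup>2 * q ^ r)"
  proof
    fix r
    have "infsum (\<lambda>ab. F (r, ab)) (?A I r \<times> ?A J r) = real (card (?A I r \<times> ?A J r)) * q ^ r"
      using fin(1)[of r] finJ(1)[of r] by (simp add: F_def)
    then show "infsum (\<lambda>ab. F (r, ab)) (?A I r \<times> ?A J r) = (real ((r + m - 1) choose r))\<^sup>2 * q ^ r"
      using fin(2)[of r] finJ(2)[of r] by (simp add: card_cartesian_product power2_eq_square)
  qed
  also have "infsum (\<lambda>r. (real ((r + m - 1) choose r))\<^sup>2 * q ^ r) UNIV = (\<Sum>r. (real ((r + m - 1) choose r))\<^sup>2 * q ^ r)"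
  proof -
    have "(\<lambda>r. infsum (\<lambda>ab. F (r, ab)) (?A I r \<times> ?A J r)) summable_on UNIV"
      by (rule summable_on_Sigma_banach[where f = "\<lambda>r ab. F (r, ab)"]) (use sF in \<open>simp add: case_prod_unfold\<close>)
    moreover have "(\<lambda>r. infsum (\<lambda>ab. F (r, ab)) (?A I r \<times> ?A J r)) = (\<lambda>r. (real ((r + m - 1) choose r))\<^sup>2 * q ^ r)"
    proof
      fix r
      have "infsum (\<lambda>ab. F (r, ab)) (?A I r \<times> ?A J r) = real (card (?A I r \<times> ?A J r)) * q ^ r"
        using fin(1)[of r] finJ(1)[of r] by (simp add: F_def)
      then show "infsum (\<lambda>ab. F (r, ab)) (?A I r \<times> ?A J r) = (real ((r + m - 1) choose r))\<^sup>2 * q ^ r"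
        using fin(2)[of r] finJ(2)[of r] by (simp add: card_cartesian_product power2_eq_square)
    qed
    ultimately have "(\<lambda>r. (real ((r + m - 1) choose r))\<^sup>2 * q ^ r) summable_on UNIV" by simp
    from has_sum_imp_sums[OF has_sum_infsum[OF this]] show ?thesis by (rule sums_unique)
  qed
  finally show ?thesis .
qed

text \<open>The exponent \<open>m * m\<close> in the Euler factor is the number of matrix entries,
  and the series there is the weight of the chosen matrices.\<close>

lemma arith_factor_eq_density:
  assumes I: "finite I" "I \<noteq> {}" and J: "finite J" "J \<noteq> {}" and card: "card I = m" "card J = m"
  shows "arith_factor m = (\<Prod>p. prime_sieve.density_factor (I \<times> J) (chosen_matrices I J) p)"
proof -
  interpret prime_sieve "I \<times> J" "chosen_matrices I J" by (rule prime_sieve_chosen[OF I(1) J(1)])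
  have m: "m \<ge> 1" using I card card_gt_0_iff[of I] by auto
  have "(if prime p then (1 - 1 / real p) ^ (m\<^sup>2) *
          (\<Sum>r. (Gamma (real r + real m) / (Gamma (real r + 1) * Gamma (real m)))\<^sup>2 * real p powi (- int r)) else 1) = density_factor p" for p
  proof (cases "prime p")
    case True
    then have p2: "p \<ge> 2" by (rule prime_ge_2_nat)
    have G: "Gamma (real n + 1) = fact n" for n using Gamma_fact[of n, where 'a = real] by (simp add: add.commute)
    have "Gamma (real r + real m) / (Gamma (real r + 1) * Gamma (real m)) = real ((r + m - 1) choose r)" for r
    proof -
      have "real r + real m = real (r + m - 1) + 1" "real m = real (m - 1) + 1" using m by (auto simp: of_nat_diff)
      then have "Gamma (real r + real m) / (Gamma (real r + 1) * Gamma (real m)) = fact (r + m - 1) / (fact r * fact (m - 1))"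
        by (metis G)
      also have "\<dots> = real ((r + m - 1) choose r)" using m by (subst binomial_fact) auto
      finally show ?thesis .
    qed
    moreover have "real p powi (- int r) = (1 / real p) ^ r" for r
      by (simp add: power_int_minus power_one_over inverse_eq_divide)
    moreover have "card (I \<times> J) = m\<^sup>2" using card by (simp add: card_cartesian_product power2_eq_square)
    ultimately show ?thesis
      using True p2 infsum_weight_chosen[OF I J card, of "1 / real p"]
      by (simp add: density_factor_def local_density_def)
  qed (simp add: density_factor_def)
  then show ?thesis unfolding arith_factor_def by presburger
qed

section \<open>Factoring pairs of tuples through a matrix\<close>

definition row_products :: "'i set \<Rightarrow> 'j set \<Rightarrow> ('i \<times> 'j \<Rightarrow> nat) \<Rightarrow> 'i \<Rightarrow> nat" where
  "row_products I J d = (\<lambda>i\<in>I. \<Prod>j\<in>J. d (i, j))"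

definition col_products :: "'i set \<Rightarrow> 'j set \<Rightarrow> ('i \<times> 'j \<Rightarrow> nat) \<Rightarrow> 'j \<Rightarrow> nat" where
  "col_products I J d = (\<lambda>j\<in>J. \<Prod>i\<in>I. d (i, j))"

lemma prime_vector_margins:
  assumes I: "finite I" and J: "finite J" and p: "prime p" and d: "d \<in> positive_tuples (I \<times> J)"
  shows "row_sums I J (prime_vector (I \<times> J) p d) = prime_vector I p (row_products I J d)"
    "col_sums I J (prime_vector (I \<times> J) p d) = prime_vector J p (col_products I J d)"
proof -
  have d0: "d (i, j) \<noteq> 0" if "i \<in> I" "j \<in> J" for i j using d that by (force simp: PiE_iff)
  show "row_sums I J (prime_vector (I \<times> J) p d) = prime_vector I p (row_products I J d)"
  proof
    fix i show "row_sums I J (prime_vector (I \<times> J) p d) i = prime_vector I p (row_products I J d) i"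
    proof (cases "i \<in> I")
      case True
      have "0 \<notin> (\<lambda>j. d (i, j)) ` J" using d0[OF True] by (metis imageE)
      then have "multiplicity p (\<Prod>j\<in>J. d (i, j)) = (\<Sum>j\<in>J. multiplicity p (d (i, j)))"
        using p J by (intro prime_elem_multiplicity_prod_distrib) auto
      then show ?thesis using True by (simp add: row_sums_def prime_vector_def row_products_def)
    qed (simp add: row_sums_def prime_vector_def)
  qed
  show "col_sums I J (prime_vector (I \<times> J) p d) = prime_vector J p (col_products I J d)"
  proof
    fix j show "col_sums I J (prime_vector (I \<times> J) p d) j = prime_vector J p (col_products I J d) j"
    proof (cases "j \<in> J")
      case True
      have "0 \<notin> (\<lambda>i. d (i, j)) ` I" 
      proof
        assume "0 \<in> (\<lambda>i. d (i, j)) ` I"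
        then obtain i where "i \<in> I" "d (i, j) = 0" by force
        then show False using d0[of i j] True by blast
      qed
      then have "multiplicity p (\<Prod>i\<in>I. d (i, j)) = (\<Sum>i\<in>I. multiplicity p (d (i, j)))"
        using p I by (intro prime_elem_multiplicity_prod_distrib) auto
      then show ?thesis using True by (simp add: col_sums_def prime_vector_def col_products_def)
    qed (simp add: col_sums_def prime_vector_def)
  qed
qed

lemma positive_tuples_eqI:
  assumes "d \<in> positive_tuples X" "d' \<in> positive_tuples X" "\<And>p. prime p \<Longrightarrow> prime_vector X p d = prime_vector X p d'"
  shows "d = d'"
proof (rule PiE_ext[OF assms(1,2)])
  fix x assume x: "x \<in> X"
  have "d x > 0" "d' x > 0" using assms(1,2) x by (force simp: PiE_iff)+
  then show "d x = d' x"
  proof (rule multiplicity_eq_nat)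
    fix p :: nat assume "prime p"
    from fun_cong[OF assms(3)[OF this], of x] show "multiplicity p (d x) = multiplicity p (d' x)" using x by (simp add: prime_vector_def)
  qed
qed

text \<open>The inverse of taking row and column products, assembled prime by prime from margin
  matrices. The primes of the common product suffice: at any other prime all margins are 0, hence
  all entries.\<close>

definition matrix_of_products :: "'i set \<Rightarrow> 'j set \<Rightarrow> ('i \<Rightarrow> nat) \<Rightarrow> ('j \<Rightarrow> nat) \<Rightarrow> 'i \<times> 'j \<Rightarrow> nat" where
  "matrix_of_products I J m n = (\<lambda>x\<in>I \<times> J. \<Prod>p\<in>prime_factors (\<Prod>i\<in>I. m i).
     p ^ margin_matrix I J (prime_vector I p m) (prime_vector J p n) x)"

lemma matrix_of_products:
  assumes I: "finite I" and J: "finite J" and m: "m \<in> positive_tuples I" and n: "n \<in> positive_tuples J"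
    and eq: "(\<Prod>i\<in>I. m i) = (\<Prod>j\<in>J. n j)"
  shows "matrix_of_products I J m n \<in> positive_tuples (I \<times> J)"
    "prime p \<Longrightarrow> prime_vector (I \<times> J) p (matrix_of_products I J m n) \<in> chosen_matrices I J"
    "row_products I J (matrix_of_products I J m n) = m" "col_products I J (matrix_of_products I J m n) = n"
proof -
  let ?D = "matrix_of_products I J m n" and ?N = "\<Prod>i\<in>I. m i"
  have m0: "m i \<noteq> 0" if "i \<in> I" for i using m that by (force simp: PiE_iff)
  have n0: "n j \<noteq> 0" if "j \<in> J" for j using n that by (force simp: PiE_iff)
  have N0: "?N \<noteq> 0" using m0 I by simp
  have mar: "(prime_vector I p m, prime_vector J p n) \<in> margins I J" if p: "prime p" for p
  proof -
    have z: "0 \<notin> m ` I" "0 \<notin> n ` J" using m0 n0 by (metis imageE)+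
    have "(\<Sum>i\<in>I. multiplicity p (m i)) = multiplicity p ?N"
      using p z I by (intro prime_elem_multiplicity_prod_distrib[symmetric]) auto
    moreover have "(\<Sum>j\<in>J. multiplicity p (n j)) = multiplicity p (\<Prod>j\<in>J. n j)"
      using p z J by (intro prime_elem_multiplicity_prod_distrib[symmetric]) auto
    ultimately show ?thesis unfolding eq by (simp add: margins_def prime_vector_def)
  qed
  show pos: "?D \<in> positive_tuples (I \<times> J)"
  proof (rule PiE_I)
    fix x assume x: "x \<in> I \<times> J"
    have "(\<Prod>p\<in>prime_factors ?N. p ^ margin_matrix I J (prime_vector I p m) (prime_vector J p n) x) > 0"
      by (intro prod_pos) (auto dest: in_prime_factors_imp_prime simp: prime_gt_0_nat)
    moreover have "?D x = (\<Prod>p\<in>prime_factors ?N. p ^ margin_matrix I J (prime_vector I p m) (prime_vector J p n) x)"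
      using x by (simp only: matrix_of_products_def restrict_apply if_True)
    ultimately have "?D x > 0" by (simp only:)
    then show "?D x \<in> {1..}" by simp
  qed (simp add: matrix_of_products_def)
  have pv: "prime_vector (I \<times> J) p ?D = margin_matrix I J (prime_vector I p m) (prime_vector J p n)" if p: "prime p" for p
  proof (rule PiE_ext[of _ "I \<times> J" "\<lambda>_. UNIV" _ ])
    show "prime_vector (I \<times> J) p ?D \<in> I \<times> J \<rightarrow>\<^sub>E UNIV" by (simp add: prime_vector_def)
    show mm: "margin_matrix I J (prime_vector I p m) (prime_vector J p n) \<in> I \<times> J \<rightarrow>\<^sub>E UNIV"
      by (rule margin_matrix(1)[OF I J mar[OF p]])
    fix x assume x: "x \<in> I \<times> J"
    then obtain i j where ij: "x = (i, j)" "i \<in> I" "j \<in> J" by auto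
    have "prime_vector (I \<times> J) p ?D x = (if p \<in> prime_factors ?N then margin_matrix I J (prime_vector I p m) (prime_vector J p n) x else 0)"
    proof -
      have "multiplicity p (\<Prod>q\<in>prime_factors ?N. q ^ margin_matrix I J (prime_vector I q m) (prime_vector J q n) x)
        = (if p \<in> prime_factors ?N then margin_matrix I J (prime_vector I p m) (prime_vector J p n) x else 0)"
        by (rule multiplicity_prod_prime_powers) (use p in auto)
      then show ?thesis using x by (simp only: prime_vector_def matrix_of_products_def restrict_apply if_True)
    qed
    also have "\<dots> = margin_matrix I J (prime_vector I p m) (prime_vector J p n) x"
    proof (cases "p \<in> prime_factors ?N")
      case False
      then have "\<not> p dvd ?N" using p N0 by (simp add: prime_factors_dvd)
      then have "\<not> p dvd m i" using ij I by (meson dvd_prodI dvd_trans)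
      then have "prime_vector I p m i = 0" using ij by (simp add: prime_vector_def not_dvd_imp_multiplicity_0)
      then have "row_sums I J (margin_matrix I J (prime_vector I p m) (prime_vector J p n)) i = 0"
        using margin_matrix(2)[OF I J mar[OF p]] by simp
      then show ?thesis using ij J False by (simp add: row_sums_def)
    qed simp
    finally show "prime_vector (I \<times> J) p ?D x = margin_matrix I J (prime_vector I p m) (prime_vector J p n) x" .
  qed
  show "prime_vector (I \<times> J) p ?D \<in> chosen_matrices I J" if p: "prime p"
    unfolding pv[OF p] chosen_matrices_def using mar[OF p] by force
  have rp: "row_products I J ?D \<in> positive_tuples I" "col_products I J ?D \<in> positive_tuples J"
    using pos by (auto simp: row_products_def col_products_def PiE_iff Suc_le_eq intro!: prod_pos)
  show "row_products I J ?D = m"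
    by (rule positive_tuples_eqI[OF rp(1) m])
       (simp add: prime_vector_margins(1)[OF I J _ pos, symmetric] pv margin_matrix(2)[OF I J mar])
  show "col_products I J ?D = n"
    by (rule positive_tuples_eqI[OF rp(2) n])
       (simp add: prime_vector_margins(2)[OF I J _ pos, symmetric] pv margin_matrix(3)[OF I J mar])
qed

lemma prod_row_products:
  assumes "finite I" "finite J"
  shows "(\<Prod>x\<in>I \<times> J. d x) = (\<Prod>i\<in>I. row_products I J d i)" "(\<Prod>x\<in>I \<times> J. d x) = (\<Prod>j\<in>J. col_products I J d j)"
proof -
  have 1: "(\<Prod>x\<in>I \<times> J. d x) = (\<Prod>i\<in>I. \<Prod>j\<in>J. d (i, j))" by (simp add: prod.cartesian_product)
  then show "(\<Prod>x\<in>I \<times> J. d x) = (\<Prod>i\<in>I. row_products I J d i)" by (simp add: row_products_def)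
  show "(\<Prod>x\<in>I \<times> J. d x) = (\<Prod>j\<in>J. col_products I J d j)"
    unfolding 1 by (subst prod.swap) (simp add: col_products_def)
qed

text \<open>Unique factorization: a matrix is determined by its exponent matrices, and a chosen
  exponent matrix by its margins, which are the exponents of the row and column products.\<close>

lemma bij_betw_products:
  assumes I: "finite I" and J: "finite J"
  shows "bij_betw (\<lambda>d. (row_products I J d, col_products I J d))
    {d \<in> positive_tuples (I \<times> J). \<forall>p\<in>{p. prime p}. prime_vector (I \<times> J) p d \<in> chosen_matrices I J}
    {(m, n). m \<in> positive_tuples I \<and> n \<in> positive_tuples J \<and> (\<Prod>i\<in>I. m i) = (\<Prod>j\<in>J. n j)}"
proof (rule bij_betw_byWitness[where f' = "\<lambda>(m, n). matrix_of_products I J m n"])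
  show "\<forall>d\<in>{d \<in> positive_tuples (I \<times> J). \<forall>p\<in>{p. prime p}. prime_vector (I \<times> J) p d \<in> chosen_matrices I J}.
    (case (row_products I J d, col_products I J d) of (m, n) \<Rightarrow> matrix_of_products I J m n) = d"
  proof (intro ballI)
    fix d assume d: "d \<in> {d \<in> positive_tuples (I \<times> J). \<forall>p\<in>{p. prime p}. prime_vector (I \<times> J) p d \<in> chosen_matrices I J}"
    then have dp: "d \<in> positive_tuples (I \<times> J)" by simp
    have rp: "row_products I J d \<in> positive_tuples I" "col_products I J d \<in> positive_tuples J"
      using dp by (auto simp: row_products_def col_products_def PiE_iff Suc_le_eq intro!: prod_pos)
    have eq: "(\<Prod>i\<in>I. row_products I J d i) = (\<Prod>j\<in>J. col_products I J d j)"
      using prod_row_products[OF I J, of d] by simp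
    note M = matrix_of_products[OF I J rp eq]
    have "matrix_of_products I J (row_products I J d) (col_products I J d) = d"
    proof (rule positive_tuples_eqI[OF M(1) dp])
      fix p :: nat assume p: "prime p"
      have "prime_vector (I \<times> J) p d \<in> chosen_matrices I J" using d p by simp
      from chosen_matrices(2)[OF I J this] chosen_matrices(2)[OF I J M(2)[OF p]]
      show "prime_vector (I \<times> J) p (matrix_of_products I J (row_products I J d) (col_products I J d)) = prime_vector (I \<times> J) p d"
        unfolding prime_vector_margins[OF I J p dp] prime_vector_margins[OF I J p M(1)] M(3,4) by simp
    qed
    then show "(case (row_products I J d, col_products I J d) of (m, n) \<Rightarrow> matrix_of_products I J m n) = d" by simp
  qed
  show "\<forall>a\<in>{(m, n). m \<in> positive_tuples I \<and> n \<in> positive_tuples J \<and> (\<Prod>i\<in>I. m i) = (\<Prod>j\<in>J. n j)}.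
     (\<lambda>d. (row_products I J d, col_products I J d)) (case a of (m, n) \<Rightarrow> matrix_of_products I J m n) = a"
    using matrix_of_products(3,4)[OF I J] by auto
  show "(\<lambda>d. (row_products I J d, col_products I J d)) ` {d \<in> positive_tuples (I \<times> J). \<forall>p\<in>{p. prime p}. prime_vector (I \<times> J) p d \<in> chosen_matrices I J}
     \<subseteq> {(m, n). m \<in> positive_tuples I \<and> n \<in> positive_tuples J \<and> (\<Prod>i\<in>I. m i) = (\<Prod>j\<in>J. n j)}"
  proof (rule image_subsetI)
    fix d assume "d \<in> {d \<in> positive_tuples (I \<times> J). \<forall>p\<in>{p. prime p}. prime_vector (I \<times> J) p d \<in> chosen_matrices I J}"
    then have "row_products I J d \<in> positive_tuples I" "col_products I J d \<in> positive_tuples J"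
      by (auto simp: row_products_def col_products_def PiE_iff Suc_le_eq intro!: prod_pos)
    then show "(row_products I J d, col_products I J d) \<in> {(m, n). m \<in> positive_tuples I \<and> n \<in> positive_tuples J \<and> (\<Prod>i\<in>I. m i) = (\<Prod>j\<in>J. n j)}"
      using prod_row_products[OF I J, of d] by simp
  qed
  show "(\<lambda>(m, n). matrix_of_products I J m n) ` {(m, n). m \<in> positive_tuples I \<and> n \<in> positive_tuples J \<and> (\<Prod>i\<in>I. m i) = (\<Prod>j\<in>J. n j)}
    \<subseteq> {d \<in> positive_tuples (I \<times> J). \<forall>p\<in>{p. prime p}. prime_vector (I \<times> J) p d \<in> chosen_matrices I J}"
    using matrix_of_products(1,2)[OF I J] by auto
qed

section \<open>Pairs of tuples with equal products\<close>

text \<open>The summand in logarithmic coordinates: for \<open>u = ln d / L\<close> the row and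
  column products of \<open>d\<close> become row and column sums.\<close>

definition matrix_weight :: "'i set \<Rightarrow> 'j set \<Rightarrow> ('i \<Rightarrow> real \<Rightarrow> complex) \<Rightarrow> ('j \<Rightarrow> real \<Rightarrow> complex) \<Rightarrow> ('i \<times> 'j \<Rightarrow> real) \<Rightarrow> complex" where
  "matrix_weight I J f g u = (\<Prod>i\<in>I. f i (\<Sum>j\<in>J. u (i, j))) * (\<Prod>j\<in>J. g j (\<Sum>i\<in>I. u (i, j)))"

lemma matrix_weight_measurable:
  assumes "finite I" "finite J" "\<And>i. i \<in> I \<Longrightarrow> f i \<in> borel_measurable borel" "\<And>j. j \<in> J \<Longrightarrow> g j \<in> borel_measurable borel"
  shows "matrix_weight I J f g \<in> borel_measurable (Pi\<^sub>M (I \<times> J) (\<lambda>_. lborel))"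
proof -
  have c: "(\<lambda>u. u x) \<in> borel_measurable (Pi\<^sub>M (I \<times> J) (\<lambda>_. lborel :: real measure))" if "x \<in> I \<times> J" for x
    using measurable_component_singleton[OF that, of "\<lambda>_. lborel :: real measure"] by simp
  show ?thesis
    unfolding matrix_weight_def[abs_def]
    by (intro borel_measurable_times borel_measurable_prod measurable_compose[OF borel_measurable_sum assms(3)]
        measurable_compose[OF borel_measurable_sum assms(4)] c) auto
qed

lemma norm_prod_le_power:
  fixes F :: "'a \<Rightarrow> complex"
  assumes "C \<ge> 1" "finite A" "\<And>x. x \<in> A \<Longrightarrow> norm (F x) \<le> C" "card A \<le> n"
  shows "norm (\<Prod>x\<in>A. F x) \<le> C ^ n"
proof -
  have "norm (\<Prod>x\<in>A. F x) \<le> (\<Prod>x\<in>A. C)" unfolding prod_norm[symmetric] using assms by (intro prod_mono) auto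
  also have "\<dots> \<le> C ^ n" using assms by (simp add: power_increasing)
  finally show ?thesis .
qed

text \<open>A single entry occurs in one row sum and one column sum, so the slice is a constant
  times a product of two shifted cut functions. The row function is cut at 1 and shifting only
  lowers the cut, whence \<open>U <= 1\<close> whatever the column cuts \<open>V\<close>
  are.\<close>

lemma matrix_weight_slice:
  assumes I: "finite I" and J: "finite J" and C: "C \<ge> 1"
    and f: "\<And>i. i \<in> I \<Longrightarrow> cut_lipschitz C 1 (f i)" and g: "\<And>j. j \<in> J \<Longrightarrow> cut_lipschitz C (V j) (g j)"
    and u: "u \<in> I \<times> J \<rightarrow>\<^sub>E {0..}" and x: "x \<in> I \<times> J"
  shows "\<exists>U\<le>1. cut_lipschitz (C ^ (card I + card J) * (2 * C * C)) U (\<lambda>v. matrix_weight I J f g (u(x := v)))"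
proof -
  obtain i0 j0 where x0: "x = (i0, j0)" "i0 \<in> I" "j0 \<in> J" using x by auto
  define a where "a = (\<Sum>j\<in>J - {j0}. u (i0, j))"
  define b where "b = (\<Sum>i\<in>I - {i0}. u (i, j0))"
  have u0: "u (i, j) \<ge> 0" if "i \<in> I" "j \<in> J" for i j using u that by (force simp: PiE_iff)
  have a0: "a \<ge> 0" and b0: "b \<ge> 0" unfolding a_def b_def using u0 x0 by (auto intro!: sum_nonneg)
  define c where "c = (\<Prod>i\<in>I - {i0}. f i (\<Sum>j\<in>J. u (i, j))) * (\<Prod>j\<in>J - {j0}. g j (\<Sum>i\<in>I. u (i, j)))"
  have r1: "(\<Sum>j\<in>J. (u(x := v)) (i0, j)) = v + a" for v
    using J x0 by (subst sum.remove[OF J x0(3)]) (auto simp: a_def intro!: sum.cong)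
  have r2: "(\<Sum>i\<in>I. (u(x := v)) (i, j0)) = v + b" for v
    using I x0 by (subst sum.remove[OF I x0(2)]) (auto simp: b_def intro!: sum.cong)
  have r3: "(\<Sum>j\<in>J. (u(x := v)) (i, j)) = (\<Sum>j\<in>J. u (i, j))" if "i \<noteq> i0" for i v
    using that x0 by (intro sum.cong) auto
  have r4: "(\<Sum>i\<in>I. (u(x := v)) (i, j)) = (\<Sum>i\<in>I. u (i, j))" if "j \<noteq> j0" for j v
    using that x0 by (intro sum.cong) auto
  have eq: "matrix_weight I J f g (u(x := v)) = c * (f i0 (v + a) * g j0 (v + b))" for v
  proof -
    have "(\<Prod>i\<in>I. f i (\<Sum>j\<in>J. (u(x := v)) (i, j))) = f i0 (v + a) * (\<Prod>i\<in>I - {i0}. f i (\<Sum>j\<in>J. u (i, j)))"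
    proof -
      have "(\<Prod>i\<in>I - {i0}. f i (\<Sum>j\<in>J. (u(x := v)) (i, j))) = (\<Prod>i\<in>I - {i0}. f i (\<Sum>j\<in>J. u (i, j)))"
      proof (rule prod.cong[OF refl])
        fix i assume "i \<in> I - {i0}"
        then have "i \<noteq> i0" by simp
        from r3[OF this] show "f i (\<Sum>j\<in>J. (u(x := v)) (i, j)) = f i (\<Sum>j\<in>J. u (i, j))" by (simp only:)
      qed
      then show ?thesis unfolding prod.remove[OF I x0(2)] r1 by (simp only:)
    qed
    moreover have "(\<Prod>j\<in>J. g j (\<Sum>i\<in>I. (u(x := v)) (i, j))) = g j0 (v + b) * (\<Prod>j\<in>J - {j0}. g j (\<Sum>i\<in>I. u (i, j)))"
    proof -
      have "(\<Prod>j\<in>J - {j0}. g j (\<Sum>i\<in>I. (u(x := v)) (i, j))) = (\<Prod>j\<in>J - {j0}. g j (\<Sum>i\<in>I. u (i, j)))"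
      proof (rule prod.cong[OF refl])
        fix j assume "j \<in> J - {j0}"
        then have "j \<noteq> j0" by simp
        from r4[OF this] show "g j (\<Sum>i\<in>I. (u(x := v)) (i, j)) = g j (\<Sum>i\<in>I. u (i, j))" by (simp only:)
      qed
      then show ?thesis unfolding prod.remove[OF J x0(3)] r2 by (simp only:)
    qed
    ultimately show ?thesis unfolding matrix_weight_def c_def by (simp only: mult_ac)
  qed
  have c: "norm c \<le> C ^ (card I + card J)"
  proof -
    have "norm (\<Prod>i\<in>I - {i0}. f i (\<Sum>j\<in>J. u (i, j))) \<le> C ^ card I"
      using I u0 by (intro norm_prod_le_power C cut_lipschitzD(1)[OF f]) (auto intro!: sum_nonneg card_mono)
    moreover have "norm (\<Prod>j\<in>J - {j0}. g j (\<Sum>i\<in>I. u (i, j))) \<le> C ^ card J"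
      using J u0 by (intro norm_prod_le_power C cut_lipschitzD(1)[OF g]) (auto intro!: sum_nonneg card_mono)
    ultimately show ?thesis unfolding c_def norm_mult power_add using C by (intro mult_mono) auto
  qed
  have "cut_lipschitz (C ^ (card I + card J) * (2 * C * C)) (min (1 - a) (V j0 - b)) (\<lambda>v. c * (f i0 (v + a) * g j0 (v + b)))"
    by (intro cut_lipschitz_cmult[OF _ c] cut_lipschitz_mult cut_lipschitz_shift f g x0 a0 b0)
  then show ?thesis unfolding eq using a0 by (intro exI[of _ "min (1 - a) (V j0 - b)"]) auto
qed

lemma matrix_weight_log:
  assumes I: "finite I" and J: "finite J" and d: "d \<in> positive_tuples (I \<times> J)"
  shows "matrix_weight I J f g (\<lambda>x\<in>I \<times> J. ln (real (d x)) / L) =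
    (\<Prod>i\<in>I. f i (ln (real (row_products I J d i)) / L)) * (\<Prod>j\<in>J. g j (ln (real (col_products I J d j)) / L))"
proof -
  have d0: "real (d (i, j)) > 0" if "i \<in> I" "j \<in> J" for i j using d that by (force simp: PiE_iff)
  have "(\<Sum>j\<in>J. ln (real (d (i, j))) / L) = ln (real (row_products I J d i)) / L" if "i \<in> I" for i
    using that d0 J by (simp add: row_products_def sum_divide_distrib[symmetric] ln_prod)
  moreover have "(\<Sum>i\<in>I. ln (real (d (i, j))) / L) = ln (real (col_products I J d j)) / L" if "j \<in> J" for j
    using that d0 I by (simp add: col_products_def sum_divide_distrib[symmetric] ln_prod)
  ultimately show ?thesis
    unfolding matrix_weight_def by (intro arg_cong2[of _ _ _ _ "(*)"] prod.cong refl) simp_all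
qed

definition diagonal_pairs :: "'i set \<Rightarrow> 'j set \<Rightarrow> nat \<Rightarrow> nat \<Rightarrow> (('i \<Rightarrow> nat) \<times> ('j \<Rightarrow> nat)) set" where
  "diagonal_pairs I J Y M = {(\<mu>, \<nu>). \<mu> \<in> I \<rightarrow>\<^sub>E {1..Y} \<and> \<nu> \<in> J \<rightarrow>\<^sub>E {1..<M} \<and> (\<Prod>i\<in>I. \<mu> i) = (\<Prod>j\<in>J. \<nu> j)}"

definition diagonal_sum :: "'i set \<Rightarrow> 'j set \<Rightarrow> ('i \<Rightarrow> real \<Rightarrow> complex) \<Rightarrow> ('j \<Rightarrow> real \<Rightarrow> complex) \<Rightarrow> real \<Rightarrow> nat \<Rightarrow> complex" where
  "diagonal_sum I J f g L M = (\<Sum>(\<mu>, \<nu>)\<in>diagonal_pairs I J (nat \<lfloor>exp L\<rfloor>) M.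
     (\<Prod>i\<in>I. f i (ln (real (\<mu> i)) / L)) * (\<Prod>j\<in>J. g j (ln (real (\<nu> j)) / L)) / of_real (\<Prod>i\<in>I. real (\<mu> i)))"

text \<open>Under the bijection with chosen matrices the sieve conditions disappear. The row
  functions vanish behind 1, so only row products up to \<open>Y\<close> count; each column product
  then divides a number that is at most \<open>Y ^ card I\<close>, and so lies below
  \<open>M\<close> of its own accord.\<close>

lemma sieved_sum_eq_diagonal:
  assumes I: "finite I" and J: "finite J" and L: "L \<ge> 1" and Y: "Y = nat \<lfloor>exp L\<rfloor>" and M: "M > Y ^ card I"
    and f: "\<And>i v. i \<in> I \<Longrightarrow> v > 1 \<Longrightarrow> f i v = 0"
  shows "prime_sieve.sieved_sum (I \<times> J) (chosen_matrices I J) (\<lambda>d. matrix_weight I J f g (\<lambda>x\<in>I \<times> J. ln (real (d x)) / L)) Y {p. prime p}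
    = (\<Sum>(\<mu>, \<nu>)\<in>diagonal_pairs I J Y M. (\<Prod>i\<in>I. f i (ln (real (\<mu> i)) / L)) * (\<Prod>j\<in>J. g j (ln (real (\<nu> j)) / L)) / of_real (\<Prod>i\<in>I. real (\<mu> i)))"
proof -
  interpret prime_sieve "I \<times> J" "chosen_matrices I J" by (rule prime_sieve_chosen[OF I J])
  let ?X = "I \<times> J"
  define ch where "ch = (\<lambda>d. \<forall>p\<in>{p. prime p}. prime_vector ?X p d \<in> chosen_matrices I J)"
  define G where "G = (\<lambda>(\<mu>, \<nu>). (\<Prod>i\<in>I. f i (ln (real (\<mu> i)) / L)) * (\<Prod>j\<in>J. g j (ln (real (\<nu> j)) / L)) / complex_of_real (\<Prod>i\<in>I. real (\<mu> i)))"
  define \<phi> where "\<phi> = (\<lambda>d. (row_products I J d, col_products I J d))"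
  define S where "S = {d \<in> positive_tuples ?X. ch d \<and> (\<forall>i\<in>I. row_products I J d i \<le> Y)}"
  have fin: "finite (grid ?X Y)" using I J by (intro finite_PiE) auto
  have pos: "d \<in> positive_tuples ?X" if "d \<in> grid ?X Y" for d using that by (force simp: PiE_iff)
  have le_row: "d (i, j) \<le> row_products I J d i" if "d \<in> positive_tuples ?X" "i \<in> I" "j \<in> J" for d i j
  proof -
    have "d (i, j) dvd (\<Prod>j\<in>J. d (i, j))" using J that by (intro dvd_prodI)
    moreover have "(\<Prod>j\<in>J. d (i, j)) > 0" using that by (intro prod_pos) (force simp: PiE_iff)
    ultimately show ?thesis using that by (simp add: row_products_def dvd_imp_le)
  qed
  have Sbox: "S \<subseteq> grid ?X Y"
  proof
    fix d assume d: "d \<in> S"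
    then have "d x \<in> {1..Y}" if "x \<in> ?X" for x
      using that le_row[of d "fst x" "snd x"] by (auto simp: S_def PiE_iff intro: order_trans)
    then show "d \<in> grid ?X Y" using d by (auto simp: S_def PiE_iff)
  qed
  have G: "matrix_weight I J f g (\<lambda>x\<in>?X. ln (real (d x)) / L) / of_real (\<Prod>x\<in>?X. real (d x)) = G (\<phi> d)" if "d \<in> positive_tuples ?X" for d
  proof -
    have "(\<Prod>x\<in>?X. real (d x)) = (\<Prod>i\<in>I. real (row_products I J d i))"
      using prod_row_products(1)[OF I J, of d] by (metis of_nat_prod)
    then show ?thesis unfolding matrix_weight_log[OF I J that] G_def \<phi>_def prod.case by (simp only:)
  qed
  have big: "matrix_weight I J f g (\<lambda>x\<in>?X. ln (real (d x)) / L) = 0" if d: "d \<in> positive_tuples ?X" "i \<in> I" "row_products I J d i > Y" for d i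
  proof -
    have "real (row_products I J d i) > exp L" using d(3) unfolding Y by linarith
    then have "ln (real (row_products I J d i)) > L" by (metis exp_gt_zero exp_ln exp_less_cancel_iff less_trans)
    then have "f i (ln (real (row_products I J d i)) / L) = 0" using f[OF d(2)] L by simp
    then have "(\<Prod>i\<in>I. f i (ln (real (row_products I J d i)) / L)) = 0" using I d(2) by (intro prod_zero) auto
    then show ?thesis unfolding matrix_weight_log[OF I J d(1)] by (simp only: mult_zero_left)
  qed
  have "sieved_sum (\<lambda>d. matrix_weight I J f g (\<lambda>x\<in>?X. ln (real (d x)) / L)) Y {p. prime p} = (\<Sum>d\<in>S. G (\<phi> d))"
    unfolding sieved_sum_def
  proof (rule sum.mono_neutral_cong_right[OF fin Sbox])
    show "\<forall>d\<in>grid ?X Y - S. of_bool (\<forall>q\<in>{p. prime p}. prime_vector ?X q d \<in> chosen_matrices I J) * matrix_weight I J f g (\<lambda>x\<in>?X. ln (real (d x)) / L) / of_real (\<Prod>x\<in>?X. real (d x)) = 0"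
    proof
      fix d assume d: "d \<in> grid ?X Y - S"
      note dp = pos[OF DiffD1[OF d]]
      show "of_bool (\<forall>q\<in>{p. prime p}. prime_vector ?X q d \<in> chosen_matrices I J) * matrix_weight I J f g (\<lambda>x\<in>?X. ln (real (d x)) / L) / of_real (\<Prod>x\<in>?X. real (d x)) = 0"
      proof (cases "ch d")
        case True
        have "\<not> (\<forall>i\<in>I. row_products I J d i \<le> Y)"
        proof
          assume "\<forall>i\<in>I. row_products I J d i \<le> Y"
          then have "d \<in> S" unfolding S_def using dp True by (intro CollectI conjI)
          then show False by (rule DiffD2[OF d])
        qed
        then obtain i where "i \<in> I" "row_products I J d i > Y" unfolding Ball_def not_le[symmetric] by blast
        then have "matrix_weight I J f g (\<lambda>x\<in>?X. ln (real (d x)) / L) = 0" by (rule big[OF dp])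
        then show ?thesis by (simp only: mult_zero_right div_0)
      next
        case False
        then have "(of_bool (ch d) :: complex) = 0" by (simp only: of_bool_eq)
        then show ?thesis unfolding ch_def by (simp only: mult_zero_left div_0)
      qed
    qed
    show "of_bool (\<forall>q\<in>{p. prime p}. prime_vector ?X q d \<in> chosen_matrices I J) * matrix_weight I J f g (\<lambda>x\<in>?X. ln (real (d x)) / L) / of_real (\<Prod>x\<in>?X. real (d x)) = G (\<phi> d)"
      if "d \<in> S" for d
    proof -
      have d: "d \<in> positive_tuples ?X" "ch d" using that unfolding S_def by (simp_all only: mem_Collect_eq)
      have "(of_bool (ch d) :: complex) = 1" using d(2) by (simp only: of_bool_eq)
      then show ?thesis unfolding ch_def G[OF d(1), symmetric] by (simp only: mult_1_left)
    qed
  qed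
  also have "\<dots> = (\<Sum>z\<in>diagonal_pairs I J Y M. G z)"
  proof (rule sum.reindex_bij_betw)
    have bij: "bij_betw \<phi> {d \<in> positive_tuples ?X. ch d} {(m, n). m \<in> positive_tuples I \<and> n \<in> positive_tuples J \<and> (\<Prod>i\<in>I. m i) = (\<Prod>j\<in>J. n j)}"
      unfolding \<phi>_def ch_def by (rule bij_betw_products[OF I J])
    show "bij_betw \<phi> S (diagonal_pairs I J Y M)"
      unfolding bij_betw_def
    proof
      show "inj_on \<phi> S" using bij_betw_imp_inj_on[OF bij] by (rule inj_on_subset) (unfold S_def, rule Collect_mono, rule impI, elim conjE, rule conjI)
      show "\<phi> ` S = diagonal_pairs I J Y M"
      proof (intro equalityI subsetI)
        fix z assume "z \<in> \<phi> ` S"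
        then obtain d where d: "d \<in> S" "z = \<phi> d" by auto
        obtain \<mu> \<nu> where z: "z = (\<mu>, \<nu>)" by (cases z)
        have "z \<in> {(m, n). m \<in> positive_tuples I \<and> n \<in> positive_tuples J \<and> (\<Prod>i\<in>I. m i) = (\<Prod>j\<in>J. n j)}"
        proof -
          have "d \<in> {d \<in> positive_tuples ?X. ch d}" using d(1) unfolding S_def mem_Collect_eq by (elim conjE) (rule conjI)
          then show ?thesis using bij_betwE[OF bij] d(2) by (simp only:)
        qed
        then have mn: "\<mu> \<in> positive_tuples I" "\<nu> \<in> positive_tuples J" "(\<Prod>i\<in>I. \<mu> i) = (\<Prod>j\<in>J. \<nu> j)" using z by auto
        have "\<mu> = row_products I J d" using d(2) z by (simp add: \<phi>_def)
        moreover have "\<forall>i\<in>I. row_products I J d i \<le> Y" using d(1) unfolding S_def mem_Collect_eq by (elim conjE)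
        ultimately have \<mu>Y: "\<mu> i \<le> Y" if "i \<in> I" for i using that by simp
        have "(\<Prod>i\<in>I. \<mu> i) \<le> (\<Prod>i\<in>I. Y)" using \<mu>Y by (intro prod_mono) auto
        then have PY: "(\<Prod>i\<in>I. \<mu> i) < M" using M by simp
        have "\<nu> j < M" if "j \<in> J" for j
        proof -
          have "\<nu> j dvd (\<Prod>j\<in>J. \<nu> j)" using J that by (intro dvd_prodI)
          moreover have "(\<Prod>j\<in>J. \<nu> j) > 0" using mn by (intro prod_pos) (force simp: PiE_iff)
          ultimately have "\<nu> j \<le> (\<Prod>j\<in>J. \<nu> j)" by (rule dvd_imp_le)
          then show ?thesis using PY mn(3) by simp
        qed
        then show "z \<in> diagonal_pairs I J Y M"
          using mn \<mu>Y unfolding z diagonal_pairs_def by (auto simp: PiE_iff)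
      next
        fix z assume z: "z \<in> diagonal_pairs I J Y M"
        then obtain \<mu> \<nu> where zz: "z = (\<mu>, \<nu>)" "\<mu> \<in> I \<rightarrow>\<^sub>E {1..Y}" "\<nu> \<in> J \<rightarrow>\<^sub>E {1..<M}" "(\<Prod>i\<in>I. \<mu> i) = (\<Prod>j\<in>J. \<nu> j)"
          unfolding diagonal_pairs_def by auto
        then have "\<mu> \<in> positive_tuples I" "\<nu> \<in> positive_tuples J" by (simp_all add: PiE_iff)
        then have "z \<in> {(m, n). m \<in> positive_tuples I \<and> n \<in> positive_tuples J \<and> (\<Prod>i\<in>I. m i) = (\<Prod>j\<in>J. n j)}"
          using zz(1,4) by simp
        then obtain d where d: "d \<in> positive_tuples ?X" "ch d" "z = \<phi> d"
        proof -
          note surj = bij_betw_imp_surj_on[OF bij]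
          have "z \<in> \<phi> ` {d \<in> positive_tuples ?X. ch d}" unfolding surj by fact
          then show ?thesis using that by (elim imageE CollectE conjE)
        qed
        have "\<mu> = row_products I J d" using d(3) zz(1) by (simp add: \<phi>_def)
        then have "row_products I J d i \<le> Y" if "i \<in> I" for i
          using PiE_mem[OF zz(2) that] by simp
        then have "d \<in> S" unfolding S_def using d(1,2) by (intro CollectI conjI ballI)
        then show "z \<in> \<phi> ` S" unfolding d(3) by (rule imageI)
      qed
    qed
  qed
  finally show ?thesis unfolding G_def .
qed

text \<open>The sieve and the Riemann sum combined, each losing one power of \<open>L\<close>. The
  constant is fixed before the functions and the cuts; this uniformity permits shifts that vary with
  \<open>T\<close>, as they enter through the column functions.\<close>

lemma diagonal_sum_asymptotic:
  assumes I: "finite I" "I \<noteq> {}" and J: "finite J" "J \<noteq> {}" and card: "card I = m" "card J = m" and C: "C \<ge> 1"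
  shows "\<exists>K\<ge>0. \<forall>L\<ge>1. \<forall>f g V M. (\<forall>i\<in>I. cut_lipschitz C 1 (f i) \<and> f i \<in> borel_measurable borel) \<longrightarrow>
    (\<forall>j\<in>J. cut_lipschitz C (V j) (g j) \<and> g j \<in> borel_measurable borel) \<longrightarrow> M > nat \<lfloor>exp L\<rfloor> ^ m \<longrightarrow>
    norm (diagonal_sum I J f g L M
      - of_real (arith_factor m * L ^ m\<^sup>2) * (\<integral>u. indicator (I \<times> J \<rightarrow>\<^sub>E {0..1}) u *\<^sub>R matrix_weight I J f g u \<partial>Pi\<^sub>M (I \<times> J) (\<lambda>_. lborel)))
    \<le> K * L ^ (m\<^sup>2 - 1)"
proof -
  interpret prime_sieve "I \<times> J" "chosen_matrices I J" by (rule prime_sieve_chosen[OF I(1) J(1)])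
  define N where "N = m\<^sup>2"
  have N: "card (I \<times> J) = N" using card by (simp add: N_def card_cartesian_product power2_eq_square)
  define C' where "C' = C ^ (m + m) * (2 * C * C)"
  have C': "C' \<ge> 0" using C by (simp add: C'_def)
  define K1 where "K1 = 144 * (decay_constant N)\<^sup>2 * (3 * C') * 2 ^ (N - 1) * (\<Sum>n. real n powr (- 5 / 4))"
  define K2 where "K2 = \<bar>arith_factor m\<bar> * (6 * C' * real N * 2 ^ (N - 1))"
  have Z: "(\<Sum>n. real n powr (- 5 / 4)) \<ge> 0" by (intro suminf_nonneg summable_powr_five_quarters) auto
  have K1: "K1 \<ge> 0" using C' Z by (simp add: K1_def)
  have K2: "K2 \<ge> 0" using C' by (simp add: K2_def)
  show ?thesis
  proof (rule exI[of _ "K1 + K2"], intro conjI allI impI)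
    show "0 \<le> K1 + K2" using K1 K2 by simp
    fix L :: real and f :: "'a \<Rightarrow> real \<Rightarrow> complex" and g :: "'b \<Rightarrow> real \<Rightarrow> complex" and V :: "'b \<Rightarrow> real" and M :: nat
    assume L: "L \<ge> 1" and f: "\<forall>i\<in>I. cut_lipschitz C 1 (f i) \<and> f i \<in> borel_measurable borel"
      and g: "\<forall>j\<in>J. cut_lipschitz C (V j) (g j) \<and> g j \<in> borel_measurable borel" and M: "M > nat \<lfloor>exp L\<rfloor> ^ m"
    let ?X = "I \<times> J" and ?W = "matrix_weight I J f g"
    define Y where "Y = nat \<lfloor>exp L\<rfloor>"
    define w where "w = (\<lambda>d. ?W (\<lambda>x\<in>?X. ln (real (d x)) / L))"
    have sl: "\<exists>U\<le>1. cut_lipschitz C' U (\<lambda>v. ?W (u(x := v)))" if "u \<in> ?X \<rightarrow>\<^sub>E {0..}" "x \<in> ?X" for u x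
      using matrix_weight_slice[OF I(1) J(1) C _ _ that, of f V g] f g card unfolding C'_def by simp
    have lX: "(\<lambda>x\<in>?X. ln (real (d x)) / L) \<in> ?X \<rightarrow>\<^sub>E {0..}" if "d \<in> positive_tuples ?X" for d
      using that L by (force simp: PiE_iff)
    have dil: "(\<Sum>n=1..Y. norm (w (d(x := n * q)) - w (d(x := n))) / real n) \<le> 3 * C' * (1 + ln (real q))"
      if xd: "x \<in> ?X" "d \<in> positive_tuples ?X" "q \<ge> 1" for x d and q :: nat
    proof -
      define u where "u = (\<lambda>x\<in>?X. ln (real (d x)) / L)"
      obtain U where U: "U \<le> 1" "cut_lipschitz C' U (\<lambda>v. ?W (u(x := v)))"
        using sl[OF lX[OF xd(2)] xd(1)] unfolding u_def by blast
      have "(\<lambda>y\<in>?X. ln (real ((d(x := n)) y)) / L) = u(x := ln (real n) / L)" for n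
        using xd(1) by (auto simp: u_def fun_eq_iff)
      then have "w (d(x := n)) = ?W (u(x := ln (real n) / L))" for n unfolding w_def by simp
      then show ?thesis using cut_lipschitz_sum_dilation[OF U(2,1) L xd(3)] unfolding Y_def by simp
    qed
    have bdd: "norm (w d) \<le> C'" if d: "d \<in> positive_tuples ?X" for d
    proof -
      obtain x where x: "x \<in> ?X" using I(2) J(2) by auto
      define u where "u = (\<lambda>x\<in>?X. ln (real (d x)) / L)"
      have u: "u \<in> ?X \<rightarrow>\<^sub>E {0..}" unfolding u_def by (rule lX[OF d])
      obtain U where "cut_lipschitz C' U (\<lambda>v. ?W (u(x := v)))" using sl[OF u x] by blast
      moreover have "u x \<ge> 0" using u x by (auto simp: PiE_iff)
      ultimately have "norm (?W (u(x := u x))) \<le> C'" by (rule cut_lipschitzD(1))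
      then show ?thesis unfolding w_def u_def[symmetric] by simp
    qed
    have supp: "w d = 0" if d: "d \<in> positive_tuples ?X" and n: "d \<notin> grid ?X Y" for d
    proof -
      obtain x where x: "x \<in> ?X" "\<not> d x \<le> Y" using d n by (auto simp: PiE_iff)
      define u where "u = (\<lambda>x\<in>?X. ln (real (d x)) / L)"
      have u: "u \<in> ?X \<rightarrow>\<^sub>E {0..}" unfolding u_def by (rule lX[OF d])
      obtain U where U: "U \<le> 1" "cut_lipschitz C' U (\<lambda>v. ?W (u(x := v)))" using sl[OF u x(1)] by blast
      have "real (d x) > exp L" using x(2) unfolding Y_def by linarith
      then have "ln (real (d x)) > L" by (metis exp_gt_zero exp_ln exp_less_cancel_iff less_trans)
      then have "1 < ln (real (d x)) / L" using L by (simp add: less_divide_eq)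
      then have "u x > U" using x(1) U(1) by (simp add: u_def)
      moreover have "u x \<ge> 0" using u x by (auto simp: PiE_iff)
      ultimately have "?W (u(x := u x)) = 0" using cut_lipschitzD(2)[OF U(2)] by blast
      then show ?thesis unfolding w_def u_def[symmetric] by simp
    qed
    have h: "harmonic_sum Y ^ (N - 1) \<le> 2 ^ (N - 1) * L ^ (N - 1)"
      using harmonic_sum_le[OF L] harmonic_sum_nonneg[of Y] unfolding Y_def power_mult_distrib[symmetric] by (intro power_mono)
    have A: "norm (sieved_sum w Y {p. prime p} - of_real (arith_factor m) * sieved_sum w Y {}) \<le> K1 * L ^ (N - 1)"
    proof -
      have "norm (sieved_sum w Y {p. prime p} - of_real (arith_factor m) * sieved_sum w Y {})
        \<le> 144 * (decay_constant N)\<^sup>2 * (3 * C') * harmonic_sum Y ^ (N - 1) * (\<Sum>n. real n powr (- 5 / 4))"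
        unfolding arith_factor_eq_density[OF I J card] N[symmetric]
        by (rule sieved_sum_primes[OF _ dil bdd supp]) (use C' in simp)
      also have "\<dots> \<le> 144 * (decay_constant N)\<^sup>2 * (3 * C') * (2 ^ (N - 1) * L ^ (N - 1)) * (\<Sum>n. real n powr (- 5 / 4))"
        using h C' Z by (intro mult_right_mono mult_left_mono) auto
      finally show ?thesis by (simp add: K1_def mult_ac)
    qed
    let ?Int = "\<integral>u. indicator (?X \<rightarrow>\<^sub>E {0..1}) u *\<^sub>R ?W u \<partial>Pi\<^sub>M ?X (\<lambda>_. lborel)"
    have B: "norm (sieved_sum w Y {} - of_real (L ^ N) * ?Int) \<le> 6 * C' * real N * (2 * L) ^ (N - 1)"
    proof -
      have "sieved_sum w Y {} = (\<Sum>d\<in>grid ?X Y. ?W (\<lambda>x\<in>?X. ln (real (d x)) / L) / of_real (\<Prod>x\<in>?X. real (d x)))"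
        unfolding sieved_sum_def w_def by simp
      then show ?thesis
        using box_sum_integral[of ?X L C' ?W] I J L C' sl matrix_weight_measurable[of I J f g] f g unfolding N Y_def by simp
    qed
    have "norm (of_real (arith_factor m) * (sieved_sum w Y {} - of_real (L ^ N) * ?Int)) \<le> \<bar>arith_factor m\<bar> * (6 * C' * real N * (2 * L) ^ (N - 1))"
      unfolding norm_mult norm_of_real using B by (intro mult_left_mono) auto
    also have "\<dots> = K2 * L ^ (N - 1)" by (simp add: K2_def power_mult_distrib)
    finally have "norm ((sieved_sum w Y {p. prime p} - of_real (arith_factor m) * sieved_sum w Y {}) + of_real (arith_factor m) * (sieved_sum w Y {} - of_real (L ^ N) * ?Int)) \<le> K1 * L ^ (N - 1) + K2 * L ^ (N - 1)"
      using A by (intro norm_triangle_le add_mono)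
    moreover have "(sieved_sum w Y {p. prime p} - of_real (arith_factor m) * sieved_sum w Y {}) + of_real (arith_factor m) * (sieved_sum w Y {} - of_real (L ^ N) * ?Int)
      = sieved_sum w Y {p. prime p} - of_real (arith_factor m * L ^ N) * ?Int"
      by (simp add: algebra_simps)
    moreover have "sieved_sum w Y {p. prime p} = (\<Sum>(\<mu>, \<nu>)\<in>diagonal_pairs I J Y M. (\<Prod>i\<in>I. f i (ln (real (\<mu> i)) / L)) * (\<Prod>j\<in>J. g j (ln (real (\<nu> j)) / L)) / of_real (\<Prod>i\<in>I. real (\<mu> i)))"
      unfolding w_def
      by (rule sieved_sum_eq_diagonal[OF I(1) J(1) L Y_def]) (use M card f J cut_lipschitzD(2)[of C 1] in \<open>auto simp: Y_def\<close>)
    ultimately show "norm (diagonal_sum I J f g L M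
      - of_real (arith_factor m * L ^ m\<^sup>2) * ?Int) \<le> (K1 + K2) * L ^ (m\<^sup>2 - 1)"
      unfolding diagonal_sum_def Y_def N_def by (simp only: distrib_right)
  qed
qed

section \<open>The parameter integral\<close>

definition cut_poly :: "real poly \<Rightarrow> real \<Rightarrow> complex" where
  "cut_poly P v = (if 0 \<le> v \<and> v \<le> 1 then of_real (poly P (1 - v)) else 0)"

definition cut_exp :: "real \<Rightarrow> complex \<Rightarrow> real \<Rightarrow> complex" where
  "cut_exp V c v = (if 0 \<le> v \<and> v \<le> V then exp (c * of_real v) else 0)"

text \<open>The last four columns come from the zeta factors. The cut at \<open>k + 2\<close> is harmless: an entry of a
  diagonal pair divides a product of \<open>k + 2\<close> integers of size at most \<open>exp L\<close>.\<close>
definition column_weight :: "nat \<Rightarrow> real poly \<Rightarrow> (nat \<Rightarrow> complex) \<Rightarrow> nat \<Rightarrow> real \<Rightarrow> complex" where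
  "column_weight k P c j = (if j \<le> k - 2 then cut_poly P else cut_exp (real k + 2) (c j))"

text \<open>The columns \<open>k - 1\<close> to \<open>k + 2\<close> carry the zeta factors in the
  order of the shifts; the last branch is the value at \<open>k + 2\<close>.\<close>

definition shift_vector :: "nat \<Rightarrow> complex \<Rightarrow> complex \<Rightarrow> complex \<Rightarrow> complex \<Rightarrow> nat \<Rightarrow> complex" where
  "shift_vector k a b c d j = (if j = k - 1 then a else if j = k then b else if j = k + 1 then c else d)"

lemma cut_poly_measurable: "cut_poly P \<in> borel_measurable borel"
proof -
  have "(\<lambda>v. complex_of_real (poly P (1 - v))) \<in> borel_measurable borel"
    by (intro borel_measurable_continuous_onI continuous_intros)
  then show ?thesis unfolding cut_poly_def[abs_def] by measurable
qed

lemma cut_exp_measurable: "cut_exp V c \<in> borel_measurable borel"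
proof -
  have "(\<lambda>v. exp (c * complex_of_real v)) \<in> borel_measurable borel"
    by (intro borel_measurable_continuous_onI continuous_intros)
  then show ?thesis unfolding cut_exp_def[abs_def] by measurable
qed

lemma column_split:
  fixes k :: nat
  assumes "k \<ge> 2"
  shows "{1..k + 2} = {1..k - 2} \<union> {k - 1, k, k + 1, k + 2}" "{1..k - 2} \<inter> {k - 1, k, k + 1, k + 2} = {}"
  using assms by auto

lemma prod_column_split:
  fixes h :: "nat \<Rightarrow> 'a :: comm_monoid_mult"
  assumes "k \<ge> 2"
  shows "(\<Prod>j=1..k + 2. h j) = (\<Prod>j=1..k - 2. h j) * (h (k - 1) * (h k * (h (k + 1) * h (k + 2))))"
proof -
  have "k - 1 \<noteq> k" "k - 1 \<noteq> k + 1" "k - 1 \<noteq> k + 2" using assms by auto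
  then show ?thesis unfolding column_split(1)[OF assms] by (subst prod.union_disjoint[OF _ _ column_split(2)[OF assms]]) simp_all
qed

lemma sum_column_split:
  fixes h :: "nat \<Rightarrow> 'a :: comm_monoid_add"
  assumes "k \<ge> 2"
  shows "(\<Sum>j=1..k + 2. h j) = (\<Sum>j=1..k - 2. h j) + (h (k - 1) + (h k + (h (k + 1) + h (k + 2))))"
proof -
  have "k - 1 \<noteq> k" "k - 1 \<noteq> k + 1" "k - 1 \<noteq> k + 2" using assms by auto
  then show ?thesis unfolding column_split(1)[OF assms] by (subst sum.union_disjoint[OF _ _ column_split(2)[OF assms]]) simp_all
qed

section \<open>Regrouping the variables into one matrix\<close>

definition join_columns :: "nat \<Rightarrow> point \<Rightarrow> nat \<times> nat \<Rightarrow> real" where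
  "join_columns k = (\<lambda>(t, w, x, y, z). \<lambda>(i, j)\<in>{1..k + 2} \<times> {1..k + 2}.
     if j \<le> k - 2 then t (i, j) else if j = k - 1 then w i else if j = k then x i else if j = k + 1 then y i else z i)"

lemma join_columns_simps:
  assumes "k \<ge> 2" "i \<in> {1..k + 2}"
  shows "j \<in> {1..k - 2} \<Longrightarrow> join_columns k (t, w, x, y, z) (i, j) = t (i, j)"
    "join_columns k (t, w, x, y, z) (i, k - 1) = w i" "join_columns k (t, w, x, y, z) (i, k) = x i"
    "join_columns k (t, w, x, y, z) (i, k + 1) = y i" "join_columns k (t, w, x, y, z) (i, k + 2) = z i"
  using assms by (auto simp: join_columns_def)

lemma join_columns_PiE_iff:
  assumes k: "k \<ge> 2" and t: "t \<in> extensional ({1..k + 2} \<times> {1..k - 2})" and w: "w \<in> extensional {1..k + 2}"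
    and x: "x \<in> extensional {1..k + 2}" and y: "y \<in> extensional {1..k + 2}" and z: "z \<in> extensional {1..k + 2}"
  shows "join_columns k (t, w, x, y, z) \<in> Pi\<^sub>E ({1..k + 2} \<times> {1..k + 2}) A \<longleftrightarrow>
    t \<in> Pi\<^sub>E ({1..k + 2} \<times> {1..k - 2}) A \<and> w \<in> (\<Pi>\<^sub>E i\<in>{1..k + 2}. A (i, k - 1)) \<and> x \<in> (\<Pi>\<^sub>E i\<in>{1..k + 2}. A (i, k)) \<and>
    y \<in> (\<Pi>\<^sub>E i\<in>{1..k + 2}. A (i, k + 1)) \<and> z \<in> (\<Pi>\<^sub>E i\<in>{1..k + 2}. A (i, k + 2))"
proof -
  have e: "join_columns k (t, w, x, y, z) \<in> extensional ({1..k + 2} \<times> {1..k + 2})" by (simp add: join_columns_def)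
  have "join_columns k (t, w, x, y, z) \<in> Pi\<^sub>E ({1..k + 2} \<times> {1..k + 2}) A \<longleftrightarrow>
    (\<forall>i\<in>{1..k + 2}. \<forall>j\<in>{1..k + 2}. join_columns k (t, w, x, y, z) (i, j) \<in> A (i, j))"
    using e by (simp add: PiE_iff del: split_paired_All)
  also have "\<dots> \<longleftrightarrow> (\<forall>i\<in>{1..k + 2}. (\<forall>j\<in>{1..k - 2}. t (i, j) \<in> A (i, j)) \<and> w i \<in> A (i, k - 1) \<and> x i \<in> A (i, k) \<and> y i \<in> A (i, k + 1) \<and> z i \<in> A (i, k + 2))"
  proof (rule ball_cong[OF refl])
    fix i assume i: "i \<in> {1..k + 2}"
    show "(\<forall>j\<in>{1..k + 2}. join_columns k (t, w, x, y, z) (i, j) \<in> A (i, j)) \<longleftrightarrow>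
      (\<forall>j\<in>{1..k - 2}. t (i, j) \<in> A (i, j)) \<and> w i \<in> A (i, k - 1) \<and> x i \<in> A (i, k) \<and> y i \<in> A (i, k + 1) \<and> z i \<in> A (i, k + 2)"
      unfolding column_split(1)[OF k] ball_Un ball_simps join_columns_simps(2-5)[OF k i]
      using join_columns_simps(1)[OF k i] by (intro arg_cong2[of _ _ _ _ "(\<and>)"] ball_cong refl) simp_all
  qed
  also have "\<dots> \<longleftrightarrow> t \<in> Pi\<^sub>E ({1..k + 2} \<times> {1..k - 2}) A \<and> w \<in> (\<Pi>\<^sub>E i\<in>{1..k + 2}. A (i, k - 1)) \<and> x \<in> (\<Pi>\<^sub>E i\<in>{1..k + 2}. A (i, k)) \<and>
    y \<in> (\<Pi>\<^sub>E i\<in>{1..k + 2}. A (i, k + 1)) \<and> z \<in> (\<Pi>\<^sub>E i\<in>{1..k + 2}. A (i, k + 2))"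
    using t w x y z by (simp add: PiE_iff ball_conj_distrib del: split_paired_All)
  finally show ?thesis .
qed

lemma join_columns_measurable:
  assumes k: "k \<ge> 2"
  shows "join_columns k \<in> measurable (param_measure k) (Pi\<^sub>M ({1..k + 2} \<times> {1..k + 2}) (\<lambda>_. lborel))"
proof -
  have c: "(\<lambda>u. u a) \<in> measurable (Pi\<^sub>M X (\<lambda>_. lborel :: real measure)) lborel" if "a \<in> X" for a :: 'b and X
    using measurable_component_singleton[OF that, of "\<lambda>_. lborel :: real measure"] by simp
  have "(\<lambda>p. \<lambda>a\<in>{1..k + 2} \<times> {1..k + 2}. join_columns k p a) \<in> measurable (param_measure k) (Pi\<^sub>M ({1..k + 2} \<times> {1..k + 2}) (\<lambda>_. lborel))"
  proof (rule measurable_restrict)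
    fix a assume a: "a \<in> {1..k + 2} \<times> {1..k + 2}"
    obtain i j where ij: "a = (i, j)" "i \<in> {1..k + 2}" "j \<in> {1..k + 2}" using a by auto
    consider "j \<in> {1..k - 2}" | "j = k - 1" | "j = k" | "j = k + 1" | "j = k + 2" using ij(3) unfolding column_split(1)[OF k] by auto
    then show "(\<lambda>p. join_columns k p a) \<in> measurable (param_measure k) lborel"
    proof cases
      case 1
      then have "(\<lambda>p. join_columns k p a) = (\<lambda>p. fst p (i, j))" using ij join_columns_simps[OF k ij(2)] by auto
      then show ?thesis unfolding param_measure_def using 1 ij by (auto intro!: measurable_compose[OF measurable_fst c])
    next
      case 2
      then have "(\<lambda>p. join_columns k p a) = (\<lambda>p. fst (snd p) i)" using ij join_columns_simps[OF k ij(2)] by auto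
      then show ?thesis unfolding param_measure_def using ij
        by (auto intro!: measurable_compose[OF measurable_snd] measurable_compose[OF measurable_fst c])
    next
      case 3
      then have "(\<lambda>p. join_columns k p a) = (\<lambda>p. fst (snd (snd p)) i)" using ij join_columns_simps[OF k ij(2)] by auto
      then show ?thesis unfolding param_measure_def using ij
        by (auto intro!: measurable_compose[OF measurable_snd] measurable_compose[OF measurable_fst c])
    next
      case 4
      then have "(\<lambda>p. join_columns k p a) = (\<lambda>p. fst (snd (snd (snd p))) i)" using ij join_columns_simps[OF k ij(2)] by auto
      then show ?thesis unfolding param_measure_def using ij
        by (auto intro!: measurable_compose[OF measurable_snd] measurable_compose[OF measurable_fst c])
    next
      case 5
      then have "(\<lambda>p. join_columns k p a) = (\<lambda>p. snd (snd (snd (snd p))) i)" using ij join_columns_simps[OF k ij(2)] by auto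
      then show ?thesis unfolding param_measure_def using ij
        by (auto intro!: measurable_compose[OF measurable_snd] c)
    qed
  qed
  moreover have "(\<lambda>p. \<lambda>a\<in>{1..k + 2} \<times> {1..k + 2}. join_columns k p a) = join_columns k"
    by (auto simp: join_columns_def fun_eq_iff)
  ultimately show ?thesis by simp
qed

text \<open>A product measure is determined by its values on boxes, and the preimage of a box under
  the regrouping is a product of five boxes.\<close>

lemma distr_join_columns:
  assumes k: "k \<ge> 2"
  shows "distr (param_measure k) (Pi\<^sub>M ({1..k + 2} \<times> {1..k + 2}) (\<lambda>_. lborel)) (join_columns k) = Pi\<^sub>M ({1..k + 2} \<times> {1..k + 2}) (\<lambda>_. lborel)"
proof (rule product_sigma_finite.PiM_eqI)
  let ?I = "{1..k + 2}"
  interpret product_sigma_finite "\<lambda>_::nat. lborel :: real measure" by standard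
  interpret pp: product_sigma_finite "\<lambda>_::nat \<times> nat. lborel :: real measure" by standard
  show "product_sigma_finite (\<lambda>_::nat \<times> nat. lborel :: real measure)" by standard
  show "finite (?I \<times> ?I)" by simp
  show "sets (distr (param_measure k) (Pi\<^sub>M (?I \<times> ?I) (\<lambda>_. lborel)) (join_columns k)) = sets (Pi\<^sub>M (?I \<times> ?I) (\<lambda>_. lborel))" by simp
  fix A :: "nat \<times> nat \<Rightarrow> real set" assume A: "\<And>a. a \<in> ?I \<times> ?I \<Longrightarrow> A a \<in> sets lborel"
  have kI: "k - 1 \<in> ?I" "k \<in> ?I" "k + 1 \<in> ?I" "k + 2 \<in> ?I" "{1..k - 2} \<subseteq> ?I" using k by auto
  let ?Q = "\<lambda>j. Pi\<^sub>E ?I (\<lambda>i. A (i, j))"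
  let ?M = "Pi\<^sub>M ?I (\<lambda>_. lborel :: real measure)"
  have Q: "?Q j \<in> sets ?M" if "j \<in> ?I" for j using A that by (intro sets_PiM_I_finite) auto
  have Q1: "Pi\<^sub>E (?I \<times> {1..k - 2}) A \<in> sets (Pi\<^sub>M (?I \<times> {1..k - 2}) (\<lambda>_. lborel))"
    using A kI by (intro sets_PiM_I_finite) auto
  have eQ: "emeasure ?M (?Q j) = (\<Prod>i\<in>?I. emeasure lborel (A (i, j)))" if "j \<in> ?I" for j
    using A that by (intro emeasure_PiM) auto
  have eQ1: "emeasure (Pi\<^sub>M (?I \<times> {1..k - 2}) (\<lambda>_. lborel)) (Pi\<^sub>E (?I \<times> {1..k - 2}) A) = (\<Prod>a\<in>?I \<times> {1..k - 2}. emeasure lborel (A a))"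
    using A kI by (intro pp.emeasure_PiM) auto
  have sf: "sigma_finite_measure ?M" by (rule sigma_finite) simp
  interpret sf: sigma_finite_measure ?M by (rule sf)
  interpret p2: pair_sigma_finite ?M ?M by standard
  interpret p3: pair_sigma_finite ?M "?M \<Otimes>\<^sub>M ?M" by standard
  interpret p4: pair_sigma_finite ?M "?M \<Otimes>\<^sub>M (?M \<Otimes>\<^sub>M ?M)" by standard
  have pre: "join_columns k -` Pi\<^sub>E (?I \<times> ?I) A \<inter> space (param_measure k) =
    Pi\<^sub>E (?I \<times> {1..k - 2}) A \<times> ?Q (k - 1) \<times> ?Q k \<times> ?Q (k + 1) \<times> ?Q (k + 2)" (is "?l = ?r")
  proof (rule set_eqI)
    fix p :: point
    obtain t w x y z where p: "p = (t, w, x, y, z)" by (cases p)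
    have sp: "p \<in> space (param_measure k) \<longleftrightarrow> t \<in> extensional (?I \<times> {1..k - 2}) \<and> w \<in> extensional ?I \<and> x \<in> extensional ?I \<and> y \<in> extensional ?I \<and> z \<in> extensional ?I"
      by (simp add: p param_measure_def space_pair_measure space_PiM PiE_def)
    show "p \<in> ?l \<longleftrightarrow> p \<in> ?r"
    proof (cases "p \<in> space (param_measure k)")
      case True
      then show ?thesis using join_columns_PiE_iff[OF k, of t w x y z A] sp by (simp add: p)
    next
      case False
      then have "p \<notin> ?r" unfolding sp by (auto simp: p PiE_def)
      then show ?thesis using False by simp
    qed
  qed
  have "emeasure (distr (param_measure k) (Pi\<^sub>M (?I \<times> ?I) (\<lambda>_. lborel)) (join_columns k)) (Pi\<^sub>E (?I \<times> ?I) A)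
    = emeasure (param_measure k) ?r"
    unfolding pre[symmetric] using A by (intro emeasure_distr join_columns_measurable[OF k] sets_PiM_I_finite) auto
  also have "\<dots> = (\<Prod>a\<in>?I \<times> {1..k - 2}. emeasure lborel (A a)) * ((\<Prod>i\<in>?I. emeasure lborel (A (i, k - 1))) *
     ((\<Prod>i\<in>?I. emeasure lborel (A (i, k))) * ((\<Prod>i\<in>?I. emeasure lborel (A (i, k + 1))) * (\<Prod>i\<in>?I. emeasure lborel (A (i, k + 2))))))"
    unfolding param_measure_def
    by (simp only: sigma_finite_measure.emeasure_pair_measure_Times[OF p4.sigma_finite_measure_axioms] sigma_finite_measure.emeasure_pair_measure_Times[OF p3.sigma_finite_measure_axioms] sigma_finite_measure.emeasure_pair_measure_Times[OF p2.sigma_finite_measure_axioms] sf.emeasure_pair_measure_Times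
        Q1 Q kI pair_measureI eQ eQ1)
  also have "\<dots> = (\<Prod>j=1..k + 2. \<Prod>i\<in>?I. emeasure lborel (A (i, j)))"
  proof -
    have "(\<Prod>a\<in>?I \<times> {1..k - 2}. emeasure lborel (A a)) = (\<Prod>j=1..k - 2. \<Prod>i\<in>?I. emeasure lborel (A (i, j)))"
      by (subst prod.swap) (simp only: prod.cartesian_product split_def prod.collapse)
    then show ?thesis unfolding prod_column_split[OF k, of "\<lambda>j. \<Prod>i\<in>?I. emeasure lborel (A (i, j))"] by (simp only:)
  qed
  also have "\<dots> = (\<Prod>a\<in>?I \<times> ?I. emeasure lborel (A a))"
    by (subst prod.swap) (simp only: prod.cartesian_product split_def prod.collapse)
  finally show "emeasure (distr (param_measure k) (Pi\<^sub>M (?I \<times> ?I) (\<lambda>_. lborel)) (join_columns k)) (Pi\<^sub>E (?I \<times> ?I) A) = (\<Prod>a\<in>?I \<times> ?I. emeasure lborel (A a))" .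
qed

lemma column_weight_measurable: "column_weight k P c j \<in> borel_measurable borel"
  using cut_poly_measurable cut_exp_measurable by (simp add: column_weight_def)

text \<open>Within the cube the cuts of \<open>cut_poly\<close> at 1 are exactly the inequalities of
  the region: all row sums and the first \<open>k - 2\<close> column sums are at most 1. The
  exponential columns are cut at \<open>k + 2\<close>, which a sum of \<open>k + 2\<close> entries
  from \<open>[0, 1]\<close> cannot exceed, so the power of \<open>Y\<close> appears in
  full.\<close>

lemma param_integral_eq_matrix_integral:
  fixes \<alpha>1 \<alpha>2 \<alpha>3 \<alpha>4 :: complex
  assumes k: "k \<ge> 2" and Y: "Y > 0"
  defines "c \<equiv> shift_vector k (\<alpha>1 * of_real (ln Y)) (\<alpha>2 * of_real (ln Y)) (- \<alpha>3 * of_real (ln Y)) (- \<alpha>4 * of_real (ln Y))"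
  shows "param_integral k P Y \<alpha>1 \<alpha>2 \<alpha>3 \<alpha>4 =
    (\<integral>u. indicator ({1..k + 2} \<times> {1..k + 2} \<rightarrow>\<^sub>E {0..1}) u *\<^sub>R matrix_weight {1..k + 2} {1..k + 2} (\<lambda>_. cut_poly P) (column_weight k P c) u
      \<partial>Pi\<^sub>M ({1..k + 2} \<times> {1..k + 2}) (\<lambda>_. lborel))"
proof -
  let ?I = "{1..k + 2}"
  let ?F = "\<lambda>u. indicator (?I \<times> ?I \<rightarrow>\<^sub>E {0..1}) u *\<^sub>R matrix_weight ?I ?I (\<lambda>_. cut_poly P) (column_weight k P c) u"
  let ?N = "Pi\<^sub>M (?I \<times> ?I) (\<lambda>_. lborel :: real measure)"
  have F: "?F \<in> borel_measurable ?N"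
    by (intro borel_measurable_scaleR borel_measurable_indicator matrix_weight_measurable cut_poly_measurable column_weight_measurable)
      (use cube_emeasure(1)[of "?I \<times> ?I"] in auto)
  have "(\<integral>u. ?F u \<partial>?N) = (\<integral>u. ?F u \<partial>distr (param_measure k) ?N (join_columns k))" unfolding distr_join_columns[OF k] ..
  also have "\<dots> = (\<integral>p. ?F (join_columns k p) \<partial>param_measure k)"
    by (rule integral_distr[OF join_columns_measurable[OF k] F])
  also have "\<dots> = param_integral k P Y \<alpha>1 \<alpha>2 \<alpha>3 \<alpha>4"
    unfolding param_integral_def set_lebesgue_integral_def
  proof (rule Bochner_Integration.integral_cong[OF refl])
    fix p assume p: "p \<in> space (param_measure k)"
    obtain t w x y z where pp: "p = (t, w, x, y, z)" by (cases p)
    have sp: "t \<in> extensional (?I \<times> {1..k - 2})" "w \<in> extensional ?I" "x \<in> extensional ?I" "y \<in> extensional ?I" "z \<in> extensional ?I"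
      using p by (simp_all add: pp param_measure_def space_pair_measure space_PiM PiE_def)
    let ?u = "join_columns k (t, w, x, y, z)"
    have rows: "(\<Sum>j\<in>?I. ?u (i, j)) = (\<Sum>j=1..k - 2. t (i, j)) + w i + x i + y i + z i" if "i \<in> ?I" for i
      unfolding sum_column_split[OF k, of "\<lambda>j. ?u (i, j)"] join_columns_simps(2-5)[OF k that] using join_columns_simps(1)[OF k that] by simp
    have cols: "(\<Sum>i\<in>?I. ?u (i, j)) = (\<Sum>i\<in>?I. t (i, j))" if "j \<in> {1..k - 2}" for j
      using join_columns_simps(1)[OF k _ that] by (intro sum.cong) auto
    have last: "(\<Sum>i\<in>?I. ?u (i, k - 1)) = (\<Sum>i\<in>?I. w i)" "(\<Sum>i\<in>?I. ?u (i, k)) = (\<Sum>i\<in>?I. x i)"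
      "(\<Sum>i\<in>?I. ?u (i, k + 1)) = (\<Sum>i\<in>?I. y i)" "(\<Sum>i\<in>?I. ?u (i, k + 2)) = (\<Sum>i\<in>?I. z i)"
      by (intro sum.cong refl join_columns_simps(2-5)[OF k]; assumption)+
    show "?F (join_columns k p) = indicator (param_region k) p *\<^sub>R (case p of (t, w, x, y, z) \<Rightarrow>
       of_real Y powr (\<alpha>1 * of_real (\<Sum>i=1..k+2. w i) + \<alpha>2 * of_real (\<Sum>i=1..k+2. x i)
          - \<alpha>3 * of_real (\<Sum>i=1..k+2. y i) - \<alpha>4 * of_real (\<Sum>i=1..k+2. z i)) *
       of_real ((\<Prod>i=1..k+2. poly P (1 - (\<Sum>j=1..k-2. t (i, j)) - w i - x i - y i - z i)) *
          (\<Prod>j=1..k-2. poly P (1 - (\<Sum>i=1..k+2. t (i, j))))))"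
    proof (cases "?u \<in> ?I \<times> ?I \<rightarrow>\<^sub>E {0..1}")
      case False
      then have "p \<notin> param_region k"
        using join_columns_PiE_iff[OF k sp, of "\<lambda>_. {0..1}"] by (auto simp: param_region_def pp)
      then show ?thesis using False by (simp add: pp)
    next
      case True
      note u = True
      have cube: "t \<in> ?I \<times> {1..k - 2} \<rightarrow>\<^sub>E {0..1}" "w \<in> ?I \<rightarrow>\<^sub>E {0..1}" "x \<in> ?I \<rightarrow>\<^sub>E {0..1}" "y \<in> ?I \<rightarrow>\<^sub>E {0..1}" "z \<in> ?I \<rightarrow>\<^sub>E {0..1}"
        using join_columns_PiE_iff[OF k sp, of "\<lambda>_. {0..1}"] u by simp_all
      have r0: "(\<Sum>j\<in>?I. ?u (i, j)) \<ge> 0" if "i \<in> ?I" for i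
        using PiE_mem[OF u, of "(i, _)"] that by (intro sum_nonneg) auto
      have c0: "0 \<le> (\<Sum>i\<in>?I. ?u (i, j))" "(\<Sum>i\<in>?I. ?u (i, j)) \<le> real k + 2" if "j \<in> ?I" for j
      proof -
        have m: "?u (i, j) \<in> {0..1}" if "i \<in> ?I" for i using PiE_mem[OF u, of "(i, j)"] that \<open>j \<in> ?I\<close> by simp
        show "0 \<le> (\<Sum>i\<in>?I. ?u (i, j))" using m by (intro sum_nonneg) auto
        have "(\<Sum>i\<in>?I. ?u (i, j)) \<le> (\<Sum>i\<in>?I. 1)" using m by (intro sum_mono) auto
        then show "(\<Sum>i\<in>?I. ?u (i, j)) \<le> real k + 2" by simp
      qed
      define R where "R = (\<lambda>i. (\<Sum>j\<in>?I. ?u (i, j)))"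
      define S where "S = (\<lambda>j. (\<Sum>i\<in>?I. ?u (i, j)))"
      have W: "matrix_weight ?I ?I (\<lambda>_. cut_poly P) (column_weight k P c) ?u = (\<Prod>i\<in>?I. cut_poly P (R i)) *
        ((\<Prod>j=1..k - 2. cut_poly P (S j)) * (exp (c (k - 1) * of_real (S (k - 1))) * (exp (c k * of_real (S k)) * (exp (c (k + 1) * of_real (S (k + 1))) * exp (c (k + 2) * of_real (S (k + 2)))))))"
      proof -
        have "column_weight k P c j (S j) = exp (c j * of_real (S j))" if "j \<in> {k - 1, k, k + 1, k + 2}" for j
        proof -
          have "j \<in> ?I" "\<not> j \<le> k - 2" using that k by auto
          then show ?thesis using c0[of j] by (simp add: column_weight_def cut_exp_def S_def)
        qed
        moreover have "(\<Prod>j=1..k - 2. column_weight k P c j (S j)) = (\<Prod>j=1..k - 2. cut_poly P (S j))"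
          by (intro prod.cong) (auto simp: column_weight_def)
        moreover have "matrix_weight ?I ?I (\<lambda>_. cut_poly P) (column_weight k P c) ?u = (\<Prod>i\<in>?I. cut_poly P (R i)) * (\<Prod>j\<in>?I. column_weight k P c j (S j))"
          by (simp only: matrix_weight_def R_def S_def)
        ultimately show ?thesis by (simp only: prod_column_split[OF k, of "\<lambda>j. column_weight k P c j (S j)"] insertI1 insertI2)
      qed
      have reg: "p \<in> param_region k \<longleftrightarrow> (\<forall>i\<in>?I. R i \<le> 1) \<and> (\<forall>j\<in>{1..k - 2}. S j \<le> 1)"
      proof -
        have "(\<forall>i\<in>?I. (\<Sum>j=1..k - 2. t (i, j)) + w i + x i + y i + z i \<le> 1) \<longleftrightarrow> (\<forall>i\<in>?I. R i \<le> 1)"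
          by (intro ball_cong refl) (simp only: R_def rows)
        moreover have "(\<forall>j\<in>{1..k - 2}. (\<Sum>i\<in>?I. t (i, j)) \<le> 1) \<longleftrightarrow> (\<forall>j\<in>{1..k - 2}. S j \<le> 1)"
          by (intro ball_cong refl) (simp only: S_def cols)
        ultimately show ?thesis unfolding param_region_def pp mem_Collect_eq prod.case using cube by (simp only: simp_thms)
      qed
      show ?thesis
      proof (cases "p \<in> param_region k")
        case False
        then consider i where "i \<in> ?I" "R i > 1" | j where "j \<in> {1..k - 2}" "S j > 1" unfolding reg by (meson not_le)
        then have "(\<Prod>i\<in>?I. cut_poly P (R i)) * (\<Prod>j=1..k - 2. cut_poly P (S j)) = 0"
        proof cases
          case 1
          then have "cut_poly P (R i) = 0" by (simp add: cut_poly_def)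
          then have "(\<Prod>i\<in>?I. cut_poly P (R i)) = 0" using 1(1) by (intro prod_zero) auto
          then show ?thesis by simp
        next
          case 2
          then have "cut_poly P (S j) = 0" by (simp add: cut_poly_def)
          then have "(\<Prod>j=1..k - 2. cut_poly P (S j)) = 0" using 2(1) by (intro prod_zero) auto
          then show ?thesis by simp
        qed
        then have "matrix_weight ?I ?I (\<lambda>_. cut_poly P) (column_weight k P c) ?u = 0" unfolding W by (simp only: mult.assoc[symmetric]) simp
        then show ?thesis using False by (simp add: pp)
      next
        case True
        have "(\<Prod>i\<in>?I. cut_poly P (R i)) = of_real (\<Prod>i\<in>?I. poly P (1 - R i))"
          using True r0 unfolding reg of_real_prod by (intro prod.cong) (auto simp: cut_poly_def R_def)
        moreover have "(\<Prod>i\<in>?I. poly P (1 - R i)) = (\<Prod>i=1..k+2. poly P (1 - (\<Sum>j=1..k-2. t (i, j)) - w i - x i - y i - z i))"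
          by (intro prod.cong refl arg_cong[of _ _ "poly P"]) (simp only: R_def rows diff_diff_eq)
        moreover have "(\<Prod>j=1..k - 2. cut_poly P (S j)) = of_real (\<Prod>j=1..k - 2. poly P (1 - S j))"
          using True c0(1) unfolding reg of_real_prod by (intro prod.cong) (auto simp: cut_poly_def S_def)
        moreover have "(\<Prod>j=1..k - 2. poly P (1 - S j)) = (\<Prod>j=1..k-2. poly P (1 - (\<Sum>i=1..k+2. t (i, j))))"
          by (intro prod.cong refl arg_cong[of _ _ "poly P"]) (simp only: S_def cols)
        moreover have "of_real Y powr (\<alpha>1 * of_real (\<Sum>i=1..k+2. w i) + \<alpha>2 * of_real (\<Sum>i=1..k+2. x i)
          - \<alpha>3 * of_real (\<Sum>i=1..k+2. y i) - \<alpha>4 * of_real (\<Sum>i=1..k+2. z i)) =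
          exp (c (k - 1) * of_real (S (k - 1))) * (exp (c k * of_real (S k)) * (exp (c (k + 1) * of_real (S (k + 1))) * exp (c (k + 2) * of_real (S (k + 2)))))"
        proof -
          have "c (k - 1) = \<alpha>1 * of_real (ln Y)" "c k = \<alpha>2 * of_real (ln Y)" "c (k + 1) = - \<alpha>3 * of_real (ln Y)" "c (k + 2) = - \<alpha>4 * of_real (ln Y)"
            using k by (auto simp: c_def shift_vector_def)
          moreover have "of_real Y powr v = exp (v * of_real (ln Y))" for v :: complex using Y by (simp add: powr_def Ln_of_real)
          ultimately show ?thesis
            unfolding S_def last exp_add[symmetric] by (simp only: algebra_simps mult_minus_left add_uminus_conv_diff minus_add_distrib)
        qed
        ultimately have "matrix_weight ?I ?I (\<lambda>_. cut_poly P) (column_weight k P c) ?u =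
            of_real Y powr (\<alpha>1 * of_real (\<Sum>i=1..k+2. w i) + \<alpha>2 * of_real (\<Sum>i=1..k+2. x i)
              - \<alpha>3 * of_real (\<Sum>i=1..k+2. y i) - \<alpha>4 * of_real (\<Sum>i=1..k+2. z i)) *
            of_real ((\<Prod>i=1..k+2. poly P (1 - (\<Sum>j=1..k-2. t (i, j)) - w i - x i - y i - z i)) *
              (\<Prod>j=1..k-2. poly P (1 - (\<Sum>i=1..k+2. t (i, j)))))"
          unfolding W of_real_mult by (simp only: mult_ac)
        then show ?thesis using True u unfolding pp prod.case by (simp only: indicator_simps)
      qed
    qed
  qed
  finally show ?thesis by simp
qed

section \<open>Smooth weights\<close>

lemma deriv_vanish_open:
  fixes f :: "real \<Rightarrow> real"
  assumes "open S" "\<And>t. t \<in> S \<Longrightarrow> f t = 0" "t \<in> S"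
  shows "(deriv ^^ j) f t = 0"
  using assms(3)
proof (induction j arbitrary: t)
  case (Suc j)
  have "((deriv ^^ j) f has_real_derivative 0) (at t)"
    by (rule has_field_derivative_transform_within_open[OF DERIV_const assms(1) Suc.prems]) (simp add: Suc.IH)
  then show ?case by (simp add: DERIV_imp_deriv)
qed (simp add: assms)

lemma scaled_derivs:
  fixes F :: "real \<Rightarrow> real"
  assumes F: "\<And>j u. (deriv ^^ j) F field_differentiable (at u)" and T: "T > 0"
  shows "(deriv ^^ j) (\<lambda>x. F (x / T)) = (\<lambda>t. (deriv ^^ j) F (t / T) / T ^ j)"
    and "((deriv ^^ j) (\<lambda>x. F (x / T)) has_real_derivative (deriv ^^ Suc j) (\<lambda>x. F (x / T)) t) (at t)"
proof -
  have d: "((\<lambda>t. (deriv ^^ j) F (t / T) / T ^ j) has_real_derivative (deriv ^^ Suc j) F (t / T) / T ^ Suc j) (at t)" for j t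
  proof -
    have 1: "((deriv ^^ j) F has_real_derivative deriv ((deriv ^^ j) F) (t / T)) (at (t / T))"
      using F DERIV_deriv_iff_field_differentiable by blast
    have 2: "((\<lambda>t. t / T) has_real_derivative 1 / T) (at t)" by (intro DERIV_cdivide DERIV_ident)
    have "((\<lambda>t. (deriv ^^ j) F (t / T) / T ^ j) has_real_derivative deriv ((deriv ^^ j) F) (t / T) * (1 / T) / T ^ j) (at t)"
      by (intro DERIV_cdivide DERIV_chain2[OF 1 2])
    moreover have "deriv ((deriv ^^ j) F) (t / T) * (1 / T) / T ^ j = (deriv ^^ Suc j) F (t / T) / T ^ Suc j"
      by (simp add: mult.commute)
    ultimately show ?thesis by (simp only:)
  qed
  have e: "(deriv ^^ j) (\<lambda>x. F (x / T)) = (\<lambda>t. (deriv ^^ j) F (t / T) / T ^ j)" for j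
  proof (induction j)
    case (Suc j)
    have "(deriv ^^ Suc j) (\<lambda>x. F (x / T)) = deriv (\<lambda>t. (deriv ^^ j) F (t / T) / T ^ j)" by (simp add: Suc.IH)
    also have "\<dots> = (\<lambda>t. (deriv ^^ Suc j) F (t / T) / T ^ Suc j)" by (rule ext) (rule DERIV_imp_deriv[OF d])
    finally show ?case .
  qed simp
  show "(deriv ^^ j) (\<lambda>x. F (x / T)) = (\<lambda>t. (deriv ^^ j) F (t / T) / T ^ j)" by (rule e)
  show "((deriv ^^ j) (\<lambda>x. F (x / T)) has_real_derivative (deriv ^^ Suc j) (\<lambda>x. F (x / T)) t) (at t)"
    unfolding e by (rule d)
qed

text \<open>The constants and thresholds depend on the order of differentiation, so a common choice
  is possible only for the finitely many orders up to \<open>N\<close>. Smoothness and support hold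
  for all orders at once.\<close>

lemma smooth_weight_derivs:
  assumes "smooth_weight \<Phi>"
  shows "\<exists>C\<ge>1. \<forall>\<^sub>F T in at_top.
    (\<forall>j t. ((deriv ^^ j) (\<lambda>x. \<Phi> T (x / T)) has_real_derivative (deriv ^^ Suc j) (\<lambda>x. \<Phi> T (x / T)) t) (at t)) \<and>
    (\<forall>j t. t \<notin> {T / 4..2 * T} \<longrightarrow> (deriv ^^ j) (\<lambda>x. \<Phi> T (x / T)) t = 0) \<and>
    (\<forall>j\<le>N. \<forall>t. \<bar>(deriv ^^ j) (\<lambda>x. \<Phi> T (x / T)) t\<bar> \<le> C * (ln T / T) ^ j) \<and> (\<forall>u. 0 \<le> \<Phi> T u \<and> \<Phi> T u \<le> 1)"
proof -
  have ev1: "\<forall>\<^sub>F T in at_top. (\<forall>j u. (deriv ^^ j) (\<Phi> T) field_differentiable (at u)) \<and> (\<forall>u. 0 \<le> \<Phi> T u \<and> \<Phi> T u \<le> 1) \<and> closure {u. \<Phi> T u \<noteq> 0} \<subseteq> {1/4..2}"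
    and "\<forall>j. \<exists>C. \<forall>\<^sub>F T in at_top. \<forall>t. \<bar>(deriv ^^ j) (\<lambda>x. \<Phi> T (x / T)) t\<bar> \<le> C * (T / ln T) powi (- int j)"
    using assms unfolding smooth_weight_def by (rule conjunct1, rule conjunct2)
  from choice[OF this(2)] obtain C where C: "\<forall>j. \<forall>\<^sub>F T in at_top. \<forall>t. \<bar>(deriv ^^ j) (\<lambda>x. \<Phi> T (x / T)) t\<bar> \<le> C j * (T / ln T) powi (- int j)" ..
  define D where "D = 1 + (\<Sum>j\<le>N. \<bar>C j\<bar>)"
  have CD: "C j \<le> D" if "j \<le> N" for j
  proof -
    have "\<bar>C j\<bar> \<le> (\<Sum>j\<le>N. \<bar>C j\<bar>)" using that by (intro member_le_sum) auto
    then show ?thesis unfolding D_def by linarith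
  qed
  have ev2: "\<forall>\<^sub>F T in at_top. \<forall>j\<in>{..N}. \<forall>t. \<bar>(deriv ^^ j) (\<lambda>x. \<Phi> T (x / T)) t\<bar> \<le> C j * (T / ln T) powi (- int j)"
    using C by (intro eventually_ball_finite) auto
  show ?thesis
  proof (intro exI[of _ D] conjI)
    show "1 \<le> D" unfolding D_def by (simp add: sum_nonneg)
    show "\<forall>\<^sub>F T in at_top.
    (\<forall>j t. ((deriv ^^ j) (\<lambda>x. \<Phi> T (x / T)) has_real_derivative (deriv ^^ Suc j) (\<lambda>x. \<Phi> T (x / T)) t) (at t)) \<and>
    (\<forall>j t. t \<notin> {T / 4..2 * T} \<longrightarrow> (deriv ^^ j) (\<lambda>x. \<Phi> T (x / T)) t = 0) \<and>
    (\<forall>j\<le>N. \<forall>t. \<bar>(deriv ^^ j) (\<lambda>x. \<Phi> T (x / T)) t\<bar> \<le> D * (ln T / T) ^ j) \<and> (\<forall>u. 0 \<le> \<Phi> T u \<and> \<Phi> T u \<le> 1)"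
      using ev1 ev2 eventually_gt_at_top[of 1]
    proof eventually_elim
      case (elim T)
      then have T: "T > 1" "T > 0" and F: "\<And>j u. (deriv ^^ j) (\<Phi> T) field_differentiable (at u)"
        and cl: "closure {u. \<Phi> T u \<noteq> 0} \<subseteq> {1/4..2}" and ub: "\<forall>u. 0 \<le> \<Phi> T u \<and> \<Phi> T u \<le> 1" by auto
      have v: "(deriv ^^ j) (\<lambda>x. \<Phi> T (x / T)) t = 0" if "t \<notin> {T / 4..2 * T}" for j t
      proof (rule deriv_vanish_open[of "- {T / 4..2 * T}"])
        show "open (- {T / 4..2 * T})" by (intro open_Compl) simp
        show "t \<in> - {T / 4..2 * T}" using that by simp
        fix s assume s: "s \<in> - {T / 4..2 * T}"
        then have "s / T \<notin> {1/4..2}" using T by (auto simp: field_simps)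
        then have "s / T \<notin> {u. \<Phi> T u \<noteq> 0}" by (rule contra_subsetD[OF order_trans[OF closure_subset cl]])
        then show "\<Phi> T (s / T) = 0" by simp
      qed
      have b: "\<bar>(deriv ^^ j) (\<lambda>x. \<Phi> T (x / T)) t\<bar> \<le> D * (ln T / T) ^ j" if "j \<le> N" for j t
      proof -
        have "\<bar>(deriv ^^ j) (\<lambda>x. \<Phi> T (x / T)) t\<bar> \<le> C j * (T / ln T) powi (- int j)" using elim(2) that by (simp only: atMost_iff Ball_def)
        also have "(T / ln T) powi (- int j) = (ln T / T) ^ j" by (simp add: power_int_minus power_divide)
        also have "C j * (ln T / T) ^ j \<le> D * (ln T / T) ^ j" using CD[OF that] T by (intro mult_right_mono zero_le_power) auto
        finally show ?thesis .
      qed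
      show ?case by (intro conjI allI impI scaled_derivs(2)[OF F T(2)] v b) (use ub in simp_all)
    qed
  qed
qed

section \<open>Mean values of products of Dirichlet polynomials\<close>

text \<open>The integer nearest to \<open>q\<close> already differs from it by a relative amount of
  about \<open>1 / q\<close>, however large \<open>p\<close> may be. Bounding one side alone keeps
  the long zeta polynomials out of the frequency gap.\<close>

lemma abs_ln_diff_ge:
  fixes p q :: nat
  assumes "p \<ge> 1" "q \<ge> 1" "q \<le> Q" "p \<noteq> q"
  shows "\<bar>ln (real p) - ln (real q)\<bar> \<ge> 1 / (2 * real Q)"
proof -
  have q: "1 / (2 * real Q) \<le> 1 / (2 * real q)" using assms by (intro divide_left_mono) auto
  show ?thesis
  proof (cases "p < q")
    case True
    have "ln (real p / real q) \<le> real p / real q - 1" using assms by (intro ln_le_minus_one) auto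
    moreover have "real p / real q \<le> 1 - 1 / real q" using True assms by (simp add: field_simps)
    moreover have "ln (real p / real q) = ln (real p) - ln (real q)" using assms by (simp add: ln_div)
    moreover have "1 / (2 * real q) \<le> 1 / real q" using assms by (intro divide_left_mono) auto
    ultimately show ?thesis using q by linarith
  next
    case False
    then have pq: "real p \<ge> real q + 1" using assms by linarith
    have "ln (real q / real p) \<le> real q / real p - 1" using assms by (intro ln_le_minus_one) auto
    moreover have "real q / real p \<le> real q / (real q + 1)" using assms pq by (intro divide_left_mono) auto
    moreover have "real q / (real q + 1) = 1 - 1 / (real q + 1)" by (simp add: field_simps)
    moreover have "1 / (2 * real q) \<le> 1 / (real q + 1)" using assms by (intro divide_left_mono) auto
    moreover have "ln (real q / real p) = ln (real q) - ln (real p)" using assms by (simp add: ln_div)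
    ultimately show ?thesis using q by linarith
  qed
qed

text \<open>After expansion each pair of tuples carries the frequency \<open>ln\<close> of the
  quotient of its products. Frequency 0 is the diagonal; any other is at least
  \<open>1 / (2 * Y ^ card I)\<close>, and since \<open>N\<close> is free the crude count of all
  pairs is affordable. The factors \<open>\<rho>\<close> allow coefficients depending on the height,
  as the last term of a zeta polynomial has.\<close>

lemma oscillatory_moment:
  fixes a :: "'i \<Rightarrow> nat \<Rightarrow> complex" and b :: "'j \<Rightarrow> nat \<Rightarrow> complex" and \<rho> :: "'j \<Rightarrow> nat \<Rightarrow> complex \<Rightarrow> complex"
    and \<phi> :: "nat \<Rightarrow> real \<Rightarrow> real" and h :: "complex \<Rightarrow> complex"
  assumes IJ: "finite I" "finite J" and u: "u \<le> v" and c: "c \<ge> 0" and \<delta>: "\<delta> > 0"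
    and der: "\<And>j t. t \<in> {u..v} \<Longrightarrow> (\<phi> j has_real_derivative \<phi> (Suc j) t) (at t)"
    and van: "\<And>j. \<phi> j u = 0" "\<And>j. \<phi> j v = 0"
    and bd: "\<And>j t. j \<le> N \<Longrightarrow> t \<in> {u..v} \<Longrightarrow> \<bar>\<phi> j t\<bar> \<le> c * \<delta> ^ j"
    and S: "open S" "h holomorphic_on S" and r: "r > 0" "1 / r \<le> \<delta>"
    and disc: "\<And>t. t \<in> {u..v} \<Longrightarrow> cball (of_real t) r \<subseteq> S"
    and hB: "\<And>z. z \<in> S \<Longrightarrow> norm (h z) \<le> B"
    and \<rho>: "\<And>j n. \<rho> j n holomorphic_on S" "\<And>j n z. z \<in> S \<Longrightarrow> norm (\<rho> j n z) \<le> 1"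
    and Q: "Q \<ge> 0" "\<And>i n. i \<in> I \<Longrightarrow> n \<in> {1..Y} \<Longrightarrow> norm (a i n) \<le> Q" "\<And>j n. j \<in> J \<Longrightarrow> n \<in> {1..M} \<Longrightarrow> norm (b j n) \<le> Q"
  shows "norm (integral {u..v} (\<lambda>t. of_real (\<phi> 0 t) * h (of_real t) * (\<Prod>i\<in>I. \<Sum>n=1..Y. a i n * exp (- \<i> * of_real (t * ln (real n)))) *
      (\<Prod>j\<in>J. \<Sum>n=1..M. b j n * \<rho> j n (of_real t) * exp (\<i> * of_real (t * ln (real n)))))
    - (\<Sum>(\<mu>, \<nu>)\<in>{(\<mu>, \<nu>). \<mu> \<in> I \<rightarrow>\<^sub>E {1..Y} \<and> \<nu> \<in> J \<rightarrow>\<^sub>E {1..M} \<and> (\<Prod>i\<in>I. \<mu> i) = (\<Prod>j\<in>J. \<nu> j)}.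
        (\<Prod>i\<in>I. a i (\<mu> i)) * (\<Prod>j\<in>J. b j (\<nu> j)) * integral {u..v} (\<lambda>t. of_real (\<phi> 0 t) * (h (of_real t) * (\<Prod>j\<in>J. \<rho> j (\<nu> j) (of_real t))))))
    \<le> real Y ^ card I * real M ^ card J * (Q ^ card I * Q ^ card J * ((v - u) * c * B * fact N * (4 * \<delta> * real Y ^ card I) ^ N))"
proof -
  define U where "U = (I \<rightarrow>\<^sub>E {1..Y}) \<times> (J \<rightarrow>\<^sub>E {1..M})"
  define \<Delta> where "\<Delta> = {(\<mu>, \<nu>). \<mu> \<in> I \<rightarrow>\<^sub>E {1..Y} \<and> \<nu> \<in> J \<rightarrow>\<^sub>E {1..M} \<and> (\<Prod>i\<in>I. \<mu> i) = (\<Prod>j\<in>J. \<nu> j)}"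
  define coef where "coef = (\<lambda>(\<mu>, \<nu>). (\<Prod>i\<in>I. a i (\<mu> i)) * (\<Prod>j\<in>J. b j (\<nu> j)))"
  define x where "x = (\<lambda>(\<mu>, \<nu>). ln (real (\<Prod>j\<in>J. \<nu> j)) - ln (real (\<Prod>i\<in>I. \<mu> i)))"
  define hh where "hh = (\<lambda>p :: ('i \<Rightarrow> nat) \<times> ('j \<Rightarrow> nat). \<lambda>z. h z * (\<Prod>j\<in>J. \<rho> j (snd p j) z))"
  define E where "E = (v - u) * c * B * fact N * (4 * \<delta> * real Y ^ card I) ^ N"
  define G where "G = (\<lambda>p t. of_real (\<phi> 0 t) * hh p (of_real t) * exp (\<i> * complex_of_real (x p * t)))"
  have finU: "finite U" unfolding U_def using IJ by (intro finite_cartesian_product finite_PiE) auto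
  have \<Delta>U: "\<Delta> \<subseteq> U" by (auto simp: \<Delta>_def U_def)
  have hhS: "hh p holomorphic_on S" for p unfolding hh_def using S(2) \<rho>(1) by (intro holomorphic_intros) auto
  have \<rho>1: "norm (\<Prod>j\<in>J. \<rho> j (f j) z) \<le> 1" if "z \<in> S" for f z
    unfolding prod_norm[symmetric] using \<rho>(2)[OF that] by (intro prod_le_1) auto
  have hhB: "norm (hh p z) \<le> B" if "z \<in> S" for p z
    using mult_mono[OF hB[OF that] \<rho>1[OF that, of "snd p"]] order_trans[OF norm_ge_zero hB[OF that]] by (simp add: hh_def norm_mult)
  have tS: "complex_of_real t \<in> S" if "t \<in> {u..v}" for t using disc[OF that] r(1) by auto
  have cont: "continuous_on {u..v} (G p)" for p
  proof -
    have "continuous_on {u..v} (\<phi> 0)" using der[of _ 0] by (meson DERIV_isCont continuous_at_imp_continuous_on)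
    moreover have "continuous_on {u..v} (\<lambda>t. hh p (complex_of_real t))"
      by (rule continuous_on_compose2[OF holomorphic_on_imp_continuous_on[OF hhS]]) (use tS in \<open>auto intro!: continuous_intros\<close>)
    ultimately show ?thesis unfolding G_def by (intro continuous_intros)
  qed
  have int: "G p integrable_on {u..v}" for p by (rule integrable_continuous_interval[OF cont])
  have ln_prod': "ln (real (\<Prod>i\<in>A. f i)) = (\<Sum>i\<in>A. ln (real (f i)))" if "finite A" "f \<in> A \<rightarrow>\<^sub>E {1..Z}" for A :: "'z set" and f :: "'z \<Rightarrow> nat" and Z
    using that by (auto simp: ln_prod PiE_iff Pi_iff Suc_le_eq intro!: ln_prod)
  have expand: "of_real (\<phi> 0 t) * h (of_real t) * (\<Prod>i\<in>I. \<Sum>n=1..Y. a i n * exp (- \<i> * of_real (t * ln (real n)))) *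
      (\<Prod>j\<in>J. \<Sum>n=1..M. b j n * \<rho> j n (of_real t) * exp (\<i> * of_real (t * ln (real n)))) = (\<Sum>p\<in>U. coef p * G p t)" for t
  proof -
    have e1: "(\<Prod>i\<in>I. \<Sum>n=1..Y. a i n * exp (- \<i> * of_real (t * ln (real n)))) = (\<Sum>\<mu>\<in>I \<rightarrow>\<^sub>E {1..Y}. (\<Prod>i\<in>I. a i (\<mu> i) * exp (- \<i> * of_real (t * ln (real (\<mu> i))))))"
      using IJ by (intro prod_sum_PiE) auto
    have e2: "(\<Prod>j\<in>J. \<Sum>n=1..M. b j n * \<rho> j n (of_real t) * exp (\<i> * of_real (t * ln (real n)))) = (\<Sum>\<nu>\<in>J \<rightarrow>\<^sub>E {1..M}. (\<Prod>j\<in>J. b j (\<nu> j) * \<rho> j (\<nu> j) (of_real t) * exp (\<i> * of_real (t * ln (real (\<nu> j))))))"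
      using IJ by (intro prod_sum_PiE) auto
    have e3: "of_real (\<phi> 0 t) * h (of_real t) * ((\<Prod>i\<in>I. a i (\<mu> i) * exp (- \<i> * of_real (t * ln (real (\<mu> i))))) *
       (\<Prod>j\<in>J. b j (\<nu> j) * \<rho> j (\<nu> j) (of_real t) * exp (\<i> * of_real (t * ln (real (\<nu> j)))))) = coef (\<mu>, \<nu>) * G (\<mu>, \<nu>) t"
      if "\<mu> \<in> I \<rightarrow>\<^sub>E {1..Y}" "\<nu> \<in> J \<rightarrow>\<^sub>E {1..M}" for \<mu> \<nu>
    proof -
      have 1: "(\<Prod>i\<in>I. exp (- \<i> * of_real (t * ln (real (\<mu> i))))) = exp (- \<i> * of_real (t * ln (real (\<Prod>i\<in>I. \<mu> i))))"
        unfolding ln_prod'[OF IJ(1) that(1)] using IJ by (simp add: exp_sum[symmetric] sum_distrib_left sum_negf)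
      have 2: "(\<Prod>j\<in>J. exp (\<i> * of_real (t * ln (real (\<nu> j))))) = exp (\<i> * of_real (t * ln (real (\<Prod>j\<in>J. \<nu> j))))"
        unfolding ln_prod'[OF IJ(2) that(2)] using IJ by (simp add: exp_sum[symmetric] sum_distrib_left)
      have 3: "exp (- \<i> * of_real (t * ln (real (\<Prod>i\<in>I. \<mu> i)))) * exp (\<i> * of_real (t * ln (real (\<Prod>j\<in>J. \<nu> j)))) = exp (\<i> * complex_of_real (x (\<mu>, \<nu>) * t))"
        unfolding exp_add[symmetric] x_def prod.case by (intro arg_cong[of _ _ exp]) (simp only: of_real_mult of_real_diff mult_minus_left algebra_simps add_uminus_conv_diff)
      show ?thesis unfolding prod.distrib 1 2 coef_def G_def hh_def prod.case snd_conv 3[symmetric] by (simp only: mult_ac)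
    qed
    let ?C = "of_real (\<phi> 0 t) * h (of_real t)" and ?F1 = "\<lambda>\<mu>. \<Prod>i\<in>I. a i (\<mu> i) * exp (- \<i> * of_real (t * ln (real (\<mu> i))))"
      and ?F2 = "\<lambda>\<nu>. \<Prod>j\<in>J. b j (\<nu> j) * \<rho> j (\<nu> j) (of_real t) * exp (\<i> * of_real (t * ln (real (\<nu> j))))"
    have "?C * (\<Sum>\<mu>\<in>I \<rightarrow>\<^sub>E {1..Y}. ?F1 \<mu>) * (\<Sum>\<nu>\<in>J \<rightarrow>\<^sub>E {1..M}. ?F2 \<nu>) = (\<Sum>\<mu>\<in>I \<rightarrow>\<^sub>E {1..Y}. \<Sum>\<nu>\<in>J \<rightarrow>\<^sub>E {1..M}. ?C * (?F1 \<mu> * ?F2 \<nu>))"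
      unfolding mult.assoc[of ?C] unfolding sum_product unfolding sum_distrib_left by (rule refl)
    also have "\<dots> = (\<Sum>\<mu>\<in>I \<rightarrow>\<^sub>E {1..Y}. \<Sum>\<nu>\<in>J \<rightarrow>\<^sub>E {1..M}. coef (\<mu>, \<nu>) * G (\<mu>, \<nu>) t)"
      by (intro sum.cong refl e3)
    also have "\<dots> = (\<Sum>p\<in>U. coef p * G p t)"
      by (simp only: U_def sum.cartesian_product split_def prod.collapse)
    finally show ?thesis unfolding e1 e2 .
  qed
  have norm_coef: "norm (coef p) \<le> Q ^ card I * Q ^ card J" if "p \<in> U" for p
  proof -
    have "norm (\<Prod>i\<in>I. a i (fst p i)) \<le> (\<Prod>i\<in>I. Q)" "norm (\<Prod>j\<in>J. b j (snd p j)) \<le> (\<Prod>j\<in>J. Q)"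
    proof -
      have m: "fst p \<in> I \<rightarrow>\<^sub>E {1..Y}" "snd p \<in> J \<rightarrow>\<^sub>E {1..M}" using that by (auto simp: U_def)
      show "norm (\<Prod>i\<in>I. a i (fst p i)) \<le> (\<Prod>i\<in>I. Q)"
        unfolding prod_norm[symmetric] by (intro prod_mono conjI norm_ge_zero Q(2) PiE_mem[OF m(1)])
      show "norm (\<Prod>j\<in>J. b j (snd p j)) \<le> (\<Prod>j\<in>J. Q)"
        unfolding prod_norm[symmetric] by (intro prod_mono conjI norm_ge_zero Q(3) PiE_mem[OF m(2)])
    qed
    then have "norm (\<Prod>i\<in>I. a i (fst p i)) \<le> Q ^ card I" "norm (\<Prod>j\<in>J. b j (snd p j)) \<le> Q ^ card J" by simp_all
    then show ?thesis unfolding coef_def split_def norm_mult using Q(1) by (intro mult_mono) auto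
  qed
  have off: "norm (integral {u..v} (G p)) \<le> E" if p: "p \<in> U - \<Delta>" for p
  proof -
    obtain \<mu> \<nu> where pp: "p = (\<mu>, \<nu>)" by (cases p)
    have mn: "\<mu> \<in> I \<rightarrow>\<^sub>E {1..Y}" "\<nu> \<in> J \<rightarrow>\<^sub>E {1..M}" "(\<Prod>j\<in>J. \<nu> j) \<noteq> (\<Prod>i\<in>I. \<mu> i)" using p by (auto simp: pp U_def \<Delta>_def)
    have p1: "(\<Prod>i\<in>I. \<mu> i) \<ge> 1" "(\<Prod>j\<in>J. \<nu> j) \<ge> 1"
      using PiE_mem[OF mn(1)] PiE_mem[OF mn(2)] by (auto intro!: prod_ge_1 simp del: One_nat_def)
    have "(\<Prod>i\<in>I. \<mu> i) \<le> (\<Prod>i\<in>I. Y)" using mn by (intro prod_mono) (auto simp: PiE_iff)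
    then have pY: "(\<Prod>i\<in>I. \<mu> i) \<le> Y ^ card I" by simp
    have xb: "\<bar>x p\<bar> \<ge> 1 / (2 * real (Y ^ card I))" unfolding pp x_def prod.case using abs_ln_diff_ge[OF p1(2,1) pY mn(3)] .
    have Y0: "real (Y ^ card I) > 0" using p1 pY by linarith
    then have x0: "\<bar>x p\<bar> > 0" using xb by (meson divide_pos_pos less_le_trans mult_pos_pos zero_less_numeral zero_less_one)
    have "2 * \<delta> / \<bar>x p\<bar> \<le> 2 * \<delta> / (1 / (2 * real (Y ^ card I)))"
      using xb \<delta> x0 Y0 by (intro divide_left_mono) auto
    also have "\<dots> = 4 * \<delta> * real Y ^ card I" by simp
    finally have xx: "(2 * \<delta> / \<bar>x p\<bar>) ^ N \<le> (4 * \<delta> * real Y ^ card I) ^ N" using \<delta> by (intro power_mono) auto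
    have B0: "B \<ge> 0" using order_trans[OF norm_ge_zero hB[OF tS[of u]]] u by simp
    have "norm (integral {u..v} (G p)) \<le> (v - u) * c * B * fact N * (2 * \<delta> / \<bar>x p\<bar>) ^ N"
      unfolding G_def using x0
      by (intro norm_oscillatory_integral_le[OF u _ c \<delta> der van bd S(1) hhS r disc hhB]) auto
    also have "\<dots> \<le> E" unfolding E_def using xx u c B0 by (intro mult_left_mono) auto
    finally show ?thesis .
  qed
  have "integral {u..v} (\<lambda>t. \<Sum>p\<in>U. coef p * G p t) = (\<Sum>p\<in>U. coef p * integral {u..v} (G p))"
    using finU int by (simp add: integral_sum integrable_on_mult_right)
  also have "\<dots> = (\<Sum>p\<in>U - \<Delta>. coef p * integral {u..v} (G p)) + (\<Sum>p\<in>\<Delta>. coef p * integral {u..v} (G p))"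
    by (rule sum.subset_diff[OF \<Delta>U finU])
  also have "(\<Sum>p\<in>\<Delta>. coef p * integral {u..v} (G p)) = (\<Sum>(\<mu>, \<nu>)\<in>\<Delta>. (\<Prod>i\<in>I. a i (\<mu> i)) * (\<Prod>j\<in>J. b j (\<nu> j)) * integral {u..v} (\<lambda>t. of_real (\<phi> 0 t) * (h (of_real t) * (\<Prod>j\<in>J. \<rho> j (\<nu> j) (of_real t)))))"
  proof (rule sum.cong[OF refl])
    fix p assume p: "p \<in> \<Delta>"
    obtain \<mu> \<nu> where pp: "p = (\<mu>, \<nu>)" by (cases p)
    have "(\<Prod>i\<in>I. \<mu> i) = (\<Prod>j\<in>J. \<nu> j)" using p by (auto simp: pp \<Delta>_def)
    then have "x p = 0" unfolding pp x_def prod.case by (simp only: diff_self)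
    then show "coef p * integral {u..v} (G p) = (case p of (\<mu>, \<nu>) \<Rightarrow> (\<Prod>i\<in>I. a i (\<mu> i)) * (\<Prod>j\<in>J. b j (\<nu> j)) * integral {u..v} (\<lambda>t. of_real (\<phi> 0 t) * (h (of_real t) * (\<Prod>j\<in>J. \<rho> j (\<nu> j) (of_real t)))))"
      unfolding G_def coef_def hh_def by (simp add: pp)
  qed
  finally have eq: "integral {u..v} (\<lambda>t. \<Sum>p\<in>U. coef p * G p t) - (\<Sum>(\<mu>, \<nu>)\<in>\<Delta>. (\<Prod>i\<in>I. a i (\<mu> i)) * (\<Prod>j\<in>J. b j (\<nu> j)) * integral {u..v} (\<lambda>t. of_real (\<phi> 0 t) * (h (of_real t) * (\<Prod>j\<in>J. \<rho> j (\<nu> j) (of_real t))))) = (\<Sum>p\<in>U - \<Delta>. coef p * integral {u..v} (G p))"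
    by (simp only: add_diff_cancel_right')
  have E0: "E \<ge> 0 \<or> U - \<Delta> = {}" using off order_trans[OF norm_ge_zero] by blast
  have "norm (\<Sum>p\<in>U - \<Delta>. coef p * integral {u..v} (G p)) \<le> (\<Sum>p\<in>U - \<Delta>. (Q ^ card I * Q ^ card J) * E)"
    using norm_coef off Q(1) by (intro sum_norm_le) (auto simp: norm_mult intro!: mult_mono)
  also have "\<dots> \<le> real (card U) * ((Q ^ card I * Q ^ card J) * E)"
  proof (cases "U - \<Delta> = {}")
    case True
    have "B \<ge> 0" using order_trans[OF norm_ge_zero hB[OF tS[of u]]] u by simp
    then have "E \<ge> 0" unfolding E_def using u c \<delta> by simp
    then have "real (card U) * ((Q ^ card I * Q ^ card J) * E) \<ge> 0" using Q(1) by simp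
    then show ?thesis unfolding True by simp
  next
    case False
    have "real (card (U - \<Delta>)) \<le> real (card U)" using finU by (simp add: card_mono)
    then show ?thesis using E0 False Q(1) by (simp add: mult_right_mono)
  qed
  also have "real (card U) = real Y ^ card I * real M ^ card J"
    using IJ by (simp add: U_def card_cartesian_product card_PiE)
  finally show ?thesis unfolding expand \<Delta>_def[symmetric] eq E_def .
qed

section \<open>Dirichlet polynomial approximation of the moment\<close>

text \<open>The index \<open>n = M\<close> carries the tail \<open>M powr (1 - s) / (s - 1)\<close> of the approximation to \<open>zeta s\<close> at
  \<open>s = 1/2 + \<beta> - \<i> * z\<close>.\<close>
definition zeta_coeff :: "nat \<Rightarrow> complex \<Rightarrow> nat \<Rightarrow> complex" where
  "zeta_coeff M \<beta> n = (if n < M then of_nat n powr (- (1/2 + \<beta>)) else of_nat n powr (1/2 - \<beta>))"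

definition zeta_tail :: "nat \<Rightarrow> complex \<Rightarrow> nat \<Rightarrow> complex \<Rightarrow> complex" where
  "zeta_tail M \<beta> n z = (if n < M then 1 else 1 / (\<beta> - 1/2 - \<i> * z))"

lemma zeta_polynomial_eq:
  assumes "M \<ge> 1"
  shows "(\<Sum>n=1..M. zeta_coeff M \<beta> n * zeta_tail M \<beta> n (of_real t) * exp (\<i> * of_real (t * ln (real n)))) =
    (\<Sum>n\<in>{1..<M}. of_nat n powr (- (1/2 + \<beta> - \<i> * of_real t))) + of_nat M powr (1 - (1/2 + \<beta> - \<i> * of_real t)) / ((1/2 + \<beta> - \<i> * of_real t) - 1)"
proof -
  have e: "of_nat n powr (c + \<i> * of_real t) = of_nat n powr c * exp (\<i> * of_real (t * ln (real n)))" if "n \<ge> 1" for n and c :: complex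
  proof -
    have "of_nat n powr (c + \<i> * of_real t) = of_nat n powr c * of_nat n powr (\<i> * of_real t)" by (rule powr_add)
    also have "of_nat n powr (\<i> * of_real t) = exp (\<i> * of_real (t * ln (real n)))" using that by (simp add: powr_def mult_ac)
    finally show ?thesis .
  qed
  have "{1..M} = insert M {1..<M}" using assms by auto
  moreover have "(\<Sum>n\<in>{1..<M}. zeta_coeff M \<beta> n * zeta_tail M \<beta> n (of_real t) * exp (\<i> * of_real (t * ln (real n)))) = (\<Sum>n\<in>{1..<M}. of_nat n powr (- (1/2 + \<beta> - \<i> * of_real t)))"
  proof (rule sum.cong[OF refl])
    fix n assume n: "n \<in> {1..<M}"
    have "of_nat n powr (- (1/2 + \<beta> - \<i> * of_real t)) = of_nat n powr (- (1/2 + \<beta>) + \<i> * of_real t)"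
      by (intro arg_cong2[of _ _ _ _ "(powr)"] refl) (simp add: algebra_simps)
    also have "\<dots> = of_nat n powr (- (1/2 + \<beta>)) * exp (\<i> * of_real (t * ln (real n)))" using n by (intro e) auto
    finally show "zeta_coeff M \<beta> n * zeta_tail M \<beta> n (of_real t) * exp (\<i> * of_real (t * ln (real n))) = of_nat n powr (- (1/2 + \<beta> - \<i> * of_real t))"
      using n by (simp add: zeta_coeff_def zeta_tail_def)
  qed
  moreover have "zeta_coeff M \<beta> M * zeta_tail M \<beta> M (of_real t) * exp (\<i> * of_real (t * ln (real M))) = of_nat M powr (1 - (1/2 + \<beta> - \<i> * of_real t)) / ((1/2 + \<beta> - \<i> * of_real t) - 1)"
  proof -
    have r: "1 - (1/2 + \<beta> - \<i> * of_real t) = (1/2 - \<beta>) + \<i> * of_real t" "(1/2 + \<beta> - \<i> * of_real t) - 1 = \<beta> - 1/2 - \<i> * of_real t"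
      by (simp_all add: field_simps)
    have c: "zeta_coeff M \<beta> M = of_nat M powr (1/2 - \<beta>)" "zeta_tail M \<beta> M (of_real t) = 1 / (\<beta> - 1/2 - \<i> * of_real t)"
      by (simp_all add: zeta_coeff_def zeta_tail_def)
    show ?thesis unfolding r c e[OF assms] by (simp only: times_divide_eq_left times_divide_eq_right mult_1_right)
  qed
  ultimately show ?thesis by simp
qed

text \<open>For \<open>|\<beta>| <= 1/4\<close> the real part of
  \<open>s = 1/2 + \<beta> - \<i> * t\<close> is at least \<open>1/4\<close>, hence the power of
  \<open>M\<close>. The constant 13 is \<open>1 + 2 * 2 * 3\<close>, from
  \<open>|s| <= 2 * t\<close> and \<open>|s + 1| <= 3 * t\<close>.\<close>

lemma
  assumes \<beta>: "norm \<beta> \<le> 1/4" and t: "t \<ge> 1"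
  shows norm_zeta_minus_polynomial_le: "M \<ge> 1 \<Longrightarrow> norm (zeta (1/2 + \<beta> - \<i> * of_real t) -
      (\<Sum>n=1..M. zeta_coeff M \<beta> n * zeta_tail M \<beta> n (of_real t) * exp (\<i> * of_real (t * ln (real n))))) \<le> 13 * t\<^sup>2 * real M powr (- 1/4)"
    and norm_zeta_le: "norm (zeta (1/2 + \<beta> - \<i> * of_real t)) \<le> 15 * t\<^sup>2"
proof -
  let ?s = "1/2 + \<beta> - \<i> * of_real t"
  have re: "\<bar>Re \<beta>\<bar> \<le> 1/4" "\<bar>Im \<beta>\<bar> \<le> 1/4" using \<beta> abs_Re_le_cmod[of \<beta>] abs_Im_le_cmod[of \<beta>] by linarith+
  have im: "\<bar>Im (?s - 1)\<bar> \<ge> 3/4" using re t by simp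
  then have s1: "?s \<noteq> 1" by force
  have n3: "norm (1/2 + \<beta>) \<le> 3/4" using norm_triangle_ineq[of "1/2" \<beta>] \<beta> by simp
  have ns: "norm ?s \<le> 2 * t" using norm_triangle_ineq4[of "1/2 + \<beta>" "\<i> * of_real t"] n3 t by (simp add: norm_mult)
  have ns1: "norm (?s + 1) \<le> 3 * t" using norm_triangle_ineq[of ?s 1] norm_triangle_ineq4[of "1/2 + \<beta>" "\<i> * of_real t"] n3 t by (simp add: norm_mult)
  have "norm ?s * norm (?s + 1) \<le> (2 * t) * (3 * t)" using ns ns1 t by (intro mult_mono) auto
  moreover have "1 \<le> t\<^sup>2" using t by simp
  ultimately have c: "1 + 2 * norm ?s * norm (?s + 1) \<le> 13 * t\<^sup>2" by (simp add: power2_eq_square)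
  have z: "norm (zeta ?s - (\<Sum>n=1..M. zeta_coeff M \<beta> n * zeta_tail M \<beta> n (of_real t) * exp (\<i> * of_real (t * ln (real n))))) \<le> 13 * t\<^sup>2 * real M powr (- 1/4)"
    if M: "M \<ge> 1" for M
  proof -
    have "norm (zeta ?s - (\<Sum>n=1..M. zeta_coeff M \<beta> n * zeta_tail M \<beta> n (of_real t) * exp (\<i> * of_real (t * ln (real n))))) \<le> (1 + 2 * norm ?s * norm (?s + 1)) * real M powr (- Re ?s)"
      unfolding zeta_polynomial_eq[OF M] using re by (intro norm_zeta_approx_le s1 M) simp
    also have "\<dots> \<le> 13 * t\<^sup>2 * real M powr (- 1/4)"
      using c re M by (intro mult_mono powr_mono) auto
    finally show ?thesis .
  qed
  show "M \<ge> 1 \<Longrightarrow> norm (zeta ?s - (\<Sum>n=1..M. zeta_coeff M \<beta> n * zeta_tail M \<beta> n (of_real t) * exp (\<i> * of_real (t * ln (real n))))) \<le> 13 * t\<^sup>2 * real M powr (- 1/4)"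
    by (rule z)
  \<comment> \<open>At \<open>M = 1\<close> the approximating polynomial is just
    \<open>1 / (s - 1)\<close>, so the same estimate bounds zeta itself.\<close>
  have p1: "(\<Sum>n=1..1. zeta_coeff 1 \<beta> n * zeta_tail 1 \<beta> n (of_real t) * exp (\<i> * of_real (t * ln (real n)))) = 1 / (?s - 1)"
    unfolding zeta_polynomial_eq[OF order_refl] by simp
  have "norm (zeta ?s - 1 / (?s - 1)) \<le> 13 * t\<^sup>2" using z[OF order_refl] unfolding p1 by simp
  moreover have "norm (1 / (?s - 1)) \<le> 4/3"
  proof -
    have "norm (?s - 1) \<ge> 3/4" using im abs_Im_le_cmod[of "?s - 1"] by linarith
    then have "1 / norm (?s - 1) \<le> 1 / (3/4)" by (intro divide_left_mono mult_pos_pos) linarith+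
    then show ?thesis unfolding norm_divide by simp
  qed
  ultimately have "norm (zeta ?s) \<le> 13 * t\<^sup>2 + 4/3" using norm_triangle_sub[of "zeta ?s" "1 / (?s - 1)"] by linarith
  then show "norm (zeta ?s) \<le> 15 * t\<^sup>2" using \<open>1 \<le> t\<^sup>2\<close> by linarith
qed

lemma norm_zeta_coeff_le:
  assumes "norm \<beta> \<le> 1/4" "n \<in> {1..M}"
  shows "norm (zeta_coeff M \<beta> n) \<le> real M"
proof -
  have re: "\<bar>Re \<beta>\<bar> \<le> 1/4" using assms(1) abs_Re_le_cmod[of \<beta>] by linarith
  have n: "real n \<ge> 1" "real n \<le> real M" using assms(2) by auto
  have "real n powr (- (1/2 + Re \<beta>)) \<le> real n powr 1" "real n powr (1/2 - Re \<beta>) \<le> real n powr 1"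
    using re n by (intro powr_mono; simp)+
  moreover have "norm (of_nat n powr c) = real n powr Re c" for c
    using norm_powr_real_powr[of "of_nat n" c] n by simp
  ultimately have "norm (zeta_coeff M \<beta> n) \<le> real n" using n unfolding zeta_coeff_def by (cases "n < M") simp_all
  then show ?thesis using n by linarith
qed

lemma
  assumes \<beta>: "norm \<beta> \<le> 1/4" and S: "\<And>z. z \<in> S \<Longrightarrow> Re z \<ge> 2"
  shows zeta_tail_holomorphic: "zeta_tail M \<beta> n holomorphic_on S"
    and norm_zeta_tail_le: "z \<in> S \<Longrightarrow> norm (zeta_tail M \<beta> n z) \<le> 1"
proof -
  have im: "\<bar>Im (\<beta> - 1/2 - \<i> * z)\<bar> \<ge> 1" if "z \<in> S" for z
    using S[OF that] \<beta> abs_Im_le_cmod[of \<beta>] by simp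
  have nz: "\<beta> - 1/2 - \<i> * z \<noteq> 0" if "z \<in> S" for z using im[OF that] by force
  have "(\<lambda>z. 1 / (\<beta> - 1/2 - \<i> * z)) holomorphic_on S" using nz by (intro holomorphic_intros) auto
  then show "zeta_tail M \<beta> n holomorphic_on S" unfolding zeta_tail_def[abs_def] by (cases "n < M") simp_all
  assume z: "z \<in> S"
  have "norm (\<beta> - 1/2 - \<i> * z) \<ge> 1" using im[OF z] abs_Im_le_cmod[of "\<beta> - 1/2 - \<i> * z"] by linarith
  then show "norm (zeta_tail M \<beta> n z) \<le> 1" by (auto simp: zeta_tail_def norm_divide divide_le_eq_1)
qed

text \<open>In the height the two factors oscillate oppositely, so the product stays bounded even
  for complex \<open>z\<close> with imaginary part up to a multiple of \<open>T\<close>; that is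
  what Cauchy's estimates require.\<close>

definition chi_ratio :: "complex \<Rightarrow> complex \<Rightarrow> complex" where
  "chi_ratio \<alpha> z = zeta_chi (1/2 + \<alpha> + \<i> * z) * zeta_chi (1/2 - \<i> * z)"

lemma chi_ratio_holomorphic:
  assumes \<alpha>: "norm \<alpha> \<le> 1/4" and S: "\<And>z. z \<in> S \<Longrightarrow> Re z \<ge> 2"
  shows "chi_ratio \<alpha> holomorphic_on S"
proof -
  have g: "1 - s \<notin> \<int>\<^sub>\<le>\<^sub>0" if "Im s \<noteq> 0" for s :: complex using that by (auto elim!: nonpos_Ints_cases simp: complex_eq_iff)
  have h: "zeta_chi holomorphic_on {s. Im s \<noteq> 0}" by (rule zeta_chi_holomorphic) (use g in auto)
  have im: "Im (1/2 + \<alpha> + \<i> * z) \<noteq> 0" "Im (1/2 - \<i> * z) \<noteq> 0" if "z \<in> S" for z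
    using S[OF that] \<alpha> abs_Im_le_cmod[of \<alpha>] by auto
  have "(\<lambda>z. zeta_chi (1/2 + \<alpha> + \<i> * z)) holomorphic_on S"
    by (rule holomorphic_on_compose_gen[OF _ h, unfolded o_def]) (use im in \<open>auto intro!: holomorphic_intros\<close>)
  moreover have "(\<lambda>z. zeta_chi (1/2 - \<i> * z)) holomorphic_on S"
    by (rule holomorphic_on_compose_gen[OF _ h, unfolded o_def]) (use im in \<open>auto intro!: holomorphic_intros\<close>)
  ultimately show ?thesis unfolding chi_ratio_def[abs_def] by (intro holomorphic_intros)
qed

lemma zeta_times_chi:
  assumes "norm \<alpha> \<le> 1/4" "t \<ge> 1"
  shows "zeta (1/2 + \<alpha> + \<i> * of_real t) * zeta_chi (1/2 - \<i> * of_real t) = chi_ratio \<alpha> (of_real t) * zeta (1/2 - \<alpha> - \<i> * of_real t)"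
proof -
  have "Im (1/2 + \<alpha> + \<i> * of_real t) > 0" using assms abs_Im_le_cmod[of \<alpha>] by simp
  from zeta_functional_equation[OF this]
  have "zeta (1/2 + \<alpha> + \<i> * of_real t) = zeta_chi (1/2 + \<alpha> + \<i> * of_real t) * zeta (1/2 - \<alpha> - \<i> * of_real t)"
    by (simp add: diff_diff_eq[symmetric])
  then show ?thesis by (simp add: chi_ratio_def mult_ac)
qed

lemma smoothed_zeta_sum_eq:
  assumes L: "L > 0" and Y: "Y = nat \<lfloor>exp L\<rfloor>"
  shows "smoothed_zeta_sum P (exp L) (1/2 + \<i> * of_real t) =
    (\<Sum>n=1..Y. cut_poly P (ln (real n) / L) * of_real (real n powr (- 1/2)) * exp (- \<i> * of_real (t * ln (real n))))"
proof -
  have "{n. 1 \<le> n \<and> real n \<le> exp L} = {1..Y}" unfolding Y by (auto simp: le_nat_floor le_nat_iff le_floor_iff)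
  moreover have "of_real (poly P (ln (exp L / real n) / ln (exp L))) * of_nat n powr (- (1/2 + \<i> * of_real t)) =
    cut_poly P (ln (real n) / L) * of_real (real n powr (- 1/2)) * exp (- \<i> * of_real (t * ln (real n)))" if n: "n \<in> {1..Y}" for n
  proof -
    have n1: "real n \<ge> 1" "real n \<le> exp L" using n unfolding Y by (auto simp: le_nat_iff le_floor_iff)
    then have l: "ln (real n) \<ge> 0" "ln (real n) \<le> L" using ln_le_cancel_iff[of "real n" "exp L"] by auto
    have "ln (exp L / real n) / ln (exp L) = 1 - ln (real n) / L" using n1 L by (simp add: ln_div diff_divide_distrib)
    moreover have "cut_poly P (ln (real n) / L) = of_real (poly P (1 - ln (real n) / L))" using l L by (simp add: cut_poly_def)
    moreover have "complex_of_nat n powr (- (1/2 + \<i> * of_real t)) = of_real (real n powr (- 1/2)) * exp (- \<i> * of_real (t * ln (real n)))"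
    proof -
      have "complex_of_nat n powr (- (1/2 + \<i> * of_real t)) = of_nat n powr (of_real (- 1/2)) * of_nat n powr (- \<i> * of_real t)"
        unfolding powr_add[symmetric] by simp
      also have "complex_of_nat n powr (- \<i> * of_real t) = exp (- \<i> * of_real (t * ln (real n)))" using n1 by (simp add: powr_def mult_ac)
      also have "complex_of_nat n powr (of_real (- 1/2)) = of_real (real n powr (- 1/2))"
        using powr_of_real[of "real n" "- 1/2"] by simp
      finally show ?thesis .
    qed
    ultimately show ?thesis by (simp only: mult.assoc)
  qed
  ultimately show ?thesis unfolding smoothed_zeta_sum_def by (intro sum.cong) auto
qed

text \<open>\<open>cut_poly\<close> vanishes beyond \<open>Y\<close>, so the sum can run up to
  \<open>M\<close> and all columns share one range of summation.\<close>

lemma cnj_smoothed_zeta_sum_eq: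
  assumes L: "L > 0" and Y: "Y = nat \<lfloor>exp L\<rfloor>" and M: "M \<ge> Y"
  shows "cnj (smoothed_zeta_sum P (exp L) (1/2 + \<i> * of_real t)) =
    (\<Sum>n=1..M. cut_poly P (ln (real n) / L) * of_real (real n powr (- 1/2)) * exp (\<i> * of_real (t * ln (real n))))"
proof -
  have r: "cnj (cut_poly P v) = cut_poly P v" for v by (simp add: cut_poly_def)
  have "cnj (smoothed_zeta_sum P (exp L) (1/2 + \<i> * of_real t)) = (\<Sum>n=1..Y. cut_poly P (ln (real n) / L) * of_real (real n powr (- 1/2)) * exp (\<i> * of_real (t * ln (real n))))"
    unfolding smoothed_zeta_sum_eq[OF L Y] by (simp add: r exp_cnj)
  also have "\<dots> = (\<Sum>n=1..M. cut_poly P (ln (real n) / L) * of_real (real n powr (- 1/2)) * exp (\<i> * of_real (t * ln (real n))))"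
  proof (rule sum.mono_neutral_left)
    show "\<forall>n\<in>{1..M} - {1..Y}. cut_poly P (ln (real n) / L) * of_real (real n powr (- 1/2)) * exp (\<i> * of_real (t * ln (real n))) = 0"
    proof
      fix n assume n: "n \<in> {1..M} - {1..Y}"
      then have "\<not> n \<le> Y" by auto
      then have "real n > exp L" unfolding Y by linarith
      then have "ln (real n) > L" by (metis exp_gt_zero exp_ln exp_less_cancel_iff less_trans)
      then have "1 < ln (real n) / L" using L by (simp add: less_divide_eq)
      then show "cut_poly P (ln (real n) / L) * of_real (real n powr (- 1/2)) * exp (\<i> * of_real (t * ln (real n))) = 0" by (simp add: cut_poly_def)
    qed
  qed (use M in auto)
  finally show ?thesis .
qed

section \<open>The moment at a fixed \<open>T\<close>\<close>

lemma norm_mult_diff_le: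
  fixes z z' w w' :: complex
  assumes "norm z' \<le> Q'" "norm w \<le> Q" "norm (z - w) \<le> e" "norm (z' - w') \<le> e'"
  shows "norm (z * z' - w * w') \<le> Q' * e + Q * e'"
proof -
  have "z * z' - w * w' = z' * (z - w) + w * (z' - w')" by (simp add: algebra_simps)
  also have "norm \<dots> \<le> norm z' * norm (z - w) + norm w * norm (z' - w')"
    by (intro order_trans[OF norm_triangle_ineq] add_mono) (simp_all add: norm_mult)
  also have "\<dots> \<le> Q' * e + Q * e'"
    using assms order_trans[OF norm_ge_zero] by (intro add_mono mult_mono norm_ge_zero) blast+
  finally show ?thesis .
qed

lemma prod_powr_nat: "(\<Prod>x\<in>X. real (f x) powr r) = (\<Prod>x\<in>X. real (f x)) powr r"
  by (induction X rule: infinite_finite_induct) (auto simp: powr_mult prod_nonneg)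

text \<open>\<open>T\<close> and the shifts are fixed, and all bounds are explicit in
  \<open>c\<close>, \<open>p\<close> and \<open>B\<close>; the final uniformity rests on these three
  being independent of \<open>T\<close> and the shifts. \<open>\<phi> j\<close> is the
  \<open>j\<close>-th derivative of \<open>w (t / T)\<close>.\<close>

locale twisted_setup =
  fixes k :: nat and P :: "real poly" and T L :: real and w :: "real \<Rightarrow> real" and \<phi> :: "nat \<Rightarrow> real \<Rightarrow> real"
    and \<alpha>1 \<alpha>2 \<alpha>3 \<alpha>4 :: complex and c p B :: real and M N :: nat
  assumes k: "k \<ge> 2" and T: "T \<ge> 32" and L: "L > 0"
    and \<alpha>: "norm \<alpha>1 \<le> 1/4" "norm \<alpha>2 \<le> 1/4" "norm \<alpha>3 \<le> 1/4" "norm \<alpha>4 \<le> 1/4"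
    and deriv: "\<And>j t. (\<phi> j has_real_derivative \<phi> (Suc j) t) (at t)"
    and vanish: "\<And>j t. t \<notin> {T / 4..2 * T} \<Longrightarrow> \<phi> j t = 0"
    and bound: "\<And>j t. j \<le> N \<Longrightarrow> \<bar>\<phi> j t\<bar> \<le> c * (ln T / T) ^ j"
    and \<phi>0: "\<And>t. \<phi> 0 t = w (t / T)" and w01: "\<And>t. 0 \<le> w t" "\<And>t. w t \<le> 1"
    and p: "p \<ge> 1" "\<And>v. v \<ge> 0 \<Longrightarrow> norm (cut_poly P v) \<le> p"
    and B: "\<And>z. T / 8 < Re z \<Longrightarrow> Re z < 3 * T \<Longrightarrow> \<bar>Im z\<bar> < T / 16 \<Longrightarrow> norm (chi_ratio \<alpha>1 z * chi_ratio \<alpha>2 z) \<le> B"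
    and M: "M > nat \<lfloor>exp L\<rfloor> ^ (k + 2)" and Y1: "exp L \<ge> 1"
begin

abbreviation "K \<equiv> k + 2"
definition "Y = nat \<lfloor>exp L\<rfloor>"
text \<open>\<open>[u, v]\<close> is slightly larger than \<open>[T / 4, 2 * T]\<close>, so that the
  weight and its derivatives vanish at both ends, yet discs of radius \<open>T / 32\<close> about
  its points stay inside \<open>\<Omega>\<close>.\<close>

definition "u = 3 * T / 16"
definition "v = 33 * T / 16"
definition "\<Omega> = {z. T / 8 < Re z} \<inter> {z. Re z < 3 * T} \<inter> ({z. - (T / 16) < Im z} \<inter> {z. Im z < T / 16})"
definition "h z = chi_ratio \<alpha>1 z * chi_ratio \<alpha>2 z"
definition "A t = smoothed_zeta_sum P (exp L) (1/2 + \<i> * complex_of_real t)"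
text \<open>The first two shifts change sign because the functional equation turns
  \<open>1/2 + \<alpha> + \<i> * t\<close> into \<open>1/2 - \<alpha> - \<i> * t\<close>.\<close>

definition "\<beta> = shift_vector k (- \<alpha>1) (- \<alpha>2) \<alpha>3 \<alpha>4"
definition "a n = cut_poly P (ln (real n) / L) * of_real (real n powr (- 1/2))" for n
definition "b j n = (if j \<le> k - 2 then a n else zeta_coeff M (\<beta> j) n)"
definition "\<rho> j n = (if j \<le> k - 2 then (\<lambda>z. 1) else zeta_tail M (\<beta> j) n)"
definition "Z j t = zeta (1/2 + \<beta> j - \<i> * complex_of_real t)"
definition "D j t = (\<Sum>n=1..M. zeta_coeff M (\<beta> j) n * zeta_tail M (\<beta> j) n (of_real t) * exp (\<i> * of_real (t * ln (real n))))"
definition "W = integral {u..v} (\<lambda>t. of_real (\<phi> 0 t) * h (of_real t))"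
definition "S = diagonal_sum {1..K} {1..K} (\<lambda>_. cut_poly P) (column_weight k P (\<lambda>j. - \<beta> j * of_real L)) L M"

lemma uv: "u \<le> v" "u \<ge> 1" "v - u \<le> 2 * T" "0 < u" "u < T / 4" "2 * T < v" "v \<le> 3 * T"
  using T by (simp_all add: u_def v_def)

lemma t_ge: "t \<in> {u..v} \<Longrightarrow> t \<ge> 1" using uv by auto

lemma \<Omega>: "open \<Omega>" "t \<in> {u..v} \<Longrightarrow> of_real t \<in> \<Omega>" "z \<in> \<Omega> \<Longrightarrow> Re z \<ge> 2" "z \<in> \<Omega> \<Longrightarrow> norm (h z) \<le> B"
  and h_holomorphic: "h holomorphic_on \<Omega>"
proof -
  show "open \<Omega>" unfolding \<Omega>_def by (intro open_Int open_halfspace_Re_gt open_halfspace_Re_lt open_halfspace_Im_gt open_halfspace_Im_lt)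
  show "t \<in> {u..v} \<Longrightarrow> of_real t \<in> \<Omega>" using T by (auto simp: \<Omega>_def u_def v_def)
  have re: "Re z \<ge> 2" if "z \<in> \<Omega>" for z using T that by (auto simp: \<Omega>_def)
  then show "z \<in> \<Omega> \<Longrightarrow> Re z \<ge> 2" .
  show "z \<in> \<Omega> \<Longrightarrow> norm (h z) \<le> B" unfolding h_def by (rule B) (auto simp: \<Omega>_def)
  show "h holomorphic_on \<Omega>" unfolding h_def by (intro holomorphic_intros chi_ratio_holomorphic \<alpha> re)
qed

lemma disc: "t \<in> {u..v} \<Longrightarrow> cball (of_real t) (T / 32) \<subseteq> \<Omega>"
proof
  fix z assume t: "t \<in> {u..v}" and z: "z \<in> cball (complex_of_real t) (T / 32)"
  then have "norm (z - of_real t) \<le> T / 32" by (simp add: dist_norm norm_minus_commute)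
  then have "\<bar>Re z - t\<bar> \<le> T / 32" "\<bar>Im z\<bar> \<le> T / 32" using abs_Re_le_cmod[of "z - of_real t"] abs_Im_le_cmod[of "z - of_real t"] by simp_all
  then have "t - T / 32 \<le> Re z" "Re z \<le> t + T / 32" "- (T / 32) \<le> Im z" "Im z \<le> T / 32" by linarith+
  moreover have "3 * T / 16 \<le> t" "t \<le> 33 * T / 16" using t by (auto simp: u_def v_def)
  ultimately show "z \<in> \<Omega>" unfolding \<Omega>_def using T by (intro IntI CollectI) linarith+
qed

lemma \<beta>: "norm (\<beta> j) \<le> 1/4" "\<beta> (k - 1) = - \<alpha>1" "\<beta> k = - \<alpha>2" "\<beta> (k + 1) = \<alpha>3" "\<beta> (k + 2) = \<alpha>4"
  using \<alpha> k by (auto simp: \<beta>_def shift_vector_def)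

lemma M1: "M \<ge> 1" and YM: "Y \<le> M" and Y_ge: "Y \<ge> 1"
proof -
  show M1: "M \<ge> 1" using M by simp
  show Y: "Y \<ge> 1" using Y1 by (simp add: Y_def le_nat_iff le_floor_iff)
  have "Y \<le> Y ^ K" using Y by (intro self_le_power) auto
  then show "Y \<le> M" using M unfolding Y_def[symmetric] by linarith
qed

lemma A_eq: "A t = (\<Sum>n=1..Y. a n * exp (- \<i> * of_real (t * ln (real n))))"
  unfolding A_def a_def by (rule smoothed_zeta_sum_eq[OF L Y_def])

lemma cnj_A_eq: "cnj (A t) = (\<Sum>n=1..M. a n * exp (\<i> * of_real (t * ln (real n))))"
  unfolding A_def a_def by (rule cnj_smoothed_zeta_sum_eq[OF L Y_def YM])

lemma norm_a: "n \<ge> 1 \<Longrightarrow> norm (a n) \<le> p"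
proof -
  assume n: "n \<ge> 1"
  have "norm (cut_poly P (ln (real n) / L)) \<le> p" using n L by (intro p) simp
  moreover have "norm (complex_of_real (real n powr (- 1/2))) \<le> 1"
    using powr_mono[of "- 1/2" 0 "real n"] n by simp
  ultimately have "norm (cut_poly P (ln (real n) / L)) * norm (complex_of_real (real n powr (- 1/2))) \<le> p * 1"
    using p(1) by (intro mult_mono) auto
  then show ?thesis unfolding a_def norm_mult by simp
qed

lemma norm_A: "norm (A t) \<le> p * real Y"
proof -
  have "norm (A t) \<le> (\<Sum>n=1..Y. p)" unfolding A_eq using norm_a by (intro sum_norm_le) (simp add: norm_mult)
  then show ?thesis by (simp add: mult.commute)
qed

lemma columns_eq: "(\<Prod>j\<in>{1..K}. \<Sum>n=1..M. b j n * \<rho> j n (of_real t) * exp (\<i> * of_real (t * ln (real n)))) =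
    cnj (A t) ^ (k - 2) * (D (k - 1) t * (D k t * (D (k + 1) t * D (k + 2) t)))"
proof -
  have "(\<Sum>n=1..M. b j n * \<rho> j n (of_real t) * exp (\<i> * of_real (t * ln (real n)))) = cnj (A t)" if "j \<in> {1..k - 2}" for j
    unfolding cnj_A_eq using that by (simp add: b_def \<rho>_def)
  moreover have "(\<Sum>n=1..M. b j n * \<rho> j n (of_real t) * exp (\<i> * of_real (t * ln (real n)))) = D j t" if "\<not> j \<le> k - 2" for j
    unfolding D_def using that by (simp add: b_def \<rho>_def)
  moreover have "\<not> k - 1 \<le> k - 2" "\<not> k \<le> k - 2" "\<not> k + 1 \<le> k - 2" "\<not> k + 2 \<le> k - 2" using k by auto
  ultimately show ?thesis unfolding prod_column_split[OF k] by simp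
qed

lemma norm_ZD:
  assumes t: "t \<in> {u..v}"
  shows "norm (Z j t - D j t) \<le> 117 * T\<^sup>2 * real M powr (- 1/4)" "norm (Z j t) \<le> 300 * T\<^sup>2" "norm (D j t) \<le> 300 * T\<^sup>2"
proof -
  \<comment> \<open>From \<open>t <= 3 * T\<close> come \<open>117 = 13 * 9\<close> and
    \<open>135 = 15 * 9\<close>; the common bound 300 exceeds their sum.\<close>
  have "t\<^sup>2 \<le> (3 * T)\<^sup>2" using t uv T by (intro power_mono) auto
  then have t2: "t\<^sup>2 \<le> 9 * T\<^sup>2" by (simp add: power_mult_distrib)
  have "13 * t\<^sup>2 * real M powr (- 1/4) \<le> 117 * T\<^sup>2 * real M powr (- 1/4)" using t2 by (intro mult_right_mono) auto
  then show 1: "norm (Z j t - D j t) \<le> 117 * T\<^sup>2 * real M powr (- 1/4)"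
    using norm_zeta_minus_polynomial_le[OF \<beta>(1) t_ge[OF t] M1, of j] unfolding Z_def D_def by linarith
  have "real M powr (- 1/4) \<le> 1" using M1 powr_mono[of "- 1/4" 0 "real M"] by simp
  then have "117 * T\<^sup>2 * real M powr (- 1/4) \<le> 117 * T\<^sup>2 * 1" by (intro mult_left_mono) auto
  moreover have Z: "norm (Z j t) \<le> 15 * t\<^sup>2" unfolding Z_def by (rule norm_zeta_le[OF \<beta>(1) t_ge[OF t]])
  moreover have "norm (D j t) \<le> norm (Z j t) + norm (Z j t - D j t)" by (metis norm_triangle_sub norm_minus_commute add.commute)
  ultimately show "norm (D j t) \<le> 300 * T\<^sup>2" using 1 t2 by (smt (verit) zero_le_power2)
  show "norm (Z j t) \<le> 300 * T\<^sup>2" using Z t2 by (smt (verit) zero_le_power2)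
qed

lemma norm_ZD4:
  assumes t: "t \<in> {u..v}"
  shows "norm (Z (k - 1) t * (Z k t * (Z (k + 1) t * Z (k + 2) t)) - D (k - 1) t * (D k t * (D (k + 1) t * D (k + 2) t)))
    \<le> 4 * (300 * T\<^sup>2) ^ 3 * (117 * T\<^sup>2 * real M powr (- 1/4))"
proof -
  define Q where "Q = 300 * T\<^sup>2"
  define e where "e = 117 * T\<^sup>2 * real M powr (- 1/4)"
  note ZD = norm_ZD[OF t, folded Q_def e_def]
  have Q: "Q \<ge> 0" by (simp add: Q_def)
  have 2: "norm (Z (k + 1) t * Z (k + 2) t - D (k + 1) t * D (k + 2) t) \<le> Q * e + Q * e"
    by (rule norm_mult_diff_le[OF ZD(2,3,1,1)])
  have Z2: "norm (Z (k + 1) t * Z (k + 2) t) \<le> Q * Q" unfolding norm_mult using Q ZD(2) by (intro mult_mono) auto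
  have 3: "norm (Z k t * (Z (k + 1) t * Z (k + 2) t) - D k t * (D (k + 1) t * D (k + 2) t)) \<le> (Q * Q) * e + Q * (Q * e + Q * e)"
    by (rule norm_mult_diff_le[OF Z2 ZD(3,1) 2])
  have Z3: "norm (Z k t * (Z (k + 1) t * Z (k + 2) t)) \<le> Q * (Q * Q)" unfolding norm_mult[of "Z k t"] using Q ZD(2) Z2 by (intro mult_mono) auto
  have "norm (Z (k - 1) t * (Z k t * (Z (k + 1) t * Z (k + 2) t)) - D (k - 1) t * (D k t * (D (k + 1) t * D (k + 2) t)))
    \<le> (Q * (Q * Q)) * e + Q * ((Q * Q) * e + Q * (Q * e + Q * e))"
    by (rule norm_mult_diff_le[OF Z3 ZD(3,1) 3])
  also have "\<dots> = 4 * Q ^ 3 * e" by (simp add: power3_eq_cube algebra_simps)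
  finally show ?thesis unfolding Q_def e_def .
qed

definition "main t = of_real (\<phi> 0 t) * h (of_real t) * A t ^ K"

lemma cont: "continuous_on {u..v} main" "continuous_on {u..v} (\<lambda>t. cnj (A t))" "continuous_on {u..v} (Z j)" "continuous_on {u..v} (D j)"
proof -
  have "continuous_on {u..v} (\<phi> 0)" using deriv[of 0] by (meson DERIV_isCont continuous_at_imp_continuous_on)
  moreover have "continuous_on {u..v} (\<lambda>t. h (complex_of_real t))"
    by (rule continuous_on_compose2[OF holomorphic_on_imp_continuous_on[OF h_holomorphic]]) (use \<Omega> in \<open>auto intro!: continuous_intros\<close>)
  ultimately show "continuous_on {u..v} main" unfolding main_def A_eq by (intro continuous_intros)
  show "continuous_on {u..v} (\<lambda>t. cnj (A t))" unfolding cnj_A_eq by (intro continuous_intros)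
  show "continuous_on {u..v} (Z j)" unfolding Z_def
  proof (rule continuous_on_compose2[OF holomorphic_on_imp_continuous_on[OF zeta_holomorphic]])
    show "continuous_on {u..v} (\<lambda>t. 1/2 + \<beta> j - \<i> * complex_of_real t)" by (intro continuous_intros)
    show "(\<lambda>t. 1/2 + \<beta> j - \<i> * complex_of_real t) ` {u..v} \<subseteq> - {1}"
    proof (rule image_subsetI)
      fix t assume "t \<in> {u..v}"
      then have "Im (1/2 + \<beta> j - \<i> * complex_of_real t) \<noteq> Im 1"
        using t_ge[of t] \<beta>(1)[of j] abs_Im_le_cmod[of "\<beta> j"] by simp
      then show "1/2 + \<beta> j - \<i> * complex_of_real t \<in> - {1}" by (metis ComplI singletonD)
    qed
  qed
  have "continuous_on {u..v} (\<lambda>t. zeta_tail M (\<beta> j) n (complex_of_real t))" for n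
    by (rule continuous_on_compose2[OF holomorphic_on_imp_continuous_on[OF zeta_tail_holomorphic[OF \<beta>(1) \<Omega>(3)]]]) (use \<Omega> in \<open>auto intro!: continuous_intros\<close>)
  then show "continuous_on {u..v} (D j)" unfolding D_def by (intro continuous_intros)
qed

text \<open>The split \<open>|A| ^ (2 * k - 4) * A ^ 4 = A ^ (k + 2) * cnj A ^ (k - 2)\<close>
  separates the two directions of oscillation, and one factor \<open>zeta_chi\<close> is spent on
  each of the first two zetas. Outside \<open>[u, v]\<close> the weight vanishes.\<close>

lemma twisted_moment_eq:
  "twisted_moment k P (exp L) w T \<alpha>1 \<alpha>2 \<alpha>3 \<alpha>4 =
    integral {u..v} (\<lambda>t. main t * (cnj (A t) ^ (k - 2) * (Z (k - 1) t * (Z k t * (Z (k + 1) t * Z (k + 2) t)))))"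
    (is "_ = integral _ ?g")
proof -
  have "continuous_on {u..v} ?g" by (intro continuous_intros cont)
  then have int: "set_integrable lborel {u..v} ?g" unfolding set_integrable_def by (rule borel_integrable_compact[OF compact_Icc])
  have "twisted_moment k P (exp L) w T \<alpha>1 \<alpha>2 \<alpha>3 \<alpha>4 = (LBINT t. indicator {u..v} t *\<^sub>R ?g t)"
    unfolding twisted_moment_def
  proof (rule Bochner_Integration.integral_cong[OF refl])
    fix t :: real
    show "zeta (1/2 + \<alpha>1 + \<i> * of_real t) * zeta (1/2 + \<alpha>2 + \<i> * of_real t) *
        zeta (1/2 + \<alpha>3 - \<i> * of_real t) * zeta (1/2 + \<alpha>4 - \<i> * of_real t) *
        of_real (cmod (smoothed_zeta_sum P (exp L) (1/2 + \<i> * of_real t)) ^ (2 * k - 4)) *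
        smoothed_zeta_sum P (exp L) (1/2 + \<i> * of_real t) ^ 4 *
        zeta_chi (1/2 - \<i> * of_real t) ^ 2 * of_real (w (t / T)) = indicator {u..v} t *\<^sub>R ?g t"
    proof (cases "t \<in> {u..v}")
      case False
      then have "\<phi> 0 t = 0" using uv by (intro vanish) auto
      then show ?thesis using False by (simp add: \<phi>0)
    next
      case True
      note t = t_ge[OF True]
      obtain m where m: "k = m + 2" using k by (metis le_add_diff_inverse2)
      have pw: "of_real (cmod (A t) ^ (2 * k - 4)) * A t ^ 4 = A t ^ K * cnj (A t) ^ (k - 2)"
      proof -
        have "complex_of_real (cmod (A t) ^ (2 * k - 4)) = (of_real ((cmod (A t))\<^sup>2)) ^ m" by (simp add: m power_mult)
        also have "\<dots> = (A t * cnj (A t)) ^ m" unfolding complex_norm_square ..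
        finally have "complex_of_real (cmod (A t) ^ (2 * k - 4)) = A t ^ m * cnj (A t) ^ m" by (simp only: power_mult_distrib)
        moreover have "K = m + 4" by (simp add: m)
        then have "A t ^ K = A t ^ m * A t ^ 4" by (simp only: power_add)
        moreover have "k - 2 = m" by (simp add: m)
        ultimately show ?thesis by (simp only: mult_ac)
      qed
      have z: "zeta (1/2 + \<alpha>1 + \<i> * of_real t) * zeta_chi (1/2 - \<i> * of_real t) = chi_ratio \<alpha>1 (of_real t) * Z (k - 1) t"
        "zeta (1/2 + \<alpha>2 + \<i> * of_real t) * zeta_chi (1/2 - \<i> * of_real t) = chi_ratio \<alpha>2 (of_real t) * Z k t"
        "zeta (1/2 + \<alpha>3 - \<i> * of_real t) = Z (k + 1) t" "zeta (1/2 + \<alpha>4 - \<i> * of_real t) = Z (k + 2) t"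
        unfolding Z_def \<beta> using zeta_times_chi[OF \<alpha>(1) t] zeta_times_chi[OF \<alpha>(2) t] by simp_all
      have "zeta (1/2 + \<alpha>1 + \<i> * of_real t) * zeta (1/2 + \<alpha>2 + \<i> * of_real t) *
        zeta (1/2 + \<alpha>3 - \<i> * of_real t) * zeta (1/2 + \<alpha>4 - \<i> * of_real t) *
        of_real (cmod (A t) ^ (2 * k - 4)) * A t ^ 4 *
        zeta_chi (1/2 - \<i> * of_real t) ^ 2 * of_real (w (t / T)) =
        of_real (w (t / T)) * (zeta (1/2 + \<alpha>1 + \<i> * of_real t) * zeta_chi (1/2 - \<i> * of_real t)) * (zeta (1/2 + \<alpha>2 + \<i> * of_real t) * zeta_chi (1/2 - \<i> * of_real t))
        * zeta (1/2 + \<alpha>3 - \<i> * of_real t) * zeta (1/2 + \<alpha>4 - \<i> * of_real t) * (of_real (cmod (A t) ^ (2 * k - 4)) * A t ^ 4)"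
        by (simp only: power2_eq_square mult_ac)
      also have "\<dots> = ?g t" unfolding z pw main_def h_def \<phi>0 by (simp only: mult_ac)
      finally show ?thesis using True unfolding A_def by simp
    qed
  qed
  also have "\<dots> = integral {u..v} ?g"
    using set_borel_integral_eq_integral(2)[OF int] by (simp add: set_lebesgue_integral_def)
  finally show ?thesis .
qed

lemma B_nonneg: "B \<ge> 0"
  using order_trans[OF norm_ge_zero \<Omega>(4)[OF \<Omega>(2)[of u]]] uv by simp

text \<open>\<open>A\<close> and its conjugate occur \<open>2 * k\<close> times in all, each with
  the trivial bound \<open>p * Y\<close>. The four zetas are replaced one at a time, each
  replacement being charged with three bounds \<open>300 * T^2\<close>.\<close>

lemma replace_zeta:
  "norm (twisted_moment k P (exp L) w T \<alpha>1 \<alpha>2 \<alpha>3 \<alpha>4 - integral {u..v} (\<lambda>t. main t * (cnj (A t) ^ (k - 2) * (D (k - 1) t * (D k t * (D (k + 1) t * D (k + 2) t))))))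
    \<le> B * (p * real Y) ^ (2 * k) * (4 * (300 * T\<^sup>2) ^ 3 * (117 * T\<^sup>2 * real M powr (- 1/4))) * (2 * T)"
    (is "norm (_ - integral _ ?g') \<le> ?E * _")
proof -
  let ?g = "\<lambda>t. main t * (cnj (A t) ^ (k - 2) * (Z (k - 1) t * (Z k t * (Z (k + 1) t * Z (k + 2) t))))"
  have E0: "?E \<ge> 0" using B_nonneg p(1) T by simp
  have c: "continuous_on {u..v} ?g" "continuous_on {u..v} ?g'" by (intro continuous_intros cont)+
  have pt: "norm (?g t - ?g' t) \<le> ?E" if t: "t \<in> {u..v}" for t
  proof -
    have "\<bar>\<phi> 0 t\<bar> \<le> 1" using w01[of "t / T"] by (simp add: \<phi>0)
    then have "norm (main t) \<le> 1 * B * (p * real Y) ^ K"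
      unfolding main_def norm_mult norm_power norm_of_real
      using \<Omega>(4)[OF \<Omega>(2)[OF t]] norm_A B_nonneg p(1) by (intro mult_mono power_mono) auto
    moreover have "norm (cnj (A t) ^ (k - 2)) \<le> (p * real Y) ^ (k - 2)" unfolding norm_power using norm_A by (intro power_mono) auto
    ultimately have m: "norm (main t * cnj (A t) ^ (k - 2)) \<le> (1 * B * (p * real Y) ^ K) * (p * real Y) ^ (k - 2)"
      unfolding norm_mult using B_nonneg p(1) by (intro mult_mono) auto
    have "K + (k - 2) = 2 * k" using k by simp
    then have "(1 * B * (p * real Y) ^ K) * (p * real Y) ^ (k - 2) = B * (p * real Y) ^ (2 * k)"
      by (simp only: mult_1_left mult.assoc power_add[symmetric])
    then have m': "norm (main t * cnj (A t) ^ (k - 2)) \<le> B * (p * real Y) ^ (2 * k)" using m by (simp only:)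
    have "?g t - ?g' t = main t * cnj (A t) ^ (k - 2) * (Z (k - 1) t * (Z k t * (Z (k + 1) t * Z (k + 2) t)) - D (k - 1) t * (D k t * (D (k + 1) t * D (k + 2) t)))"
      by (simp only: right_diff_distrib mult.assoc)
    then show ?thesis unfolding norm_mult[of "main t * _"] using m' norm_ZD4[OF t] B_nonneg p(1)
      by (simp only: norm_mult[of "main t * cnj (A t) ^ (k - 2)"]) (intro mult_mono, auto)
  qed
  have "norm (integral {u..v} ?g - integral {u..v} ?g') = norm (integral {u..v} (\<lambda>t. ?g t - ?g' t))"
    using c by (subst Henstock_Kurzweil_Integration.integral_diff) (auto intro: integrable_continuous_interval)
  also have "\<dots> \<le> ?E * (v - u)"
    by (rule integral_bound[OF uv(1) _ pt]) (intro continuous_intros c)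
  also have "\<dots> \<le> ?E * (2 * T)" using uv(3) E0 by (rule mult_left_mono)
  finally show ?thesis unfolding twisted_moment_eq .
qed

text \<open>Entries of a diagonal pair are at most \<open>Y ^ (k + 2) < M\<close>, so the last terms
  of the zeta polynomials never take part. The remaining integral is then the same number
  \<open>W\<close> for every diagonal pair and factors out.\<close>

lemma diagonal_expansion:
  assumes c: "c \<ge> 0"
  shows "norm (integral {u..v} (\<lambda>t. main t * (cnj (A t) ^ (k - 2) * (D (k - 1) t * (D k t * (D (k + 1) t * D (k + 2) t))))) - W * S)
    \<le> real Y ^ K * real M ^ K * ((p * real M) ^ K * (p * real M) ^ K * (2 * T * c * B * fact N * (128 * ln T / T * real Y ^ K) ^ N))"
proof -
  let ?I = "{1..K}"
  let ?\<Delta> = "{(\<mu>, \<nu>). \<mu> \<in> ?I \<rightarrow>\<^sub>E {1..Y} \<and> \<nu> \<in> ?I \<rightarrow>\<^sub>E {1..M} \<and> (\<Prod>i\<in>?I. \<mu> i) = (\<Prod>j\<in>?I. \<nu> j)}"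
  let ?V = "\<lambda>\<nu>. integral {u..v} (\<lambda>t. of_real (\<phi> 0 t) * (h (of_real t) * (\<Prod>j\<in>?I. \<rho> j (\<nu> j) (of_real t))))"
  have lnT: "ln T \<ge> 1" using T exp_le by (simp add: ln_ge_iff)
  \<comment> \<open>One rate for both kinds of derivative: it dominates \<open>ln T / T\<close> from
    the weight and \<open>32 / T\<close> from the discs of radius \<open>T / 32\<close>.\<close>
  define \<delta> where "\<delta> = 32 * ln T / T"
  have \<delta>: "\<delta> > 0" "1 / (T / 32) \<le> \<delta>" "ln T / T \<le> \<delta>" using T lnT by (auto simp: \<delta>_def divide_simps)
  have bd: "\<bar>\<phi> j t\<bar> \<le> c * \<delta> ^ j" if "j \<le> N" for j t
  proof -
    have "c * (ln T / T) ^ j \<le> c * \<delta> ^ j" using \<delta> c lnT T by (intro mult_left_mono power_mono) auto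
    then show ?thesis using bound[OF that, of t] by linarith
  qed
  have vu: "\<phi> j u = 0" "\<phi> j v = 0" for j using uv by (auto intro!: vanish)
  have \<rho>h: "\<rho> j n holomorphic_on \<Omega>" for j n unfolding \<rho>_def using zeta_tail_holomorphic[OF \<beta>(1) \<Omega>(3)] by auto
  have \<rho>1: "norm (\<rho> j n z) \<le> 1" if "z \<in> \<Omega>" for j n z unfolding \<rho>_def using norm_zeta_tail_le[OF \<beta>(1) \<Omega>(3) that] by auto
  have pM: "p \<le> p * real M" "real M \<le> p * real M" using p(1) M1 mult_left_mono[of 1 "real M" p] mult_right_mono[of 1 p "real M"] by auto
  have qa: "norm (a n) \<le> p * real M" if "n \<in> {1..Y}" for n using order_trans[OF norm_a pM(1), of n] that by (simp only: atLeastAtMost_iff)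
  have qb: "norm (b j n) \<le> p * real M" if "n \<in> {1..M}" for j n
    using order_trans[OF norm_a pM(1), of n] order_trans[OF norm_zeta_coeff_le[OF \<beta>(1) that] pM(2), of j] that
    unfolding b_def by (cases "j \<le> k - 2") (simp_all only: if_True if_False atLeastAtMost_iff)
  have r: "T / 32 > 0" using T by simp
  have Q0: "p * real M \<ge> 0" using p(1) by simp
  have osc: "norm (integral {u..v} (\<lambda>t. of_real (\<phi> 0 t) * h (of_real t) * (\<Prod>i\<in>?I. \<Sum>n=1..Y. a n * exp (- \<i> * of_real (t * ln (real n)))) *
      (\<Prod>j\<in>?I. \<Sum>n=1..M. b j n * \<rho> j n (of_real t) * exp (\<i> * of_real (t * ln (real n)))))
    - (\<Sum>(\<mu>, \<nu>)\<in>?\<Delta>. (\<Prod>i\<in>?I. a (\<mu> i)) * (\<Prod>j\<in>?I. b j (\<nu> j)) * ?V \<nu>))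
    \<le> real Y ^ card ?I * real M ^ card ?I * ((p * real M) ^ card ?I * (p * real M) ^ card ?I * ((v - u) * c * B * fact N * (4 * \<delta> * real Y ^ card ?I) ^ N))"
    by (rule oscillatory_moment[OF _ _ uv(1) c \<delta>(1) deriv vu bd \<Omega>(1) h_holomorphic r \<delta>(2) disc \<Omega>(4) \<rho>h \<rho>1 Q0 qa qb]) auto
  have int_eq: "of_real (\<phi> 0 t) * h (of_real t) * (\<Prod>i\<in>?I. \<Sum>n=1..Y. a n * exp (- \<i> * of_real (t * ln (real n)))) *
      (\<Prod>j\<in>?I. \<Sum>n=1..M. b j n * \<rho> j n (of_real t) * exp (\<i> * of_real (t * ln (real n)))) = main t * (cnj (A t) ^ (k - 2) * (D (k - 1) t * (D k t * (D (k + 1) t * D (k + 2) t))))" for t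
    unfolding columns_eq A_eq[symmetric] main_def by simp
  have \<Delta>: "?\<Delta> = diagonal_pairs ?I ?I Y M"
    and small: "\<And>\<mu> \<nu> j. (\<mu>, \<nu>) \<in> ?\<Delta> \<Longrightarrow> j \<in> ?I \<Longrightarrow> 1 \<le> \<nu> j \<and> \<nu> j \<le> Y ^ K"
  proof -
    have sm: "1 \<le> \<nu> j \<and> \<nu> j \<le> Y ^ K" if mn: "\<mu> \<in> ?I \<rightarrow>\<^sub>E {1..Y}" "\<nu> \<in> ?I \<rightarrow>\<^sub>E {1..Z}" "(\<Prod>i\<in>?I. \<mu> i) = (\<Prod>j\<in>?I. \<nu> j)" "j \<in> ?I" for \<mu> \<nu> j Z
    proof
      show 1: "1 \<le> \<nu> j" using PiE_mem[OF mn(2,4)] by simp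
      have "\<nu> j dvd (\<Prod>j\<in>?I. \<nu> j)" using mn(4) by (intro dvd_prodI) auto
      moreover have "(\<Prod>j\<in>?I. \<nu> j) > 0" using PiE_mem[OF mn(2)] by (intro prod_pos) (simp add: Suc_le_eq)
      ultimately have "\<nu> j \<le> (\<Prod>i\<in>?I. \<mu> i)" unfolding mn(3) by (rule dvd_imp_le)
      also have "\<dots> \<le> (\<Prod>i\<in>?I. Y)" using PiE_mem[OF mn(1)] by (intro prod_mono) simp
      finally show "\<nu> j \<le> Y ^ K" by simp
    qed
    show "1 \<le> \<nu> j \<and> \<nu> j \<le> Y ^ K" if "(\<mu>, \<nu>) \<in> ?\<Delta>" "j \<in> ?I" for \<mu> \<nu> j using that sm by blast
    have YKM: "n < M" if "n \<le> Y ^ K" for n using that M unfolding Y_def by simp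
    have iff: "\<nu> \<in> ?I \<rightarrow>\<^sub>E {1..M} \<longleftrightarrow> \<nu> \<in> ?I \<rightarrow>\<^sub>E {1..<M}" if "\<mu> \<in> ?I \<rightarrow>\<^sub>E {1..Y}" "(\<Prod>i\<in>?I. \<mu> i) = (\<Prod>j\<in>?I. \<nu> j)" for \<mu> \<nu>
    proof
      assume n: "\<nu> \<in> ?I \<rightarrow>\<^sub>E {1..M}"
      show "\<nu> \<in> ?I \<rightarrow>\<^sub>E {1..<M}"
      proof (rule PiE_I)
        fix j assume j: "j \<in> ?I"
        show "\<nu> j \<in> {1..<M}" using sm[OF that(1) n that(2) j] YKM[of "\<nu> j"] by simp
      qed (use PiE_arb[OF n] in auto)
    next
      assume "\<nu> \<in> ?I \<rightarrow>\<^sub>E {1..<M}"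
      moreover have "?I \<rightarrow>\<^sub>E {1..<M} \<subseteq> ?I \<rightarrow>\<^sub>E {1..M}" by (rule PiE_mono) auto
      ultimately show "\<nu> \<in> ?I \<rightarrow>\<^sub>E {1..M}" by blast
    qed
    show "?\<Delta> = diagonal_pairs ?I ?I Y M" unfolding diagonal_pairs_def
      by (intro Collect_cong) (use iff in \<open>auto simp only: split_paired_all prod.case\<close>)
  qed
  have diag_term: "(\<Prod>i\<in>?I. a (\<mu> i)) * (\<Prod>j\<in>?I. b j (\<nu> j)) * ?V \<nu> = W * ((\<Prod>i\<in>?I. cut_poly P (ln (real (\<mu> i)) / L)) *
   (\<Prod>j\<in>?I. column_weight k P (\<lambda>j. - \<beta> j * of_real L) j (ln (real (\<nu> j)) / L)) / of_real (\<Prod>i\<in>?I. real (\<mu> i)))"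
    if mn: "(\<mu>, \<nu>) \<in> ?\<Delta>" for \<mu> \<nu>
  proof -
    note sm = small[OF mn]
    have \<mu>1: "\<mu> i \<ge> 1" if "i \<in> ?I" for i using mn that by (auto simp: PiE_iff)
    have lt: "\<nu> j < M" if "j \<in> ?I" for j using sm[OF that] M unfolding Y_def by simp
    have "\<rho> j (\<nu> j) z = 1" if "j \<in> ?I" for j z using lt[OF that] by (simp add: \<rho>_def zeta_tail_def)
    then have V: "?V \<nu> = W" unfolding W_def by simp
    have b: "b j (\<nu> j) = column_weight k P (\<lambda>j. - \<beta> j * of_real L) j (ln (real (\<nu> j)) / L) * of_real (real (\<nu> j) powr (- 1/2))" if j: "j \<in> ?I" for j
    proof (cases "j \<le> k - 2")
      case True
      then show ?thesis by (simp add: b_def a_def column_weight_def)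
    next
      case False
      have n: "\<nu> j \<ge> 1" "\<nu> j \<le> Y ^ K" using sm[OF j] by auto
      have "real (\<nu> j) > 0" "real (\<nu> j) \<le> real (Y ^ K)" using n by (simp_all only: of_nat_le_iff of_nat_0_less_iff)
      then have "ln (real (\<nu> j)) \<le> ln (real Y ^ K)" unfolding of_nat_power by (intro iffD2[OF ln_le_cancel_iff]) linarith+
      also have "\<dots> = real K * ln (real Y)" by (rule ln_realpow)
      also have "\<dots> \<le> real K * L"
      proof -
        have "real Y \<le> exp L" unfolding Y_def by (simp add: of_nat_floor)
        then have "ln (real Y) \<le> ln (exp L)" using Y_ge by (intro iffD2[OF ln_le_cancel_iff]) simp_all
        then have "ln (real Y) \<le> L" by simp
        then show ?thesis by (intro mult_left_mono) auto
      qed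
      finally have "ln (real (\<nu> j)) / L \<le> real k + 2" using L by (simp add: divide_le_eq add.commute)
      moreover have "ln (real (\<nu> j)) / L \<ge> 0" using n L by simp
      ultimately have "column_weight k P (\<lambda>j. - \<beta> j * of_real L) j (ln (real (\<nu> j)) / L) = exp (- \<beta> j * of_real (ln (real (\<nu> j))))"
        using False L by (simp add: column_weight_def cut_exp_def)
      moreover have "b j (\<nu> j) = exp (- \<beta> j * of_real (ln (real (\<nu> j)))) * of_real (real (\<nu> j) powr (- 1/2))"
      proof -
        have "b j (\<nu> j) = of_nat (\<nu> j) powr (- \<beta> j + of_real (- 1/2))" using False lt[OF j] by (simp add: b_def zeta_coeff_def add.commute)
        also have "\<dots> = of_nat (\<nu> j) powr (- \<beta> j) * of_nat (\<nu> j) powr (of_real (- 1/2))" by (rule powr_add)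
        also have "of_nat (\<nu> j) powr (- \<beta> j) = exp (- \<beta> j * of_real (ln (real (\<nu> j))))" using n by (simp add: powr_def)
        also have "complex_of_nat (\<nu> j) powr (of_real (- 1/2)) = of_real (real (\<nu> j) powr (- 1/2))"
          using powr_of_real[of "real (\<nu> j)" "- 1/2"] by simp
        finally show ?thesis .
      qed
      ultimately show ?thesis by simp
    qed
    \<comment> \<open>The powers \<open>- 1/2\<close> from both sides combine to the full reciprocal
      because the two products are equal.\<close>
    have "(\<Prod>i\<in>?I. real (\<mu> i) powr (- 1/2)) * (\<Prod>j\<in>?I. real (\<nu> j) powr (- 1/2)) = 1 / (\<Prod>i\<in>?I. real (\<mu> i))"
    proof -
      have "(\<Prod>i\<in>?I. \<mu> i) = (\<Prod>j\<in>?I. \<nu> j)" using mn by auto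
      then have e: "(\<Prod>j\<in>?I. real (\<nu> j)) = (\<Prod>i\<in>?I. real (\<mu> i))" by (simp only: of_nat_prod[symmetric])
      have pos: "(\<Prod>i\<in>?I. real (\<mu> i)) > 0" using \<mu>1 by (intro prod_pos) (simp add: Suc_le_eq)
      have "(\<Prod>i\<in>?I. real (\<mu> i) powr (- 1/2)) = (\<Prod>i\<in>?I. real (\<mu> i)) powr (- 1/2)" by (rule prod_powr_nat)
      moreover have "(\<Prod>j\<in>?I. real (\<nu> j) powr (- 1/2)) = (\<Prod>j\<in>?I. real (\<nu> j)) powr (- 1/2)" by (rule prod_powr_nat)
      moreover have "(\<Prod>i\<in>?I. real (\<mu> i)) powr (- 1/2) * (\<Prod>i\<in>?I. real (\<mu> i)) powr (- 1/2) = (\<Prod>i\<in>?I. real (\<mu> i)) powr (- 1)"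
        unfolding powr_add[symmetric] by simp
      moreover have "(\<Prod>i\<in>?I. real (\<mu> i)) powr (- 1) = 1 / (\<Prod>i\<in>?I. real (\<mu> i))" using pos by (simp add: powr_minus_divide)
      ultimately show ?thesis unfolding e by (simp only:)
    qed
    then have pw: "complex_of_real (\<Prod>i\<in>?I. real (\<mu> i) powr (- 1/2)) * of_real (\<Prod>j\<in>?I. real (\<nu> j) powr (- 1/2)) = 1 / of_real (\<Prod>i\<in>?I. real (\<mu> i))"
      by (simp only: of_real_mult[symmetric] of_real_divide of_real_1)
    have "(\<Prod>i\<in>?I. a (\<mu> i)) * (\<Prod>j\<in>?I. b j (\<nu> j)) * ?V \<nu> = W * ((\<Prod>i\<in>?I. cut_poly P (ln (real (\<mu> i)) / L)) *
      (\<Prod>j\<in>?I. column_weight k P (\<lambda>j. - \<beta> j * of_real L) j (ln (real (\<nu> j)) / L)) * (of_real (\<Prod>i\<in>?I. real (\<mu> i) powr (- 1/2)) * of_real (\<Prod>j\<in>?I. real (\<nu> j) powr (- 1/2))))"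
    proof -
      have "(\<Prod>j\<in>?I. b j (\<nu> j)) = (\<Prod>j\<in>?I. column_weight k P (\<lambda>j. - \<beta> j * of_real L) j (ln (real (\<nu> j)) / L) * of_real (real (\<nu> j) powr (- 1/2)))"
        by (intro prod.cong refl b)
      then show ?thesis unfolding V a_def prod.distrib of_real_prod by (simp only: mult_ac)
    qed
    then show ?thesis unfolding pw by (simp only: times_divide_eq_right mult_1_right)
  qed
  have sum_eq: "(\<Sum>(\<mu>, \<nu>)\<in>?\<Delta>. (\<Prod>i\<in>?I. a (\<mu> i)) * (\<Prod>j\<in>?I. b j (\<nu> j)) * ?V \<nu>) = W * S"
    unfolding S_def diagonal_sum_def Y_def[symmetric] \<Delta>[symmetric] sum_distrib_left
  proof (rule sum.cong[OF refl])
    fix x assume x: "x \<in> ?\<Delta>"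
    obtain \<mu> \<nu> where xx: "x = (\<mu>, \<nu>)" by (cases x)
    show "(case x of (\<mu>, \<nu>) \<Rightarrow> (\<Prod>i\<in>?I. a (\<mu> i)) * (\<Prod>j\<in>?I. b j (\<nu> j)) * ?V \<nu>) = W * (case x of (\<mu>, \<nu>) \<Rightarrow> (\<Prod>i\<in>?I. cut_poly P (ln (real (\<mu> i)) / L)) *
   (\<Prod>j\<in>?I. column_weight k P (\<lambda>j. - \<beta> j * of_real L) j (ln (real (\<nu> j)) / L)) / of_real (\<Prod>i\<in>?I. real (\<mu> i)))"
      using diag_term[of \<mu> \<nu>] x unfolding xx prod.case by blast
  qed
  have cd: "card ?I = K" by simp
  have \<delta>4: "4 * \<delta> = 128 * ln T / T" by (simp add: \<delta>_def)
  have le: "(v - u) * c * B * fact N * (4 * \<delta> * real Y ^ K) ^ N \<le> 2 * T * c * B * fact N * (4 * \<delta> * real Y ^ K) ^ N"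
    using uv c B_nonneg \<delta> by (intro mult_right_mono) auto
  have last: "real Y ^ K * real M ^ K * ((p * real M) ^ K * (p * real M) ^ K * ((v - u) * c * B * fact N * (4 * \<delta> * real Y ^ K) ^ N))
     \<le> real Y ^ K * real M ^ K * ((p * real M) ^ K * (p * real M) ^ K * (2 * T * c * B * fact N * (128 * ln T / T * real Y ^ K) ^ N))"
    unfolding \<delta>4[symmetric] using p(1) by (intro mult_left_mono le mult_nonneg_nonneg zero_le_power) auto
  show ?thesis using order_trans[OF osc[unfolded int_eq sum_eq cd] last] .
qed

end

section \<open>Bounds uniform in the shifts\<close>

lemma cut_poly_lipschitz: "\<exists>C\<ge>1. cut_lipschitz C 1 (cut_poly P)"
proof -
  have "compact (poly P ` {0..1::real})" "compact (poly (pderiv P) ` {0..1::real})"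
    by (intro compact_continuous_image continuous_intros; simp)+
  then obtain C1 C2 where "\<forall>y\<in>poly P ` {0..1}. norm y \<le> C1" "\<forall>y\<in>poly (pderiv P) ` {0..1}. norm y \<le> C2"
    by (meson bounded_iff compact_imp_bounded)
  then have C1: "\<And>x. x \<in> {0..1::real} \<Longrightarrow> \<bar>poly P x\<bar> \<le> C1" and C2: "\<And>x. x \<in> {0..1::real} \<Longrightarrow> \<bar>poly (pderiv P) x\<bar> \<le> C2" by auto
  define C where "C = max 1 (max C1 C2)"
  have C: "C \<ge> 1" "C1 \<le> C" "C2 \<le> C" by (auto simp: C_def)
  have lip: "\<bar>poly P x - poly P y\<bar> \<le> C2 * \<bar>x - y\<bar>" if "x \<in> {0..1}" "y \<in> {0..1}" for x y :: real
  proof -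
    have "norm (poly P x - poly P y) \<le> C2 * norm (x - y)"
    proof (rule field_differentiable_bound[of "{0..1}" "poly P" "poly (pderiv P)"])
      show "(poly P has_field_derivative poly (pderiv P) z) (at z within {0..1})" for z
        by (rule DERIV_subset[OF poly_DERIV]) simp
      show "norm (poly (pderiv P) z) \<le> C2" if "z \<in> {0..1}" for z using C2[OF that] by simp
    qed (use that in auto)
    then show ?thesis by simp
  qed
  have "cut_lipschitz C 1 (cut_poly P)"
    unfolding cut_lipschitz_def
  proof (intro conjI allI impI)
    show "norm (cut_poly P v) \<le> C" if "v \<ge> 0" for v
      using that C1[of "1 - v"] C by (auto simp: cut_poly_def)
    show "cut_poly P v = 0" if "v > 1" for v using that by (simp add: cut_poly_def)
    fix v v' :: real assume v: "0 \<le> v \<and> v \<le> v' \<and> v' \<le> 1"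
    then have "norm (cut_poly P v - cut_poly P v') = \<bar>poly P (1 - v) - poly P (1 - v')\<bar>"
      by (simp add: cut_poly_def flip: of_real_diff)
    also have "\<dots> \<le> C2 * (v' - v)" using lip[of "1 - v" "1 - v'"] v by simp
    also have "\<dots> \<le> C * (v' - v)" using C v by (intro mult_right_mono) auto
    finally show "norm (cut_poly P v - cut_poly P v') \<le> C * (v' - v)" .
  qed
  then show ?thesis using C(1) by blast
qed

text \<open>The increment is \<open>exp (c * v)\<close> times \<open>exp (c * (v' - v)) - 1\<close>,
  and the resulting constant depends on \<open>c\<close> only through \<open>E\<close>.\<close>

lemma cut_exp_lipschitz:
  assumes c: "norm c \<le> E" and V: "V \<ge> 0"
  shows "cut_lipschitz ((1 + E) * exp (E * V)) V (cut_exp V c)"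
  unfolding cut_lipschitz_def
proof (intro conjI allI impI)
  have E: "E \<ge> 0" using c norm_ge_zero order_trans by blast
  have ev: "norm (exp (c * of_real v)) \<le> exp (E * v)" if "v \<ge> 0" for v
  proof -
    have "norm (c * of_real v) \<le> E * v" unfolding norm_mult using c that by (simp add: mult_right_mono)
    then show ?thesis using norm_exp[of "c * of_real v"] by (meson exp_le_cancel_iff order_trans)
  qed
  show "norm (cut_exp V c v) \<le> (1 + E) * exp (E * V)" if "v \<ge> 0" for v
  proof (cases "v \<le> V")
    case True
    have "norm (exp (c * of_real v)) \<le> 1 * exp (E * v)" using ev[OF that] by simp
    also have "\<dots> \<le> (1 + E) * exp (E * V)" using E True that by (intro mult_mono) (auto intro: mult_left_mono)
    finally show ?thesis using True that by (simp add: cut_exp_def)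
  qed (use E in \<open>simp add: cut_exp_def\<close>)
  show "cut_exp V c v = 0" if "v > V" for v using that by (simp add: cut_exp_def)
  fix v v' :: real assume v: "0 \<le> v \<and> v \<le> v' \<and> v' \<le> V"
  have d: "norm (c * of_real (v' - v)) \<le> E * (v' - v)" unfolding norm_mult norm_of_real using c v E by (intro mult_mono) auto
  have "cut_exp V c v - cut_exp V c v' = - (exp (c * of_real v) * (exp (c * of_real (v' - v)) - 1))"
    using v by (simp add: cut_exp_def algebra_simps flip: exp_add)
  then have "norm (cut_exp V c v - cut_exp V c v') = norm (exp (c * of_real v)) * norm (exp (c * of_real (v' - v)) - 1)"
    by (simp only: norm_minus_cancel norm_mult)
  also have "\<dots> \<le> exp (E * v) * (norm (c * of_real (v' - v)) * exp (norm (c * of_real (v' - v))))"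
    using v by (intro mult_mono ev norm_exp_minus_one_le) auto
  also have "\<dots> \<le> exp (E * v) * (E * (v' - v) * exp (E * (v' - v)))"
    using d E v by (intro mult_left_mono mult_mono) auto
  also have "\<dots> = E * exp (E * v') * (v' - v)" by (simp add: mult_exp_exp algebra_simps)
  also have "\<dots> \<le> (1 + E) * exp (E * V) * (v' - v)"
    using E v by (intro mult_right_mono mult_mono) (auto intro: mult_left_mono)
  finally show "norm (cut_exp V c v - cut_exp V c v') \<le> (1 + E) * exp (E * V) * (v' - v)" .
qed

text \<open>For \<open>|\<alpha>| <= 1/4\<close> the exponential in
  \<open>norm_zeta_chi_shift_le\<close> is at most \<open>exp (84 / 4) = exp 21\<close>. The first
  estimate uses \<open>\<alpha> = O(1 / ln T)\<close> and saves a logarithm; the others are plain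
  bounds.\<close>

lemma chi_ratio_bounds:
  assumes T: "T \<ge> 32" and \<alpha>: "norm \<alpha> \<le> 1/4" "norm \<alpha> \<le> A / ln T" and z: "T / 8 \<le> Re z" "Re z \<le> 3 * T" "\<bar>Im z\<bar> \<le> T / 16"
  shows "norm (chi_ratio \<alpha> z * exp (\<alpha> * of_real (ln (T / (2 * pi)))) - 1) \<le> 84 * exp 21 * (A / ln T)" (is "?d \<le> _")
    and "norm (chi_ratio \<alpha> z * exp (\<alpha> * of_real (ln (T / (2 * pi)))) - 1) \<le> 84 * exp 21"
    and "norm (\<alpha> * of_real (ln (T / (2 * pi)))) \<le> A"
    and "norm (chi_ratio \<alpha> z) \<le> exp A * (1 + 84 * exp 21)"
proof -
  define l where "l = ln (T / (2 * pi))"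
  have "84 * norm \<alpha> * exp (84 * norm \<alpha>) \<le> 84 * norm \<alpha> * exp 21" using \<alpha> by (intro mult_left_mono) auto
  then have 0: "?d \<le> 84 * norm \<alpha> * exp 21"
    using norm_zeta_chi_shift_le[OF T _ z, of \<alpha>] \<alpha> unfolding chi_ratio_def by linarith
  have "84 * norm \<alpha> * exp 21 \<le> 84 * (A / ln T) * exp 21" using \<alpha> by (intro mult_right_mono mult_left_mono) auto
  then show "?d \<le> 84 * exp 21 * (A / ln T)" using 0 by (simp add: mult_ac)
  have "84 * norm \<alpha> * exp 21 \<le> 84 * 1 * exp 21" using \<alpha> by (intro mult_right_mono mult_left_mono) auto
  then show d: "?d \<le> 84 * exp 21" using 0 by linarith
  have l: "0 \<le> l" "l \<le> ln T"
  proof -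
    have "2 * pi \<le> T" using T pi_less_4 by linarith
    then show "0 \<le> l" using pi_gt_zero T by (auto simp: l_def divide_simps)
    have "T / (2 * pi) \<le> T" using T pi_ge_two by (auto simp: divide_simps)
    then show "l \<le> ln T" unfolding l_def using T by (intro iffD2[OF ln_le_cancel_iff]) auto
  qed
  have lnT: "ln T > 0" using T by simp
  have "norm (\<alpha> * of_real l) \<le> (A / ln T) * ln T"
    unfolding norm_mult norm_of_real using \<alpha> l lnT order_trans[OF norm_ge_zero \<alpha>(2)] by (intro mult_mono) auto
  then show n: "norm (\<alpha> * of_real (ln (T / (2 * pi)))) \<le> A" using lnT by (simp add: l_def)
  have "chi_ratio \<alpha> z = chi_ratio \<alpha> z * exp (\<alpha> * of_real l) * exp (- (\<alpha> * of_real l))"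
    by (simp add: mult.assoc flip: exp_add)
  then have "norm (chi_ratio \<alpha> z) = norm (chi_ratio \<alpha> z * exp (\<alpha> * of_real l)) * norm (exp (- (\<alpha> * of_real l)))"
    by (metis norm_mult)
  also have "\<dots> \<le> (1 + 84 * exp 21) * exp A"
  proof (intro mult_mono)
    show "norm (chi_ratio \<alpha> z * exp (\<alpha> * of_real l)) \<le> 1 + 84 * exp 21"
      using d norm_triangle_sub[of "chi_ratio \<alpha> z * exp (\<alpha> * of_real l)" 1] unfolding l_def by simp
    have "norm (exp (- (\<alpha> * of_real l))) \<le> exp (norm (- (\<alpha> * of_real l)))" by (rule norm_exp)
    then show "norm (exp (- (\<alpha> * of_real l))) \<le> exp A" using n unfolding l_def[symmetric] by (simp add: order_trans)
  qed auto
  finally show "norm (chi_ratio \<alpha> z) \<le> exp A * (1 + 84 * exp 21)" by (simp only: mult.commute)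
qed

text \<open>\<open>1 / E\<close> will be the power of \<open>T / (2 * pi)\<close> in the main term;
  it is \<open>W * E\<close>, not \<open>W\<close>, that is close to the weight integral
  \<open>F\<close>.\<close>

lemma norm_product_approx:
  fixes tm W S E F R :: complex
  assumes "norm (tm - W * S) \<le> e0" "norm (W * E - F) \<le> e1" "norm (S - R) \<le> e2" "norm S \<le> s" "norm F \<le> f" "norm (1 / E) \<le> \<eta>" "E \<noteq> 0"
  shows "norm (tm - F * (1 / E) * R) \<le> e0 + \<eta> * (e1 * s + f * e2)"
proof -
  note nn = order_trans[OF norm_ge_zero assms(2)] order_trans[OF norm_ge_zero assms(3)] order_trans[OF norm_ge_zero assms(4)]
    order_trans[OF norm_ge_zero assms(5)] order_trans[OF norm_ge_zero assms(6)]
  have "tm - F * (1 / E) * R = (tm - W * S) + (1 / E) * ((W * E - F) * S + F * (S - R))"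
    using assms(7) by (simp add: field_simps)
  also have "norm \<dots> \<le> e0 + norm ((1 / E) * ((W * E - F) * S + F * (S - R)))"
    by (rule order_trans[OF norm_triangle_ineq add_right_mono[OF assms(1)]])
  also have "norm ((1 / E) * ((W * E - F) * S + F * (S - R))) \<le> \<eta> * (e1 * s + f * e2)"
  proof -
    have "norm ((W * E - F) * S + F * (S - R)) \<le> e1 * s + f * e2"
      using assms nn by (intro norm_triangle_le add_mono) (auto simp: norm_mult intro!: mult_mono)
    then show ?thesis unfolding norm_mult[of "1 / E"] using assms nn by (intro mult_mono) auto
  qed
  finally show ?thesis by simp
qed

lemma norm_matrix_integral_le:
  assumes I: "finite I" "finite J" and C: "C \<ge> 1" and f: "\<And>i. i \<in> I \<Longrightarrow> cut_lipschitz C 1 (f i) \<and> f i \<in> borel_measurable borel"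
    and g: "\<And>j. j \<in> J \<Longrightarrow> cut_lipschitz C (V j) (g j) \<and> g j \<in> borel_measurable borel"
  shows "norm (\<integral>u. indicator (I \<times> J \<rightarrow>\<^sub>E {0..1}) u *\<^sub>R matrix_weight I J f g u \<partial>Pi\<^sub>M (I \<times> J) (\<lambda>_. lborel)) \<le> C ^ (card I + card J)"
proof -
  let ?Q = "I \<times> J \<rightarrow>\<^sub>E {0..1::real}"
  have b: "norm (matrix_weight I J f g u) \<le> C ^ (card I + card J)" if u: "u \<in> ?Q" for u
  proof -
    have m: "u (i, j) \<ge> 0" if "i \<in> I" "j \<in> J" for i j using PiE_mem[OF u, of "(i, j)"] that by simp
    have "norm (\<Prod>i\<in>I. f i (\<Sum>j\<in>J. u (i, j))) \<le> C ^ card I"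
      using m f C I by (intro norm_prod_le_power cut_lipschitzD(1)[of C 1] sum_nonneg) auto
    moreover have "norm (\<Prod>j\<in>J. g j (\<Sum>i\<in>I. u (i, j))) \<le> C ^ card J"
      using m g C I by (intro norm_prod_le_power cut_lipschitzD(1) sum_nonneg) auto
    ultimately show ?thesis unfolding matrix_weight_def norm_mult power_add using C by (intro mult_mono) auto
  qed
  show ?thesis using I f g by (intro integrable_cube(2) matrix_weight_measurable b) auto
qed

context twisted_setup
begin

lemma norm_chi_product_le:
  assumes A: "norm \<alpha>1 \<le> \<kappa> / ln T" "norm \<alpha>2 \<le> \<kappa> / ln T" and t: "t \<in> {u..v}"
  shows "norm (h (of_real t) * exp ((\<alpha>1 + \<alpha>2) * of_real (ln (T / (2 * pi)))) - 1) \<le> (2 + 84 * exp 21) * (84 * exp 21 * (\<kappa> / ln T))"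
proof -
  define l where "l = complex_of_real (ln (T / (2 * pi)))"
  define G :: real where "G = 84 * exp 21"
  have z: "T / 8 \<le> Re (of_real t)" "Re (complex_of_real t) \<le> 3 * T" "\<bar>Im (complex_of_real t)\<bar> \<le> T / 16"
    using t T by (auto simp: u_def v_def)
  note b1 = chi_ratio_bounds[OF T \<alpha>(1) A(1) z, folded l_def G_def]
  note b2 = chi_ratio_bounds[OF T \<alpha>(2) A(2) z, folded l_def G_def]
  have "norm (chi_ratio \<alpha>2 (of_real t) * exp (\<alpha>2 * l)) \<le> 1 + G"
    using b2(2) norm_triangle_sub[of "chi_ratio \<alpha>2 (of_real t) * exp (\<alpha>2 * l)" 1] by simp
  then have "norm ((chi_ratio \<alpha>1 (of_real t) * exp (\<alpha>1 * l)) * (chi_ratio \<alpha>2 (of_real t) * exp (\<alpha>2 * l)) - 1 * 1) \<le> (1 + G) * (G * (\<kappa> / ln T)) + 1 * (G * (\<kappa> / ln T))"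
    by (rule norm_mult_diff_le) (use b1 b2 in auto)
  moreover have "(chi_ratio \<alpha>1 (of_real t) * exp (\<alpha>1 * l)) * (chi_ratio \<alpha>2 (of_real t) * exp (\<alpha>2 * l)) = h (of_real t) * exp ((\<alpha>1 + \<alpha>2) * l)"
    unfolding h_def distrib_right exp_add by (simp only: mult_ac)
  moreover have "(1 + G) * x + 1 * x = (2 + G) * x" for x :: real
    by (simp add: algebra_simps)
  moreover note this[of "G * (\<kappa> / ln T)"]
  ultimately show ?thesis unfolding l_def G_def by (simp only: mult_1_left)
qed

lemma \<phi>0_cont: "continuous_on X (\<phi> 0)"
  using deriv[of 0] by (meson DERIV_isCont continuous_at_imp_continuous_on)

lemma weight_integral: "integral {u..v} (\<phi> 0) = T * (LBINT x. w x)"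
proof -
  have int: "set_integrable lborel {u..v} (\<phi> 0)"
    unfolding set_integrable_def by (rule borel_integrable_compact[OF compact_Icc \<phi>0_cont])
  have "(LBINT x. w x) = \<bar>1 / T\<bar> *\<^sub>R (LBINT t. w (0 + (1 / T) * t))"
    using T by (intro lborel_integral_real_affine) simp
  also have "(LBINT t. w (0 + (1 / T) * t)) = (LBINT t. indicator {u..v} t *\<^sub>R \<phi> 0 t)"
  proof (rule Bochner_Integration.integral_cong[OF refl])
    fix t :: real
    have "t \<notin> {u..v} \<Longrightarrow> \<phi> 0 t = 0" using uv by (intro vanish) auto
    then show "w (0 + (1 / T) * t) = indicator {u..v} t *\<^sub>R \<phi> 0 t" using \<phi>0[of t] by (cases "t \<in> {u..v}") simp_all
  qed
  also have "\<dots> = integral {u..v} (\<phi> 0)"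
    using set_borel_integral_eq_integral(2)[OF int] by (simp add: set_lebesgue_integral_def)
  finally show ?thesis using T by simp
qed

lemma weight_integral_bound: "\<bar>T * (LBINT x. w x)\<bar> \<le> 2 * T"
proof -
  have "norm (integral {u..v} (\<phi> 0)) \<le> 1 * (v - u)"
    by (rule integral_bound[OF uv(1) \<phi>0_cont]) (use w01 in \<open>simp add: \<phi>0\<close>)
  then show ?thesis using uv(3) unfolding weight_integral by simp
qed

text \<open>Pointwise the two \<open>chi_ratio\<close> factors times the exponential are
  \<open>1 + O(1 / ln T)\<close>. So the bare weight integral remains, with an error
  \<open>O(T / ln T)\<close> over an interval of length at most \<open>2 * T\<close>.\<close>

lemma W_approx:
  assumes A: "norm \<alpha>1 \<le> \<kappa> / ln T" "norm \<alpha>2 \<le> \<kappa> / ln T"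
  shows "norm (W * exp ((\<alpha>1 + \<alpha>2) * of_real (ln (T / (2 * pi)))) - of_real (T * (LBINT x. w x)))
    \<le> 2 * T * ((2 + 84 * exp 21) * (84 * exp 21 * (\<kappa> / ln T)))"
proof -
  let ?E = "exp ((\<alpha>1 + \<alpha>2) * of_real (ln (T / (2 * pi))))"
  let ?e = "(2 + 84 * exp 21) * (84 * exp 21 * (\<kappa> / ln T))"
  have e0: "?e \<ge> 0" using order_trans[OF norm_ge_zero A(1)] by (intro mult_nonneg_nonneg) auto
  have ch: "continuous_on {u..v} (\<lambda>t. h (complex_of_real t))"
    by (rule continuous_on_compose2[OF holomorphic_on_imp_continuous_on[OF h_holomorphic]]) (use \<Omega> in \<open>auto intro!: continuous_intros\<close>)
  have c: "continuous_on {u..v} (\<lambda>t. of_real (\<phi> 0 t) * h (of_real t) * ?E)" "continuous_on {u..v} (\<lambda>t. complex_of_real (\<phi> 0 t))"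
    by (intro continuous_intros \<phi>0_cont ch)+
  have "((\<lambda>t. complex_of_real (\<phi> 0 t)) has_integral of_real (integral {u..v} (\<phi> 0))) {u..v}"
    by (intro has_integral_of_real integrable_integral integrable_continuous_interval \<phi>0_cont)
  then have "of_real (T * (LBINT x. w x)) = integral {u..v} (\<lambda>t. complex_of_real (\<phi> 0 t))"
    unfolding weight_integral by (simp add: integral_unique)
  moreover have "W * ?E = integral {u..v} (\<lambda>t. of_real (\<phi> 0 t) * h (of_real t) * ?E)"
    unfolding W_def by (rule integral_mult_left[symmetric])
  ultimately have "W * ?E - of_real (T * (LBINT x. w x)) = integral {u..v} (\<lambda>t. of_real (\<phi> 0 t) * h (of_real t) * ?E - of_real (\<phi> 0 t))"
    using c by (simp only: Henstock_Kurzweil_Integration.integral_diff integrable_continuous_interval)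
  also have "norm \<dots> \<le> ?e * (v - u)"
  proof (rule integral_bound[OF uv(1)])
    show "continuous_on {u..v} (\<lambda>t. of_real (\<phi> 0 t) * h (of_real t) * ?E - of_real (\<phi> 0 t))" by (intro continuous_intros c)
    fix t assume t: "t \<in> {u..v}"
    have "of_real (\<phi> 0 t) * h (of_real t) * ?E - of_real (\<phi> 0 t) = of_real (\<phi> 0 t) * (h (of_real t) * ?E - 1)" by (simp add: algebra_simps)
    also have "norm \<dots> \<le> 1 * ?e"
      unfolding norm_mult norm_of_real using norm_chi_product_le[OF A t] w01 e0 by (intro mult_mono) (auto simp: \<phi>0)
    finally show "norm (of_real (\<phi> 0 t) * h (of_real t) * ?E - of_real (\<phi> 0 t)) \<le> ?e" by simp
  qed
  also have "\<dots> \<le> ?e * (2 * T)" using uv(3) e0 by (intro mult_left_mono)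
  finally show ?thesis by (simp only: mult.commute)
qed

lemma moment_approx:
  assumes A: "norm \<alpha>1 \<le> \<kappa> / ln T" "norm \<alpha>2 \<le> \<kappa> / ln T"
    and e: "norm (twisted_moment k P (exp L) w T \<alpha>1 \<alpha>2 \<alpha>3 \<alpha>4 - W * S) \<le> e0" "norm (S - of_real r * R) \<le> e2" "norm S \<le> s"
  shows "norm (twisted_moment k P (exp L) w T \<alpha>1 \<alpha>2 \<alpha>3 \<alpha>4 - of_real (r * T * (LBINT x. w x)) * of_real (T / (2 * pi)) powr (- \<alpha>1 - \<alpha>2) * R)
    \<le> e0 + exp (2 * \<kappa>) * (2 * T * ((2 + 84 * exp 21) * (84 * exp 21 * (\<kappa> / ln T))) * s + 2 * T * e2)"
proof -
  define l where "l = complex_of_real (ln (T / (2 * pi)))"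
  have z: "T / 8 \<le> Re (of_real T)" "Re (complex_of_real T) \<le> 3 * T" "\<bar>Im (complex_of_real T)\<bar> \<le> T / 16" using T by auto
  have "norm (- ((\<alpha>1 + \<alpha>2) * l)) \<le> 2 * \<kappa>"
    using chi_ratio_bounds(3)[OF T \<alpha>(1) A(1) z] chi_ratio_bounds(3)[OF T \<alpha>(2) A(2) z] norm_triangle_ineq[of "\<alpha>1 * l" "\<alpha>2 * l"]
    unfolding l_def norm_minus_cancel distrib_right by linarith
  then have "exp (norm (- ((\<alpha>1 + \<alpha>2) * l))) \<le> exp (2 * \<kappa>)" by simp
  then have "norm (exp (- ((\<alpha>1 + \<alpha>2) * l))) \<le> exp (2 * \<kappa>)" by (rule order_trans[OF norm_exp])
  then have E: "norm (1 / exp ((\<alpha>1 + \<alpha>2) * l)) \<le> exp (2 * \<kappa>)" by (simp add: exp_minus inverse_eq_divide)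
  have pw: "of_real (T / (2 * pi)) powr (- \<alpha>1 - \<alpha>2) = 1 / exp ((\<alpha>1 + \<alpha>2) * l)"
  proof -
    have "T / (2 * pi) > 0" "T \<noteq> 0" using T by simp_all
    then have "of_real (T / (2 * pi)) powr (- \<alpha>1 - \<alpha>2) = exp ((- \<alpha>1 - \<alpha>2) * l)"
      by (simp add: powr_def l_def Ln_of_real del: of_real_divide)
    also have "(- \<alpha>1 - \<alpha>2) * l = - ((\<alpha>1 + \<alpha>2) * l)" by (simp add: algebra_simps)
    finally show ?thesis by (simp add: exp_minus inverse_eq_divide)
  qed
  have F: "norm (complex_of_real (T * (LBINT x. w x))) \<le> 2 * T" using weight_integral_bound by (simp only: norm_of_real)
  have "norm (twisted_moment k P (exp L) w T \<alpha>1 \<alpha>2 \<alpha>3 \<alpha>4 - of_real (T * (LBINT x. w x)) * (1 / exp ((\<alpha>1 + \<alpha>2) * l)) * (of_real r * R))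
    \<le> e0 + exp (2 * \<kappa>) * (2 * T * ((2 + 84 * exp 21) * (84 * exp 21 * (\<kappa> / ln T))) * s + 2 * T * e2)"
    by (rule norm_product_approx[OF e(1) W_approx[OF A, folded l_def] e(2,3) F E exp_not_eq_zero])
  moreover have "of_real (T * (LBINT x. w x)) * (1 / exp ((\<alpha>1 + \<alpha>2) * l)) * (of_real r * R) = of_real (r * T * (LBINT x. w x)) * of_real (T / (2 * pi)) powr (- \<alpha>1 - \<alpha>2) * R"
    unfolding pw of_real_mult by (simp only: mult_ac)
  ultimately show ?thesis by (simp only:)
qed

end

text \<open>The powers of \<open>T\<close> explain the length \<open>T ^ 40\<close>: its power
  \<open>- 1/4\<close> is \<open>T powr (- 10)\<close>, which absorbs \<open>T ^ 8\<close> from the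
  zeta bounds, \<open>T\<close> from \<open>Y ^ (2 * k)\<close> and \<open>T\<close> from the
  interval.\<close>

lemma approx_error_le:
  fixes T Y M p B :: real
  assumes T: "T > 0" and Y: "0 \<le> Y" "Y ^ (2 * k) \<le> T" and M: "M \<ge> T ^ 40" and pB: "p \<ge> 0" "B \<ge> 0"
  shows "B * (p * Y) ^ (2 * k) * (4 * (300 * T\<^sup>2) ^ 3 * (117 * T\<^sup>2 * M powr (- 1/4))) * (2 * T) \<le> B * p ^ (2 * k) * (8 * 300 ^ 3 * 117)"
proof -
  have "M powr (- 1/4) \<le> (T ^ 40) powr (- 1/4)" using M T by (intro powr_mono2') auto
  also have "(T ^ 40) powr (- 1/4) = 1 / T ^ 10"
  proof -
    have "(T ^ 40) powr (- 1/4) = (T powr 40) powr (- 1/4)" using T by simp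
    also have "\<dots> = T powr (- 10)" unfolding powr_powr by simp
    finally show ?thesis using T by (simp add: powr_minus_divide)
  qed
  finally have m: "M powr (- 1/4) \<le> 1 / T ^ 10" .
  have "B * (p * Y) ^ (2 * k) * (4 * (300 * T\<^sup>2) ^ 3 * (117 * T\<^sup>2 * M powr (- 1/4))) * (2 * T)
    \<le> B * (p ^ (2 * k) * T) * (4 * (300 * T\<^sup>2) ^ 3 * (117 * T\<^sup>2 * (1 / T ^ 10))) * (2 * T)"
    unfolding power_mult_distrib[of p] using m Y T pB by (intro mult_right_mono mult_mono mult_left_mono) auto
  also have "\<dots> = B * p ^ (2 * k) * (8 * 300 ^ 3 * 117)"
  proof -
    have "T * ((300 * T\<^sup>2) ^ 3 * (T\<^sup>2 * (1 / T ^ 10))) * T = 300 ^ 3"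
      using T by (simp add: power_mult_distrib field_simps flip: power_mult power_add power_Suc)
    then have "B * p ^ (2 * k) * (8 * 117) * (T * ((300 * T\<^sup>2) ^ 3 * (T\<^sup>2 * (1 / T ^ 10))) * T) = B * p ^ (2 * k) * (8 * 117) * 300 ^ 3"
      by (simp only:)
    then show ?thesis by (simp only: mult_ac)
  qed
  finally show ?thesis .
qed

text \<open>Each integration by parts gains \<open>T powr (- 1/4)\<close>, as
  \<open>Y ^ K <= T powr (1/2)\<close>. Doing \<open>4 * (120 * K + 2)\<close> of them gains
  \<open>T ^ (120 * K + 2)\<close>, which matches \<open>T ^ (40 * K)\<close> for the number of
  column tuples, \<open>T ^ (80 * K)\<close> for the coefficients, and \<open>T ^ 2\<close> for
  \<open>Y ^ K\<close> and the interval.\<close>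

lemma off_diagonal_error_le:
  fixes T Y M p B c :: real
  assumes T: "T \<ge> 1" and Y: "0 \<le> Y" "Y ^ K \<le> T powr (1/2)" and M: "0 \<le> M" "M \<le> 2 * T ^ 40" and pB: "p \<ge> 0" "B \<ge> 0" "c \<ge> 0"
    and ln: "128 * ln T / T * T powr (1/2) \<le> T powr (- 1/4)"
  shows "Y ^ K * M ^ K * ((p * M) ^ K * (p * M) ^ K * (2 * T * c * B * fact (4 * (120 * K + 2)) * (128 * ln T / T * Y ^ K) ^ (4 * (120 * K + 2))))
    \<le> 2 ^ K * (2 * p) ^ (2 * K) * (2 * c * B * fact (4 * (120 * K + 2)))"
proof -
  let ?N = "4 * (120 * K + 2)"
  have lnT: "ln T \<ge> 0" using T by simp
  have "128 * ln T / T * Y ^ K \<le> 128 * ln T / T * T powr (1/2)" using Y lnT T by (intro mult_left_mono) auto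
  then have "(128 * ln T / T * Y ^ K) ^ ?N \<le> (T powr (- 1/4)) ^ ?N" using ln Y lnT T by (intro power_mono) auto
  also have "(T powr (- 1/4)) ^ ?N = 1 / T ^ (120 * K + 2)"
  proof -
    have "(T powr (- 1/4)) ^ ?N = ((T powr (- 1/4)) ^ 4) ^ (120 * K + 2)" by (rule power_mult)
    also have "(T powr (- 1/4)) ^ 4 = T powr (- 1)" using T by (simp add: powr_power)
    also have "T powr (- 1) = 1 / T" using T by (simp add: powr_minus_divide)
    finally show ?thesis by (simp add: power_divide)
  qed
  finally have N: "(128 * ln T / T * Y ^ K) ^ ?N \<le> 1 / T ^ (120 * K + 2)" .
  have "T powr (1/2) \<le> T powr 1" using T by (intro powr_mono) auto
  then have YT: "Y ^ K \<le> T" using Y T by simp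
  have pM: "(p * M) ^ K \<le> (2 * p) ^ K * (T ^ 40) ^ K"
  proof -
    have "p * M \<le> 2 * p * T ^ 40" using mult_left_mono[OF M(2) pB(1)] by (simp add: mult_ac)
    then have "(p * M) ^ K \<le> (2 * p * T ^ 40) ^ K" using pB M by (intro power_mono) auto
    then show ?thesis by (simp only: power_mult_distrib)
  qed
  have M': "M ^ K \<le> 2 ^ K * (T ^ 40) ^ K" using power_mono[OF M(2,1), of K] by (simp only: power_mult_distrib)
  have "Y ^ K * M ^ K * ((p * M) ^ K * (p * M) ^ K * (2 * T * c * B * fact ?N * (128 * ln T / T * Y ^ K) ^ ?N))
    \<le> T * (2 ^ K * (T ^ 40) ^ K) * (((2 * p) ^ K * (T ^ 40) ^ K) * ((2 * p) ^ K * (T ^ 40) ^ K) * (2 * T * c * B * fact ?N * (1 / T ^ (120 * K + 2))))"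
    using YT M' pM N Y M pB T lnT by (intro mult_mono mult_nonneg_nonneg zero_le_power) auto
  also have "\<dots> = (2 ^ K * ((2 * p) ^ K * (2 * p) ^ K) * (2 * c * B * fact ?N)) * (T * ((T ^ 40) ^ K * ((T ^ 40) ^ K * (T ^ 40) ^ K) * T * (1 / T ^ (120 * K + 2))))"
    by (simp only: mult_ac)
  also have "T * ((T ^ 40) ^ K * ((T ^ 40) ^ K * (T ^ 40) ^ K) * T * (1 / T ^ (120 * K + 2))) = 1"
  proof -
    have "T * ((T ^ 40) ^ K * ((T ^ 40) ^ K * (T ^ 40) ^ K) * T) = T ^ (1 + (40 * K + (40 * K + 40 * K) + 1))"
      by (simp only: power_add power_mult power_one_right)
    also have "1 + (40 * K + (40 * K + 40 * K) + 1) = 120 * K + 2" by simp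
    finally show ?thesis using T by (simp add: mult.assoc[symmetric])
  qed
  also have "(2 * p) ^ K * (2 * p) ^ K = (2 * p) ^ (2 * K)" by (simp only: power_add[symmetric] mult_2)
  finally show ?thesis by simp
qed

section \<open>The asymptotic formula\<close>

text \<open>In logarithmic coordinates the shifts appear only as \<open>\<alpha> * L\<close>, which
  stays bounded. One Lipschitz constant therefore covers all column functions, and
  \<open>diagonal_sum_asymptotic\<close> applies uniformly.\<close>

lemma param_integral_approx:
  fixes k :: nat and P :: "real poly"
  assumes k: "k \<ge> 2" and E: "E \<ge> 0"
  shows "\<exists>C\<ge>1. \<exists>K1\<ge>0. (\<forall>v\<ge>0. norm (cut_poly P v) \<le> C) \<and>
    (\<forall>L\<ge>1. \<forall>\<alpha>1 \<alpha>2 \<alpha>3 \<alpha>4 M. norm \<alpha>1 * L \<le> E \<longrightarrow> norm \<alpha>2 * L \<le> E \<longrightarrow> norm \<alpha>3 * L \<le> E \<longrightarrow> norm \<alpha>4 * L \<le> E \<longrightarrow>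
      M > nat \<lfloor>exp L\<rfloor> ^ (k + 2) \<longrightarrow>
      norm (diagonal_sum {1..k + 2} {1..k + 2} (\<lambda>_. cut_poly P) (column_weight k P (\<lambda>j. - shift_vector k (- \<alpha>1) (- \<alpha>2) \<alpha>3 \<alpha>4 j * of_real L)) L M
        - of_real (arith_factor (k + 2) * L ^ (k + 2)\<^sup>2) * param_integral k P (exp L) \<alpha>1 \<alpha>2 \<alpha>3 \<alpha>4) \<le> K1 * L ^ ((k + 2)\<^sup>2 - 1) \<and>
      norm (param_integral k P (exp L) \<alpha>1 \<alpha>2 \<alpha>3 \<alpha>4) \<le> C ^ (2 * (k + 2)))"
proof -
  let ?I = "{1..k + 2}"
  obtain C0 where C0: "C0 \<ge> 1" "cut_lipschitz C0 1 (cut_poly P)" using cut_poly_lipschitz by blast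
  define C where "C = max C0 ((1 + E) * exp (E * (real k + 2)))"
  have C: "C \<ge> 1" "C0 \<le> C" "(1 + E) * exp (E * (real k + 2)) \<le> C" using C0 by (auto simp: C_def)
  define V where "V = (\<lambda>j. if j \<le> k - 2 then 1 else real k + 2)"
  have f: "cut_lipschitz C 1 (cut_poly P)" by (rule cut_lipschitz_mono[OF C0(2) C(2)])
  have g: "cut_lipschitz C (V j) (column_weight k P c j)" if "norm (c j) \<le> E" for c j
  proof (cases "j \<le> k - 2")
    case True
    then show ?thesis using f by (simp add: V_def column_weight_def)
  next
    case False
    then show ?thesis using cut_lipschitz_mono[OF cut_exp_lipschitz[OF that, of "real k + 2"] C(3)] by (simp add: V_def column_weight_def)
  qed
  have "\<exists>K\<ge>0. \<forall>L\<ge>1. \<forall>f g V M. (\<forall>i\<in>?I. cut_lipschitz C 1 (f i) \<and> f i \<in> borel_measurable borel) \<longrightarrow>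
    (\<forall>j\<in>?I. cut_lipschitz C (V j) (g j) \<and> g j \<in> borel_measurable borel) \<longrightarrow> M > nat \<lfloor>exp L\<rfloor> ^ (k + 2) \<longrightarrow>
    norm (diagonal_sum ?I ?I f g L M
      - of_real (arith_factor (k + 2) * L ^ (k + 2)\<^sup>2) * (\<integral>u. indicator (?I \<times> ?I \<rightarrow>\<^sub>E {0..1}) u *\<^sub>R matrix_weight ?I ?I f g u \<partial>Pi\<^sub>M (?I \<times> ?I) (\<lambda>_. lborel)))
    \<le> K * L ^ ((k + 2)\<^sup>2 - 1)"
    by (rule diagonal_sum_asymptotic) (use C in auto)
  then obtain K1 where K1: "K1 \<ge> 0" and diag: "\<And>L f g V M. L \<ge> 1 \<Longrightarrow> (\<forall>i\<in>?I. cut_lipschitz C 1 (f i) \<and> f i \<in> borel_measurable borel) \<Longrightarrow>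
    (\<forall>j\<in>?I. cut_lipschitz C (V j) (g j) \<and> g j \<in> borel_measurable borel) \<Longrightarrow> M > nat \<lfloor>exp L\<rfloor> ^ (k + 2) \<Longrightarrow>
    norm (diagonal_sum ?I ?I f g L M
      - of_real (arith_factor (k + 2) * L ^ (k + 2)\<^sup>2) * (\<integral>u. indicator (?I \<times> ?I \<rightarrow>\<^sub>E {0..1}) u *\<^sub>R matrix_weight ?I ?I f g u \<partial>Pi\<^sub>M (?I \<times> ?I) (\<lambda>_. lborel)))
    \<le> K1 * L ^ ((k + 2)\<^sup>2 - 1)" by blast
  show ?thesis
  proof (rule exI[of _ C], rule conjI[OF C(1)], rule exI[of _ K1], intro conjI allI impI K1)
    show "norm (cut_poly P v) \<le> C" if "v \<ge> 0" for v using cut_lipschitzD(1)[OF f that] .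
    fix L :: real and \<alpha>1 \<alpha>2 \<alpha>3 \<alpha>4 :: complex and M :: nat
    assume L: "L \<ge> 1" and \<alpha>: "norm \<alpha>1 * L \<le> E" "norm \<alpha>2 * L \<le> E" "norm \<alpha>3 * L \<le> E" "norm \<alpha>4 * L \<le> E"
    define c where "c = (\<lambda>j. - shift_vector k (- \<alpha>1) (- \<alpha>2) \<alpha>3 \<alpha>4 j * complex_of_real L)"
    have nc: "norm (c j) \<le> E" for j using \<alpha> L by (auto simp: c_def shift_vector_def norm_mult)
    have c: "c = shift_vector k (\<alpha>1 * of_real L) (\<alpha>2 * of_real L) (- \<alpha>3 * of_real L) (- \<alpha>4 * of_real L)"
      by (auto simp: c_def shift_vector_def)
    have pe: "param_integral k P (exp L) \<alpha>1 \<alpha>2 \<alpha>3 \<alpha>4 =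
      (\<integral>u. indicator (?I \<times> ?I \<rightarrow>\<^sub>E {0..1}) u *\<^sub>R matrix_weight ?I ?I (\<lambda>_. cut_poly P) (column_weight k P c) u \<partial>Pi\<^sub>M (?I \<times> ?I) (\<lambda>_. lborel))"
      using param_integral_eq_matrix_integral[OF k exp_gt_zero, of P L \<alpha>1 \<alpha>2 \<alpha>3 \<alpha>4] by (simp only: c ln_exp)
    have ff: "\<forall>i\<in>?I. cut_lipschitz C 1 (cut_poly P) \<and> cut_poly P \<in> borel_measurable borel" using f cut_poly_measurable by blast
    have gg: "\<forall>j\<in>?I. cut_lipschitz C (V j) (column_weight k P c j) \<and> column_weight k P c j \<in> borel_measurable borel"
      by (intro ballI conjI g nc column_weight_measurable)
    have "norm (param_integral k P (exp L) \<alpha>1 \<alpha>2 \<alpha>3 \<alpha>4) \<le> C ^ (card ?I + card ?I)"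
      unfolding pe by (rule norm_matrix_integral_le[OF finite_atLeastAtMost finite_atLeastAtMost C(1) bspec[OF ff] bspec[OF gg]])
    then show "norm (param_integral k P (exp L) \<alpha>1 \<alpha>2 \<alpha>3 \<alpha>4) \<le> C ^ (2 * (k + 2))" by (simp only: card_atLeastAtMost mult_2) simp
    assume M: "M > nat \<lfloor>exp L\<rfloor> ^ (k + 2)"
    show "norm (diagonal_sum ?I ?I (\<lambda>_. cut_poly P) (column_weight k P (\<lambda>j. - shift_vector k (- \<alpha>1) (- \<alpha>2) \<alpha>3 \<alpha>4 j * of_real L)) L M
        - of_real (arith_factor (k + 2) * L ^ (k + 2)\<^sup>2) * param_integral k P (exp L) \<alpha>1 \<alpha>2 \<alpha>3 \<alpha>4) \<le> K1 * L ^ ((k + 2)\<^sup>2 - 1)"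
      using diag[OF L ff gg M] unfolding pe c_def[symmetric] .
  qed
qed

theorem theorem17:
  fixes k :: nat and P :: "real poly" and \<theta> :: real and \<Phi> :: "real \<Rightarrow> real \<Rightarrow> real"
  assumes "k \<ge> 2"
    and "0 < \<theta>" and "\<theta> < 1 / (4 * real k)"
    and "smooth_weight \<Phi>"
  shows "\<forall>A>0. \<exists>C. \<forall>\<^sub>F T in at_top. \<forall>\<alpha>1 \<alpha>2 \<alpha>3 \<alpha>4 :: complex.
    cmod \<alpha>1 \<le> A / ln T \<and> cmod \<alpha>2 \<le> A / ln T \<and> cmod \<alpha>3 \<le> A / ln T \<and> cmod \<alpha>4 \<le> A / ln T \<longrightarrow>
    (let y = T powr \<theta> in
      cmod (twisted_moment k P y (\<Phi> T) T \<alpha>1 \<alpha>2 \<alpha>3 \<alpha>4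
        - of_real (arith_factor (k + 2) * T * ln y ^ ((k + 2)\<^sup>2) * (LBINT u. \<Phi> T u)) *
          of_real (T / (2 * pi)) powr (- \<alpha>1 - \<alpha>2) *
          param_integral k P y \<alpha>1 \<alpha>2 \<alpha>3 \<alpha>4)
      \<le> C * (T * ln T ^ ((k + 2)\<^sup>2 - 1)))"
proof (intro allI impI)
  fix A :: real assume A: "A > 0"
  note k = assms(1) and \<theta> = assms(2,3)
  \<comment> \<open>The number of integrations by parts that \<open>off_diagonal_error_le\<close>
    demands, and so the number of derivatives to be controlled.\<close>
  define N where "N = 4 * (120 * (k + 2) + 2)"
  obtain p K1 where p: "p \<ge> 1" "\<forall>v\<ge>0. norm (cut_poly P v) \<le> p" and K1: "K1 \<ge> 0"
    and approx: "\<forall>L\<ge>1. \<forall>\<alpha>1 \<alpha>2 \<alpha>3 \<alpha>4 M. norm \<alpha>1 * L \<le> A \<longrightarrow> norm \<alpha>2 * L \<le> A \<longrightarrow> norm \<alpha>3 * L \<le> A \<longrightarrow> norm \<alpha>4 * L \<le> A \<longrightarrow>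
      M > nat \<lfloor>exp L\<rfloor> ^ (k + 2) \<longrightarrow>
      norm (diagonal_sum {1..k + 2} {1..k + 2} (\<lambda>_. cut_poly P) (column_weight k P (\<lambda>j. - shift_vector k (- \<alpha>1) (- \<alpha>2) \<alpha>3 \<alpha>4 j * of_real L)) L M
        - of_real (arith_factor (k + 2) * L ^ (k + 2)\<^sup>2) * param_integral k P (exp L) \<alpha>1 \<alpha>2 \<alpha>3 \<alpha>4) \<le> K1 * L ^ ((k + 2)\<^sup>2 - 1) \<and>
      norm (param_integral k P (exp L) \<alpha>1 \<alpha>2 \<alpha>3 \<alpha>4) \<le> p ^ (2 * (k + 2))"
    using param_integral_approx[OF k less_imp_le[OF A], of P] by (elim exE conjE) (rule that; assumption)
  obtain c where c: "c \<ge> 1" and weight: "\<forall>\<^sub>F T in at_top.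
    (\<forall>j t. ((deriv ^^ j) (\<lambda>x. \<Phi> T (x / T)) has_real_derivative (deriv ^^ Suc j) (\<lambda>x. \<Phi> T (x / T)) t) (at t)) \<and>
    (\<forall>j t. t \<notin> {T / 4..2 * T} \<longrightarrow> (deriv ^^ j) (\<lambda>x. \<Phi> T (x / T)) t = 0) \<and>
    (\<forall>j\<le>N. \<forall>t. \<bar>(deriv ^^ j) (\<lambda>x. \<Phi> T (x / T)) t\<bar> \<le> c * (ln T / T) ^ j) \<and> (\<forall>u. 0 \<le> \<Phi> T u \<and> \<Phi> T u \<le> 1)"
    using smooth_weight_derivs[OF assms(4), of N] by blast
  define G :: real where "G = 84 * exp 21"
  define B where "B = (exp A * (1 + G)) * (exp A * (1 + G))"
  define s where "s = \<bar>arith_factor (k + 2)\<bar> * p ^ (2 * (k + 2)) + K1"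
  \<comment> \<open>\<open>e0\<close> bounds the replacement of the zetas and the off-diagonal terms
    together; both are \<open>O(1)\<close> by the choice of \<open>M\<close> and
    \<open>N\<close>.\<close>
  define e0 where "e0 = B * p ^ (2 * k) * (8 * 300 ^ 3 * 117) + 2 ^ (k + 2) * (2 * p) ^ (2 * (k + 2)) * (2 * c * B * fact N)"
  define C where "C = e0 + exp (2 * A) * (2 * ((2 + G) * (G * A)) * s + 2 * K1)"
  have B0: "B \<ge> 0" by (simp add: B_def G_def)
  have e00: "e0 \<ge> 0" using B0 p(1) c by (simp add: e0_def)
  have ev1: "\<forall>\<^sub>F T in at_top. \<theta> * ln T \<ge> 1"
  proof -
    have "filterlim (\<lambda>T. \<theta> * ln T) at_top at_top" using \<theta> by real_asymp
    then show ?thesis by (simp add: filterlim_at_top)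
  qed
  have ev2: "\<forall>\<^sub>F T in at_top. A / ln T \<le> 1/4"
  proof -
    have "((\<lambda>T. A / ln T) \<longlongrightarrow> 0) at_top" by real_asymp
    then have "\<forall>\<^sub>F T in at_top. A / ln T < 1/4" by (rule order_tendstoD) simp
    then show ?thesis by (rule eventually_mono) simp
  qed
  have ev3: "\<forall>\<^sub>F T::real in at_top. 128 * ln T / T * T powr (1/2) \<le> T powr (- 1/4)" by real_asymp
  show "\<exists>C. \<forall>\<^sub>F T in at_top. \<forall>\<alpha>1 \<alpha>2 \<alpha>3 \<alpha>4 :: complex.
    cmod \<alpha>1 \<le> A / ln T \<and> cmod \<alpha>2 \<le> A / ln T \<and> cmod \<alpha>3 \<le> A / ln T \<and> cmod \<alpha>4 \<le> A / ln T \<longrightarrow>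
    (let y = T powr \<theta> in
      cmod (twisted_moment k P y (\<Phi> T) T \<alpha>1 \<alpha>2 \<alpha>3 \<alpha>4
        - of_real (arith_factor (k + 2) * T * ln y ^ ((k + 2)\<^sup>2) * (LBINT u. \<Phi> T u)) *
          of_real (T / (2 * pi)) powr (- \<alpha>1 - \<alpha>2) *
          param_integral k P y \<alpha>1 \<alpha>2 \<alpha>3 \<alpha>4)
      \<le> C * (T * ln T ^ ((k + 2)\<^sup>2 - 1)))"
  proof (rule exI[of _ C], use weight ev1 ev2 ev3 eventually_ge_at_top[of 32] in eventually_elim)
    case (elim T)
    have T: "T \<ge> 32" "T > 0" and lnT: "ln T > 0" using elim(5) by auto
    define L where "L = \<theta> * ln T"
    have L: "L \<ge> 1" "L \<le> ln T"
    proof -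
      show "L \<ge> 1" using elim(2) by (simp add: L_def)
      have "1 / (4 * real k) \<le> 1" using k by simp
      then have "\<theta> \<le> 1" using \<theta> by linarith
      then show "L \<le> ln T" using mult_right_mono[of \<theta> 1 "ln T"] lnT by (simp add: L_def)
    qed
    have lnT1: "ln T \<ge> 1" using L by linarith
    have y: "T powr \<theta> = exp L" using T by (simp add: powr_def L_def)
    define Y0 where "Y0 = nat \<lfloor>exp L\<rfloor>"
    have YT: "real Y0 \<le> T powr \<theta>" unfolding Y0_def y by (simp add: of_nat_floor)
    have Ypow: "real Y0 ^ m \<le> T powr (real m * \<theta>)" for m
    proof -
      have "real Y0 ^ m \<le> (T powr \<theta>) ^ m" using YT by (intro power_mono) auto
      also have "\<dots> = T powr (real m * \<theta>)" using T by (simp add: powr_power mult.commute)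
      finally show ?thesis .
    qed
    have k\<theta>: "real k * \<theta> < 1/4" using \<theta> k by (simp add: less_divide_eq mult.commute)
    \<comment> \<open>From \<open>k >= 2\<close>, so that
      \<open>(k + 2) * \<theta> <= 2 * k * \<theta> < 1/2\<close>; this keeps the product of the
      \<open>k + 2\<close> short variables below \<open>T powr (1/2)\<close>.\<close>
    have \<theta>8: "2 * \<theta> \<le> real k * \<theta>" using \<theta> k by (intro mult_right_mono) auto
    have Y2k: "real Y0 ^ (2 * k) \<le> T"
    proof -
      have "real (2 * k) * \<theta> \<le> 1" using k\<theta> by simp
      then have "T powr (real (2 * k) * \<theta>) \<le> T powr 1" using T by (intro powr_mono) auto
      then show ?thesis using Ypow[of "2 * k"] T by simp
    qed
    have YK: "real Y0 ^ (k + 2) \<le> T powr (1/2)"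
    proof -
      have "real (k + 2) * \<theta> \<le> 1/2" using k\<theta> \<theta>8 by (simp add: distrib_right)
      then have "T powr (real (k + 2) * \<theta>) \<le> T powr (1/2)" using T by (intro powr_mono) auto
      then show ?thesis using Ypow[of "k + 2"] by linarith
    qed
    \<comment> \<open>The length of the zeta polynomials. It also exceeds every entry of a diagonal
      pair, since those are at most \<open>T powr (1/2)\<close>.\<close>
    define M where "M = nat \<lceil>T ^ 40\<rceil>"
    have M: "real M \<ge> T ^ 40" "real M \<le> 2 * T ^ 40"
    proof -
      show "real M \<ge> T ^ 40" unfolding M_def by linarith
      have T40: "T ^ 40 \<ge> 1" using T by simp
      then have "real M \<le> T ^ 40 + 1" unfolding M_def by linarith
      then show "real M \<le> 2 * T ^ 40" using T40 by linarith
    qed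
    have MY: "M > nat \<lfloor>exp L\<rfloor> ^ (k + 2)"
    proof -
      have "T powr (1/2) < T powr 40" using T by (intro powr_less_mono) auto
      then have "real (Y0 ^ (k + 2)) < real M" using YK M(1) T by simp
      then show ?thesis unfolding Y0_def of_nat_less_iff .
    qed
    show ?case
    proof (intro allI impI, elim conjE, unfold Let_def y ln_exp)
      fix \<alpha>1 \<alpha>2 \<alpha>3 \<alpha>4 :: complex
      assume \<alpha>: "cmod \<alpha>1 \<le> A / ln T" "cmod \<alpha>2 \<le> A / ln T" "cmod \<alpha>3 \<le> A / ln T" "cmod \<alpha>4 \<le> A / ln T"
      have q: "norm a \<le> 1/4" if "norm a \<le> A / ln T" for a :: complex using that elim(3) by linarith
      have aL: "norm a * L \<le> A" if "norm a \<le> A / ln T" for a :: complex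
      proof -
        have "norm a * L \<le> (A / ln T) * ln T" using that L A lnT by (intro mult_mono) auto
        then show ?thesis using lnT by simp
      qed
      interpret moment: twisted_setup k P T L "\<Phi> T" "\<lambda>j. (deriv ^^ j) (\<lambda>x. \<Phi> T (x / T))" \<alpha>1 \<alpha>2 \<alpha>3 \<alpha>4 c p B M N
      proof
        show "norm (chi_ratio \<alpha>1 z * chi_ratio \<alpha>2 z) \<le> B" if "T / 8 < Re z" "Re z < 3 * T" "\<bar>Im z\<bar> < T / 16" for z
          unfolding B_def norm_mult G_def using that
          by (intro mult_mono chi_ratio_bounds(4)[OF T(1) q[OF \<alpha>(1)] \<alpha>(1)] chi_ratio_bounds(4)[OF T(1) q[OF \<alpha>(2)] \<alpha>(2)]) auto
        show "1 \<le> exp L" using L by simp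
        show "norm (cut_poly P v) \<le> p" if "v \<ge> 0" for v using p that by blast
      qed (use k T L q \<alpha> elim(1) p(1) MY in auto)
      have Yeq: "moment.Y = Y0" by (simp only: moment.Y_def Y0_def)
      note ap = approx[rule_format, OF L(1) aL[OF \<alpha>(1)] aL[OF \<alpha>(2)] aL[OF \<alpha>(3)] aL[OF \<alpha>(4)] MY]
      have tm: "norm (twisted_moment k P (exp L) (\<Phi> T) T \<alpha>1 \<alpha>2 \<alpha>3 \<alpha>4 - moment.W * moment.S) \<le> e0"
      proof -
        note r1 = order_trans[OF moment.replace_zeta[unfolded Yeq] approx_error_le[OF T(2) of_nat_0_le_iff Y2k M(1) _ B0]]
        note r2 = order_trans[OF moment.diagonal_expansion[unfolded Yeq] off_diagonal_error_le[OF _ of_nat_0_le_iff YK of_nat_0_le_iff M(2) _ B0 _ elim(4), folded N_def]]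
        show ?thesis unfolding e0_def
          by (rule norm_diff_triangle_le[OF r1 r2]) (use p(1) c T in auto)
      qed
      have SR: "norm (moment.S - of_real (arith_factor (k + 2) * L ^ (k + 2)\<^sup>2) * param_integral k P (exp L) \<alpha>1 \<alpha>2 \<alpha>3 \<alpha>4) \<le> K1 * ln T ^ ((k + 2)\<^sup>2 - 1)"
      proof -
        have "K1 * L ^ ((k + 2)\<^sup>2 - 1) \<le> K1 * ln T ^ ((k + 2)\<^sup>2 - 1)" using K1 L by (intro mult_left_mono power_mono) auto
        then show ?thesis using ap unfolding moment.S_def moment.\<beta>_def by linarith
      qed
      have sq: "(k + 2)\<^sup>2 = Suc ((k + 2)\<^sup>2 - 1)" by simp
      have Ss: "norm moment.S \<le> s * ln T ^ (k + 2)\<^sup>2"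
      proof -
        have "norm (complex_of_real (arith_factor (k + 2) * L ^ (k + 2)\<^sup>2) * param_integral k P (exp L) \<alpha>1 \<alpha>2 \<alpha>3 \<alpha>4) \<le> (\<bar>arith_factor (k + 2)\<bar> * ln T ^ (k + 2)\<^sup>2) * p ^ (2 * (k + 2))"
          unfolding norm_mult norm_of_real abs_mult power_abs using ap L by (intro mult_mono power_mono) auto
        moreover have "K1 * ln T ^ ((k + 2)\<^sup>2 - 1) \<le> K1 * ln T ^ (k + 2)\<^sup>2" using K1 lnT1 by (intro mult_left_mono power_increasing) auto
        moreover have "norm moment.S \<le> norm (complex_of_real (arith_factor (k + 2) * L ^ (k + 2)\<^sup>2) * param_integral k P (exp L) \<alpha>1 \<alpha>2 \<alpha>3 \<alpha>4) + norm (moment.S - of_real (arith_factor (k + 2) * L ^ (k + 2)\<^sup>2) * param_integral k P (exp L) \<alpha>1 \<alpha>2 \<alpha>3 \<alpha>4)"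
          by (rule norm_triangle_sub)
        moreover have "s * ln T ^ (k + 2)\<^sup>2 = (\<bar>arith_factor (k + 2)\<bar> * ln T ^ (k + 2)\<^sup>2) * p ^ (2 * (k + 2)) + K1 * ln T ^ (k + 2)\<^sup>2"
          by (simp only: s_def distrib_right distrib_left mult_ac)
        ultimately show ?thesis using SR by linarith
      qed
      have "norm (twisted_moment k P (exp L) (\<Phi> T) T \<alpha>1 \<alpha>2 \<alpha>3 \<alpha>4 - of_real (arith_factor (k + 2) * L ^ (k + 2)\<^sup>2 * T * (LBINT x. \<Phi> T x)) * of_real (T / (2 * pi)) powr (- \<alpha>1 - \<alpha>2) * param_integral k P (exp L) \<alpha>1 \<alpha>2 \<alpha>3 \<alpha>4)
        \<le> e0 + exp (2 * A) * (2 * T * ((2 + G) * (G * (A / ln T))) * (s * ln T ^ (k + 2)\<^sup>2) + 2 * T * (K1 * ln T ^ ((k + 2)\<^sup>2 - 1)))"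
        unfolding G_def by (rule moment.moment_approx[OF \<alpha>(1,2) tm SR Ss])
      \<comment> \<open>The \<open>1 / ln T\<close> from the chi factors lowers the power of
        \<open>ln T\<close> in the bound for \<open>S\<close> by one, to that of the error
        term.\<close>
      also have "2 * T * ((2 + G) * (G * (A / ln T))) * (s * ln T ^ (k + 2)\<^sup>2) = 2 * ((2 + G) * (G * A)) * s * (T * ln T ^ ((k + 2)\<^sup>2 - 1))"
        using lnT by (subst sq) (simp only: power_Suc, simp add: field_simps)
      also have "e0 + exp (2 * A) * (2 * ((2 + G) * (G * A)) * s * (T * ln T ^ ((k + 2)\<^sup>2 - 1)) + 2 * T * (K1 * ln T ^ ((k + 2)\<^sup>2 - 1)))
        \<le> C * (T * ln T ^ ((k + 2)\<^sup>2 - 1))"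
      proof -
        have "1 * 1 \<le> T * ln T ^ ((k + 2)\<^sup>2 - 1)" using T lnT1 by (intro mult_mono one_le_power) auto
        then have "e0 * 1 \<le> e0 * (T * ln T ^ ((k + 2)\<^sup>2 - 1))" using e00 by (intro mult_left_mono) auto
        then show ?thesis unfolding C_def by (simp add: algebra_simps)
      qed
      finally show "cmod (twisted_moment k P (exp L) (\<Phi> T) T \<alpha>1 \<alpha>2 \<alpha>3 \<alpha>4
        - of_real (arith_factor (k + 2) * T * L ^ ((k + 2)\<^sup>2) * (LBINT u. \<Phi> T u)) *
          of_real (T / (2 * pi)) powr (- \<alpha>1 - \<alpha>2) *
          param_integral k P (exp L) \<alpha>1 \<alpha>2 \<alpha>3 \<alpha>4)
        \<le> C * (T * ln T ^ ((k + 2)\<^sup>2 - 1))"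
        by (simp only: mult_ac)
    qed
  qed
qed

end
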